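(* The problem SetCovering over definable structures, i.e. given a definable set $X$ and a definable family $\mathcal{S}$ of subsets of $X$, does $\mathcal{S}$ contain a finite subfamily $C$ whose union is $X$?, belongs to $\mathsf{PSPACE}$.
   Context: Fix a countably infinite set $\mathbb{A}$ of atoms and an infinite set of atom variables. An expression is either a variable or a formal finite (possibly empty) union of set-builder expressions $\{e \mid x_1,\dots,x_k\in\mathbb{A},\ \varphi\}$ (with $k\ge 0$), where $e$ is an expression, the $x_i$ are bound variables, and $\varphi$ is a first-order formula over the atom variables with equality as the only relation symbol (interpreted in $(\mathbb{A},=)$). An expression $e$ with set of free variables $V$, together with a valuation $\sigma:V\to\mathbb{A}$, has a value $e[\sigma]$, defined in the obvious way by induction on $e$, which is an atom or a set; the sets arising this way are called definable. Input representation: a definable set is represented as a pair $(e,\sigma)$ written in this basic language (no syntactic sugar), and the input size is the length of this representation. Pairs are Kuratowski pairs $(x,y)=\{x,\{x,y\}\}$ and tuples are nested pairs with right-associative bracketing, $(a_1,a_2,a_3)=(a_1,(a_2,a_3))$, so that a tuple has representation size linear in the sum of the sizes of the chosen representations of its components. *)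

theory Defs
  imports Main "HOL-Library.Countable_Set_Type" "HOL-Computational_Algebra.Polynomial"
begin

section \<open>Set-builder expressions\<close>

type_synonym atom = nat
type_synonym var = nat

datatype fm =
    FEq var var
  | FNot fm
  | FAnd fm fm
  | FOr fm fm
  | FEx var fm
  | FAll var fm

text \<open>\<open>EUnion [Builder e1 xs1 f1, \<dots>]\<close> is the formal union of the expressions
  \<open>{e1 | xs1 \<in> \<bbbA>, f1}, \<dots>\<close>; the empty list gives the empty set.\<close>

datatype expr = EVar var | EUnion "builder list"
and builder = Builder expr "var list" fm

fun fv_fm :: "fm \<Rightarrow> var set" where
  "fv_fm (FEq x y) = {x, y}"
| "fv_fm (FNot f) = fv_fm f"
| "fv_fm (FAnd f g) = fv_fm f \<union> fv_fm g"
| "fv_fm (FOr f g) = fv_fm f \<union> fv_fm g"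
| "fv_fm (FEx x f) = fv_fm f - {x}"
| "fv_fm (FAll x f) = fv_fm f - {x}"

fun fv :: "expr \<Rightarrow> var set" and fv_builder :: "builder \<Rightarrow> var set" where
  "fv (EVar x) = {x}"
| "fv (EUnion bs) = (\<Union>b\<in>set bs. fv_builder b)"
| "fv_builder (Builder e xs f) = (fv e \<union> fv_fm f) - set xs"

fun sat :: "fm \<Rightarrow> (var \<Rightarrow> atom) \<Rightarrow> bool" where
  "sat (FEq x y) \<sigma> \<longleftrightarrow> \<sigma> x = \<sigma> y"
| "sat (FNot f) \<sigma> \<longleftrightarrow> \<not> sat f \<sigma>"
| "sat (FAnd f g) \<sigma> \<longleftrightarrow> sat f \<sigma> \<and> sat g \<sigma>"
| "sat (FOr f g) \<sigma> \<longleftrightarrow> sat f \<sigma> \<or> sat g \<sigma>"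
| "sat (FEx x f) \<sigma> \<longleftrightarrow> (\<exists>a. sat f (\<sigma>(x := a)))"
| "sat (FAll x f) \<sigma> \<longleftrightarrow> (\<forall>a. sat f (\<sigma>(x := a)))"

section \<open>Values\<close>

text \<open>Hereditarily countable sets over the atoms, with extensional equality. Since there are
  only countably many atoms, every definable set is countable (\<open>elems_denot_EUnion\<close> below), so
  this universe contains all of them.\<close>

datatype val = Atom atom | Set "val cset"

fun is_set :: "val \<Rightarrow> bool" where
  "is_set (Atom a) \<longleftrightarrow> False"
| "is_set (Set A) \<longleftrightarrow> True"

fun elems :: "val \<Rightarrow> val set" where
  "elems (Atom a) = {}"
| "elems (Set A) = rcset A"

text \<open>Valuations are total functions here; the value depends only on their restriction to the
  free variables (\<open>denot_cong\<close> below).\<close>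

definition rebindings :: "var list \<Rightarrow> (var \<Rightarrow> atom) \<Rightarrow> (var \<Rightarrow> atom) set" where
  "rebindings xs \<sigma> = {\<tau>. \<forall>y. y \<notin> set xs \<longrightarrow> \<tau> y = \<sigma> y}"

fun denot :: "expr \<Rightarrow> (var \<Rightarrow> atom) \<Rightarrow> val"
and members :: "builder \<Rightarrow> (var \<Rightarrow> atom) \<Rightarrow> val set" where
  "denot (EVar x) \<sigma> = Atom (\<sigma> x)"
| "denot (EUnion bs) \<sigma> = Set (acset (\<Union>b\<in>set bs. members b \<sigma>))"
| "members (Builder e xs f) \<sigma> = {denot e \<tau> |\<tau>. \<tau> \<in> rebindings xs \<sigma> \<and> sat f \<tau>}"

lemma countable_rebindings: "countable (rebindings xs \<sigma>)"
proof -
  have "rebindings xs \<sigma> \<subseteq> range (\<lambda>as y. case map_of (zip xs as) y of None \<Rightarrow> \<sigma> y | Some a \<Rightarrow> a)"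
  proof
    fix \<tau> assume "\<tau> \<in> rebindings xs \<sigma>"
    then have "\<tau> = (\<lambda>y. case map_of (zip xs (map \<tau> xs)) y of None \<Rightarrow> \<sigma> y | Some a \<Rightarrow> a)"
      by (auto simp: rebindings_def map_of_zip_map fun_eq_iff)
    then show "\<tau> \<in> range (\<lambda>as y. case map_of (zip xs as) y of None \<Rightarrow> \<sigma> y | Some a \<Rightarrow> a)"
      by blast
  qed
  then show ?thesis
    by (rule countable_subset) simp
qed

lemma countable_members: "countable (members b \<sigma>)"
proof (cases b)
  case (Builder e xs f)
  have "members b \<sigma> \<subseteq> (\<lambda>\<tau>. denot e \<tau>) ` rebindings xs \<sigma>"
    using Builder by auto
  then show ?thesis
    by (rule countable_subset) (rule countable_image[OF countable_rebindings])
qed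

lemma elems_denot_EUnion: "elems (denot (EUnion bs) \<sigma>) = (\<Union>b\<in>set bs. members b \<sigma>)"
proof -
  have "countable (\<Union>b\<in>set bs. members b \<sigma>)"
    by (intro countable_UN countable_finite countable_members) simp
  then show ?thesis by (simp del: members.simps)
qed

lemma sat_cong: "(\<And>x. x \<in> fv_fm f \<Longrightarrow> \<sigma> x = \<tau> x) \<Longrightarrow> sat f \<sigma> = sat f \<tau>"
proof (induction f arbitrary: \<sigma> \<tau>)
  case (FNot f)
  then show ?case by (metis fv_fm.simps(2) sat.simps(2))
next
  case (FAnd f g)
  then show ?case by (metis UnCI fv_fm.simps(3) sat.simps(3))
next
  case (FOr f g)
  then show ?case by (metis UnCI fv_fm.simps(4) sat.simps(4))
next
  case (FEx x f)
  have "sat f (\<sigma>(x := a)) = sat f (\<tau>(x := a))" for a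
    using FEx.prems by (intro FEx.IH) auto
  then show ?case by simp
next
  case (FAll x f)
  have "sat f (\<sigma>(x := a)) = sat f (\<tau>(x := a))" for a
    using FAll.prems by (intro FAll.IH) auto
  then show ?case by simp
qed auto

lemma members_mono_aux:
  assumes "\<And>\<sigma> \<tau>. (\<And>x. x \<in> fv e \<Longrightarrow> \<sigma> x = \<tau> x) \<Longrightarrow> denot e \<sigma> = denot e \<tau>"
    and "\<And>x. x \<in> fv_builder (Builder e xs f) \<Longrightarrow> \<sigma> x = \<tau> x"
  shows "members (Builder e xs f) \<sigma> \<subseteq> members (Builder e xs f) \<tau>"
proof
  fix v assume "v \<in> members (Builder e xs f) \<sigma>"
  then obtain \<rho> where r: "v = denot e \<rho>" "\<rho> \<in> rebindings xs \<sigma>" "sat f \<rho>"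
    by auto
  define \<rho>' where "\<rho>' = (\<lambda>y. if y \<in> set xs then \<rho> y else \<tau> y)"
  have agree: "\<rho> y = \<rho>' y" if "y \<in> fv e \<union> fv_fm f" for y
    using that r(2) assms(2)[of y] by (auto simp: \<rho>'_def rebindings_def)
  have "denot e \<rho> = denot e \<rho>'" by (rule assms(1)) (simp add: agree)
  moreover have "sat f \<rho> = sat f \<rho>'" by (rule sat_cong) (simp add: agree)
  moreover have "\<rho>' \<in> rebindings xs \<tau>" by (simp add: \<rho>'_def rebindings_def)
  ultimately show "v \<in> members (Builder e xs f) \<tau>"
    using r by auto
qed

lemma denot_cong: "(\<And>x. x \<in> fv e \<Longrightarrow> \<sigma> x = \<tau> x) \<Longrightarrow> denot e \<sigma> = denot e \<tau>"
  and members_cong: "(\<And>x. x \<in> fv_builder b \<Longrightarrow> \<sigma> x = \<tau> x) \<Longrightarrow> members b \<sigma> = members b \<tau>"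
proof (induction e and b arbitrary: \<sigma> \<tau> and \<sigma> \<tau>)
  case (EUnion bs)
  have "members b \<sigma> = members b \<tau>" if "b \<in> set bs" for b
    using that EUnion.prems by (intro EUnion.IH) auto
  then have "(\<Union>b\<in>set bs. members b \<sigma>) = (\<Union>b\<in>set bs. members b \<tau>)" by simp
  then show ?case by (simp only: denot.simps)
next
  case (Builder e xs f)
  have "members (Builder e xs f) \<sigma> \<subseteq> members (Builder e xs f) \<tau>"
    by (rule members_mono_aux[OF Builder.IH]) (use Builder.prems in simp_all)
  moreover have "members (Builder e xs f) \<tau> \<subseteq> members (Builder e xs f) \<sigma>"
    by (rule members_mono_aux[OF Builder.IH]) (use Builder.prems in simp_all)
  ultimately show ?case by (rule subset_antisym)
qed simp

text \<open>The Kuratowski pair \<open>{x, {x, y}}\<close>.\<close>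

definition kpair :: "val \<Rightarrow> val \<Rightarrow> val" where
  "kpair x y = Set (cinsert x (csingle (Set (cinsert x (csingle y)))))"

section \<open>Written representations\<close>

text \<open>A representation is a pair of an expression and a valuation of its free variables,
  given as an association list.\<close>

type_synonym representation = "expr \<times> (var \<times> atom) list"

definition is_representation :: "representation \<Rightarrow> bool" where
  "is_representation = (\<lambda>(e, ps). distinct (map fst ps) \<and> set (map fst ps) = fv e)"

definition represented :: "representation \<Rightarrow> val" where
  "represented = (\<lambda>(e, ps). denot e (\<lambda>x. the (map_of ps x)))"

datatype token =
    TVar | TAtom | TZero | TOne
  | TEq | TNot | TAnd | TOr | TEx | TAll
  | TLParen | TRParen | TLBrace | TRBrace | TBar | TComma | TSemicolon

instance token :: finite
proof
  have "UNIV = {TVar, TAtom, TZero, TOne, TEq, TNot, TAnd, TOr, TEx, TAll,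
    TLParen, TRParen, TLBrace, TRBrace, TBar, TComma, TSemicolon}"
    using token.exhaust by blast
  then show "finite (UNIV :: token set)" by (rule ssubst) (intro finite.insertI finite.emptyI)
qed

text \<open>Names of variables and atoms are written in binary, least significant bit first,
  without leading zeros (so 0 is the empty word).\<close>

fun write_nat :: "nat \<Rightarrow> token list" where
  "write_nat n =
    (if n = 0 then [] else (if odd n then TOne else TZero) # write_nat (n div 2))"

declare write_nat.simps [simp del]

definition write_var :: "var \<Rightarrow> token list" where
  "write_var x = TVar # write_nat x"

definition write_atom :: "atom \<Rightarrow> token list" where
  "write_atom a = TAtom # write_nat a"

fun write_fm :: "fm \<Rightarrow> token list" where
  "write_fm (FEq x y) = TEq # write_var x @ write_var y"
| "write_fm (FNot f) = TNot # write_fm f"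
| "write_fm (FAnd f g) = TAnd # write_fm f @ write_fm g"
| "write_fm (FOr f g) = TOr # write_fm f @ write_fm g"
| "write_fm (FEx x f) = TEx # write_var x @ write_fm f"
| "write_fm (FAll x f) = TAll # write_var x @ write_fm f"

fun write_expr :: "expr \<Rightarrow> token list" and write_builder :: "builder \<Rightarrow> token list" where
  "write_expr (EVar x) = write_var x"
| "write_expr (EUnion bs) = TLParen # concat (map write_builder bs) @ [TRParen]"
| "write_builder (Builder e xs f) =
    TLBrace # write_expr e @ TBar # concat (map write_var xs) @ TComma # write_fm f @ [TRBrace]"

definition write_representation :: "representation \<Rightarrow> token list" where
  "write_representation = (\<lambda>(e, ps).
    write_expr e @ TSemicolon # concat (map (\<lambda>(x, a). write_var x @ write_atom a) ps))"

text \<open>Writing is unambiguous.\<close>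

definition no_digit :: "token list \<Rightarrow> bool" where
  "no_digit ts \<longleftrightarrow> (case ts of [] \<Rightarrow> True | t # _ \<Rightarrow> t \<noteq> TZero \<and> t \<noteq> TOne)"

lemma no_digit_simps [simp]:
  "no_digit []" "no_digit (t # ts) \<longleftrightarrow> t \<noteq> TZero \<and> t \<noteq> TOne"
  by (simp_all add: no_digit_def)

lemma write_nat_inj:
  "no_digit u \<Longrightarrow> no_digit v \<Longrightarrow> write_nat m @ u = write_nat n @ v \<longleftrightarrow> m = n \<and> u = v"
proof (induction m arbitrary: n rule: less_induct)
  case (less m)
  consider "m = 0" | "n = 0" | "m > 0" "n > 0" by blast
  then show ?case
  proof cases
    case 3
    have "write_nat (m div 2) @ u = write_nat (n div 2) @ v \<longleftrightarrow> m div 2 = n div 2 \<and> u = v"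
      using 3 less by simp
    moreover have "m = n \<longleftrightarrow> (odd m \<longleftrightarrow> odd n) \<and> m div 2 = n div 2"
      by (metis bit_eq_rec)
    ultimately show ?thesis
      using 3 by (subst (1 2) write_nat.simps) auto
  qed (use less.prems in \<open>auto simp: write_nat.simps[of m] write_nat.simps[of n]
    write_nat.simps[of 0]\<close>)
qed

lemma write_var_inj:
  "no_digit u \<Longrightarrow> no_digit v \<Longrightarrow> write_var x @ u = write_var y @ v \<longleftrightarrow> x = y \<and> u = v"
  by (simp add: write_var_def write_nat_inj)

lemma write_atom_inj:
  "no_digit u \<Longrightarrow> no_digit v \<Longrightarrow> write_atom a @ u = write_atom b @ v \<longleftrightarrow> a = b \<and> u = v"
  by (simp add: write_atom_def write_nat_inj)

lemma no_digit_write [simp]: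
  "no_digit (write_var x @ u)" "no_digit (write_atom a @ u)" "no_digit (write_fm f @ u)"
  by (simp_all add: write_var_def write_atom_def) (cases f; simp)

lemma write_fm_inj:
  "no_digit u \<Longrightarrow> no_digit v \<Longrightarrow> write_fm f @ u = write_fm g @ v \<longleftrightarrow> f = g \<and> u = v"
proof (induction f arbitrary: g u v)
  case (FEq x y)
  then show ?case by (cases g) (auto simp: write_var_inj)
next
  case (FNot f)
  then show ?case by (cases g) auto
next
  case (FAnd f1 f2)
  then show ?case by (cases g) auto
next
  case (FOr f1 f2)
  then show ?case by (cases g) auto
next
  case (FEx x f)
  then show ?case by (cases g) (auto simp: write_var_inj)
next
  case (FAll x f)
  then show ?case by (cases g) (auto simp: write_var_inj)
qed

lemma write_vars_inj:
  "concat (map write_var xs) @ TComma # u = concat (map write_var ys) @ TComma # v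
    \<longleftrightarrow> xs = ys \<and> u = v"
proof (induction xs arbitrary: ys)
  case Nil
  then show ?case by (cases ys) (auto simp: write_var_def)
next
  case (Cons x xs)
  have nd: "no_digit (concat (map write_var zs) @ TComma # w)" for zs w
    by (cases zs) auto
  show ?case
    by (cases ys) (use Cons nd in \<open>auto simp: write_var_inj\<close>, auto simp: write_var_def)
qed

lemma write_expr_inj:
  "no_digit u \<Longrightarrow> no_digit v \<Longrightarrow> write_expr e @ u = write_expr e' @ v \<longleftrightarrow> e = e' \<and> u = v"
  and write_builder_inj: "write_builder b @ u = write_builder b' @ v \<longleftrightarrow> b = b' \<and> u = v"
proof (induction e and b arbitrary: e' u v and b' u v)
  case (EVar x)
  then show ?case by (cases e') (auto simp: write_var_inj, auto simp: write_var_def)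
next
  case (EUnion bs)
  have *: "concat (map write_builder bs) @ TRParen # u = concat (map write_builder cs) @ TRParen # v
      \<longleftrightarrow> bs = cs \<and> u = v" for cs
    using EUnion.IH
  proof (induction bs arbitrary: cs)
    case Nil
    show ?case
    proof (cases cs)
      case (Cons c ds)
      then show ?thesis by (cases c) auto
    qed simp
  next
    case (Cons b bs)
    show ?case
    proof (cases cs)
      case Nil
      then show ?thesis by (cases b) auto
    next
      case (Cons c ds)
      then show ?thesis using Cons.IH Cons.prems by auto
    qed
  qed
  show ?case by (cases e') (auto simp: *, auto simp: write_var_def)
next
  case (Builder e xs f)
  then show ?case by (cases b') (auto simp: write_vars_inj write_fm_inj)
qed

theorem inj_write_representation: "inj write_representation"
proof -
  let ?w = "\<lambda>ps. concat (map (\<lambda>(x, a). write_var x @ write_atom a) ps)"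
  have nd: "no_digit (?w ps)" for ps
    by (cases ps) auto
  have "?w ps = ?w qs \<Longrightarrow> ps = qs" for ps qs
  proof (induction ps arbitrary: qs)
    case Nil
    then show ?case by (cases qs) (auto simp: write_var_def)
  next
    case (Cons p ps)
    then show ?case
      by (cases qs) (use nd in \<open>auto simp: write_var_inj write_atom_inj split: prod.splits\<close>,
        auto simp: write_var_def split: prod.splits)
  qed
  then show ?thesis
    by (auto simp: inj_def write_representation_def write_expr_inj)
qed

section \<open>Polynomial space\<close>

text \<open>Deterministic multi-tape Turing machines with input alphabet \<open>'a\<close> and two-way infinite
  tapes. The states are \<open>{..<num_states}\<close>; the tape alphabet consists of the blank, the input
  letters and \<open>num_work\<close> further symbols. The input is written on tape 0. The
  transition function is only relevant on states and symbols of the machine.\<close>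

datatype 'a symbol = Blank | Input 'a | Work nat

datatype move = Move_Left | Stay | Move_Right

record 'a tm =
  num_tapes :: nat
  num_states :: nat
  num_work :: nat
  start_state :: nat
  accept_state :: nat
  reject_state :: nat
  delta :: "nat \<Rightarrow> 'a symbol list \<Rightarrow> nat \<times> ('a symbol \<times> move) list"

definition tape_alphabet :: "'a tm \<Rightarrow> 'a symbol set" where
  "tape_alphabet M = insert Blank (range Input \<union> Work ` {..<num_work M})"

definition wf_tm :: "'a tm \<Rightarrow> bool" where
  "wf_tm M \<longleftrightarrow>
    num_tapes M > 0 \<and>
    start_state M < num_states M \<and>
    accept_state M < num_states M \<and>
    reject_state M < num_states M \<and>
    accept_state M \<noteq> reject_state M \<and>
    (\<forall>q ss. q < num_states M \<and> length ss = num_tapes M \<and> set ss \<subseteq> tape_alphabet M \<longrightarrow>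
      fst (delta M q ss) < num_states M \<and>
      length (snd (delta M q ss)) = num_tapes M \<and>
      fst ` set (snd (delta M q ss)) \<subseteq> tape_alphabet M)"

type_synonym 'a tape = "(int \<Rightarrow> 'a symbol) \<times> int"
type_synonym 'a config = "nat \<times> 'a tape list"

fun displacement :: "move \<Rightarrow> int" where
  "displacement Move_Left = -1"
| "displacement Stay = 0"
| "displacement Move_Right = 1"

fun act :: "'a symbol \<times> move \<Rightarrow> 'a tape \<Rightarrow> 'a tape" where
  "act (s, m) (c, p) = (c(p := s), p + displacement m)"

fun step :: "'a tm \<Rightarrow> 'a config \<Rightarrow> 'a config" where
  "step M (q, ts) =
    (if q = accept_state M \<or> q = reject_state M then (q, ts)
     else let (q', as) = delta M q (map (\<lambda>(c, p). c p) ts) in (q', map2 act as ts))"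

definition input_tape :: "'a list \<Rightarrow> 'a tape" where
  "input_tape w = (\<lambda>p. if 0 \<le> p \<and> p < int (length w) then Input (w ! nat p) else Blank, 0)"

definition blank_tape :: "'a tape" where
  "blank_tape = (\<lambda>_. Blank, 0)"

definition config_at :: "'a tm \<Rightarrow> 'a list \<Rightarrow> nat \<Rightarrow> 'a config" where
  "config_at M w t =
    (step M ^^ t) (start_state M, input_tape w # replicate (num_tapes M - 1) blank_tape)"

definition accepts :: "'a tm \<Rightarrow> 'a list \<Rightarrow> bool" where
  "accepts M w \<longleftrightarrow> (\<exists>t. fst (config_at M w t) = accept_state M)"

definition rejects :: "'a tm \<Rightarrow> 'a list \<Rightarrow> bool" where
  "rejects M w \<longleftrightarrow> (\<exists>t. fst (config_at M w t) = reject_state M)"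

definition decides :: "'a tm \<Rightarrow> 'a list set \<Rightarrow> bool" where
  "decides M L \<longleftrightarrow> (\<forall>w. (w \<in> L \<longrightarrow> accepts M w) \<and> (w \<notin> L \<longrightarrow> rejects M w))"

definition visited_cells :: "'a tm \<Rightarrow> 'a list \<Rightarrow> (nat \<times> int) set" where
  "visited_cells M w = {(i, snd (snd (config_at M w t) ! i)) |i t. i < num_tapes M}"

definition runs_in_space :: "'a tm \<Rightarrow> (nat \<Rightarrow> nat) \<Rightarrow> bool" where
  "runs_in_space M s \<longleftrightarrow>
    (\<forall>w. finite (visited_cells M w) \<and> card (visited_cells M w) \<le> s (length w))"

definition PSPACE :: "'a::finite list set set" where
  "PSPACE = {L. \<exists>(M :: 'a tm) (p :: nat poly). wf_tm M \<and> decides M L \<and> runs_in_space M (poly p)}"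

section \<open>Set covering\<close>

definition set_covering_instance :: "val \<Rightarrow> val \<Rightarrow> bool" where
  "set_covering_instance X S \<longleftrightarrow>
    is_set X \<and> is_set S \<and> (\<forall>s\<in>elems S. is_set s \<and> elems s \<subseteq> elems X)"

definition has_finite_cover :: "val \<Rightarrow> val \<Rightarrow> bool" where
  "has_finite_cover X S \<longleftrightarrow> (\<exists>C. C \<subseteq> elems S \<and> finite C \<and> (\<Union>s\<in>C. elems s) = elems X)"

text \<open>An input is a representation of the definable pair \<open>(X, S)\<close>. As usual, words that do
  not represent an instance are not in the language.\<close>

definition SetCovering :: "token list set" where
  "SetCovering = {write_representation r |r X S.
    is_representation r \<and> represented r = kpair X S \<and>
    set_covering_instance X S \<and> has_finite_cover X S}"

end

theory Submission imports Defs "HOL-Combinatorics.Permutations"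
begin

text \<open>Definable sets are invariant under renamings of atoms that fix their parameters. Hence
  elements of definable sets only need to be considered if their parameters lie among the atoms
  below \<open>2 ^ l\<close>, for some \<open>l\<close> linear in the size of the input, and such an element is written with
  polynomially many bits. If \<open>S\<close> has a finite cover of \<open>X\<close>, then the members of \<open>S\<close> with
  parameters below \<open>2 ^ l\<close>, of which there are finitely many, cover \<open>X\<close>; and for this it suffices
  that they cover the elements of \<open>X\<close> with parameters below \<open>2 ^ (l + 1)\<close>. Equality of two sets is
  tested by mutual inclusion and recursion to members, whose expressions are shorter, and formulas
  are evaluated over the atoms below \<open>2 ^ l\<close>. This gives an alternating algorithm running in
  polynomial time, and alternating polynomial time is contained in \<open>PSPACE\<close> by evaluating the tree
  of choices depth first.\<close>

section \<open>Renaming atoms\<close>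

text \<open>The obstacle is that a finite cover may use any atoms, unrelated to \<open>l\<close>,
  while members with parameters below \<open>2 ^ l\<close> have to do its work for infinitely many
  elements. Two counts settle this. An object of size \<open>n\<close> depends on at most
  \<open>n\<close> atoms, and each argument keeps at most three such sets of atoms apart from those
  being moved, whence \<open>4 * n \<le> 2 ^ l\<close>. The union of all members with parameters
  below \<open>2 ^ l\<close>, however, may depend on all these atoms; a test element needs up to
  \<open>n\<close> more, and one more bit supplies them.

  Alternation keeps the time polynomial: comparing two sets involves exponentially many pairs of
  members, but a single branch meets one pair per level, so the costs of the levels add up. Members
  stay closures, a shorter expression with a longer environment, whose total size does not grow.

  Since a machine receives arbitrary words, the grammar of the input and the domain of the valuation
  have to be checked as well. Everything is one program in a small stack language, which is compiled
  to machines once and for all and is reasoned about with explicit time bounds.\<close>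

primrec rename :: "(atom \<Rightarrow> atom) \<Rightarrow> val \<Rightarrow> val" where
  "rename \<pi> (Atom a) = Atom (\<pi> a)"
| "rename \<pi> (Set A) = Set (cimage (rename \<pi>) A)"

lemma elems_rename: "elems (rename \<pi> v) = rename \<pi> ` elems v"
  by (cases v) (simp_all add: cimage.rep_eq)

lemma is_set_rename [simp]: "is_set (rename \<pi> v) = is_set v"
  by (cases v) simp_all

lemma elems_eqI: "is_set u \<Longrightarrow> is_set v \<Longrightarrow> elems u = elems v \<Longrightarrow> u = v"
  by (cases u; cases v) (simp_all add: rcset_inject)

lemma rename_rename: "rename \<pi> (rename \<rho> v) = rename (\<pi> \<circ> \<rho>) v"
  by (induction v) (simp_all add: cset.map_comp cong: cset.map_cong)

lemma rename_ident: "rename (\<lambda>a. a) v = v"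
proof (induction v)
  case (Set A)
  then have "cimage (rename (\<lambda>a. a)) A = cimage id A" by (intro cset.map_cong) auto
  then show ?case by (simp add: cset.map_id)
qed simp

lemma rename_inv: "bij \<pi> \<Longrightarrow> rename (inv \<pi>) (rename \<pi> v) = v" "bij \<pi> \<Longrightarrow> rename \<pi> (rename (inv \<pi>) v) = v"
  by (simp_all add: rename_rename comp_def bij_is_inj bij_is_surj surj_f_inv_f rename_ident)

lemma inj_rename: "bij \<pi> \<Longrightarrow> rename \<pi> u = rename \<pi> v \<longleftrightarrow> u = v"
  by (metis rename_inv(1))

lemma rebindings_comp: "\<tau> \<in> rebindings xs \<sigma> \<Longrightarrow> \<pi> \<circ> \<tau> \<in> rebindings xs (\<pi> \<circ> \<sigma>)"
  by (simp add: rebindings_def)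

lemma comp_inv_comp: "bij \<pi> \<Longrightarrow> inv \<pi> \<circ> (\<pi> \<circ> \<sigma>) = \<sigma>" "bij \<pi> \<Longrightarrow> \<pi> \<circ> (inv \<pi> \<circ> \<sigma>) = \<sigma>"
  by (simp_all add: fun_eq_iff bij_is_inj bij_is_surj surj_f_inv_f)

text \<open>Equality is the only relation symbol, and a bijection preserves and reflects it. At a
  quantifier every atom has the form \<open>\<pi> b\<close>, so the quantified atom can be pulled
  back.\<close>

lemma sat_rename: "bij \<pi> \<Longrightarrow> sat f (\<pi> \<circ> \<sigma>) = sat f \<sigma>"
proof (induction f arbitrary: \<sigma>)
  case (FEq x y)
  then show ?case by (auto dest: bij_is_inj simp: inj_eq)
next
  case (FEx x f)
  have "(\<exists>a. sat f ((\<pi> \<circ> \<sigma>)(x := a))) \<longleftrightarrow> (\<exists>b. sat f ((\<pi> \<circ> \<sigma>)(x := \<pi> b)))"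
    using FEx.prems by (metis bij_pointE)
  also have "\<dots> \<longleftrightarrow> (\<exists>b. sat f (\<pi> \<circ> \<sigma>(x := b)))" by (simp add: fun_upd_comp)
  finally show ?case by (simp only: sat.simps FEx.IH[OF FEx.prems])
next
  case (FAll x f)
  have "(\<forall>a. sat f ((\<pi> \<circ> \<sigma>)(x := a))) \<longleftrightarrow> (\<forall>b. sat f ((\<pi> \<circ> \<sigma>)(x := \<pi> b)))"
    using FAll.prems by (metis bij_pointE)
  also have "\<dots> \<longleftrightarrow> (\<forall>b. sat f (\<pi> \<circ> \<sigma>(x := b)))" by (simp add: fun_upd_comp)
  finally show ?case by (simp only: sat.simps FAll.IH[OF FAll.prems])
qed auto

text \<open>The definition of values mentions no particular atom, hence commutes with renamings. For
  builders a witness for the renamed set is carried back by \<open>inv \<pi>\<close>.\<close>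

lemma denot_rename: "bij \<pi> \<Longrightarrow> denot e (\<pi> \<circ> \<sigma>) = rename \<pi> (denot e \<sigma>)"
  and members_rename: "bij \<pi> \<Longrightarrow> members b (\<pi> \<circ> \<sigma>) = rename \<pi> ` members b \<sigma>"
proof (induction e and b arbitrary: \<sigma> and \<sigma>)
  case (EUnion bs)
  have "elems (denot (EUnion bs) (\<pi> \<circ> \<sigma>)) = elems (rename \<pi> (denot (EUnion bs) \<sigma>))"
    using EUnion by (simp only: elems_rename elems_denot_EUnion image_UN) blast
  then show ?case by (rule elems_eqI[rotated 2]) simp_all
next
  case (Builder e xs f)
  show ?case
  proof (intro equalityI subsetI)
    fix v assume "v \<in> members (Builder e xs f) (\<pi> \<circ> \<sigma>)"
    then obtain \<tau> where t: "v = denot e \<tau>" "\<tau> \<in> rebindings xs (\<pi> \<circ> \<sigma>)" "sat f \<tau>" by auto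
    have "inv \<pi> \<circ> \<tau> \<in> rebindings xs \<sigma>"
      using rebindings_comp[OF t(2), of "inv \<pi>"] Builder.prems by (simp add: comp_inv_comp)
    moreover have "sat f (inv \<pi> \<circ> \<tau>)" "v = rename \<pi> (denot e (inv \<pi> \<circ> \<tau>))"
      using t sat_rename[OF Builder.prems, of f "inv \<pi> \<circ> \<tau>"] Builder.IH[OF Builder.prems, of "inv \<pi> \<circ> \<tau>"]
      by (simp_all only: comp_inv_comp[OF Builder.prems])
    ultimately show "v \<in> rename \<pi> ` members (Builder e xs f) \<sigma>" by auto
  next
    fix v assume "v \<in> rename \<pi> ` members (Builder e xs f) \<sigma>"
    then obtain \<tau> where t: "v = rename \<pi> (denot e \<tau>)" "\<tau> \<in> rebindings xs \<sigma>" "sat f \<tau>" by auto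
    then have "v = denot e (\<pi> \<circ> \<tau>) \<and> \<pi> \<circ> \<tau> \<in> rebindings xs (\<pi> \<circ> \<sigma>) \<and> sat f (\<pi> \<circ> \<tau>)"
      using Builder.prems by (simp add: Builder.IH rebindings_comp sat_rename)
    then show "v \<in> members (Builder e xs f) (\<pi> \<circ> \<sigma>)" by auto
  qed
qed simp

text \<open>The values of the free variables support the set: the renamed valuation agrees with the
  old one on them, so \<open>denot_cong\<close> applies after \<open>denot_rename\<close>.\<close>

lemma rename_denot_fixed:
  assumes "bij \<pi>" "\<And>x. x \<in> fv e \<Longrightarrow> \<pi> (\<sigma> x) = \<sigma> x"
  shows "rename \<pi> (denot e \<sigma>) = denot e \<sigma>"
  using denot_rename[OF assms(1), of e \<sigma>] denot_cong[of e "\<pi> \<circ> \<sigma>" \<sigma>] assms(2) by simp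

text \<open>The workhorse for moving parameters. Only the atoms of \<open>U - F\<close> have to
  move, into \<open>D - F\<close>, where counting leaves room for them; an atom of \<open>U\<close>
  in \<open>F\<close> stays, and so must lie in \<open>D\<close> already. The resulting injection is
  completed to a permutation of a finite set and by the identity elsewhere.\<close>

lemma ex_renaming:
  fixes F U D :: "'a set"
  assumes "finite F" "finite U" "finite D" "U \<inter> F \<subseteq> D" "card F + card U \<le> card D"
  shows "\<exists>\<pi>. bij \<pi> \<and> (\<forall>a\<in>F. \<pi> a = a) \<and> \<pi> ` U \<subseteq> D"
proof -
  have "card (U - F) \<le> card (D - F)"
    using assms card_mono[of U "U - F"] diff_card_le_card_Diff[OF assms(1), of D] by auto
  then obtain g where g: "inj_on g (U - F)" "g ` (U - F) \<subseteq> D - F"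
    using card_le_inj[of "U - F" "D - F"] assms by auto
  define f where "f = (\<lambda>a. if a \<in> F then a else g a)"
  have f: "inj_on f (F \<union> (U - F))" "f ` U \<subseteq> D"
    using g assms(4) by (auto simp: f_def inj_on_def)
  let ?A = "F \<union> (U - F)"
  let ?Z = "?A \<union> f ` ?A"
  have fin: "finite ?Z" using assms by simp
  \<comment> \<open>Inside the finite set \<open>?Z\<close>, domain and range of the injection
    \<open>f\<close> have complements of equal size, so any bijection \<open>h\<close> between these
    complements completes a permutation.\<close>
  have "card (?Z - ?A) = card (?Z - f ` ?A)"
    using fin f(1) by (simp add: card_Diff_subset card_image)
  then obtain h where h: "bij_betw h (?Z - ?A) (?Z - f ` ?A)"
    using fin by (metis finite_Diff finite_same_card_bij)
  define \<pi> where "\<pi> = (\<lambda>a. if a \<in> ?A then f a else if a \<in> ?Z then h a else a)"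
  have A: "bij_betw \<pi> ?A (f ` ?A)"
    using f(1) by (auto simp: bij_betw_def \<pi>_def inj_on_def)
  have "bij_betw \<pi> (?Z - ?A) (?Z - f ` ?A)"
    using h by (rule bij_betw_cong[THEN iffD1, rotated]) (auto simp: \<pi>_def)
  then have "bij_betw \<pi> (?A \<union> (?Z - ?A)) (f ` ?A \<union> (?Z - f ` ?A))"
    by (rule bij_betw_combine[OF A]) auto
  moreover have "?A \<union> (?Z - ?A) = ?Z" "f ` ?A \<union> (?Z - f ` ?A) = ?Z" by auto
  ultimately have Z: "bij_betw \<pi> ?Z ?Z" by simp
  have "bij_betw \<pi> (- ?Z) (- ?Z)"
    by (rule bij_betw_cong[THEN iffD1, OF _ bij_betw_id]) (auto simp: \<pi>_def)
  then have "bij_betw \<pi> (?Z \<union> - ?Z) (?Z \<union> - ?Z)"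
    by (rule bij_betw_combine[OF Z]) auto
  moreover have "?Z \<union> - ?Z = UNIV" by blast
  ultimately have "bij \<pi>" by simp
  moreover have "\<pi> a = a" if "a \<in> F" for a using that by (simp add: \<pi>_def f_def)
  moreover have "\<pi> ` U \<subseteq> D" using f(2) by (auto simp: \<pi>_def)
  ultimately show ?thesis by blast
qed

section \<open>Members with parameters among finitely many atoms\<close>

type_synonym env = "(var \<times> atom) list"

definition valuation :: "env \<Rightarrow> var \<Rightarrow> atom" where
  "valuation ps = (\<lambda>x. the (map_of ps x))"

lemma valuation_Cons: "valuation ((x, a) # ps) = (valuation ps)(x := a)"
  by (auto simp: valuation_def)

text \<open>New pairs go in front, where \<open>map_of\<close> finds them first. So a binder shadows
  an outer variable of the same name, and of a repeated variable in the list the last occurrence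
  counts.\<close>

fun bindings :: "nat \<Rightarrow> var list \<Rightarrow> env \<Rightarrow> env set" where
  "bindings l [] ps = {ps}"
| "bindings l (x # xs) ps = (\<Union>a<2 ^ l. bindings l xs ((x, a) # ps))"

lemma valuation_bindings:
  "valuation ` bindings l xs ps = {\<tau> \<in> rebindings xs (valuation ps). \<tau> ` set xs \<subseteq> {..<2 ^ l}}"
proof (induction xs arbitrary: ps)
  case Nil
  then show ?case by (auto simp: rebindings_def)
next
  case (Cons x xs)
  have "valuation ` bindings l (x # xs) ps
      = (\<Union>a<2 ^ l. {\<tau> \<in> rebindings xs ((valuation ps)(x := a)). \<tau> ` set xs \<subseteq> {..<2 ^ l}})"
    by (simp add: image_UN Cons.IH valuation_Cons del: fun_upd_apply)
  also have "\<dots> = {\<tau> \<in> rebindings (x # xs) (valuation ps). \<tau> ` set (x # xs) \<subseteq> {..<2 ^ l}}"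
  proof (intro equalityI subsetI)
    fix \<tau> assume "\<tau> \<in> (\<Union>a<2 ^ l. {\<tau> \<in> rebindings xs ((valuation ps)(x := a)). \<tau> ` set xs \<subseteq> {..<2 ^ l}})"
    then obtain a where "a < 2 ^ l" "\<tau> \<in> rebindings xs ((valuation ps)(x := a))" "\<tau> ` set xs \<subseteq> {..<2 ^ l}"
      by blast
    \<comment> \<open>If \<open>x\<close> occurs again in \<open>xs\<close>, the value
      \<open>a\<close> is overwritten, and the bound on \<open>\<tau> x\<close> comes from the later
      occurrence.\<close>
    then show "\<tau> \<in> {\<tau> \<in> rebindings (x # xs) (valuation ps). \<tau> ` set (x # xs) \<subseteq> {..<2 ^ l}}"
      by (cases "x \<in> set xs") (auto simp: rebindings_def)
  next
    fix \<tau> assume "\<tau> \<in> {\<tau> \<in> rebindings (x # xs) (valuation ps). \<tau> ` set (x # xs) \<subseteq> {..<2 ^ l}}"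
    then have "\<tau> x < 2 ^ l" "\<tau> \<in> rebindings xs ((valuation ps)(x := \<tau> x))" "\<tau> ` set xs \<subseteq> {..<2 ^ l}"
      by (auto simp: rebindings_def)
    then show "\<tau> \<in> (\<Union>a<2 ^ l. {\<tau> \<in> rebindings xs ((valuation ps)(x := a)). \<tau> ` set xs \<subseteq> {..<2 ^ l}})"
      by blast
  qed
  finally show ?case .
qed

lemma bindings_fst: "ps' \<in> bindings l xs ps \<Longrightarrow> fst ` set ps' = set xs \<union> fst ` set ps"
proof (induction xs arbitrary: ps)
  case (Cons x xs)
  then obtain a where "ps' \<in> bindings l xs ((x, a) # ps)" by auto
  from Cons.IH[OF this] show ?case by simp
qed simp

lemma bindings_snd: "ps' \<in> bindings l xs ps \<Longrightarrow> snd ` set ps' \<subseteq> {..<2 ^ l} \<union> snd ` set ps"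
proof (induction xs arbitrary: ps)
  case (Cons x xs)
  then obtain a where a: "a < 2 ^ l" "ps' \<in> bindings l xs ((x, a) # ps)" by auto
  from Cons.IH[OF this(2)] a(1) show ?case by auto
qed simp

type_synonym obj = "expr \<times> env"

definition value_of :: "obj \<Rightarrow> val" where
  "value_of = (\<lambda>(e, ps). denot e (valuation ps))"

text \<open>A member is a closure, the body of a builder with an extended environment, so that it
  can be written on a tape without computing its value. Different closures may have the same
  value.\<close>

fun mems :: "nat \<Rightarrow> obj \<Rightarrow> obj set" where
  "mems l (EVar x, ps) = {}"
| "mems l (EUnion bs, ps) = {(e, ps') |e xs f ps'.
     Builder e xs f \<in> set bs \<and> ps' \<in> bindings l xs ps \<and> sat f (valuation ps')}"

text \<open>The bound on the length of the expression also bounds the number of its free variables.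
  The environment may bind further variables, left over from enclosing builders.\<close>

definition obj_ok :: "nat \<Rightarrow> nat \<Rightarrow> obj \<Rightarrow> bool" where
  "obj_ok n l = (\<lambda>(e, ps). length (write_expr e) \<le> n \<and> fv e \<subseteq> fst ` set ps \<and> snd ` set ps \<subseteq> {..<2 ^ l})"

text \<open>A support of the value. Counting only the free variables keeps it below the size of the
  expression, however long the environment becomes.\<close>

definition atoms_of :: "obj \<Rightarrow> atom set" where
  "atoms_of = (\<lambda>(e, ps). valuation ps ` fv e)"

section \<open>Sizes of expressions and the number of atoms they depend on\<close>

lemma length_write_var: "length (write_var x) \<ge> 1"
  by (simp add: write_var_def)

lemma length_le_write_vars: "length xs \<le> length (concat (map write_var xs))"
proof (induction xs)
  case (Cons x xs)
  then show ?case using length_write_var[of x] by simp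
qed simp

lemma card_fv_fm: "finite (fv_fm f) \<and> card (fv_fm f) \<le> length (write_fm f)"
proof (induction f)
  case (FEq x y)
  have "card {x, y} \<le> 2" by (simp add: card_insert_if)
  then show ?case using length_write_var[of x] length_write_var[of y] by simp
next
  case (FAnd f g)
  then show ?case using card_Un_le[of "fv_fm f" "fv_fm g"] by simp
next
  case (FOr f g)
  then show ?case using card_Un_le[of "fv_fm f" "fv_fm g"] by simp
next
  case (FEx x f)
  then show ?case using card_Diff1_le[of "fv_fm f" x] by (simp add: le_SucI trans_le_add2)
next
  case (FAll x f)
  then show ?case using card_Diff1_le[of "fv_fm f" x] by (simp add: le_SucI trans_le_add2)
qed simp

lemma card_fv: "finite (fv e) \<and> card (fv e) \<le> length (write_expr e)"
  and card_fv_builder: "finite (fv_builder b) \<and> card (fv_builder b) \<le> length (write_builder b)"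
proof (induction e and b)
  case (EVar x)
  then show ?case using length_write_var[of x] by simp
next
  case (EUnion bs)
  then have "finite (\<Union>b\<in>set bs. fv_builder b) \<and>
      card (\<Union>b\<in>set bs. fv_builder b) \<le> length (concat (map write_builder bs))"
  proof (induction bs)
    case (Cons b bs)
    then show ?case
      using card_Un_le[of "fv_builder b" "\<Union>b\<in>set bs. fv_builder b"] by fastforce
  qed simp
  then show ?case by simp
next
  case (Builder e xs f)
  have "card (fv e \<union> fv_fm f - set xs) \<le> card (fv e \<union> fv_fm f)"
    using Builder card_fv_fm[of f] by (intro card_mono) auto
  then show ?case
    using Builder card_fv_fm[of f] card_Un_le[of "fv e" "fv_fm f"] by simp
qed

lemma length_write_member: "b \<in> set bs \<Longrightarrow> length (write_builder b) < length (write_expr (EUnion bs))"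
  by (induction bs) auto

lemma length_write_Builder:
  "length (write_expr e) + length xs + length (write_fm f) < length (write_builder (Builder e xs f))"
  using length_le_write_vars[of xs] by simp

lemma card_atoms_of: "obj_ok n l m \<Longrightarrow> finite (atoms_of m) \<and> card (atoms_of m) \<le> n"
proof -
  assume a: "obj_ok n l m"
  obtain e ps where m: "m = (e, ps)" by force
  have "card (valuation ps ` fv e) \<le> card (fv e)" using card_fv[of e] by (simp add: card_image_le)
  then show ?thesis using a m card_fv[of e] by (simp add: obj_ok_def atoms_of_def)
qed

lemma valuation_in: "x \<in> fst ` set ps \<Longrightarrow> valuation ps x \<in> snd ` set ps"
proof -
  assume "x \<in> fst ` set ps"
  then have "map_of ps x \<noteq> None" by (simp add: map_of_eq_None_iff)
  then obtain a where a: "map_of ps x = Some a" by blast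
  then have "(x, a) \<in> set ps" by (rule map_of_SomeD)
  then show ?thesis using a by (force simp: valuation_def)
qed

lemma atoms_of_less: "obj_ok n l m \<Longrightarrow> atoms_of m \<subseteq> {..<2 ^ l}"
proof -
  assume ok: "obj_ok n l m"
  obtain e ps where m: "m = (e, ps)" by force
  have "valuation ps ` fv e \<subseteq> valuation ps ` (fst ` set ps)"
    using ok m by (intro image_mono) (simp add: obj_ok_def)
  also have "\<dots> \<subseteq> snd ` set ps" using valuation_in by blast
  also have "\<dots> \<subseteq> {..<2 ^ l}" using ok m by (simp add: obj_ok_def)
  finally show ?thesis by (simp add: atoms_of_def m)
qed

lemma obj_ok_mono: "obj_ok n l m \<Longrightarrow> l \<le> l' \<Longrightarrow> obj_ok n l' m"
proof -
  assume ok: "obj_ok n l m" "l \<le> l'"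
  obtain e ps where m: "m = (e, ps)" by force
  have "snd ` set ps \<subseteq> {..<2 ^ l}" using ok(1) m by (simp add: obj_ok_def)
  also have "\<dots> \<subseteq> {..<2 ^ l'}" using ok(2) by (simp add: power_increasing)
  finally show ?thesis using ok(1) m by (simp add: obj_ok_def)
qed

lemma memsE:
  assumes "m' \<in> mems l m"
  obtains bs ps e xs f ps' where "m = (EUnion bs, ps)" "m' = (e, ps')" "Builder e xs f \<in> set bs"
    "ps' \<in> bindings l xs ps" "sat f (valuation ps')"
proof -
  obtain ex ps where m: "m = (ex, ps)" by force
  show thesis using assms that m by (cases ex) auto
qed

text \<open>The same \<open>n\<close> and \<open>l\<close> serve at every depth of the recursion to
  members: bodies are shorter, and the variables bound on the way get atoms below
  \<open>2 ^ l\<close>.\<close>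

lemma obj_ok_mems:
  assumes "obj_ok n l m" "m' \<in> mems l m"
  shows "obj_ok n l m'"
proof -
  from assms(2) obtain bs ps e xs f ps' where m: "m = (EUnion bs, ps)"
    and m': "m' = (e, ps')" "Builder e xs f \<in> set bs" "ps' \<in> bindings l xs ps"
    by (rule memsE)
  have ok: "length (write_expr (EUnion bs)) \<le> n" "fv (EUnion bs) \<subseteq> fst ` set ps" "snd ` set ps \<subseteq> {..<2 ^ l}"
    using assms(1) m by (simp_all add: obj_ok_def)
  have "length (write_expr e) \<le> n"
    using length_write_member[OF m'(2)] length_write_Builder[of e xs f] ok(1) by linarith
  moreover have "fv e - set xs \<subseteq> fv (EUnion bs)" using m'(2) by force
  then have "fv e \<subseteq> fst ` set ps'"
    using ok(2) by (subst bindings_fst[OF m'(3)]) blast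
  moreover have "snd ` set ps' \<subseteq> {..<2 ^ l}"
    using bindings_snd[OF m'(3)] ok(3) by blast
  ultimately show ?thesis by (simp add: obj_ok_def m'(1))
qed

lemma in_mems:
  assumes "Builder e xs f \<in> set bs" "\<tau> \<in> rebindings xs (valuation ps)" "\<tau> ` set xs \<subseteq> {..<2 ^ l}" "sat f \<tau>"
  obtains m where "m \<in> mems l (EUnion bs, ps)" "value_of m = denot e \<tau>"
proof -
  obtain ps' where "ps' \<in> bindings l xs ps" "\<tau> = valuation ps'"
    using assms(2,3) valuation_bindings[of l xs ps] by blast
  then show thesis using that[of "(e, ps')"] assms by (auto simp: value_of_def)
qed

lemma mems_elems: "m' \<in> mems l m \<Longrightarrow> value_of m' \<in> elems (value_of m)"
proof -
  assume a: "m' \<in> mems l m"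
  then obtain bs ps e xs f ps' where m: "m = (EUnion bs, ps)"
    and m': "m' = (e, ps')" "Builder e xs f \<in> set bs" "ps' \<in> bindings l xs ps" "sat f (valuation ps')"
    by (rule memsE)
  have "valuation ps' \<in> rebindings xs (valuation ps)"
    using m'(3) valuation_bindings[of l xs ps] by blast
  then have "value_of m' \<in> members (Builder e xs f) (valuation ps)"
    using m' by (auto simp: value_of_def)
  then show ?thesis using m'(2) unfolding m value_of_def prod.case elems_denot_EUnion by blast
qed

section \<open>Restricting quantifiers over elements to finitely many members\<close>

definition fixing :: "atom set \<Rightarrow> (atom \<Rightarrow> atom) \<Rightarrow> bool" where
  "fixing F \<pi> \<longleftrightarrow> bij \<pi> \<and> (\<forall>a\<in>F. \<pi> a = a)"

lemma fixing_inv: "fixing F \<pi> \<Longrightarrow> fixing F (inv \<pi>)"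
  by (auto simp: fixing_def bij_imp_bij_inv) (metis bij_inv_eq_iff)

lemma rename_value_of: "fixing F \<pi> \<Longrightarrow> atoms_of m \<subseteq> F \<Longrightarrow> rename \<pi> (value_of m) = value_of m"
  unfolding fixing_def value_of_def atoms_of_def
  by (cases m) (auto intro!: rename_denot_fixed)

text \<open>The renamed witness \<open>\<pi> \<circ> \<tau>\<close> need not be a rebinding of the
  environment, as \<open>\<pi>\<close> may move the value of a variable that is not free in the set.
  Resetting such variables to their values in \<open>ps\<close> gives \<open>\<tau>'\<close>, which
  agrees with it on everything the body and the formula read.\<close>

lemma move_member:
  assumes b: "Builder e xs f \<in> set bs" "\<tau> \<in> rebindings xs (valuation ps)" "sat f \<tau>"
    and \<pi>: "fixing (atoms_of (EUnion bs, ps)) \<pi>" "\<pi> ` \<tau> ` set xs \<subseteq> {..<2 ^ l}"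
  obtains m where "m \<in> mems l (EUnion bs, ps)" "value_of m = rename \<pi> (denot e \<tau>)"
proof -
  define \<tau>' where "\<tau>' = (\<lambda>y. if y \<in> set xs then \<pi> (\<tau> y) else valuation ps y)"
  have ag: "(\<pi> \<circ> \<tau>) y = \<tau>' y" if "y \<in> fv e \<union> fv_fm f" for y
  proof (cases "y \<in> set xs")
    case False
    then have "y \<in> fv (EUnion bs)" using that b(1) by force
    then have "\<pi> (valuation ps y) = valuation ps y" using \<pi>(1) by (auto simp: fixing_def atoms_of_def)
    then show ?thesis using False b(2) by (simp add: \<tau>'_def rebindings_def)
  qed (simp add: \<tau>'_def)
  have bij: "bij \<pi>" using \<pi>(1) by (simp add: fixing_def)
  have "\<tau>' \<in> rebindings xs (valuation ps)" "\<tau>' ` set xs \<subseteq> {..<2 ^ l}"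
    using \<pi>(2) by (auto simp: \<tau>'_def rebindings_def)
  moreover have "sat f \<tau>'" using sat_cong[of f "\<pi> \<circ> \<tau>" \<tau>'] ag b(3) sat_rename[OF bij, of f \<tau>] by simp
  moreover have "denot e \<tau>' = rename \<pi> (denot e \<tau>)"
    using denot_cong[of e "\<pi> \<circ> \<tau>" \<tau>'] ag denot_rename[OF bij, of e \<tau>] by simp
  ultimately show thesis using that in_mems[OF b(1), of \<tau>' ps l] by metis
qed

lemma elemsE:
  assumes "v \<in> elems (value_of m)"
  obtains bs ps e xs f \<tau> where "m = (EUnion bs, ps)" "Builder e xs f \<in> set bs"
    "\<tau> \<in> rebindings xs (valuation ps)" "sat f \<tau>" "v = denot e \<tau>"
proof -
  obtain ex ps where m: "m = (ex, ps)" by force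
  then show thesis
  proof (cases ex)
    case (EVar x)
    then show thesis using assms m by (simp add: value_of_def)
  next
    case (EUnion bs)
    then have "v \<in> (\<Union>b\<in>set bs. members b (valuation ps))"
      using assms m by (simp only: value_of_def prod.case elems_denot_EUnion)
    then obtain b where "b \<in> set bs" "v \<in> members b (valuation ps)" by (rule UN_E)
    moreover obtain e xs f where "b = Builder e xs f" by (cases b)
    ultimately show thesis using that[of bs ps e xs f] m EUnion by auto
  qed
qed

lemma length_builder_vars: "Builder e xs f \<in> set bs \<Longrightarrow> obj_ok n l (EUnion bs, ps) \<Longrightarrow> card (\<tau> ` set xs) \<le> n"
proof -
  assume b: "Builder e xs f \<in> set bs" "obj_ok n l (EUnion bs, ps)"
  have "card (\<tau> ` set xs) \<le> length xs"
    using card_image_le[of "set xs" \<tau>] card_length[of xs] by simp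
  also have "\<dots> \<le> n"
  proof -
    have "length (write_expr (EUnion bs)) \<le> n" using b(2) unfolding obj_ok_def by blast
    then show ?thesis using length_write_member[OF b(1)] length_write_Builder[of e xs f] by linarith
  qed
  finally show ?thesis .
qed

text \<open>A quantifier over the members of a set may be restricted to members with parameters below
  \<open>2 ^ l\<close>, provided the matrix is invariant under renamings that fix a set \<open>F\<close> containing the
  parameters of the set, and there is room for the parameters of one member next to \<open>F\<close>.\<close>

lemma ex_elems_iff_mems:
  assumes ok: "obj_ok n l m" and F: "atoms_of m \<subseteq> F" "F \<subseteq> {..<2 ^ l'}" "card F + n \<le> 2 ^ l'"
    and inv: "\<And>\<pi> v. fixing F \<pi> \<Longrightarrow> Q v \<Longrightarrow> Q (rename \<pi> v)"
  shows "(\<exists>v\<in>elems (value_of m). Q v) \<longleftrightarrow> (\<exists>m'\<in>mems l' m. Q (value_of m'))"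
proof
  assume "\<exists>v\<in>elems (value_of m). Q v"
  then obtain v where v: "v \<in> elems (value_of m)" "Q v" by blast
  from v(1) obtain bs ps e xs f \<tau> where m: "m = (EUnion bs, ps)" "Builder e xs f \<in> set bs"
    "\<tau> \<in> rebindings xs (valuation ps)" "sat f \<tau>" "v = denot e \<tau>" by (rule elemsE)
  have finF: "finite F" using F(2) by (rule finite_subset) simp
  have "card F + card (\<tau> ` set xs) \<le> card {..<(2 :: nat) ^ l'}"
    using F(3) length_builder_vars[OF m(2), of n l ps \<tau>] ok m(1) by simp
  moreover have "\<tau> ` set xs \<inter> F \<subseteq> {..<2 ^ l'}" using F(2) by blast
  ultimately obtain \<pi> where \<pi>: "bij \<pi>" "\<forall>a\<in>F. \<pi> a = a" "\<pi> ` \<tau> ` set xs \<subseteq> {..<2 ^ l'}"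
    using ex_renaming[of F "\<tau> ` set xs" "{..<2 ^ l'}"] finF by auto
  then have fx: "fixing F \<pi>" "fixing (atoms_of (EUnion bs, ps)) \<pi>"
    using F(1) m(1) by (auto simp: fixing_def)
  obtain m' where "m' \<in> mems l' (EUnion bs, ps)" "value_of m' = rename \<pi> (denot e \<tau>)"
    using move_member[OF m(2-4) fx(2) \<pi>(3)] by blast
  then show "\<exists>m'\<in>mems l' m. Q (value_of m')"
    using inv[OF fx(1) v(2)] unfolding m(1,5) by metis
next
  assume "\<exists>m'\<in>mems l' m. Q (value_of m')"
  then show "\<exists>v\<in>elems (value_of m). Q v" using mems_elems by blast
qed

lemma rename_in_elems_value:
  assumes "fixing F \<pi>" "atoms_of m \<subseteq> F"
  shows "rename \<pi> v \<in> elems (value_of m) \<longleftrightarrow> v \<in> elems (value_of m)"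
proof -
  have "elems (value_of m) = rename \<pi> ` elems (value_of m)"
    using rename_value_of[OF assms] elems_rename[of \<pi> "value_of m"] by simp
  moreover have "rename \<pi> v \<in> rename \<pi> ` elems (value_of m) \<longleftrightarrow> v \<in> elems (value_of m)"
    using assms(1) inj_rename by (auto simp: fixing_def)
  ultimately show ?thesis by simp
qed

text \<open>Being equal to the value of \<open>m'\<close> is invariant under renamings that fix the
  atoms of \<open>m'\<close>. The constant 3 counts the atoms of both objects and those of one
  member to be moved.\<close>

lemma elem_iff_mems:
  assumes "obj_ok n l m" "obj_ok n l m'" "3 * n \<le> 2 ^ l"
  shows "value_of m' \<in> elems (value_of m) \<longleftrightarrow> (\<exists>u\<in>mems l m. value_of u = value_of m')"
proof -
  let ?F = "atoms_of m \<union> atoms_of m'"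
  have "card ?F + n \<le> 2 ^ l"
    using card_Un_le[of "atoms_of m" "atoms_of m'"] card_atoms_of[OF assms(1)] card_atoms_of[OF assms(2)] assms(3)
    by linarith
  moreover have "?F \<subseteq> {..<2 ^ l}" using atoms_of_less[OF assms(1)] atoms_of_less[OF assms(2)] by blast
  ultimately have "(\<exists>v\<in>elems (value_of m). v = value_of m') \<longleftrightarrow> (\<exists>u\<in>mems l m. value_of u = value_of m')"
    by (intro ex_elems_iff_mems[OF assms(1), of ?F]) (auto simp: rename_value_of)
  then show ?thesis by blast
qed

text \<open>The outer quantifier is restricted for the predicate of not being an element of the
  second set, which is again invariant. The member found obeys the same bounds, so
  \<open>elem_iff_mems\<close> restricts the inner quantifier.\<close>

lemma subset_iff_mems:
  assumes "obj_ok n l m" "obj_ok n l m'" "3 * n \<le> 2 ^ l"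
  shows "elems (value_of m) \<subseteq> elems (value_of m') \<longleftrightarrow>
    (\<forall>u\<in>mems l m. \<exists>u'\<in>mems l m'. value_of u' = value_of u)"
proof -
  let ?F = "atoms_of m \<union> atoms_of m'"
  have "card ?F + n \<le> 2 ^ l"
    using card_Un_le[of "atoms_of m" "atoms_of m'"] card_atoms_of[OF assms(1)] card_atoms_of[OF assms(2)] assms(3)
    by linarith
  moreover have "?F \<subseteq> {..<2 ^ l}" using atoms_of_less[OF assms(1)] atoms_of_less[OF assms(2)] by blast
  moreover have "rename \<pi> v \<notin> elems (value_of m')" if "fixing ?F \<pi>" "v \<notin> elems (value_of m')" for \<pi> v
    using that rename_in_elems_value[OF that(1), of m'] by simp
  ultimately have "(\<exists>v\<in>elems (value_of m). v \<notin> elems (value_of m')) \<longleftrightarrow> (\<exists>u\<in>mems l m. value_of u \<notin> elems (value_of m'))"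
    by (intro ex_elems_iff_mems[OF assms(1), of ?F]) auto
  moreover have "value_of u \<in> elems (value_of m') \<longleftrightarrow> (\<exists>u'\<in>mems l m'. value_of u' = value_of u)" if "u \<in> mems l m" for u
    using elem_iff_mems[OF assms(2) obj_ok_mems[OF assms(1) that] assms(3)] .
  ultimately show ?thesis by blast
qed

fun is_union :: "obj \<Rightarrow> bool" where
  "is_union (EVar x, ps) = False"
| "is_union (EUnion bs, ps) = True"

lemma is_set_value_of: "is_set (value_of m) = is_union m"
  by (cases m rule: is_union.cases) (simp_all add: value_of_def)

text \<open>This equivalence is the recursion that the program \<open>Eq\<close> carries
  out.\<close>

lemma value_eq_iff_mems:
  assumes "obj_ok n l m" "obj_ok n l m'" "3 * n \<le> 2 ^ l" "is_union m" "is_union m'"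
  shows "value_of m = value_of m' \<longleftrightarrow>
    (\<forall>u\<in>mems l m. \<exists>u'\<in>mems l m'. value_of u' = value_of u) \<and>
    (\<forall>u'\<in>mems l m'. \<exists>u\<in>mems l m. value_of u = value_of u')"
proof -
  have "value_of m = value_of m' \<longleftrightarrow>
      elems (value_of m) \<subseteq> elems (value_of m') \<and> elems (value_of m') \<subseteq> elems (value_of m)"
    using elems_eqI[of "value_of m" "value_of m'"] assms(4,5) by (auto simp: is_set_value_of)
  then show ?thesis
    using subset_iff_mems[OF assms(1-3)] subset_iff_mems[OF assms(2,1,3)] by simp
qed

section \<open>Finite covers\<close>

lemma finite_bindings: "finite (bindings l xs ps)"
  by (induction xs arbitrary: ps) auto

text \<open>It allows the whole of \<open>mems l S\<close> to be taken as the finite cover.\<close>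

lemma finite_mems: "finite (mems l m)"
proof (cases m rule: is_union.cases)
  case (2 bs ps)
  have "mems l m \<subseteq> (\<Union>b\<in>set bs. case b of Builder e xs f \<Rightarrow> Pair e ` bindings l xs ps)"
    unfolding 2 by (force split: builder.split)
  moreover have "finite (\<Union>b\<in>set bs. case b of Builder e xs f \<Rightarrow> Pair e ` bindings l xs ps)"
    by (auto simp: finite_bindings split: builder.split)
  ultimately show ?thesis by (rule finite_subset)
qed simp

text \<open>Any \<open>card F + card U\<close> atoms outside the finite set \<open>B\<close> can be
  the target in \<open>ex_renaming\<close>; since \<open>U\<close> is disjoint from
  \<open>F\<close>, the condition there on atoms that stay is vacuous.\<close>

lemma avoiding_renaming:
  fixes F U B :: "nat set"
  assumes "finite F" "finite U" "finite B" "U \<inter> F = {}"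
  shows "\<exists>\<rho>. fixing F \<rho> \<and> \<rho> ` U \<inter> B = {}"
proof -
  have "infinite (- B)" using assms(3) by simp
  then obtain D where D: "D \<subseteq> - B" "finite D" "card D = card F + card U"
    using infinite_arbitrarily_large by blast
  then obtain \<rho> where "bij \<rho>" "\<forall>a\<in>F. \<rho> a = a" "\<rho> ` U \<subseteq> D"
    using ex_renaming[of F U D] assms by auto
  then show ?thesis using D(1) unfolding fixing_def by blast
qed

text \<open>If a finite cover exists, then the members with parameters below \<open>2 ^ l\<close> cover: given an
  element \<open>x\<close>, first rename the parameters of \<open>x\<close> from \<open>2 ^ l\<close> on away from those of the given cover,
  take a member covering the renamed \<open>x\<close>, rename back, and move the parameters of this member,
  none of which is a parameter of \<open>x\<close> from \<open>2 ^ l\<close> on, below \<open>2 ^ l\<close> while fixing \<open>x\<close>.\<close>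

lemma finite_cover_bounded:
  assumes X: "obj_ok n l X" and S: "obj_ok n l S" and n: "4 * n \<le> 2 ^ l"
    and C: "C \<subseteq> elems (value_of S)" "finite C" "(\<Union>s\<in>C. elems s) = elems (value_of X)"
    and x: "x \<in> elems (value_of X)"
  shows "\<exists>s\<in>mems l S. x \<in> elems (value_of s)"
proof -
  let ?D = "{..<(2 :: nat) ^ l}"
  let ?A = "atoms_of X \<union> atoms_of S"
  have A: "finite ?A" "card ?A \<le> 2 * n" "?A \<subseteq> ?D"
    using card_Un_le[of "atoms_of X" "atoms_of S"] card_atoms_of[OF X] card_atoms_of[OF S]
      atoms_of_less[OF X] atoms_of_less[OF S] by auto
  from x obtain bx px ex xx fx tx where x': "X = (EUnion bx, px)" "Builder ex xx fx \<in> set bx"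
    "tx \<in> rebindings xx (valuation px)" "sat fx tx" "x = denot ex tx" by (rule elemsE)
  let ?T = "tx ` set xx"
  have T: "finite ?T" "card ?T \<le> n"
    using length_builder_vars[OF x'(2)] X x'(1) by auto
  \<comment> \<open>One valuation is fixed for each member of \<open>C\<close>. As \<open>C\<close>
    is finite, these valuations give only finitely many atoms to the variables \<open>V\<close>
    bound in any builder of \<open>S\<close>, and finitely many atoms can be avoided.\<close>
  define rep where "rep c t \<longleftrightarrow> (\<exists>bs ps e xs f. S = (EUnion bs, ps) \<and> Builder e xs f \<in> set bs \<and>
    t \<in> rebindings xs (valuation ps) \<and> sat f t \<and> c = denot e t)" for c t
  have "\<exists>t. rep c t" if "c \<in> C" for c
  proof -
    have "c \<in> elems (value_of S)" using that C(1) by blast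
    then show ?thesis by (rule elemsE) (unfold rep_def, blast)
  qed
  then obtain t where t: "rep c (t c)" if "c \<in> C" for c by metis
  obtain bs ps where Sp: "S = (EUnion bs, ps)" if "C \<noteq> {}"
  proof (cases "C = {}")
    case False
    then obtain c where "c \<in> C" by blast
    from t[OF this] show ?thesis using that unfolding rep_def by blast
  qed (use that in blast)
  define V where "V = (\<Union>b\<in>set bs. case b of Builder e xs f \<Rightarrow> set xs)"
  have "finite V" unfolding V_def by (auto split: builder.split)
  then have B: "finite (\<Union>c\<in>C. t c ` V)" using C(2) by simp
  obtain \<rho> where \<rho>: "fixing ?A \<rho>" "\<rho> ` (?T - ?D) \<inter> (\<Union>c\<in>C. t c ` V) = {}"
    using avoiding_renaming[OF A(1) _ B, of "?T - ?D"] T(1) A(3) by auto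
  have bij\<rho>: "bij \<rho>" using \<rho>(1) by (simp add: fixing_def)
  have "rename \<rho> x \<in> elems (value_of X)"
    using x rename_value_of[OF \<rho>(1), of X] elems_rename[of \<rho> "value_of X"] by auto
  then obtain c where c: "c \<in> C" "rename \<rho> x \<in> elems c" using C(3) by blast
  obtain e xs f where e: "Builder e xs f \<in> set bs" "t c \<in> rebindings xs (valuation ps)" "sat f (t c)" "c = denot e (t c)"
    using t[OF c(1)] Sp c(1) unfolding rep_def by auto
  have xsV: "set xs \<subseteq> V" using e(1) by (force simp: V_def)
  let ?U = "inv \<rho> ` t c ` set xs"
  \<comment> \<open>The point of \<open>\<rho>\<close>: a parameter of \<open>x\<close> outside
    \<open>?D\<close> is sent by \<open>\<rho>\<close> to an atom that no \<open>t c\<close> uses,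
    whereas the atoms of \<open>?U\<close> are sent by \<open>\<rho>\<close> to values of
    \<open>t c\<close>. So the two kinds never meet outside \<open>?D\<close>, as
    \<open>ex_renaming\<close> demands.\<close>
  have "a \<in> ?D" if "a \<in> ?U" "a \<in> ?A \<union> ?T" for a
  proof (rule ccontr)
    assume "a \<notin> ?D"
    then have "a \<in> ?T - ?D" using that(2) A(3) by blast
    moreover have "\<rho> a \<in> t c ` V"
      using that(1) xsV bij\<rho> by (auto simp: bij_is_surj surj_f_inv_f)
    ultimately show False using \<rho>(2) c(1) by blast
  qed
  then have UT: "?U \<inter> (?A \<union> ?T) \<subseteq> ?D" by blast
  have "card ?U \<le> card (t c ` set xs)" by (rule card_image_le) simp
  also have "\<dots> \<le> n" using length_builder_vars[OF e(1)] S Sp c(1) by blast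
  \<comment> \<open>The room \<open>4 * n\<close> is shared by the parameters of \<open>X\<close>,
    those of \<open>S\<close>, the atoms bound for \<open>x\<close> and the atoms bound for the
    member.\<close>
  finally have "card (?A \<union> ?T) + card ?U \<le> card ?D"
    using card_Un_le[of ?A ?T] A(2) T(2) n by simp
  then obtain \<pi> where \<pi>: "bij \<pi>" "\<forall>a\<in>?A \<union> ?T. \<pi> a = a" "\<pi> ` ?U \<subseteq> ?D"
    using ex_renaming[of "?A \<union> ?T" ?U ?D] UT A(1) T(1) by auto
  have "rename \<pi> x = x"
  proof -
    have "\<pi> (tx y) = tx y" if "y \<in> fv ex" for y
    proof (cases "y \<in> set xx")
      case False
      then have "y \<in> fv (EUnion bx)" using that x'(2) by force
      then have "valuation px y \<in> atoms_of X" by (auto simp: atoms_of_def x'(1))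
      then show ?thesis using \<pi>(2) x'(3) False by (auto simp: rebindings_def)
    qed (use \<pi>(2) in auto)
    then show ?thesis using rename_denot_fixed[OF \<pi>(1)] x'(5) by simp
  qed
  moreover have "x \<in> elems (rename (inv \<rho>) c)"
    using c(2) bij\<rho> by (auto simp: elems_rename rename_inv intro: rev_image_eqI)
  ultimately have "x \<in> elems (rename \<pi> (rename (inv \<rho>) c))"
    by (metis elems_rename imageI)
  then have "x \<in> elems (rename (\<pi> \<circ> inv \<rho>) (denot e (t c)))" using e(4) by (simp only: rename_rename)
  moreover have "fixing (atoms_of (EUnion bs, ps)) (\<pi> \<circ> inv \<rho>)"
  proof -
    have "atoms_of (EUnion bs, ps) = atoms_of S" using Sp c(1) by blast
    then show ?thesis
      using \<pi>(1,2) fixing_inv[OF \<rho>(1)] by (simp add: fixing_def bij_comp)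
  qed
  moreover have "(\<pi> \<circ> inv \<rho>) ` t c ` set xs \<subseteq> ?D"
    using \<pi>(3) by (simp add: image_comp comp_assoc)
  ultimately obtain s where "s \<in> mems l (EUnion bs, ps)" "x \<in> elems (value_of s)"
    using move_member[OF e(1-3), of "\<pi> \<circ> inv \<rho>" l] by metis
  then show ?thesis using Sp c(1) by blast
qed

text \<open>The two bounds differ for a reason. Being covered by some member in
  \<open>mems l S\<close> is invariant only under renamings that fix all atoms below
  \<open>2 ^ l\<close>. Restricting the quantifier over elements therefore needs room for
  \<open>2 ^ l + n\<close> atoms, which \<open>Suc l\<close> provides. Conversely, the values of
  \<open>mems l S\<close> form the finite cover; they are subsets of \<open>X\<close> because the
  instance is valid.\<close>

lemma has_finite_cover_iff_mems:
  assumes X: "obj_ok n l X" and S: "obj_ok n l S" and n: "4 * n \<le> 2 ^ l"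
    and inst: "set_covering_instance (value_of X) (value_of S)"
  shows "has_finite_cover (value_of X) (value_of S) \<longleftrightarrow>
    (\<forall>x\<in>mems (Suc l) X. \<exists>s\<in>mems l S. \<exists>y\<in>mems (Suc l) s. value_of y = value_of x)"
proof -
  let ?D = "{..<(2 :: nat) ^ l}"
  let ?Q = "\<lambda>v. \<forall>s\<in>mems l S. v \<notin> elems (value_of s)"
  have Xs: "obj_ok n (Suc l) X" using obj_ok_mono[OF X] by simp
  have n3: "3 * n \<le> 2 ^ Suc l" using n by simp
  have "?Q (rename \<pi> v)" if p: "fixing ?D \<pi>" "?Q v" for \<pi> v
  proof
    fix s assume s: "s \<in> mems l S"
    have "atoms_of s \<subseteq> ?D" using atoms_of_less[OF obj_ok_mems[OF S s]] .
    then show "rename \<pi> v \<notin> elems (value_of s)"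
      using p s rename_in_elems_value[OF p(1), of s] by simp
  qed
  then have "(\<exists>v\<in>elems (value_of X). ?Q v) \<longleftrightarrow> (\<exists>x\<in>mems (Suc l) X. ?Q (value_of x))"
    using n atoms_of_less[OF X] by (intro ex_elems_iff_mems[OF X, of ?D]) auto
  moreover have "value_of x \<in> elems (value_of s) \<longleftrightarrow> (\<exists>y\<in>mems (Suc l) s. value_of y = value_of x)"
    if "x \<in> mems (Suc l) X" "s \<in> mems l S" for x s
    using elem_iff_mems[OF obj_ok_mono[OF obj_ok_mems[OF S that(2)]] obj_ok_mems[OF Xs that(1)] n3] by simp
  ultimately have "(\<forall>x\<in>mems (Suc l) X. \<exists>s\<in>mems l S. \<exists>y\<in>mems (Suc l) s. value_of y = value_of x) \<longleftrightarrow>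
      (\<forall>v\<in>elems (value_of X). \<exists>s\<in>mems l S. v \<in> elems (value_of s))"
    by blast
  also have "\<dots> \<longleftrightarrow> has_finite_cover (value_of X) (value_of S)"
  proof
    assume *: "\<forall>v\<in>elems (value_of X). \<exists>s\<in>mems l S. v \<in> elems (value_of s)"
    have "value_of ` mems l S \<subseteq> elems (value_of S)" using mems_elems by blast
    moreover from this have "(\<Union>s\<in>value_of ` mems l S. elems s) = elems (value_of X)"
    proof -
      have "elems s \<subseteq> elems (value_of X)" if "s \<in> elems (value_of S)" for s
        using inst that by (simp add: set_covering_instance_def)
      then have "(\<Union>s\<in>value_of ` mems l S. elems s) \<subseteq> elems (value_of X)"
        using \<open>value_of ` mems l S \<subseteq> elems (value_of S)\<close> by (meson UN_least subsetD)
      moreover have "elems (value_of X) \<subseteq> (\<Union>s\<in>value_of ` mems l S. elems s)"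
        using * by auto
      ultimately show ?thesis by (rule subset_antisym)
    qed
    ultimately show "has_finite_cover (value_of X) (value_of S)"
      unfolding has_finite_cover_def
      by (intro exI[of _ "value_of ` mems l S"] conjI finite_imageI finite_mems)
  next
    assume "has_finite_cover (value_of X) (value_of S)"
    then show "\<forall>v\<in>elems (value_of X). \<exists>s\<in>mems l S. v \<in> elems (value_of s)"
      using finite_cover_bounded[OF X S n] unfolding has_finite_cover_def by blast
  qed
  finally show ?thesis by simp
qed

section \<open>The covering condition on members\<close>

text \<open>The equation with the Kuratowski pair, where \<open>P\<close> is the inner set, is
  spelled out by memberships and bounded quantifiers, since these can be restricted to
  \<open>mems\<close>.\<close>

definition cover_pair :: "val \<Rightarrow> val \<Rightarrow> val \<Rightarrow> val \<Rightarrow> bool" where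
  "cover_pair V X P S \<longleftrightarrow> X \<in> elems V \<and> P \<in> elems V \<and> S \<in> elems P \<and>
    (\<forall>v\<in>elems V. v = X \<or> v = P) \<and> X \<in> elems P \<and> (\<forall>p\<in>elems P. p = X \<or> p = S) \<and>
    set_covering_instance X S \<and> has_finite_cover X S"

lemma rcset_cinsert [simp]: "rcset (cinsert x A) = insert x (rcset A)" "rcset cempty = {}"
  by (simp_all add: cinsert.rep_eq bot_cset.rep_eq)

lemma elems_kpair: "elems (kpair X S) = {X, Set (cinsert X (csingle S))}"
  by (simp add: kpair_def)

lemma is_set_iff_elems: "v \<in> elems u \<Longrightarrow> is_set u"
  by (cases u) auto

lemma ex_cover_pair_iff:
  "(\<exists>X P S. cover_pair V X P S) \<longleftrightarrow>
    (\<exists>X S. V = kpair X S \<and> set_covering_instance X S \<and> has_finite_cover X S)"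
proof
  assume "\<exists>X P S. cover_pair V X P S"
  then obtain X P S where c: "X \<in> elems V" "P \<in> elems V" "S \<in> elems P" "\<forall>v\<in>elems V. v = X \<or> v = P"
    "X \<in> elems P" "\<forall>p\<in>elems P. p = X \<or> p = S" "set_covering_instance X S" "has_finite_cover X S"
    unfolding cover_pair_def by blast
  have "elems P = {X, S}" using c by blast
  then have P: "P = Set (cinsert X (csingle S))"
    using is_set_iff_elems[OF c(3)] by (intro elems_eqI) simp_all
  have "elems V = {X, P}" using c by blast
  then have "V = kpair X S"
    using is_set_iff_elems[OF c(1)] P by (intro elems_eqI) (simp_all add: elems_kpair, simp add: kpair_def)
  then show "\<exists>X S. V = kpair X S \<and> set_covering_instance X S \<and> has_finite_cover X S"
    using c by blast
next
  assume "\<exists>X S. V = kpair X S \<and> set_covering_instance X S \<and> has_finite_cover X S"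
  then obtain X S where "V = kpair X S" "set_covering_instance X S" "has_finite_cover X S" by blast
  then have "cover_pair V X (Set (cinsert X (csingle S))) S"
    by (simp add: cover_pair_def elems_kpair)
  then show "\<exists>X P S. cover_pair V X P S" by blast
qed

section \<open>Invariance of the covering condition under renamings\<close>

lemma rename_in_elems: "bij \<pi> \<Longrightarrow> rename \<pi> v \<in> elems (rename \<pi> u) \<longleftrightarrow> v \<in> elems u"
  by (auto simp: elems_rename inj_rename)

lemma ball_elems_rename: "(\<forall>v\<in>elems (rename \<pi> u). Q v) \<longleftrightarrow> (\<forall>v\<in>elems u. Q (rename \<pi> v))"
  by (simp add: elems_rename)

lemma rename_elems_subset: "bij \<pi> \<Longrightarrow> elems (rename \<pi> u) \<subseteq> elems (rename \<pi> v) \<longleftrightarrow> elems u \<subseteq> elems v"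
  unfolding subset_eq ball_elems_rename by (simp add: rename_in_elems)

lemma set_covering_instance_rename:
  "bij \<pi> \<Longrightarrow> set_covering_instance (rename \<pi> X) (rename \<pi> S) \<longleftrightarrow> set_covering_instance X S"
  by (simp add: set_covering_instance_def ball_elems_rename rename_elems_subset)

lemma has_finite_cover_rename:
  "bij \<pi> \<Longrightarrow> has_finite_cover X S \<Longrightarrow> has_finite_cover (rename \<pi> X) (rename \<pi> S)"
proof -
  assume "bij \<pi>" "has_finite_cover X S"
  then obtain C where C: "C \<subseteq> elems S" "finite C" "(\<Union>s\<in>C. elems s) = elems X"
    unfolding has_finite_cover_def by blast
  have "(\<Union>s\<in>rename \<pi> ` C. elems s) = rename \<pi> ` (\<Union>s\<in>C. elems s)"
    by (simp add: elems_rename image_UN)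
  moreover have "rename \<pi> ` C \<subseteq> elems (rename \<pi> S)" unfolding elems_rename using C(1) by (rule image_mono)
  ultimately show ?thesis
    unfolding has_finite_cover_def using C(2,3)
    by (intro exI[of _ "rename \<pi> ` C"]) (simp add: elems_rename)
qed

lemma cover_pair_rename:
  "bij \<pi> \<Longrightarrow> cover_pair V X P S \<Longrightarrow> cover_pair (rename \<pi> V) (rename \<pi> X) (rename \<pi> P) (rename \<pi> S)"
  by (simp add: cover_pair_def ball_elems_rename rename_in_elems inj_rename
      set_covering_instance_rename has_finite_cover_rename)

text \<open>What remains of \<open>cover_pair\<close> once \<open>X\<close> and \<open>P\<close> are
  chosen among the members of \<open>V\<close> and \<open>S\<close> among those of \<open>P\<close>.
  The mixture of \<open>l\<close> and \<open>Suc l\<close> in the last conjunct is that of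
  \<open>has_finite_cover_iff_mems\<close>.\<close>

definition cover_test :: "nat \<Rightarrow> obj \<Rightarrow> obj \<Rightarrow> obj \<Rightarrow> obj \<Rightarrow> bool" where
  "cover_test l V X P S \<longleftrightarrow>
    (\<forall>v\<in>mems l V. value_of v = value_of X \<or> value_of v = value_of P) \<and>
    (\<exists>p\<in>mems l P. value_of p = value_of X) \<and>
    (\<forall>p\<in>mems l P. value_of p = value_of X \<or> value_of p = value_of S) \<and>
    is_union X \<and> is_union S \<and>
    (\<forall>s\<in>mems l S. is_union s) \<and>
    (\<forall>s\<in>mems l S. \<forall>y\<in>mems l s. \<exists>x\<in>mems l X. value_of y = value_of x) \<and>
    (\<forall>x\<in>mems (Suc l) X. \<exists>s\<in>mems l S. \<exists>y\<in>mems (Suc l) s. value_of y = value_of x)"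

text \<open>Origin of the constant 4: at most three objects are held fixed while the parameters of
  one member move.\<close>

lemma union_room:
  assumes "obj_ok n l u" "obj_ok n l v" "obj_ok n l w" "4 * n \<le> 2 ^ l"
  shows "card (atoms_of u \<union> atoms_of v \<union> atoms_of w) + n \<le> 2 ^ l"
    "atoms_of u \<union> atoms_of v \<union> atoms_of w \<subseteq> {..<2 ^ l}"
proof -
  show "card (atoms_of u \<union> atoms_of v \<union> atoms_of w) + n \<le> 2 ^ l"
    using card_Un_le[of "atoms_of u \<union> atoms_of v" "atoms_of w"] card_Un_le[of "atoms_of u" "atoms_of v"]
      card_atoms_of[OF assms(1)] card_atoms_of[OF assms(2)] card_atoms_of[OF assms(3)] assms(4)
    by linarith
  show "atoms_of u \<union> atoms_of v \<union> atoms_of w \<subseteq> {..<2 ^ l}"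
    using atoms_of_less[OF assms(1)] atoms_of_less[OF assms(2)] atoms_of_less[OF assms(3)] by blast
qed

lemma ball_or_iff_mems:
  assumes "obj_ok n l u" "obj_ok n l v" "obj_ok n l w" "4 * n \<le> 2 ^ l"
  shows "(\<forall>x\<in>elems (value_of u). x = value_of v \<or> x = value_of w) \<longleftrightarrow>
    (\<forall>x\<in>mems l u. value_of x = value_of v \<or> value_of x = value_of w)"
proof -
  let ?F = "atoms_of u \<union> atoms_of v \<union> atoms_of w"
  have "rename \<pi> x \<noteq> value_of v \<and> rename \<pi> x \<noteq> value_of w"
    if "fixing ?F \<pi>" "x \<noteq> value_of v \<and> x \<noteq> value_of w" for \<pi> x
  proof -
    have "rename \<pi> (value_of v) = value_of v" "rename \<pi> (value_of w) = value_of w" "bij \<pi>"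
      using that(1) by (auto intro!: rename_value_of[of ?F] simp: fixing_def)
    then show ?thesis using that(2) inj_rename[of \<pi> x] by metis
  qed
  then have "(\<exists>x\<in>elems (value_of u). x \<noteq> value_of v \<and> x \<noteq> value_of w) \<longleftrightarrow>
      (\<exists>x\<in>mems l u. value_of x \<noteq> value_of v \<and> value_of x \<noteq> value_of w)"
    using union_room[OF assms] by (intro ex_elems_iff_mems[OF assms(1), of ?F]) auto
  then show ?thesis by blast
qed

lemma set_covering_instance_iff_mems:
  assumes "obj_ok n l X" "obj_ok n l S" "4 * n \<le> 2 ^ l"
  shows "set_covering_instance (value_of X) (value_of S) \<longleftrightarrow> is_union X \<and> is_union S \<and>
    (\<forall>s\<in>mems l S. is_union s) \<and> (\<forall>s\<in>mems l S. \<forall>y\<in>mems l s. \<exists>x\<in>mems l X. value_of y = value_of x)"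
proof -
  let ?F = "atoms_of S \<union> atoms_of X \<union> atoms_of X"
  let ?Q = "\<lambda>s. \<not> (is_set s \<and> elems s \<subseteq> elems (value_of X))"
  have "?Q (rename \<pi> s)" if "fixing ?F \<pi>" "?Q s" for \<pi> s
  proof -
    have "rename \<pi> (value_of X) = value_of X" "bij \<pi>"
      using that(1) by (auto intro!: rename_value_of[of ?F] simp: fixing_def)
    then show ?thesis using that(2) rename_elems_subset[of \<pi> s "value_of X"] by simp
  qed
  then have "(\<exists>s\<in>elems (value_of S). ?Q s) \<longleftrightarrow> (\<exists>s\<in>mems l S. ?Q (value_of s))"
    using union_room[OF assms(2,1,1,3)] by (intro ex_elems_iff_mems[OF assms(2), of ?F]) auto
  moreover have "elems (value_of s) \<subseteq> elems (value_of X) \<longleftrightarrow>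
      (\<forall>y\<in>mems l s. \<exists>x\<in>mems l X. value_of y = value_of x)" if "s \<in> mems l S" for s
    using subset_iff_mems[OF obj_ok_mems[OF assms(2) that] assms(1)] assms(3)
    by (simp add: eq_commute[of "value_of _" "value_of _"])
  ultimately show ?thesis
    unfolding set_covering_instance_def is_set_value_of by blast
qed

lemma cover_pair_iff_test:
  assumes V: "obj_ok n l V" and n: "4 * n \<le> 2 ^ l"
    and X: "X \<in> mems l V" and P: "P \<in> mems l V" and S: "S \<in> mems l P"
  shows "cover_pair (value_of V) (value_of X) (value_of P) (value_of S) \<longleftrightarrow> cover_test l V X P S"
proof -
  have ok: "obj_ok n l X" "obj_ok n l P" "obj_ok n l S"
    using obj_ok_mems[OF V X] obj_ok_mems[OF V P] obj_ok_mems[OF obj_ok_mems[OF V P] S] by auto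
  have n3: "3 * n \<le> 2 ^ l" using n by simp
  show ?thesis
    unfolding cover_pair_def cover_test_def
      ball_or_iff_mems[OF V ok(1,2) n] ball_or_iff_mems[OF ok(2,1,3) n]
      elem_iff_mems[OF ok(2,1) n3] set_covering_instance_iff_mems[OF ok(1,3) n]
    using mems_elems[OF X] mems_elems[OF P] mems_elems[OF S]
      has_finite_cover_iff_mems[OF ok(1,3) n] set_covering_instance_iff_mems[OF ok(1,3) n]
    by blast
qed

text \<open>The three existential quantifiers are restricted one after the other. An object chosen
  earlier becomes a parameter for the later ones, so the fixed atoms grow from those of
  \<open>V\<close> to those of \<open>V\<close>, \<open>X\<close> and \<open>P\<close>.\<close>

theorem covering_pair_iff_test:
  assumes V: "obj_ok n l V" and n: "4 * n \<le> 2 ^ l"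
  shows "(\<exists>X S. value_of V = kpair X S \<and> set_covering_instance X S \<and> has_finite_cover X S) \<longleftrightarrow>
    (\<exists>X\<in>mems l V. \<exists>P\<in>mems l V. \<exists>S\<in>mems l P. cover_test l V X P S)"
proof -
  let ?c = "cover_pair (value_of V)"
  have "(\<exists>X\<in>elems (value_of V). \<exists>P\<in>elems (value_of V). \<exists>S\<in>elems P. ?c X P S) \<longleftrightarrow>
      (\<exists>X\<in>mems l V. \<exists>P\<in>elems (value_of V). \<exists>S\<in>elems P. ?c (value_of X) P S)"
  \<comment> \<open>The repeated set makes \<open>union_room\<close> applicable although only one
    object is fixed here.\<close>
  proof (rule ex_elems_iff_mems[OF V, of "atoms_of V \<union> atoms_of V \<union> atoms_of V"])
    fix \<pi> X assume f: "fixing (atoms_of V \<union> atoms_of V \<union> atoms_of V) \<pi>"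
      and "\<exists>P\<in>elems (value_of V). \<exists>S\<in>elems P. ?c X P S"
    then obtain P S where PS: "P \<in> elems (value_of V)" "S \<in> elems P" "?c X P S" by blast
    have r: "rename \<pi> (value_of V) = value_of V" "bij \<pi>"
      using f by (auto intro!: rename_value_of[OF f] simp: fixing_def)
    have "rename \<pi> P \<in> elems (value_of V)" "rename \<pi> S \<in> elems (rename \<pi> P)" "?c (rename \<pi> X) (rename \<pi> P) (rename \<pi> S)"
      using PS r rename_in_elems[OF r(2), of P "value_of V"] rename_in_elems[OF r(2), of S P]
        cover_pair_rename[OF r(2) PS(3)] by auto
    then show "\<exists>P\<in>elems (value_of V). \<exists>S\<in>elems P. ?c (rename \<pi> X) P S" by blast
  qed (use union_room[OF V V V n] in auto)
  moreover have "(\<exists>P\<in>elems (value_of V). \<exists>S\<in>elems P. ?c (value_of X) P S) \<longleftrightarrow>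
      (\<exists>P\<in>mems l V. \<exists>S\<in>elems (value_of P). ?c (value_of X) (value_of P) S)" if "X \<in> mems l V" for X
  proof (rule ex_elems_iff_mems[OF V, of "atoms_of V \<union> atoms_of X \<union> atoms_of X"])
    fix \<pi> P assume f: "fixing (atoms_of V \<union> atoms_of X \<union> atoms_of X) \<pi>" and "\<exists>S\<in>elems P. ?c (value_of X) P S"
    then obtain S where S: "S \<in> elems P" "?c (value_of X) P S" by blast
    have r: "rename \<pi> (value_of V) = value_of V" "rename \<pi> (value_of X) = value_of X" "bij \<pi>"
      using f by (auto intro!: rename_value_of[OF f] simp: fixing_def)
    have "rename \<pi> S \<in> elems (rename \<pi> P)" "?c (value_of X) (rename \<pi> P) (rename \<pi> S)"
      using S r rename_in_elems[OF r(3), of S P] cover_pair_rename[OF r(3) S(2)] by auto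
    then show "\<exists>S\<in>elems (rename \<pi> P). ?c (value_of X) (rename \<pi> P) S" by blast
  qed (use union_room[OF V obj_ok_mems[OF V that] obj_ok_mems[OF V that] n] in auto)
  moreover have "(\<exists>S\<in>elems (value_of P). ?c (value_of X) (value_of P) S) \<longleftrightarrow>
      (\<exists>S\<in>mems l P. ?c (value_of X) (value_of P) (value_of S))" if XP: "X \<in> mems l V" "P \<in> mems l V" for X P
  proof (rule ex_elems_iff_mems[OF obj_ok_mems[OF V XP(2)], of "atoms_of V \<union> atoms_of X \<union> atoms_of P"])
    fix \<pi> S assume f: "fixing (atoms_of V \<union> atoms_of X \<union> atoms_of P) \<pi>" and S: "?c (value_of X) (value_of P) S"
    have r: "rename \<pi> (value_of V) = value_of V" "rename \<pi> (value_of X) = value_of X" "rename \<pi> (value_of P) = value_of P" "bij \<pi>"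
      using f by (auto intro!: rename_value_of[OF f] simp: fixing_def)
    then show "?c (value_of X) (value_of P) (rename \<pi> S)"
      using cover_pair_rename[OF r(4) S] by simp
  qed (use union_room[OF V obj_ok_mems[OF V XP(1)] obj_ok_mems[OF V XP(2)] n] in auto)
  moreover have "(\<exists>X S. value_of V = kpair X S \<and> set_covering_instance X S \<and> has_finite_cover X S) \<longleftrightarrow>
      (\<exists>X\<in>elems (value_of V). \<exists>P\<in>elems (value_of V). \<exists>S\<in>elems P. ?c X P S)"
    unfolding ex_cover_pair_iff[symmetric] unfolding cover_pair_def by blast
  ultimately show ?thesis using cover_pair_iff_test[OF V n] by simp
qed

section \<open>Machines with named tapes\<close>

definition nstep ::
  "('q \<Rightarrow> ('x \<Rightarrow> 'a symbol) \<Rightarrow> 'q \<times> ('x \<Rightarrow> 'a symbol \<times> move)) \<Rightarrow> 'q set \<Rightarrow>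
    'q \<times> ('x \<Rightarrow> 'a tape) \<Rightarrow> 'q \<times> ('x \<Rightarrow> 'a tape)" where
  "nstep \<delta> H = (\<lambda>(q, T). if q \<in> H then (q, T)
     else (fst (\<delta> q (\<lambda>x. fst (T x) (snd (T x)))),
       \<lambda>x. act (snd (\<delta> q (\<lambda>x. fst (T x) (snd (T x)))) x) (T x)))"

text \<open>The cell \<open>-1\<close> is included because a head recognises the left end of the
  input or of the path by stepping onto the blank before it.\<close>

definition in_window :: "int \<Rightarrow> 'q \<times> ('x \<Rightarrow> 'a tape) \<Rightarrow> bool" where
  "in_window h c \<longleftrightarrow> (\<forall>x. -1 \<le> snd (snd c x) \<and> snd (snd c x) \<le> h)"

text \<open>States of any type and tapes indexed by a finite type are numbered to give a machine in
  the required format. A deciding run on which all heads stay in a polynomial window bounds the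
  visited cells, because nothing moves after the machine has halted.\<close>

lemma PSPACE_named_machine:
  fixes \<delta> :: "'q \<Rightarrow> ('x::finite \<Rightarrow> 'a::finite symbol) \<Rightarrow> 'q \<times> ('x \<Rightarrow> 'a symbol \<times> move)"
  defines "alph m \<equiv> insert Blank (range Input \<union> Work ` {..<m})"
  assumes Q: "finite Q" "q0 \<in> Q" "qa \<in> Q" "qr \<in> Q" "qa \<noteq> qr"
    and closed: "\<And>q rd. q \<in> Q \<Longrightarrow> range rd \<subseteq> alph m \<Longrightarrow>
      fst (\<delta> q rd) \<in> Q \<and> (\<forall>x. fst (snd (\<delta> q rd) x) \<in> alph m)"
    and run: "\<And>w. \<exists>T. (\<lambda>c c'. in_window (int (poly p (length w))) c \<and> c' = nstep \<delta> {qa, qr} c)\<^sup>*\<^sup>*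
        (q0, \<lambda>x. if x = x0 then input_tape w else blank_tape) (if w \<in> L then qa else qr, T) \<and>
        in_window (int (poly p (length w))) (qa, T)"
  shows "L \<in> PSPACE"
proof -
  obtain e where e: "bij_betw e Q {0..<card Q}"
    using ex_bij_betw_finite_nat[OF Q(1)] by blast
  define k where "k = card (UNIV :: 'x set)"
  have kpos: "k > 0" by (simp add: k_def finite_UNIV_card_ge_0)
  obtain h where h: "bij_betw h (UNIV :: 'x set) {0..<k}" "h x0 = 0"
  proof -
    obtain g where g: "bij_betw g (UNIV :: 'x set) {0..<k}"
      using ex_bij_betw_finite_nat[of "UNIV :: 'x set"] by (auto simp: k_def)
    \<comment> \<open>The input is expected on tape 0, so the numbering is adjusted by a
      transposition that gives \<open>x0\<close> this number.\<close>
    let ?g = "transpose (g x0) 0 \<circ> g"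
    have gx: "g x0 < k" using g by (auto simp: bij_betw_def)
    have "transpose (g x0) 0 permutes {0..<k}"
      by (rule permutes_swap_id) (use gx kpos in auto)
    then have "bij_betw ?g UNIV {0..<k}"
      using bij_betw_trans[OF g] permutes_imp_bij by blast
    then show thesis using that[of ?g] by (simp add: transpose_def)
  qed
  define dq where "dq = inv_into Q e"
  define dx where "dx = inv h"
  have dq: "dq (e q) = q" if "q \<in> Q" for q
    using that e by (simp add: dq_def bij_betw_inv_into_left)
  have eq: "e q < card Q" if "q \<in> Q" for q
    using that e by (auto simp: bij_betw_def)
  have dqQ: "dq i \<in> Q" if "i < card Q" for i
    using that e unfolding dq_def by (metis atLeastLessThan_iff bij_betw_def inv_into_into le0)
  have injh: "inj h" using h by (simp add: bij_betw_def)
  have dxh: "dx (h x) = x" for x using injh by (simp add: dx_def)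
  have hdx: "h (dx i) = i" if "i < k" for i
    using that h unfolding dx_def by (metis atLeastLessThan_iff bij_betw_def f_inv_into_f le0)
  have hk: "h x < k" for x using h by (auto simp: bij_betw_def)
  have dx0: "dx 0 = x0" using dxh[of x0] h(2) by simp
  define rd where "rd ss = (\<lambda>x. ss ! h x)" for ss :: "'a symbol list"
  define M :: "'a tm" where "M = \<lparr>num_tapes = k, num_states = card Q, num_work = m,
    start_state = e q0, accept_state = e qa, reject_state = e qr,
    delta = (\<lambda>q ss. (e (fst (\<delta> (dq q) (rd ss))), map (\<lambda>i. snd (\<delta> (dq q) (rd ss)) (dx i)) [0..<k]))\<rparr>"
  have al: "tape_alphabet M = alph m" by (simp add: tape_alphabet_def alph_def M_def)
  have eneq: "e q = e q' \<longleftrightarrow> q = q'" if "q \<in> Q" "q' \<in> Q" for q q'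
    using that dq by metis
  have wf: "wf_tm M"
    unfolding wf_tm_def
  proof (intro conjI allI impI)
    fix q ss assume a: "q < num_states M \<and> length ss = num_tapes M \<and> set ss \<subseteq> tape_alphabet M"
    have "range (rd ss) \<subseteq> alph m"
      using a hk al by (auto simp: rd_def M_def)
    then have c: "fst (\<delta> (dq q) (rd ss)) \<in> Q \<and> (\<forall>x. fst (snd (\<delta> (dq q) (rd ss)) x) \<in> alph m)"
      using a by (intro closed dqQ) (auto simp: M_def)
    then show "fst (delta M q ss) < num_states M" by (simp add: M_def eq)
    show "fst ` set (snd (delta M q ss)) \<subseteq> tape_alphabet M"
      using c al by (auto simp: M_def)
  qed (use Q eq eneq kpos in \<open>auto simp: M_def\<close>)
  define cv where "cv c = (e (fst c), map (\<lambda>i. snd c (dx i)) [0..<k])" for c :: "'q \<times> ('x \<Rightarrow> 'a tape)"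
  let ?N = "nstep \<delta> {qa, qr}"
  \<comment> \<open>The numbering of states is faithful only on \<open>Q\<close>, and
    \<open>\<delta>\<close> is known to stay within \<open>Q\<close> only when it reads symbols of
    the alphabet. The simulation is therefore proved under this invariant.\<close>
  define good where "good c \<longleftrightarrow> fst c \<in> Q \<and> (\<forall>x i. fst (snd c x) i \<in> alph m)"
    for c :: "'q \<times> ('x \<Rightarrow> 'a tape)"
  have good_step: "good (?N c)" if "good c" for c
  proof -
    obtain q T where c: "c = (q, T)" by force
    have 1: "fst (\<delta> q (\<lambda>x. fst (T x) (snd (T x)))) \<in> Q \<and>
        (\<forall>x. fst (snd (\<delta> q (\<lambda>x. fst (T x) (snd (T x)))) x) \<in> alph m)"
      using that by (intro closed) (auto simp: good_def c)
    have act: "fst (act a t) i \<in> alph m" if "fst a \<in> alph m" "\<forall>i. fst t i \<in> alph m" for a t i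
      using that by (cases a; cases t) auto
    show ?thesis using that 1 by (auto simp: good_def nstep_def c intro!: act)
  qed
  have sim: "cv (?N c) = step M (cv c)" if "good c" for c
  proof -
    obtain q T where c: "c = (q, T)" by force
    have q: "q \<in> Q" using that by (simp add: good_def c)
    have rd: "rd (map (\<lambda>(c, p). c p) (map (\<lambda>i. T (dx i)) [0..<k])) = (\<lambda>x. fst (T x) (snd (T x)))"
      by (rule ext) (simp add: rd_def hk dxh split_beta)
    have z: "map2 act (map (\<lambda>i. f (dx i)) [0..<k]) (map (\<lambda>i. T (dx i)) [0..<k])
       = map (\<lambda>i. act (f (dx i)) (T (dx i))) [0..<k]" for f
      by (rule nth_equalityI) auto
    have acc: "accept_state M = e qa" "reject_state M = e qr" by (simp_all add: M_def)
    have de: "delta M (e q) ss = (e (fst (\<delta> q (rd ss))), map (\<lambda>i. snd (\<delta> q (rd ss)) (dx i)) [0..<k])" for ss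
      by (simp add: M_def dq q)
    show ?thesis
      using Q q by (simp add: cv_def c nstep_def acc de rd z eneq del: map_map)
  qed
  \<comment> \<open>A halted configuration is a fixed point of \<open>step\<close>, so the window
    along the run up to halting bounds the heads at all times.\<close>
  have main: "\<exists>T. (\<exists>t. (step M ^^ t) (cv c) = cv (qf, T)) \<and> (\<forall>t. \<exists>c'. (step M ^^ t) (cv c) = cv c' \<and> in_window H c')"
    if "(\<lambda>c c'. in_window H c \<and> c' = ?N c)\<^sup>*\<^sup>* c (qf, T)" "in_window H (qa, T)" "qf \<in> {qa, qr}" "good c"
    for c T qf H
    using that(1,4)
  proof (induction rule: converse_rtranclp_induct)
    case base
    have fix1: "step M (cv (qf, T)) = cv (qf, T)"
      using sim[OF base] that(3) by (simp add: nstep_def)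
    have "(step M ^^ t) (cv (qf, T)) = cv (qf, T)" for t
      by (induction t) (simp_all add: fix1)
    moreover have "in_window H (qf, T)" using that(2) by (simp add: in_window_def)
    ultimately show ?case by blast
  next
    case (step c c')
    then have c': "c' = ?N c" "in_window H c" by auto
    then have s: "step M (cv c) = cv c'" using sim step.prems by simp
    obtain T t where T: "(step M ^^ t) (cv c') = cv (qf, T)"
      "\<forall>t. \<exists>d. (step M ^^ t) (cv c') = cv d \<and> in_window H d"
      using step.IH c' good_step step.prems by blast
    have "(step M ^^ Suc t) (cv c) = cv (qf, T)" using T(1) s by (simp add: funpow_Suc_right del: funpow.simps)
    moreover have "\<exists>d. (step M ^^ t) (cv c) = cv d \<and> in_window H d" for t
    proof (cases t)
      case 0 then show ?thesis using c' by (auto intro: exI[of _ c] simp del: split_paired_Ex)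
    next
      case (Suc u)
      then show ?thesis using T(2) s by (simp add: funpow_Suc_right del: funpow.simps)
    qed
    ultimately show ?case by blast
  qed
  have init: "config_at M w t = (step M ^^ t) (cv (q0, \<lambda>x. if x = x0 then input_tape w else blank_tape))" for w t
  proof -
    have "map (\<lambda>i. if dx i = x0 then input_tape w else blank_tape) [0..<k]
        = input_tape w # replicate (k - 1) blank_tape"
    proof (rule nth_equalityI)
      fix i assume "i < length (map (\<lambda>i. if dx i = x0 then input_tape w else blank_tape) [0..<k])"
      then have i: "i < k" by simp
      have "dx i = x0 \<longleftrightarrow> i = 0" using hdx[OF i] h(2) dx0 by metis
      then show "map (\<lambda>i. if dx i = x0 then input_tape w else blank_tape) [0..<k] ! i
          = (input_tape w # replicate (k - 1) blank_tape) ! i"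
        using i by (cases i) auto
    qed (use kpos in simp)
    then show ?thesis by (simp add: config_at_def cv_def M_def)
  qed
  have good0: "good (q0, \<lambda>x. if x = x0 then input_tape w else blank_tape)" for w
    using Q by (auto simp: good_def input_tape_def blank_tape_def alph_def)
  have key: "(if w \<in> L then accepts M w else rejects M w) \<and>
      visited_cells M w \<subseteq> {0..<k} \<times> {-1..int (poly p (length w))}" for w
  proof -
    obtain T0 where T0: "(\<lambda>c c'. in_window (int (poly p (length w))) c \<and> c' = nstep \<delta> {qa, qr} c)\<^sup>*\<^sup>*
        (q0, \<lambda>x. if x = x0 then input_tape w else blank_tape) (if w \<in> L then qa else qr, T0)"
        "in_window (int (poly p (length w))) (qa, T0)"
      using run[of w] by auto
    have qf: "(if w \<in> L then qa else qr) \<in> {qa, qr}" by simp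
    obtain T t where T: "(step M ^^ t) (cv (q0, \<lambda>x. if x = x0 then input_tape w else blank_tape))
        = cv (if w \<in> L then qa else qr, T)"
      and w: "\<forall>t. \<exists>c'. (step M ^^ t) (cv (q0, \<lambda>x. if x = x0 then input_tape w else blank_tape)) = cv c'
        \<and> in_window (int (poly p (length w))) c'"
      using main[OF T0 qf good0[of w]] by blast
    have "fst (config_at M w t) = e (if w \<in> L then qa else qr)"
      using T by (simp add: init cv_def)
    then have "if w \<in> L then accepts M w else rejects M w"
      by (auto simp: accepts_def rejects_def M_def)
    moreover have "visited_cells M w \<subseteq> {0..<k} \<times> {-1..int (poly p (length w))}"
    proof
      fix z assume "z \<in> visited_cells M w"
      then obtain i t where z: "z = (i, snd (snd (config_at M w t) ! i))" "i < k"
        by (auto simp: visited_cells_def M_def)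
      obtain c' where "config_at M w t = cv c'" "in_window (int (poly p (length w))) c'"
        using w init by metis
      then show "z \<in> {0..<k} \<times> {-1..int (poly p (length w))}"
        using z by (auto simp: cv_def in_window_def)
    qed
    ultimately show ?thesis by simp
  qed
  have "decides M L" using key by (auto simp: decides_def)
  \<comment> \<open>Positions from \<open>-1\<close> to the bound are \<open>p + [:2:]\<close> cells
    on each of the \<open>k\<close> tapes.\<close>
  moreover have "runs_in_space M (poly ([:k:] * (p + [:2:])))"
    unfolding runs_in_space_def
  proof (intro allI conjI)
    fix w :: "'a list"
    let ?S = "{0..<k} \<times> {-1..int (poly p (length w))}"
    have sub: "visited_cells M w \<subseteq> ?S" using key by blast
    then show "finite (visited_cells M w)" by (rule finite_subset) simp
    have "card (visited_cells M w) \<le> card ?S" by (rule card_mono[OF _ sub]) simp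
    also have "\<dots> = poly ([:k:] * (p + [:2:])) (length w)"
      by (simp add: card_cartesian_product nat_add_distrib)
    finally show "card (visited_cells M w) \<le> poly ([:k:] * (p + [:2:])) (length w)" .
  qed
  ultimately show ?thesis using wf by (auto simp: PSPACE_def)
qed

section \<open>An alternating stack language\<close>

text \<open>Tests and pushed letters depend only on the tops of the stacks, which a machine with one
  tape per register reads in a single step. \<open>Or\<close> and \<open>Neg\<close> have no local
  result: they act on the truth value of the entire continuation.\<close>

datatype ('r, 'a) com =
    Push 'r "('r \<Rightarrow> 'a option) \<Rightarrow> 'a"
  | Pop 'r
  | Seq "('r, 'a) com" "('r, 'a) com" (infixr ";;" 60)
  | If "('r \<Rightarrow> 'a option) \<Rightarrow> bool" "('r, 'a) com" "('r, 'a) com"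
  | While "('r \<Rightarrow> 'a option) \<Rightarrow> bool" "('r, 'a) com"
  | Or "('r, 'a) com" "('r, 'a) com"
  | Neg
  | Skip
  | Halt bool

type_synonym ('r, 'a) store = "'r \<Rightarrow> 'a list"

definition tops :: "('r, 'a) store \<Rightarrow> 'r \<Rightarrow> 'a option" where
  "tops s r = (case s r of [] \<Rightarrow> None | a # _ \<Rightarrow> Some a)"

text \<open>\<open>run t K s\<close> is the truth value of the program \<open>K\<close>, read as a boolean expression with
  connectives \<open>Or\<close> and \<open>Neg\<close>, or \<open>None\<close> if some branch takes more than \<open>t\<close> steps.\<close>

fun run :: "nat \<Rightarrow> ('r, 'a) com list \<Rightarrow> ('r, 'a) store \<Rightarrow> bool option" where
  "run 0 K s = None"
| "run (Suc t) [] s = None"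
| "run (Suc t) (Push r g # K) s = run t K (s(r := g (tops s) # s r))"
| "run (Suc t) (Pop r # K) s = run t K (s(r := tl (s r)))"
| "run (Suc t) ((c ;; d) # K) s = run t (c # d # K) s"
| "run (Suc t) (If b c d # K) s = run t ((if b (tops s) then c else d) # K) s"
| "run (Suc t) (While b c # K) s = run t (if b (tops s) then c # While b c # K else K) s"
| "run (Suc t) (Or c d # K) s =
    (case run t (c # K) s of None \<Rightarrow> None | Some True \<Rightarrow> Some True | Some False \<Rightarrow> run t (d # K) s)"
| "run (Suc t) (Neg # K) s = map_option Not (run t K s)"
| "run (Suc t) (Skip # K) s = run t K s"
| "run (Suc t) (Halt v # K) s = Some v"

text \<open>The control stacks that can arise before \<open>c\<close> hands over to
  \<open>K\<close>. There are only finitely many, as a \<open>While\<close> returns to itself, and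
  so control stacks can be states of the machine.\<close>

fun residuals :: "('r, 'a) com \<Rightarrow> ('r, 'a) com list \<Rightarrow> ('r, 'a) com list set" where
  "residuals (c ;; d) K = insert ((c ;; d) # K) (residuals c (d # K) \<union> residuals d K)"
| "residuals (If b c d) K = insert (If b c d # K) (residuals c K \<union> residuals d K)"
| "residuals (While b c) K = insert (While b c # K) (residuals c (While b c # K))"
| "residuals (Or c d) K = insert (Or c d # K) (residuals c K \<union> residuals d K)"
| "residuals c K = {c # K}"

lemma finite_residuals: "finite (residuals c K)"
  by (induction c arbitrary: K) auto

lemma residuals_self: "c # K \<in> residuals c K"
  by (cases c) auto

fun succs :: "('r, 'a) com list \<Rightarrow> ('r, 'a) com list set" where
  "succs [] = {}"
| "succs ((c ;; d) # K) = {c # d # K}"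
| "succs (If b c d # K) = {c # K, d # K}"
| "succs (While b c # K) = {c # While b c # K, K}"
| "succs (Or c d # K) = {c # K, d # K}"
| "succs (c # K) = {K}"

lemma residuals_closed: "P \<in> residuals c K \<Longrightarrow> succs P \<subseteq> residuals c K \<union> {K}"
proof (induction c arbitrary: K)
  case (Seq c d)
  then show ?case using residuals_self[of c "d # K"] residuals_self[of d K] by fastforce
next
  case (If b c d)
  then show ?case using residuals_self[of c K] residuals_self[of d K] by fastforce
next
  case (While b c)
  then show ?case using residuals_self[of c "While b c # K"] by fastforce
next
  case (Or c d)
  then show ?case using residuals_self[of c K] residuals_self[of d K] by fastforce
qed auto

section \<open>Alternating polynomial time is contained in PSPACE\<close>

text \<open>The machine evaluates the boolean expression depth first. It stores no intermediate stores:
  the tape \<open>Choices\<close> holds the path to the current branch, and after every change of the path the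
  program is started again on the input. The entries of the path are \<open>Work 0\<close> and \<open>Work 1\<close>
  (left and right branch of an \<open>Or\<close>) and \<open>Work 2\<close> (a \<open>Neg\<close>).\<close>

datatype 'r tape_name = Inp | Choices | Reg 'r

instance tape_name :: (finite) finite
proof
  have "(UNIV :: 'a tape_name set) = insert Inp (insert Choices (range Reg))"
    using tape_name.exhaust by blast
  then show "finite (UNIV :: 'a tape_name set)" by (rule ssubst) simp
qed

text \<open>\<open>Scan\<close> runs to the end of the input and \<open>Load\<close> copies it
  backwards, so that its first letter ends on top of the stack. A push takes the extra mode
  \<open>Write\<close>, because a machine step writes before it moves. \<open>Back v\<close> carries
  a value up the path, and \<open>Reset\<close> prepares a restart.\<close>

datatype ('r, 'a) mode =
    Scan | Load | Load_Write | Run "('r, 'a) com list" | Write 'r 'a "('r, 'a) com list"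
  | Back bool | Reset | Done bool

fun letter :: "'a symbol \<Rightarrow> 'a option" where
  "letter (Input a) = Some a"
| "letter _ = None"

definition acts :: "('x \<Rightarrow> 'a symbol) \<Rightarrow> ('x \<times> 'a symbol \<times> move) list \<Rightarrow> 'x \<Rightarrow> 'a symbol \<times> move" where
  "acts rd xs x = (case map_of xs x of None \<Rightarrow> (rd x, Stay) | Some am \<Rightarrow> am)"

text \<open>At an \<open>Or\<close> the recorded choice is followed; on the blank after the path a
  left choice is recorded. On the way back, the value of a left branch is final only if it is true;
  otherwise the entry is turned into a right choice and the run restarted. The value of a right
  branch is passed on, and a \<open>Neg\<close> entry negates it.\<close>

fun trans :: "'r \<Rightarrow> ('r, 'a) com \<Rightarrow> ('r, 'a) mode \<Rightarrow> ('r tape_name \<Rightarrow> 'a symbol) \<Rightarrow>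
    ('r, 'a) mode \<times> ('r tape_name \<Rightarrow> 'a symbol \<times> move)" where
  "trans r0 c Scan rd =
    (if rd Inp = Blank then (Load, acts rd [(Inp, Blank, Move_Left)])
     else (Scan, acts rd [(Inp, rd Inp, Move_Right)]))"
| "trans r0 c Load rd =
    (if rd Inp = Blank then (Run [c], acts rd [])
     else (Load_Write, acts rd [(Reg r0, rd (Reg r0), Move_Right)]))"
| "trans r0 c Load_Write rd =
    (Load, acts rd [(Reg r0, rd Inp, Stay), (Inp, rd Inp, Move_Left)])"
| "trans r0 c (Run (Push r g # K)) rd =
    (Write r (g (\<lambda>r. letter (rd (Reg r)))) K, acts rd [(Reg r, rd (Reg r), Move_Right)])"
| "trans r0 c (Write r a K) rd = (Run K, acts rd [(Reg r, Input a, Stay)])"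
| "trans r0 c (Run (Pop r # K)) rd =
    (Run K, acts rd (if rd (Reg r) = Blank then [] else [(Reg r, Blank, Move_Left)]))"
| "trans r0 c (Run ((p ;; q) # K)) rd = (Run (p # q # K), acts rd [])"
| "trans r0 c (Run (If b p q # K)) rd =
    (Run ((if b (\<lambda>r. letter (rd (Reg r))) then p else q) # K), acts rd [])"
| "trans r0 c (Run (While b p # K)) rd =
    (Run (if b (\<lambda>r. letter (rd (Reg r))) then p # While b p # K else K), acts rd [])"
| "trans r0 c (Run (Or p q # K)) rd =
    (if rd Choices = Work 1 then (Run (q # K), acts rd [(Choices, Work 1, Move_Right)])
     else (Run (p # K), acts rd [(Choices, Work 0, Move_Right)]))"
| "trans r0 c (Run (Neg # K)) rd = (Run K, acts rd [(Choices, Work 2, Move_Right)])"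
| "trans r0 c (Run (Skip # K)) rd = (Run K, acts rd [])"
| "trans r0 c (Run (Halt v # K)) rd = (Back v, acts rd [(Choices, rd Choices, Move_Left)])"
| "trans r0 c (Back v) rd =
    (if rd Choices = Blank then (Done v, acts rd [])
     else if rd Choices = Work 0 \<and> \<not> v then (Reset, acts rd [(Choices, Work 1, Stay)])
     else (Back (if rd Choices = Work 2 then \<not> v else v), acts rd [(Choices, Blank, Move_Left)]))"
| "trans r0 c Reset rd =
    (if rd Choices = Blank \<and> (\<forall>r. rd (Reg r) = Blank)
     then (Scan, acts rd [(Choices, Blank, Move_Right), (Inp, rd Inp, Move_Right)])
     else (Reset, \<lambda>x. case x of Inp \<Rightarrow> (rd Inp, Stay)
       | Choices \<Rightarrow> (rd Choices, if rd Choices = Blank then Stay else Move_Left)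
       | Reg r \<Rightarrow> (Blank, if rd (Reg r) = Blank then Stay else Move_Left)))"
| "trans r0 c m rd = (m, acts rd [])"

definition path_tape :: "nat list \<Rightarrow> int \<Rightarrow> 'a symbol" where
  "path_tape p = (\<lambda>i. if 0 \<le> i \<and> i < int (length p) then Work (p ! nat i) else Blank)"

text \<open>Cell 0 stays blank, so that the head of an empty stack reads a blank; in general the
  head stands at position \<open>length xs\<close>, on the top.\<close>

definition stack_tape :: "'a list \<Rightarrow> int \<Rightarrow> 'a symbol" where
  "stack_tape xs = (\<lambda>i. if 1 \<le> i \<and> i \<le> int (length xs) then Input (rev xs ! nat (i - 1)) else Blank)"

definition conf :: "'a list \<Rightarrow> ('r, 'a) mode \<Rightarrow> int \<Rightarrow> nat list \<Rightarrow> int \<Rightarrow> ('r, 'a) store \<Rightarrow>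
    ('r, 'a) mode \<times> ('r tape_name \<Rightarrow> 'a tape)" where
  "conf w m i p j s = (m, \<lambda>x. case x of Inp \<Rightarrow> (fst (input_tape w), i)
     | Choices \<Rightarrow> (path_tape p, j)
     | Reg r \<Rightarrow> (stack_tape (s r), int (length (s r))))"

definition reading :: "'a list \<Rightarrow> int \<Rightarrow> nat list \<Rightarrow> int \<Rightarrow> ('r, 'a) store \<Rightarrow> 'r tape_name \<Rightarrow> 'a symbol" where
  "reading w i p j s = (\<lambda>x. case x of Inp \<Rightarrow> fst (input_tape w) i
     | Choices \<Rightarrow> path_tape p j
     | Reg r \<Rightarrow> (case s r of [] \<Rightarrow> Blank | a # _ \<Rightarrow> Input a))"

lemma reading_simps [simp]:
  "reading w i p j s Inp = fst (input_tape w) i"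
  "reading w i p j s Choices = path_tape p j"
  "reading w i p j s (Reg r) = (case s r of [] \<Rightarrow> Blank | a # _ \<Rightarrow> Input a)"
  by (simp_all add: reading_def)

lemma stack_tape_top: "stack_tape xs (int (length xs)) = (case xs of [] \<Rightarrow> Blank | a # _ \<Rightarrow> Input a)"
  by (cases xs) (auto simp: stack_tape_def nth_append)

lemma stack_tape_push: "(stack_tape xs)(int (length xs) + 1 := Input a) = stack_tape (a # xs)"
  by (auto simp: stack_tape_def fun_eq_iff nth_append)

lemma stack_tape_pop: "(stack_tape (a # xs))(int (length xs) + 1 := Blank) = stack_tape xs"
  by (auto simp: stack_tape_def fun_eq_iff nth_append)

lemma stack_tape_id: "(stack_tape xs)(int (length xs) := (case xs of [] \<Rightarrow> Blank | a # _ \<Rightarrow> Input a)) = stack_tape xs"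
  using stack_tape_top[of xs] by (metis fun_upd_triv)

lemma nstep_conf:
  "nstep \<delta> H (conf w m i p j s) = (if m \<in> H then conf w m i p j s else
    (fst (\<delta> m (reading w i p j s)),
     \<lambda>x. act (snd (\<delta> m (reading w i p j s)) x) (snd (conf w m i p j s) x)))"
proof -
  have "(\<lambda>x. fst (snd (conf w m i p j s) x) (snd (snd (conf w m i p j s) x))) = reading w i p j s"
    by (auto simp: conf_def reading_def fun_eq_iff stack_tape_top split: tape_name.split)
  then show ?thesis by (simp add: nstep_def conf_def)
qed

lemma path_tape_end: "path_tape p (int (length p)) = Blank" "path_tape p (-1) = Blank"
  by (auto simp: path_tape_def)

lemma path_tape_nth: "k < length p \<Longrightarrow> path_tape p (int k) = Work (p ! k)"
  by (auto simp: path_tape_def)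

lemma path_tape_snoc: "(path_tape p)(int (length p) := Work a) = path_tape (p @ [a])"
  by (auto simp: path_tape_def fun_eq_iff nth_append)

lemma path_tape_drop: "(path_tape (p @ [a]))(int (length p) := Blank) = path_tape p"
  by (auto simp: path_tape_def fun_eq_iff nth_append)

lemma path_tape_change: "(path_tape (p @ [a]))(int (length p) := Work b) = path_tape (p @ [b])"
  by (auto simp: path_tape_def fun_eq_iff nth_append)

section \<open>Simulating the stack language by the machine\<close>

locale simulation =
  fixes r0 :: "'r::finite" and c0 :: "('r, 'a::finite) com" and w :: "'a list" and h :: int
begin

abbreviation "next \<equiv> nstep (trans r0 c0) {Done True, Done False}"

definition reach where
  "reach = (\<lambda>c c'. in_window h c \<and> c' = next c)\<^sup>*\<^sup>*"

lemma reach_refl [simp]: "reach c c"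
  by (simp add: reach_def)

lemma reach_trans: "reach c d \<Longrightarrow> reach d e \<Longrightarrow> reach c e"
  unfolding reach_def by (rule rtranclp_trans)

lemma reach_step: "in_window h c \<Longrightarrow> reach (next c) d \<Longrightarrow> reach c d"
  unfolding reach_def by (rule converse_rtranclp_into_rtranclp[of _ _ "next c"]) simp_all

lemma in_window_conf: "in_window h (conf w m i p j s) \<longleftrightarrow>
    -1 \<le> i \<and> i \<le> h \<and> -1 \<le> j \<and> j \<le> h \<and> (\<forall>r. int (length (s r)) \<le> h)"
proof (intro iffI)
  assume "in_window h (conf w m i p j s)"
  then have *: "-1 \<le> snd (snd (conf w m i p j s) x) \<and> snd (snd (conf w m i p j s) x) \<le> h" for x
    unfolding in_window_def by blast
  show "-1 \<le> i \<and> i \<le> h \<and> -1 \<le> j \<and> j \<le> h \<and> (\<forall>r. int (length (s r)) \<le> h)"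
    using *[of Inp] *[of Choices] *[of "Reg _"] by (simp add: conf_def)
next
  assume *: "-1 \<le> i \<and> i \<le> h \<and> -1 \<le> j \<and> j \<le> h \<and> (\<forall>r. int (length (s r)) \<le> h)"
  show "in_window h (conf w m i p j s)"
    unfolding in_window_def
  proof
    fix x
    show "-1 \<le> snd (snd (conf w m i p j s) x) \<and> snd (snd (conf w m i p j s) x) \<le> h"
      using * by (cases x) (simp_all add: conf_def)
  qed
qed

lemma act_unlisted:
  assumes "x \<notin> fst ` set xs"
  shows "act (acts (reading w i p j s) xs x) (snd (conf w m i p j s) x) = snd (conf w m i p j s) x"
proof -
  have "map_of xs x = None" using assms by (simp only: map_of_eq_None_iff not_False_eq_True)
  then show ?thesis by (cases x) (simp_all add: acts_def conf_def stack_tape_id)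
qed

lemma moves_none: "(m', \<lambda>x. act (acts (reading w i p j s) [] x) (snd (conf w m i p j s) x)) = conf w m' i p j s"
  by (simp add: act_unlisted) (simp add: conf_def)

lemma moves_one: "(m', \<lambda>x. act (acts (reading w i p j s) [(y, a)] x) (snd (conf w m i p j s) x))
    = (m', (snd (conf w m i p j s))(y := act a (snd (conf w m i p j s) y)))"
proof -
  have "act (acts (reading w i p j s) [(y, a)] x) (snd (conf w m i p j s) x)
    = ((snd (conf w m i p j s))(y := act a (snd (conf w m i p j s) y))) x" for x
  proof (cases "x = y")
    case False
    then have "act (acts (reading w i p j s) [(y, a)] x) (snd (conf w m i p j s) x) = snd (conf w m i p j s) x"
      by (intro act_unlisted) auto
    then show ?thesis using False by (simp add: conf_def)
  qed (simp add: acts_def)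
  then show ?thesis by auto
qed

lemma upd_Choices: "(m', (snd (conf w m i p j s))(Choices := (path_tape p', j'))) = conf w m' i p' j' s"
  by (auto simp: conf_def fun_eq_iff split: tape_name.split)

lemma upd_Inp: "(m', (snd (conf w m i p j s))(Inp := (fst (input_tape w), i'))) = conf w m' i' p j s"
  by (auto simp: conf_def fun_eq_iff split: tape_name.split)

lemma upd_Reg: "(m', (snd (conf w m i p j s))(Reg r := (stack_tape xs, int (length xs)))) = conf w m' i p j (s(r := xs))"
  by (auto simp: conf_def fun_eq_iff split: tape_name.split)

lemma letter_tops: "(\<lambda>r. letter (case s r of [] \<Rightarrow> Blank | a # _ \<Rightarrow> Input a)) = tops s"
  by (auto simp: tops_def fun_eq_iff split: list.split)

lemma path_tape_same: "k < length p \<Longrightarrow> p ! k = a \<Longrightarrow> (path_tape p)(int k := Work a) = path_tape p"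
  using path_tape_nth[of k p] by (metis fun_upd_triv)

lemma conf_pair: "(m, snd (conf w m' i p j s)) = conf w m i p j s"
  by (simp add: conf_def)

lemma snd_conf [simp]:
  "snd (conf w m i p j s) Inp = (fst (input_tape w), i)"
  "snd (conf w m i p j s) Choices = (path_tape p, j)"
  "snd (conf w m i p j s) (Reg r) = (stack_tape (s r), int (length (s r)))"
  by (simp_all add: conf_def)

lemma next_simps:
  "next (conf w (Run ((c ;; d) # K)) i p j s) = conf w (Run (c # d # K)) i p j s"
  "next (conf w (Run (If b c d # K)) i p j s) = conf w (Run ((if b (tops s) then c else d) # K)) i p j s"
  "next (conf w (Run (While b c # K)) i p j s) =
     conf w (Run (if b (tops s) then c # While b c # K else K)) i p j s"
  "next (conf w (Run (Skip # K)) i p j s) = conf w (Run K) i p j s"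
  "next (conf w (Run (Halt v # K)) i p j s) = conf w (Back v) i p (j - 1) s"
  by (simp_all only: nstep_conf) (simp_all add: letter_tops moves_none moves_one upd_Choices
    cong: if_cong)

lemma next_Pop: "next (conf w (Run (Pop r # K)) i p j s) = conf w (Run K) i p j (s(r := tl (s r)))"
proof (cases "s r")
  case Nil
  then have "s(r := tl (s r)) = s" by (metis fun_upd_triv list.sel(2))
  then show ?thesis using Nil by (simp add: nstep_conf moves_none)
next
  case (Cons a xs)
  then have "act (Blank, Move_Left) (snd (conf w m i p j s) (Reg r)) = (stack_tape xs, int (length xs))" for m
    using stack_tape_pop[of a xs] by (simp add: add.commute)
  then show ?thesis using Cons
    by (simp only: nstep_conf) (simp add: moves_one upd_Reg del: snd_conf)
qed

lemma next_Or:
  "next (conf w (Run (Or c d # K)) i p (int (length p)) s) = conf w (Run (c # K)) i (p @ [0]) (int (length p) + 1) s"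
  "k < length p \<Longrightarrow> p ! k = 0 \<Longrightarrow>
    next (conf w (Run (Or c d # K)) i p (int k) s) = conf w (Run (c # K)) i p (int k + 1) s"
  "k < length p \<Longrightarrow> p ! k = 1 \<Longrightarrow>
    next (conf w (Run (Or c d # K)) i p (int k) s) = conf w (Run (d # K)) i p (int k + 1) s"
proof -
  show
    "next (conf w (Run (Or c d # K)) i p (int (length p)) s) = conf w (Run (c # K)) i (p @ [0]) (int (length p) + 1) s"
    by (simp add: nstep_conf path_tape_end moves_one path_tape_snoc upd_Choices)
  show "k < length p \<Longrightarrow> p ! k = 0 \<Longrightarrow>
    next (conf w (Run (Or c d # K)) i p (int k) s) = conf w (Run (c # K)) i p (int k + 1) s"
    by (simp add: nstep_conf path_tape_nth path_tape_same moves_one upd_Choices)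
  show "k < length p \<Longrightarrow> p ! k = 1 \<Longrightarrow>
    next (conf w (Run (Or c d # K)) i p (int k) s) = conf w (Run (d # K)) i p (int k + 1) s"
    by (simp add: nstep_conf path_tape_nth path_tape_same moves_one upd_Choices)
qed

lemma next_Neg:
  "next (conf w (Run (Neg # K)) i p (int (length p)) s) = conf w (Run K) i (p @ [2]) (int (length p) + 1) s"
  "k < length p \<Longrightarrow> p ! k = 2 \<Longrightarrow>
    next (conf w (Run (Neg # K)) i p (int k) s) = conf w (Run K) i p (int k + 1) s"
proof -
  show
    "next (conf w (Run (Neg # K)) i p (int (length p)) s) = conf w (Run K) i (p @ [2]) (int (length p) + 1) s"
    by (simp add: nstep_conf path_tape_end moves_one path_tape_snoc upd_Choices)
  show "k < length p \<Longrightarrow> p ! k = 2 \<Longrightarrow>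
    next (conf w (Run (Neg # K)) i p (int k) s) = conf w (Run K) i p (int k + 1) s"
    by (simp add: nstep_conf path_tape_nth path_tape_same moves_one upd_Choices)
qed

lemma next_Back:
  "next (conf w (Back v) i [] (-1) s) = conf w (Done v) i [] (-1) s"
  "next (conf w (Back v) i (p @ [2]) (int (length p)) s) = conf w (Back (\<not> v)) i p (int (length p) - 1) s"
  "next (conf w (Back v) i (p @ [1]) (int (length p)) s) = conf w (Back v) i p (int (length p) - 1) s"
  "next (conf w (Back True) i (p @ [0]) (int (length p)) s) = conf w (Back True) i p (int (length p) - 1) s"
  "next (conf w (Back False) i (p @ [0]) (int (length p)) s) = conf w Reset i (p @ [1]) (int (length p)) s"
proof -
  have *: "path_tape (p @ [a]) (int (length p)) = Work a" for a
    using path_tape_nth[of "length p" "p @ [a]"] by simp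
  show
    "next (conf w (Back v) i [] (-1) s) = conf w (Done v) i [] (-1) s"
    by (simp add: nstep_conf path_tape_end moves_none)
  show
    "next (conf w (Back v) i (p @ [2]) (int (length p)) s) = conf w (Back (\<not> v)) i p (int (length p) - 1) s"
    by (simp add: nstep_conf * moves_one path_tape_drop upd_Choices)
  show
    "next (conf w (Back v) i (p @ [1]) (int (length p)) s) = conf w (Back v) i p (int (length p) - 1) s"
    by (simp add: nstep_conf * moves_one path_tape_drop upd_Choices)
  show
    "next (conf w (Back True) i (p @ [0]) (int (length p)) s) = conf w (Back True) i p (int (length p) - 1) s"
    by (simp add: nstep_conf * moves_one path_tape_drop upd_Choices)
  show
    "next (conf w (Back False) i (p @ [0]) (int (length p)) s) = conf w Reset i (p @ [1]) (int (length p)) s"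
    by (simp add: nstep_conf * moves_one path_tape_change upd_Choices)
qed

lemma reach_Push:
  assumes "in_window h (conf w (Run (Push r g # K)) i p j s)" "int (length (s r)) < h"
  shows "reach (conf w (Run (Push r g # K)) i p j s) (conf w (Run K) i p j (s(r := g (tops s) # s r)))"
proof (rule reach_step[OF assms(1)])
  let ?a = "g (tops s)"
  \<comment> \<open>Between the two machine steps of a push the head stands one cell beyond the
    stack, which \<open>conf\<close> cannot express.\<close>
  let ?T = "(snd (conf w (Run K) i p j s))(Reg r := (stack_tape (s r), int (length (s r)) + 1))"
  have top: "stack_tape (s r) (int (length (s r))) = (case s r of [] \<Rightarrow> Blank | a # _ \<Rightarrow> Input a)"
    by (rule stack_tape_top)
  have 1: "next (conf w (Run (Push r g # K)) i p j s) = (Write r ?a K, ?T)"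
    by (simp add: nstep_conf moves_one letter_tops stack_tape_id) (simp add: conf_def)
  have wi: "in_window h (Write r ?a K, ?T)"
    unfolding in_window_def
  proof
    fix x
    show "-1 \<le> snd (snd (Write r ?a K, ?T) x) \<and> snd (snd (Write r ?a K, ?T) x) \<le> h"
      using assms(1) assms(2) by (cases x) (simp_all add: in_window_conf)
  qed
  have "act (acts (\<lambda>x. fst (?T x) (snd (?T x))) [(Reg r, Input ?a, Stay)] x) (?T x)
      = snd (conf w (Run K) i p j (s(r := ?a # s r))) x" for x
    by (cases x) (simp_all add: acts_def stack_tape_push)
  then have "(\<lambda>x. act (acts (\<lambda>x. fst (?T x) (snd (?T x))) [(Reg r, Input ?a, Stay)] x) (?T x))
      = snd (conf w (Run K) i p j (s(r := ?a # s r)))"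
    by (rule ext)
  moreover have "next (Write r ?a K, ?T) = (Run K,
      \<lambda>x. act (acts (\<lambda>x. fst (?T x) (snd (?T x))) [(Reg r, Input ?a, Stay)] x) (?T x))"
    by (simp add: nstep_def del: fun_upd_apply snd_conf)
  ultimately have 2: "next (Write r ?a K, ?T) = conf w (Run K) i p j (s(r := ?a # s r))"
    by (simp only: conf_pair)
  show "reach (next (conf w (Run (Push r g # K)) i p j s)) (conf w (Run K) i p j (s(r := ?a # s r)))"
    unfolding 1 by (rule reach_step[OF wi]) (simp only: 2 reach_refl)
qed

lemma input_tape_nth: "k < length w \<Longrightarrow> fst (input_tape w) (int k) = Input (w ! k)"
  "k \<ge> length w \<Longrightarrow> fst (input_tape w) (int k) = Blank" "fst (input_tape w) (-1) = Blank"
  by (simp_all add: input_tape_def)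

lemma next_Scan:
  "fst (input_tape w) i \<noteq> Blank \<Longrightarrow> next (conf w Scan i p j s) = conf w Scan (i + 1) p j s"
  "fst (input_tape w) i = Blank \<Longrightarrow> next (conf w Scan i p j s) = conf w Load (i - 1) p j s"
proof -
  have *: "(fst (input_tape w))(i := Blank) = fst (input_tape w)" if "fst (input_tape w) i = Blank"
    using that by (metis fun_upd_triv)
  show "fst (input_tape w) i \<noteq> Blank \<Longrightarrow> next (conf w Scan i p j s) = conf w Scan (i + 1) p j s"
    by (simp add: nstep_conf moves_one upd_Inp)
  show "fst (input_tape w) i = Blank \<Longrightarrow> next (conf w Scan i p j s) = conf w Load (i - 1) p j s"
    using * by (simp add: nstep_conf moves_one upd_Inp)
qed

lemma reach_Scan:
  assumes "length w = k + n" "int (length w) \<le> h" "-1 \<le> j" "j \<le> h"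
  shows "reach (conf w Scan (int k) p j (\<lambda>_. [])) (conf w Load (int (length w) - 1) p j (\<lambda>_. []))"
  using assms
proof (induction n arbitrary: k)
  case 0
  then show ?case
    by - (rule reach_step; simp_all add: in_window_conf next_Scan input_tape_nth)
next
  case (Suc n)
  have "reach (conf w Scan (int (Suc k)) p j (\<lambda>_. [])) (conf w Load (int (length w) - 1) p j (\<lambda>_. []))"
    using Suc.prems by (intro Suc.IH) simp_all
  then show ?case using Suc.prems
    by - (rule reach_step; simp_all add: in_window_conf next_Scan input_tape_nth add.commute)
qed

lemma reach_Load_one:
  assumes "in_window h (conf w Load i p j s)" "fst (input_tape w) i = Input a" "int (length (s r0)) < h"
  shows "reach (conf w Load i p j s) (conf w Load (i - 1) p j (s(r0 := a # s r0)))"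
proof (rule reach_step[OF assms(1)])
  let ?T = "(snd (conf w Load i p j s))(Reg r0 := (stack_tape (s r0), int (length (s r0)) + 1))"
  have 1: "next (conf w Load i p j s) = (Load_Write, ?T)"
    using assms(2) by (simp add: nstep_conf moves_one stack_tape_id)
  have wi: "in_window h (Load_Write, ?T)"
    unfolding in_window_def
  proof
    fix x
    show "-1 \<le> snd (snd (Load_Write, ?T) x) \<and> snd (snd (Load_Write, ?T) x) \<le> h"
      using assms(1) assms(3) by (cases x) (simp_all add: in_window_conf)
  qed
  have same: "(fst (input_tape w))(i := Input a) = fst (input_tape w)"
    using assms(2) by (metis fun_upd_triv)
  have "act (acts (\<lambda>x. fst (?T x) (snd (?T x))) [(Reg r0, Input a, Stay), (Inp, Input a, Move_Left)] x) (?T x)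
      = snd (conf w Load (i - 1) p j (s(r0 := a # s r0))) x" for x
    using same by (cases x) (simp_all add: acts_def stack_tape_push)
  then have "(\<lambda>x. act (acts (\<lambda>x. fst (?T x) (snd (?T x))) [(Reg r0, Input a, Stay), (Inp, Input a, Move_Left)] x) (?T x))
      = snd (conf w Load (i - 1) p j (s(r0 := a # s r0)))"
    by (rule ext)
  moreover have inp: "fst (?T Inp) (snd (?T Inp)) = Input a" using assms(2) by simp
  have "next (Load_Write, ?T) = (Load,
      \<lambda>x. act (acts (\<lambda>x. fst (?T x) (snd (?T x))) [(Reg r0, Input a, Stay), (Inp, Input a, Move_Left)] x) (?T x))"
    unfolding nstep_def using inp by (simp del: fun_upd_apply snd_conf)
  ultimately have 2: "next (Load_Write, ?T) = conf w Load (i - 1) p j (s(r0 := a # s r0))"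
    by (simp only: conf_pair)
  show "reach (next (conf w Load i p j s)) (conf w Load (i - 1) p j (s(r0 := a # s r0)))"
    unfolding 1 by (rule reach_step[OF wi]) (simp only: 2 reach_refl)
qed

lemma reach_Load:
  assumes "k \<le> length w" "int (length w) < h" "-1 \<le> j" "j \<le> h"
  shows "reach (conf w Load (int k - 1) p j ((\<lambda>_. [])(r0 := drop k w)))
    (conf w (Run [c0]) (-1) p j ((\<lambda>_. [])(r0 := w)))"
  using assms
proof (induction k)
  case 0
  have "next (conf w Load (-1) p j ((\<lambda>_. [])(r0 := w))) = conf w (Run [c0]) (-1) p j ((\<lambda>_. [])(r0 := w))"
    by (simp add: nstep_conf input_tape_nth moves_none)
  moreover have "in_window h (conf w Load (-1) p j ((\<lambda>_. [])(r0 := w)))"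
    using 0 by (simp add: in_window_conf)
  ultimately show ?case using reach_step by (metis drop0 diff_0 of_nat_0 reach_refl)
next
  case (Suc k)
  let ?s = "(\<lambda>_. [])(r0 := drop (Suc k) w)"
  have "reach (conf w Load (int k) p j ?s) (conf w Load (int k - 1) p j (?s(r0 := w ! k # ?s r0)))"
    using Suc.prems by (intro reach_Load_one) (auto simp: in_window_conf input_tape_nth)
  moreover have "?s(r0 := w ! k # ?s r0) = (\<lambda>_. [])(r0 := drop k w)"
    using Suc.prems by (simp add: Cons_nth_drop_Suc)
  ultimately have "reach (conf w Load (int k) p j ?s) (conf w Load (int k - 1) p j ((\<lambda>_. [])(r0 := drop k w)))"
    by simp
  from reach_trans[OF this Suc.IH] show ?case using Suc.prems by (simp del: fun_upd_apply)
qed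

lemma next_Reset:
  assumes "path_tape p j \<noteq> (Blank :: 'a symbol) \<or> (\<exists>r. s r \<noteq> [])"
  shows "next (conf w Reset i p j s)
    = conf w Reset i p (if path_tape p j = (Blank :: 'a symbol) then j else j - 1) (\<lambda>r. tl (s r))"
proof -
  have blank: "(case xs of [] \<Rightarrow> Blank | a # _ \<Rightarrow> Input a) = Blank \<longleftrightarrow> xs = []" for xs :: "'a list"
    by (cases xs) auto
  have pop: "act (Blank, if xs = [] then Stay else Move_Left) (stack_tape xs, int (length xs))
      = (stack_tape (tl xs), int (length (tl xs)))" for xs :: "'a list"
    using stack_tape_id[of xs] stack_tape_pop[of _ "tl xs"] by (cases xs) (auto simp: add.commute)
  let ?m = "case_tape_name (fst (input_tape w) i, Stay)
    (path_tape p j, if path_tape p j = (Blank :: 'a symbol) then Stay else Move_Left)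
    (\<lambda>r. (Blank, if s r = [] then Stay else Move_Left))"
  have "\<not> (path_tape p j = (Blank :: 'a symbol) \<and> (\<forall>r. s r = []))"
    using assms by blast
  then have "next (conf w Reset i p j s) = (Reset, \<lambda>x. act (?m x) (snd (conf w Reset i p j s) x))"
    by (simp add: nstep_conf blank)
  moreover have "act (?m x) (snd (conf w Reset i p j s) x)
      = snd (conf w Reset i p (if path_tape p j = (Blank :: 'a symbol) then j else j - 1) (\<lambda>r. tl (s r))) x" for x
    by (cases x) (simp_all add: pop del: act.simps, simp_all, metis fun_upd_triv)
  then have "(\<lambda>x. act (?m x) (snd (conf w Reset i p j s) x))
      = snd (conf w Reset i p (if path_tape p j = (Blank :: 'a symbol) then j else j - 1) (\<lambda>r. tl (s r)))"
    by (rule ext)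
  ultimately show ?thesis by (simp only: conf_pair)
qed

lemma next_Reset_done:
  "next (conf w Reset (-1) p (-1) (\<lambda>_. [])) = conf w Scan 0 p 0 (\<lambda>_. [])"
proof -
  have same: "(path_tape p)(-1 := Blank) = path_tape p"
    "(fst (input_tape w))(-1 := Blank) = fst (input_tape w)"
    "(stack_tape [])(0 := Blank) = stack_tape []"
    by (auto simp: path_tape_def input_tape_def stack_tape_def fun_eq_iff)
  let ?c = "conf w Reset (-1) p (-1) (\<lambda>_. [])"
  let ?a = "acts (reading w (-1) p (-1) (\<lambda>_. [])) [(Choices, Blank, Move_Right), (Inp, Blank, Move_Right)]"
  have "next ?c = (Scan, \<lambda>x. act (?a x) (snd ?c x))"
    by (simp add: nstep_conf path_tape_end input_tape_nth)
  moreover have "act (?a x) (snd ?c x) = snd (conf w Scan 0 p 0 (\<lambda>_. [])) x" for x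
    by (cases x) (simp_all add: acts_def same)
  then have "(\<lambda>x. act (?a x) (snd ?c x)) = snd (conf w Scan 0 p 0 (\<lambda>_. []))"
    by (rule ext)
  ultimately have "next ?c = (Scan, snd (conf w Scan 0 p 0 (\<lambda>_. [])))"
    by (rule trans[OF _ arg_cong])
  then show ?thesis by (simp only: conf_pair)
qed

text \<open>All stacks shrink and the path head retreats simultaneously, while tapes that are done
  wait; so the largest of these distances \<open>n\<close> bounds the number of rounds. The head is
  at \<open>int k - 1\<close> because it stops on the blank at \<open>-1\<close>, not on the first
  entry.\<close>

lemma reach_Reset:
  assumes "\<forall>r. length (s r) \<le> n" "k \<le> n" "k \<le> length p" "int k \<le> h + 1" "\<forall>r. int (length (s r)) \<le> h" "0 \<le> h"
  shows "reach (conf w Reset (-1) p (int k - 1) s) (conf w Scan 0 p 0 (\<lambda>_. []))"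
  using assms
proof (induction n arbitrary: k s)
  case 0
  then have s: "s = (\<lambda>_. [])" and k: "k = 0" by auto
  show ?case using 0 s k by - (rule reach_step; simp add: in_window_conf next_Reset_done)
next
  case (Suc n)
  show ?case
  proof (cases "k = 0 \<and> (\<forall>r. s r = [])")
    case True
    then have "s = (\<lambda>_. [])" by auto
    then show ?thesis using Suc True by - (rule reach_step; simp add: in_window_conf next_Reset_done)
  next
    case False
    have j: "path_tape p (int k - 1) = (Blank :: 'a symbol) \<longleftrightarrow> k = 0"
      using Suc.prems by (auto simp: path_tape_def)
    have "int (length (tl (s r))) \<le> h" "length (tl (s r)) \<le> n" for r
    proof -
      have "length (tl (s r)) \<le> length (s r)" "length (s r) \<le> Suc n" "int (length (s r)) \<le> h"
        using Suc.prems by auto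
      then show "int (length (tl (s r))) \<le> h" "length (tl (s r)) \<le> n" by auto
    qed
    then have "reach (conf w Reset (-1) p (int (k - 1) - 1) (\<lambda>r. tl (s r))) (conf w Scan 0 p 0 (\<lambda>_. []))"
      using Suc.prems by (intro Suc.IH) simp_all
    moreover have "next (conf w Reset (-1) p (int k - 1) s) = conf w Reset (-1) p (int (k - 1) - 1) (\<lambda>r. tl (s r))"
      using False j by (subst next_Reset) auto
    moreover have "in_window h (conf w Reset (-1) p (int k - 1) s)"
      using Suc.prems by (simp add: in_window_conf)
    ultimately show ?thesis by (metis reach_step)
  qed
qed

lemma reach_start:
  assumes "int (length w) < h" "0 \<le> h"
  shows "reach (conf w Scan 0 p 0 (\<lambda>_. [])) (conf w (Run [c0]) (-1) p 0 ((\<lambda>_. [])(r0 := w)))"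
proof -
  have "(\<lambda>_. [])(r0 := drop (length w) w) = (\<lambda>_. [])" by auto
  then show ?thesis
    using reach_trans[OF reach_Scan[of 0 "length w" 0 p]] reach_Load[of "length w" 0 p] assms
    by simp
qed

text \<open>After a flipped choice the program starts again with a longer path, so reaching
  \<open>K\<close> must be known for every extension \<open>p @ q\<close>, not just for
  \<open>p\<close>. The bounds reserve space for the \<open>t\<close> steps left, each of which
  lengthens a stack and the path by at most one.\<close>

definition ready :: "nat \<Rightarrow> ('r, 'a) com list \<Rightarrow> ('r, 'a) store \<Rightarrow> nat list \<Rightarrow> bool" where
  "ready t K s p \<longleftrightarrow>
    (\<forall>q. int (length (p @ q)) \<le> h \<longrightarrow>
      reach (conf w Scan 0 (p @ q) 0 (\<lambda>_. [])) (conf w (Run K) (-1) (p @ q) (int (length p)) s)) \<and>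
    (\<forall>r. int (length (s r)) + int t \<le> h) \<and> int (length p) + int t \<le> h"

text \<open>The value comes back with everything appended to \<open>p\<close> erased and the head on
  the last entry of \<open>p\<close>. The store \<open>s'\<close> is left unspecified, as a restart
  rebuilds it from the input; only its size matters for the window.\<close>

definition returns :: "bool \<Rightarrow> ('r, 'a) com list \<Rightarrow> ('r, 'a) store \<Rightarrow> nat list \<Rightarrow> bool" where
  "returns v K s p \<longleftrightarrow> (\<exists>s'. (\<forall>r. int (length (s' r)) \<le> h) \<and>
    reach (conf w (Run K) (-1) p (int (length p)) s) (conf w (Back v) (-1) p (int (length p) - 1) s'))"

lemma ready_bounds:
  assumes "ready t K s p"
  shows "int (length (s r)) + int t \<le> h" "int (length p) + int t \<le> h"
  using assms by (simp_all add: ready_def)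

lemma ready_window:
  assumes "ready t K s p" "int (length (p @ q)) \<le> h"
  shows "in_window h (conf w m (-1) (p @ q) (int (length p)) s)"
proof -
  have "int (length (s r)) \<le> h" for r using ready_bounds(1)[OF assms(1), of r] by linarith
  then show ?thesis using ready_bounds(2)[OF assms(1)] by (simp add: in_window_conf)
qed

text \<open>A command appends at most one entry \<open>x\<close> to the path and one letter to each
  stack, so one unit of time pays for the space.\<close>

lemma ready_step:
  assumes "ready (Suc t) K s p" "length x \<le> 1" "\<And>r. length (s' r) \<le> Suc (length (s r))"
    and "\<And>q. int (length (p @ x @ q)) \<le> h \<Longrightarrow>
      reach (conf w (Run K) (-1) (p @ x @ q) (int (length p)) s)
        (conf w (Run K') (-1) (p @ x @ q) (int (length (p @ x))) s')"
  shows "ready t K' s' (p @ x)"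
  unfolding ready_def
proof (intro conjI allI impI)
  fix q assume "int (length ((p @ x) @ q)) \<le> h"
  then have l: "int (length (p @ x @ q)) \<le> h" by simp
  then have "reach (conf w Scan 0 (p @ x @ q) 0 (\<lambda>_. [])) (conf w (Run K) (-1) (p @ x @ q) (int (length p)) s)"
    using assms(1) by (simp add: ready_def)
  then show "reach (conf w Scan 0 ((p @ x) @ q) 0 (\<lambda>_. []))
      (conf w (Run K') (-1) ((p @ x) @ q) (int (length (p @ x))) s')"
    using reach_trans[OF _ assms(4)[OF l]] by (simp only: append_assoc)
next
  fix r
  have "int (length (s r)) + int (Suc t) \<le> h" using assms(1) by (simp add: ready_def)
  then show "int (length (s' r)) + int t \<le> h" using assms(3)[of r] by linarith
next
  show "int (length (p @ x)) + int t \<le> h" using assms(1,2) by (simp add: ready_def)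
qed

lemma returns_via:
  assumes "reach (conf w (Run K) (-1) p (int (length p)) s) (conf w (Run K') (-1) p (int (length p)) s')"
    "returns v K' s' p"
  shows "returns v K s p"
proof -
  obtain s1 where "\<forall>r. int (length (s1 r)) \<le> h"
    "reach (conf w (Run K') (-1) p (int (length p)) s') (conf w (Back v) (-1) p (int (length p) - 1) s1)"
    using assms(2) by (auto simp: returns_def)
  then show ?thesis
    unfolding returns_def by (intro exI[of _ s1] conjI) (simp_all add: reach_trans[OF assms(1)])
qed

lemma returns_det:
  assumes "ready (Suc t) K s p"
    and "\<And>q. int (length (p @ q)) \<le> h \<Longrightarrow>
      reach (conf w (Run K) (-1) (p @ q) (int (length p)) s)
        (conf w (Run K') (-1) (p @ q) (int (length p)) s')"
    and "\<And>r. length (s' r) \<le> Suc (length (s r))"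
    and "ready t K' s' p \<Longrightarrow> returns v K' s' p"
  shows "returns v K s p"
proof (rule returns_via)
  have "int (length (p @ [])) \<le> h" using assms(1) by (simp add: ready_def)
  from assms(2)[OF this]
  show "reach (conf w (Run K) (-1) p (int (length p)) s) (conf w (Run K') (-1) p (int (length p)) s')"
    by simp
  have "ready t K' s' (p @ [])"
    using assms(1-3) by (intro ready_step[of t K s p "[]"]) auto
  then show "returns v K' s' p" using assms(4) by simp
qed

text \<open>The induction follows \<open>run\<close>. At an \<open>Or\<close> the left branch is
  evaluated with the path \<open>p @ [0]\<close>. If it is false, the entry is flipped, the tapes
  are reset, and the replay guaranteed by \<open>ready\<close> for \<open>p @ [1]\<close> leads to
  the right branch with the original store.\<close>

lemma run_returns:
  assumes "run t K s = Some v" "ready t K s p" "int (length w) < h"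
  shows "returns v K s p"
  using assms(1,2)
proof (induction t K s arbitrary: v p rule: run.induct)
  case (3 t r g K s)
  have "int (length (s r)) < h" using ready_bounds(1)[OF 3(3), of r] by linarith
  then show ?case using 3
    by (intro returns_det[OF 3(3), of K "s(r := g (tops s) # s r)"] reach_Push ready_window[OF 3(3)]) (simp_all del: fun_upd_apply, simp)
next
  case (4 t r K s)
  then show ?case
    by (intro returns_det[OF 4(3), of K "s(r := tl (s r))"] reach_step[OF ready_window[OF 4(3)]])
       (simp_all add: next_Pop del: fun_upd_apply, simp, arith)
next
  case (5 t c d K s)
  then show ?case
    by (intro returns_det[OF 5(3), of "c # d # K" s] reach_step[OF ready_window[OF 5(3)]])
       (auto simp: next_simps)
next
  case (6 t b c d K s)
  then show ?case
    by (intro returns_det[OF 6(3), of "(if b (tops s) then c else d) # K" s] reach_step[OF ready_window[OF 6(3)]])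
       (auto simp: next_simps)
next
  case (7 t b c K s)
  then show ?case
    by (intro returns_det[OF 7(3), of "if b (tops s) then c # While b c # K else K" s] reach_step[OF ready_window[OF 7(3)]])
       (auto simp: next_simps)
next
  case (8 t c d K s)
  have lp: "int (length p) < h" "-1 \<le> h" and ls: "\<And>r. int (length (s r)) \<le> h"
    subgoal using ready_bounds(2)[OF 8(4)] by linarith
    subgoal using ready_bounds(2)[OF 8(4)] by linarith
    subgoal for r using ready_bounds(1)[OF 8(4), of r] by linarith
    done
  have w1: "in_window h (conf w m (-1) (p @ [a]) (int (length p)) s')" if "\<forall>r. int (length (s' r)) \<le> h" for m a s'
    using lp that by (simp add: in_window_conf)
  have w0: "in_window h (conf w m (-1) p (int (length p)) s)" for m
    using ready_window[OF 8(4), of "[]"] lp by simp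
  obtain v1 where v1: "run t (c # K) s = Some v1" "v1 \<longrightarrow> v" "\<not> v1 \<longrightarrow> run t (d # K) s = Some v"
  proof (cases "run t (c # K) s")
    case None
    then show ?thesis using 8(3) by simp
  next
    case (Some u)
    then show ?thesis using 8(3) that[of u] by (cases u) simp_all
  qed
  have r0: "ready t (c # K) s (p @ [0])"
  proof (rule ready_step[OF 8(4)])
    fix q assume "int (length (p @ [0] @ q)) \<le> h"
    then show "reach (conf w (Run (Or c d # K)) (-1) (p @ [0] @ q) (int (length p)) s)
        (conf w (Run (c # K)) (-1) (p @ [0] @ q) (int (length (p @ [0]))) s)"
      using lp ls by - (rule reach_step; simp_all add: in_window_conf next_Or(2) nth_append add.commute)
  qed simp_all
  have r1: "ready t (d # K) s (p @ [1])"
  proof (rule ready_step[OF 8(4)])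
    fix q assume "int (length (p @ [1] @ q)) \<le> h"
    then show "reach (conf w (Run (Or c d # K)) (-1) (p @ [1] @ q) (int (length p)) s)
        (conf w (Run (d # K)) (-1) (p @ [1] @ q) (int (length (p @ [1]))) s)"
      using lp ls by - (rule reach_step; simp_all add: in_window_conf next_Or(3) nth_append add.commute)
  qed simp_all
  obtain s1 where s1: "\<forall>r. int (length (s1 r)) \<le> h"
    "reach (conf w (Run (c # K)) (-1) (p @ [0]) (int (length p) + 1) s) (conf w (Back v1) (-1) (p @ [0]) (int (length p)) s1)"
    using 8(1)[OF v1(1) r0] by (auto simp: returns_def add.commute)
  have a: "reach (conf w (Run (Or c d # K)) (-1) p (int (length p)) s) (conf w (Back v1) (-1) (p @ [0]) (int (length p)) s1)"
    by (rule reach_step[OF w0]) (simp add: next_Or(1) s1(2))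
  show ?case
  proof (cases v1)
    case True
    have "reach (conf w (Back v1) (-1) (p @ [0]) (int (length p)) s1) (conf w (Back v) (-1) p (int (length p) - 1) s1)"
      using True v1(2) by - (rule reach_step[OF w1[OF s1(1)]]; simp add: next_Back)
    from reach_trans[OF a this] show ?thesis
      unfolding returns_def by (intro exI[of _ s1] conjI s1(1))
  next
    case False
    then have v: "run t (d # K) s = Some v" using v1 by simp
    have b: "reach (conf w (Back v1) (-1) (p @ [0]) (int (length p)) s1) (conf w Reset (-1) (p @ [1]) (int (length p)) s1)"
      using False by - (rule reach_step[OF w1[OF s1(1)]]; simp add: next_Back)
    have "length (s1 r) \<le> nat h + length p + 1" for r
      using s1(1)[rule_format, of r] by linarith
    then have c: "reach (conf w Reset (-1) (p @ [1]) (int (length p)) s1) (conf w Scan 0 (p @ [1]) 0 (\<lambda>_. []))"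
      using reach_Reset[of s1 "nat h + length p + 1" "length p + 1" "p @ [1]"] s1(1) lp by simp
    have d: "reach (conf w Scan 0 (p @ [1]) 0 (\<lambda>_. [])) (conf w (Run (d # K)) (-1) (p @ [1]) (int (length p) + 1) s)"
      using r1[unfolded ready_def, THEN conjunct1, rule_format, of "[]"] lp by (simp add: add.commute)
    have "returns v (d # K) s (p @ [1])"
      using False by (intro 8(2)[OF v1(1) _ v r1]) simp
    then obtain s2 where s2: "\<forall>r. int (length (s2 r)) \<le> h"
      "reach (conf w (Run (d # K)) (-1) (p @ [1]) (int (length p) + 1) s) (conf w (Back v) (-1) (p @ [1]) (int (length p)) s2)"
      by (auto simp: returns_def add.commute)
    have e: "reach (conf w (Back v) (-1) (p @ [1]) (int (length p)) s2) (conf w (Back v) (-1) p (int (length p) - 1) s2)"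
      by - (rule reach_step[OF w1[OF s2(1)]]; simp only: next_Back reach_refl)
    have "reach (conf w (Run (Or c d # K)) (-1) p (int (length p)) s)
        (conf w (Back v) (-1) p (int (length p) - 1) s2)"
      by (rule reach_trans[OF reach_trans[OF reach_trans[OF reach_trans[OF reach_trans[OF a b] c] d] s2(2)] e])
    then show ?thesis unfolding returns_def by (intro exI[of _ s2] conjI s2(1))
  qed
next
  case (9 t K s)
  have lp: "int (length p) < h" "-1 \<le> h" and ls: "\<And>r. int (length (s r)) \<le> h"
    subgoal using ready_bounds(2)[OF 9(3)] by linarith
    subgoal using ready_bounds(2)[OF 9(3)] by linarith
    subgoal for r using ready_bounds(1)[OF 9(3), of r] by linarith
    done
  have r: "ready t K s (p @ [2])"
  proof (rule ready_step[OF 9(3)])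
    fix q assume "int (length (p @ [2] @ q)) \<le> h"
    then show "reach (conf w (Run (Neg # K)) (-1) (p @ [2] @ q) (int (length p)) s)
        (conf w (Run (K)) (-1) (p @ [2] @ q) (int (length (p @ [2]))) s)"
      using lp ls by - (rule reach_step; simp_all add: in_window_conf next_Neg(2) nth_append add.commute)
  qed simp_all
  have rn: "run t K s = Some (\<not> v)" using 9(2) by auto
  obtain s1 where s1: "\<forall>r. int (length (s1 r)) \<le> h"
    "reach (conf w (Run K) (-1) (p @ [2]) (int (length p) + 1) s) (conf w (Back (\<not> v)) (-1) (p @ [2]) (int (length p)) s1)"
    using 9(1)[OF rn r] by (auto simp: returns_def add.commute)
  have "reach (conf w (Run (Neg # K)) (-1) p (int (length p)) s) (conf w (Back (\<not> v)) (-1) (p @ [2]) (int (length p)) s1)"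
    using ready_window[OF 9(3), of "[]"] lp by - (rule reach_step; simp_all add: next_Neg(1) s1(2))
  moreover have "reach (conf w (Back (\<not> v)) (-1) (p @ [2]) (int (length p)) s1) (conf w (Back v) (-1) p (int (length p) - 1) s1)"
    using s1(1) lp by - (rule reach_step; simp_all add: in_window_conf next_Back)
  ultimately have "reach (conf w (Run (Neg # K)) (-1) p (int (length p)) s) (conf w (Back v) (-1) p (int (length p) - 1) s1)"
    by (rule reach_trans)
  then show ?case unfolding returns_def by (intro exI[of _ s1] conjI s1(1))
next
  case (10 t K s)
  then show ?case
    by (intro returns_det[OF 10(3), of K s] reach_step[OF ready_window[OF 10(3)]])
       (auto simp: next_simps)
next
  case (11 t u K s)
  have lp: "int (length p) < h" and ls: "\<And>r. int (length (s r)) \<le> h"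
    subgoal using ready_bounds(2)[OF 11(2)] by linarith
    subgoal for r using ready_bounds(1)[OF 11(2), of r] by linarith
    done
  have "reach (conf w (Run (Halt u # K)) (-1) p (int (length p)) s) (conf w (Back v) (-1) p (int (length p) - 1) s)"
    using ready_window[OF 11(2), of "[]"] lp 11(1) by - (rule reach_step; simp_all add: next_simps)
  then show ?case using ls unfolding returns_def by (intro exI[of _ s] conjI allI)
qed auto

lemma reach_Done:
  assumes "run t [c0] ((\<lambda>_. [])(r0 := w)) = Some v" "int (length w) + int t < h"
  shows "\<exists>T. reach (conf w Scan 0 [] 0 (\<lambda>_. [])) (Done v, T) \<and> in_window h (Done v :: ('r, 'a) mode, T)"
proof -
  let ?s = "(\<lambda>_. [])(r0 := w)"
  have "ready t [c0] ?s []"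
    using assms(2) reach_start unfolding ready_def by auto
  then obtain s' where s': "\<forall>r. int (length (s' r)) \<le> h"
    "reach (conf w (Run [c0]) (-1) [] 0 ?s) (conf w (Back v) (-1) [] (-1) s')"
    using run_returns[OF assms(1)] assms(2) by (fastforce simp: returns_def simp del: fun_upd_apply)
  have bk: "reach (conf w (Back v) (-1) [] (-1) s') (conf w (Done v) (-1) [] (-1) s')"
    using s'(1) assms(2) by - (rule reach_step; simp add: in_window_conf next_Back)
  have "in_window h (conf w (Done v) (-1) [] (-1) s')"
    using s'(1) assms(2) by (simp add: in_window_conf)
  moreover have start: "reach (conf w Scan 0 [] 0 (\<lambda>_. [])) (conf w (Run [c0]) (-1) [] 0 ?s)"
    using assms(2) by (intro reach_start) auto
  ultimately have "reach (conf w Scan 0 [] 0 (\<lambda>_. [])) (conf w (Done v) (-1) [] (-1) s') \<and>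
      in_window h (conf w (Done v) (-1) [] (-1) s')"
    using reach_trans[OF reach_trans[OF start s'(2)] bk] by simp
  then show ?thesis
    by (intro exI[of _ "snd (conf w (Done v) (-1) [] (-1) s')"]) (simp only: conf_pair)
qed

end

theorem alternating_PSPACE:
  fixes c :: "('r::finite, 'a::finite) com" and p :: "nat poly"
  assumes "\<And>w. run (poly p (length w)) [c] ((\<lambda>_. [])(r0 := w)) = Some (w \<in> L)"
  shows "L \<in> PSPACE"
proof -
  \<comment> \<open>The empty control stack is added because \<open>residuals\<close> leaves out the
    continuation itself.\<close>
  define R where "R = insert [] (residuals c [])"
  define Q where "Q = {Scan, Load, Load_Write, Reset, Back True, Back False, Done True, Done False}
    \<union> Run ` R \<union> (\<lambda>(r, a, K). Write r a K) ` (UNIV \<times> UNIV \<times> R)"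
  have R: "succs P \<subseteq> R" if "P \<in> R" for P
    using that residuals_closed[of P c "[]"] by (auto simp: R_def)
  have "finite R" by (simp add: R_def finite_residuals)
  then have "finite Q" by (auto simp: Q_def)
  have bools: "Back v \<in> Q" "Done v \<in> Q" for v by (cases v; simp add: Q_def)+
  have Run: "Run P \<in> Q \<longleftrightarrow> P \<in> R" for P by (auto simp: Q_def)
  have Write: "Write r a P \<in> Q \<longleftrightarrow> P \<in> R" for r a P by (auto simp: Q_def image_iff)
  define al where "al = insert Blank (range Input \<union> Work ` {..<3 :: nat}) \<union> ({} :: 'a symbol set)"
  have al: "Blank \<in> al" "Input a \<in> al" "Work 0 \<in> al" "Work 1 \<in> al" "Work (Suc 0) \<in> al" "Work 2 \<in> al" for a
    by (simp_all add: al_def)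
  have one: "[c] \<in> R" by (simp add: R_def residuals_self)
  have closed: "fst (trans r0 c q rd) \<in> Q \<and> (\<forall>x. fst (snd (trans r0 c q rd) x) \<in> al)"
    if "q \<in> Q" "range rd \<subseteq> al" for q and rd :: "'r tape_name \<Rightarrow> 'a symbol"
  proof -
    have rd: "rd x \<in> al" for x using that(2) by blast
    have acts: "fst (acts rd [] x) \<in> al"
      "a \<in> al \<Longrightarrow> fst (acts rd [(y, a, m)] x) \<in> al"
      "a \<in> al \<Longrightarrow> b \<in> al \<Longrightarrow> fst (acts rd [(y, a, m), (z, b, n)] x) \<in> al" for x y z a b m n
      using rd by (simp_all add: acts_def)
    note simps = acts al rd Run Write bools
    show ?thesis
    proof (cases q)
      case q: (Run P)
      then have P: "P \<in> R" using that Run by simp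
      show ?thesis
      proof (cases P)
        case Nil
        then show ?thesis using q P by (simp add: simps)
      next
        case (Cons d K)
        have "succs (d # K) \<subseteq> R" using R P Cons by blast
        then show ?thesis
          using q Cons by (cases d) (simp_all add: simps)
      qed
    next
      case q: Reset
      have "Scan \<in> Q" "Reset \<in> Q" by (simp_all add: Q_def)
      then show ?thesis using q by (simp add: simps split: tape_name.split)
    next
      case q: Scan
      have "Scan \<in> Q" "Load \<in> Q" by (simp_all add: Q_def)
      then show ?thesis using q by (simp add: simps)
    next
      case q: Load
      have "Load_Write \<in> Q" by (simp add: Q_def)
      then show ?thesis using q by (simp add: simps one)
    next
      case q: Load_Write
      have "Load \<in> Q" by (simp add: Q_def)
      then show ?thesis using q by (simp add: simps)
    next
      case q: (Back v)
      have "Reset \<in> Q" by (simp add: Q_def)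
      then show ?thesis using q by (simp add: simps)
    next
      case q: (Write r a K)
      then show ?thesis using that by (simp add: simps)
    next
      case q: (Done v)
      then show ?thesis by (simp add: simps)
    qed
  qed
  show ?thesis
  \<comment> \<open>The three work symbols are the possible entries of the path. The window has to
    exceed the length of the input plus the running time, which gives the polynomial
    \<open>[:1, 1:] + p\<close>.\<close>
  proof (rule PSPACE_named_machine[where \<delta> = "trans r0 c" and Q = Q and ?q0.0 = Scan and qa = "Done True" and qr = "Done False"
        and m = 3 and ?x0.0 = Inp and p = "[:1, 1:] + p"])
    fix w :: "'a list"
    let ?h = "int (poly ([:1, 1:] + p) (length w))"
    interpret simulation r0 c w ?h .
    have "(\<lambda>x. if x = Inp then input_tape w else blank_tape) = snd (conf w Scan 0 [] 0 (\<lambda>_. []))"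
      by (auto simp: conf_def fun_eq_iff input_tape_def blank_tape_def path_tape_def stack_tape_def split: tape_name.split)
    then have c: "(Scan, \<lambda>x. if x = Inp then input_tape w else blank_tape) = conf w Scan 0 [] 0 (\<lambda>_. [])"
      by (simp add: conf_def)
    obtain T where T: "reach (conf w Scan 0 [] 0 (\<lambda>_. [])) (Done (w \<in> L), T)" "in_window ?h (Done (w \<in> L) :: ('r, 'a) mode, T)"
      using reach_Done[OF assms] by auto
    show "\<exists>T. (\<lambda>c' c''. in_window ?h c' \<and> c'' = nstep (trans r0 c) {Done True, Done False} c')\<^sup>*\<^sup>*
        (Scan, \<lambda>x. if x = Inp then input_tape w else blank_tape) (if w \<in> L then Done True else Done False, T) \<and>
        in_window ?h (Done True, T)"
    proof (intro exI conjI)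
      have "(if w \<in> L then Done True else Done False) = Done (w \<in> L)" by simp
      then show "(\<lambda>c' c''. in_window ?h c' \<and> c'' = nstep (trans r0 c) {Done True, Done False} c')\<^sup>*\<^sup>*
        (Scan, \<lambda>x. if x = Inp then input_tape w else blank_tape) (if w \<in> L then Done True else Done False, T)"
        using T(1) unfolding c reach_def by (cases "w \<in> L") simp_all
      show "in_window ?h (Done True, T)" using T(2) by (simp add: in_window_def)
    qed
  next
    fix q and rd :: "'r tape_name \<Rightarrow> 'a symbol"
    assume "q \<in> Q" "range rd \<subseteq> insert Blank (range Input \<union> Work ` {..<3})"
    then have "range rd \<subseteq> al" by (simp only: al_def Un_empty_right)
    show "fst (trans r0 c q rd) \<in> Q \<and>
        (\<forall>x. fst (snd (trans r0 c q rd) x) \<in> insert Blank (range Input \<union> Work ` {..<3}))"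
      using closed[OF \<open>q \<in> Q\<close> \<open>range rd \<subseteq> al\<close>] unfolding al_def Un_empty_right .
  next
    show "Scan \<in> Q" by (simp add: Q_def)
  qed (simp_all add: \<open>finite Q\<close> bools)
qed

section \<open>Symbolic execution\<close>

text \<open>By \<open>ev_mono\<close> the number \<open>t\<close> is only an upper bound, so time
  estimates may be generous. A program that ends without \<open>Halt\<close> has no value.\<close>

definition ev :: "('r, 'a) com list \<Rightarrow> ('r, 'a) store \<Rightarrow> nat \<Rightarrow> bool \<Rightarrow> bool" where
  "ev K s t v \<longleftrightarrow> run t K s = Some v"

lemma run_mono: "run t K s = Some v \<Longrightarrow> run (t + d) K s = Some v"
proof (induction t K s arbitrary: v rule: run.induct)
  case (8 t c d' K s)
  show ?case
  proof (cases "run t (c # K) s")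
    case (Some u)
    then show ?thesis using 8 by (cases u) auto
  qed (use 8 in simp)
qed auto

lemma ev_mono: "ev K s t v \<Longrightarrow> t \<le> t' \<Longrightarrow> ev K s t' v"
  unfolding ev_def using run_mono[of t K s v "t' - t"] by simp

lemma ev_weaken: "ev K s t v \<Longrightarrow> s' = s \<Longrightarrow> v' = v \<Longrightarrow> t \<le> t' \<Longrightarrow> ev K s' t' v'"
  using ev_mono by blast

lemma ev_simps [simp]:
  "ev (Push r g # K) s t v \<longleftrightarrow> 0 < t \<and> ev K (s(r := g (tops s) # s r)) (t - 1) v"
  "ev (Pop r # K) s t v \<longleftrightarrow> 0 < t \<and> ev K (s(r := tl (s r))) (t - 1) v"
  "ev ((c ;; d) # K) s t v \<longleftrightarrow> 0 < t \<and> ev (c # d # K) s (t - 1) v"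
  "ev (If b c d # K) s t v \<longleftrightarrow> 0 < t \<and> ev ((if b (tops s) then c else d) # K) s (t - 1) v"
  "ev (Neg # K) s t v \<longleftrightarrow> 0 < t \<and> ev K s (t - 1) (\<not> v)"
  "ev (Skip # K) s t v \<longleftrightarrow> 0 < t \<and> ev K s (t - 1) v"
  "ev (Halt u # K) s t v \<longleftrightarrow> 0 < t \<and> u = v"
  by (cases t; auto simp: ev_def)+

lemma ev_While:
  "ev (While b c # K) s t v \<longleftrightarrow> 0 < t \<and> ev (if b (tops s) then c # While b c # K else K) s (t - 1) v"
  by (cases t) (simp_all add: ev_def)

lemma ev_Or:
  assumes "ev (c # K) s t u" "\<not> u \<Longrightarrow> ev (d # K) s t v" "t < t'"
  shows "ev (Or c d # K) s t' (u \<or> v)"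
proof -
  have "run (Suc t) (Or c d # K) s = Some (u \<or> v)"
    using assms(1,2) by (cases u) (simp_all add: ev_def)
  then show ?thesis using ev_mono[of _ s "Suc t" _ t'] assms(3) by (simp add: ev_def)
qed

text \<open>De Morgan's law for continuations: \<open>And c d # K\<close> has the conjunction of the
  values of \<open>c # K\<close> and \<open>d # K\<close>. Each conjunct thus works on a store of
  its own and may destroy it.\<close>

definition And :: "('r, 'a) com \<Rightarrow> ('r, 'a) com \<Rightarrow> ('r, 'a) com" where
  "And c d = (Neg ;; Or (Neg ;; c) (Neg ;; d))"

lemma ev_And:
  assumes "ev (c # K) s t u" "u \<Longrightarrow> ev (d # K) s t v" "t + 5 \<le> t'"
  shows "ev (And c d # K) s t' (u \<and> v)"
proof -
  have t: "ev (c # K) s (t' - 5) u" "u \<Longrightarrow> ev (d # K) s (t' - 5) v"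
    using assms ev_mono[of _ s t _ "t' - 5"] by auto
  have "ev (Or (Neg ;; c) (Neg ;; d) # K) s (t' - 2) (\<not> u \<or> \<not> v)"
    by (rule ev_Or[where t = "t' - 3"]) (use t assms(3) in \<open>simp_all add: diff_diff_add\<close>)
  then show ?thesis using assms(3) by (simp add: And_def diff_diff_add numeral_2_eq_2)
qed

text \<open>A branch that ends in \<open>Halt True\<close> acts as a test.\<close>

definition Test :: "('r, 'a) com \<Rightarrow> ('r, 'a) com" where
  "Test c = And (c ;; Halt True) Skip"

definition Mv :: "'r \<Rightarrow> 'r \<Rightarrow> ('r, 'a) com" where
  "Mv r r' = (Push r' (\<lambda>t. the (t r)) ;; Pop r)"

lemma ev_Mv [simp]:
  "s r = a # xs \<Longrightarrow> r \<noteq> r' \<Longrightarrow>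
    ev (Mv r r' # K) s t v \<longleftrightarrow> 3 \<le> t \<and> ev K (s(r' := a # s r', r := xs)) (t - 3) v"
  by (auto simp: Mv_def tops_def numeral_3_eq_3 diff_diff_add)

definition Move_While :: "('a \<Rightarrow> bool) \<Rightarrow> 'r \<Rightarrow> 'r \<Rightarrow> ('r, 'a) com" where
  "Move_While B r r' = While (\<lambda>t. \<exists>a. t r = Some a \<and> B a) (Mv r r')"

text \<open>A round costs one test and the three steps of \<open>Mv\<close>, whence the factor
  4.\<close>

lemma ev_Move_While_aux:
  "ev K (s(r := ys, r' := rev xs @ s r')) t v \<Longrightarrow> s r = xs @ ys \<Longrightarrow> list_all B xs \<Longrightarrow>
    (ys = [] \<or> \<not> B (hd ys)) \<Longrightarrow> r \<noteq> r' \<Longrightarrow> t + 4 * length xs + 1 \<le> t' \<Longrightarrow>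
    ev (Move_While B r r' # K) s t' v"
proof (induction xs arbitrary: s t')
  case Nil
  have "ev K s (t' - 1) v"
    by (rule ev_weaken[OF Nil(1)]) (use Nil in auto)
  then show ?case using Nil unfolding Move_While_def
    by (subst ev_While) (cases ys, auto simp: tops_def)
next
  case (Cons x xs)
  let ?s = "s(r' := x # s r', r := xs @ ys)"
  have "ev (Move_While B r r' # K) ?s (t' - 4) v"
  proof (rule Cons.IH)
    show "ev K (?s(r := ys, r' := rev xs @ ?s r')) t v"
      by (rule ev_weaken[OF Cons.prems(1)]) (use Cons.prems in auto)
  qed (use Cons.prems in auto)
  then show ?case using Cons.prems
    unfolding Move_While_def by (subst ev_While) (simp add: tops_def diff_diff_add)
qed

lemma ev_Move_While:
  assumes "ev K (s(r := dropWhile B (s r), r' := rev (takeWhile B (s r)) @ s r')) t v"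
    "r \<noteq> r'" "t + 4 * length (takeWhile B (s r)) + 1 \<le> t'"
  shows "ev (Move_While B r r' # K) s t' v"
  using ev_Move_While_aux[OF assms(1)] assms(2,3) hd_dropWhile[of B "s r"]
  by (auto simp: list_all_iff dest: set_takeWhileD)

definition Drop_While :: "('a \<Rightarrow> bool) \<Rightarrow> 'r \<Rightarrow> ('r, 'a) com" where
  "Drop_While B r = While (\<lambda>t. \<exists>a. t r = Some a \<and> B a) (Pop r)"

lemma ev_Drop_While:
  assumes "ev K (s(r := dropWhile B (s r))) t v" "t + 2 * length (takeWhile B (s r)) + 1 \<le> t'"
  shows "ev (Drop_While B r # K) s t' v"
  using assms
proof (induction "s r" arbitrary: s t')
  case Nil
  have "ev K s (t' - 1) v"
    by (rule ev_weaken[OF Nil(2)]) (use Nil in auto)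
  then show ?case using Nil(1)[symmetric] Nil(3) unfolding Drop_While_def
    by (subst ev_While) (simp add: tops_def)
next
  case (Cons x xs)
  show ?case
  proof (cases "B x")
    case True
    let ?s = "s(r := xs)"
    have "ev (Drop_While B r # K) ?s (t' - 2) v"
      using Cons(2)[symmetric] Cons(3,4) True by (intro Cons(1)) auto
    then show ?thesis using Cons(2)[symmetric] Cons(4) True
      unfolding Drop_While_def by (subst ev_While) (simp add: tops_def diff_diff_add numeral_2_eq_2)
  next
    case False
    then have "ev K s (t' - 1) v"
      by (intro ev_weaken[OF Cons(3)]) (use Cons(2)[symmetric] Cons(4) in auto)
    then show ?thesis using Cons(2)[symmetric] Cons(4) False
      unfolding Drop_While_def by (subst ev_While) (simp add: tops_def)
  qed
qed

section \<open>Registers and numbers\<close>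

text \<open>An object is held by two registers, one for the expression and one for the environment;
  the words in them may be followed by garbage.\<close>

datatype which = IV | IX | IP | IS

text \<open>\<open>Len\<close> holds the bit bound \<open>l\<close> in unary and \<open>Cnt\<close>
  the part of it used up by the current guess. \<open>Dep\<close> counts pending formulas or open
  braces, \<open>Arg\<close> holds a variable under test, and \<open>Goals\<close> is the stack of
  the parser. \<open>Tmp\<close>, \<open>Var\<close> and \<open>Num\<close> are scratch
  space.\<close>

datatype reg = Ex which | En which | Len | Cnt | Dep | Tmp | Var | Num | Arg | Goals

instance which :: finite
proof
  have "(UNIV :: which set) = {IV, IX, IP, IS}" using which.exhaust by blast
  then show "finite (UNIV :: which set)" by (rule ssubst) simp
qed

instance reg :: finite
proof
  have "x \<in> range Ex \<union> range En \<union> {Len, Cnt, Dep, Tmp, Var, Num, Arg, Goals}" for x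
    by (cases x) simp_all
  then have "UNIV \<subseteq> range Ex \<union> range En \<union> {Len, Cnt, Dep, Tmp, Var, Num, Arg, Goals}"
    by blast
  then show "finite (UNIV :: reg set)" by (rule finite_subset) simp
qed

definition digit :: "token \<Rightarrow> bool" where
  "digit a \<longleftrightarrow> a = TZero \<or> a = TOne"

lemma no_digit_iff: "no_digit u \<longleftrightarrow> u = [] \<or> \<not> digit (hd u)"
  by (cases u) (auto simp: digit_def)

lemma write_nat_0 [simp]: "write_nat 0 = []"
  by (simp add: write_nat.simps)

lemma digits_write_nat: "list_all digit (write_nat n)"
proof (induction n rule: less_induct)
  case (less n)
  moreover have "digit TZero" "digit TOne" by (simp_all add: digit_def)
  ultimately show ?case by (subst write_nat.simps) simp
qed

lemma takeWhile_digits: "no_digit u \<Longrightarrow> takeWhile digit (write_nat n @ u) = write_nat n"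
  "no_digit u \<Longrightarrow> dropWhile digit (write_nat n @ u) = u"
proof -
  have d: "\<forall>a\<in>set (write_nat n). digit a" using digits_write_nat[of n] by (simp add: list_all_iff)
  assume "no_digit u"
  then have "takeWhile digit u = [] \<and> dropWhile digit u = u" by (cases u) (auto simp: no_digit_iff)
  then show "takeWhile digit (write_nat n @ u) = write_nat n" "dropWhile digit (write_nat n @ u) = u"
    using d by (simp_all add: takeWhile_append2 dropWhile_append2)
qed

lemma write_nat_push:
  "n \<noteq> 0 \<Longrightarrow> TZero # write_nat n = write_nat (2 * n)" "TOne # write_nat n = write_nat (2 * n + 1)"
  by (simp_all add: write_nat.simps[of "2 * n"] write_nat.simps[of "Suc (2 * n)"])

lemma length_write_nat: "n < 2 ^ l \<Longrightarrow> length (write_nat n) \<le> l"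
proof (induction l arbitrary: n)
  case (Suc l)
  then have "length (write_nat (n div 2)) \<le> l" by (intro Suc.IH) auto
  then show ?case by (subst write_nat.simps) simp
qed simp

text \<open>Numbers are guessed most significant bit first; \<open>Len\<close> bounds the number of their bits.\<close>

definition Guess_Bits :: "reg \<Rightarrow> (reg, token) com" where
  "Guess_Bits r = While (\<lambda>t. t Len \<noteq> None)
    (Or (Move_While (\<lambda>_. True) Len Cnt) (Mv Len Cnt ;; Or (Push r (\<lambda>_. TZero)) (Push r (\<lambda>_. TOne))))"

text \<open>Zero is the empty word; every other number begins with its leading one, pushed before
  the remaining bits. The final move restores \<open>Len\<close>.\<close>

definition Guess :: "reg \<Rightarrow> (reg, token) com" where
  "Guess r = (Or (Move_While (\<lambda>_. True) Len Cnt)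
      (If (\<lambda>t. t Len = None) Skip (Mv Len Cnt ;; Push r (\<lambda>_. TOne))) ;;
    Guess_Bits r ;; Move_While (\<lambda>_. True) Cnt Len)"

text \<open>Here \<open>b\<close> consists of the bits guessed so far, and
  \<open>a div 2 ^ j = b\<close> says that \<open>a\<close> extends them by \<open>j\<close> lower
  bits. A nonzero \<open>b\<close> is needed since a zero digit on the empty word is not a written
  number.\<close>

lemma ev_Guess_Bits:
  assumes "s Len = replicate l TOne" "s Cnt = replicate k TOne" "s r = write_nat b @ u" "b \<noteq> 0"
    and "r \<noteq> Len" "r \<noteq> Cnt"
    and "\<And>j a. j \<le> l \<Longrightarrow> a div 2 ^ j = b \<Longrightarrow>
      ev K (s(Len := [], Cnt := replicate (l + k) TOne, r := write_nat a @ u)) t (Q a)"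
    and "t + 10 * l + 1 \<le> t'"
  shows "ev (Guess_Bits r # K) s t' (\<exists>j\<le>l. \<exists>a. a div 2 ^ j = b \<and> Q a)"
  using assms
proof (induction l arbitrary: s k b t')
  case 0
  have "ev K s t (Q b)"
    by (rule ev_weaken[OF 0(7)[of 0 b]]) (use 0 in auto)
  then show ?case using 0 unfolding Guess_Bits_def
    by (subst ev_While) (auto simp: tops_def intro: ev_mono)
next
  case (Suc l)
  let ?W = "Guess_Bits r"
  let ?s = "\<lambda>b. s(Len := replicate l TOne, Cnt := replicate (Suc k) TOne, r := write_nat b @ u)"
  have stop: "ev (Move_While (\<lambda>_. True) Len Cnt # ?W # K) s (t' - 2) (Q b)"
  proof (rule ev_Move_While)
    have "ev K (s(Len := [], Cnt := replicate (Suc l) TOne @ replicate k TOne)) t (Q b)"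
      by (rule ev_weaken[OF Suc.prems(7)[of 0 b]]) (use Suc.prems in \<open>auto simp: replicate_add\<close>)
    then have "ev (?W # K) (s(Len := [], Cnt := replicate (Suc l) TOne @ replicate k TOne)) (t + 1) (Q b)"
      unfolding Guess_Bits_def by (subst ev_While) (simp add: tops_def)
    then show "ev (?W # K) (s(Len := dropWhile (\<lambda>_. True) (s Len),
        Cnt := rev (takeWhile (\<lambda>_. True) (s Len)) @ s Cnt)) (t + 1) (Q b)"
      using Suc.prems(1,2) by (simp add: takeWhile_eq_all_conv[THEN iffD2] dropWhile_eq_Nil_conv[THEN iffD2] rev_replicate del: replicate_Suc)
  qed (use Suc.prems in \<open>auto simp: takeWhile_eq_all_conv[THEN iffD2]\<close>)
  have bit: "ev (?W # K) (?s b') (t' - 8) (\<exists>j\<le>l. \<exists>a. a div 2 ^ j = b' \<and> Q a)"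
    if b': "b' div 2 = b" for b'
  proof (rule Suc.IH[of "?s b'" "Suc k" b'])
    fix j a assume j: "j \<le> l" "a div 2 ^ j = b'"
    then have a: "a div 2 ^ Suc j = b" using b' by (simp add: power_Suc2 div_mult2_eq del: power_Suc)
    show "ev K ((?s b')(Len := [], Cnt := replicate (l + Suc k) TOne, r := write_nat a @ u)) t (Q a)"
      by (rule ev_weaken[OF Suc.prems(7)[of "Suc j" a]]) (use j(1) a in auto)
  qed (use Suc.prems b' in auto)
  have eq: "s(Cnt := TOne # s Cnt, Len := replicate l TOne, r := x # s r) = ?s b'"
    if "x # write_nat b = write_nat b'" for x b'
    using Suc.prems(2,3,5,6) that by (auto simp flip: append_Cons)
  have "ev (Or (Push r (\<lambda>_. TZero)) (Push r (\<lambda>_. TOne)) # ?W # K)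
      (s(Cnt := TOne # s Cnt, Len := replicate l TOne)) (t' - 6)
      ((\<exists>j\<le>l. \<exists>a. a div 2 ^ j = 2 * b \<and> Q a) \<or> (\<exists>j\<le>l. \<exists>a. a div 2 ^ j = 2 * b + 1 \<and> Q a))"
    using bit[of "2 * b"] bit[of "2 * b + 1"] eq[OF write_nat_push(1)[OF Suc.prems(4)]] eq[OF write_nat_push(2)]
      Suc.prems(5,6,8)
    by (intro ev_Or[where t = "t' - 7"]) (auto simp: diff_diff_add)
  then have "ev ((Mv Len Cnt ;; Or (Push r (\<lambda>_. TZero)) (Push r (\<lambda>_. TOne))) # ?W # K) s (t' - 2)
      ((\<exists>j\<le>l. \<exists>a. a div 2 ^ j = 2 * b \<and> Q a) \<or> (\<exists>j\<le>l. \<exists>a. a div 2 ^ j = 2 * b + 1 \<and> Q a))"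
    using Suc.prems(1,8) by (simp add: diff_diff_add)
  from ev_Or[OF stop this, of "t' - 1"]
  have "ev (Or (Move_While (\<lambda>_. True) Len Cnt) (Mv Len Cnt ;; Or (Push r (\<lambda>_. TZero)) (Push r (\<lambda>_. TOne))) # ?W # K)
      s (t' - 1) (Q b \<or> (\<exists>j\<le>l. \<exists>a. a div 2 ^ j = 2 * b \<and> Q a) \<or> (\<exists>j\<le>l. \<exists>a. a div 2 ^ j = 2 * b + 1 \<and> Q a))"
    using Suc.prems(8) by simp
  moreover have "(Q b \<or> (\<exists>j\<le>l. \<exists>a. a div 2 ^ j = 2 * b \<and> Q a) \<or> (\<exists>j\<le>l. \<exists>a. a div 2 ^ j = 2 * b + 1 \<and> Q a))
      \<longleftrightarrow> (\<exists>j\<le>Suc l. \<exists>a. a div 2 ^ j = b \<and> Q a)"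
  proof -
    have "a div 2 ^ Suc j = b \<longleftrightarrow> a div 2 ^ j = 2 * b \<or> a div 2 ^ j = 2 * b + 1" for a j :: nat
      by (simp add: div_mult2_eq mult.commute[of 2]) linarith
    moreover have "(\<exists>j\<le>Suc l. P j) \<longleftrightarrow> P 0 \<or> (\<exists>j\<le>l. P (Suc j))" for P
      by (metis Suc_le_mono bot_nat_0.extremum not0_implies_Suc)
    ultimately show ?thesis by auto
  qed
  ultimately show ?case
    using Suc.prems(1,8) unfolding Guess_Bits_def by (subst ev_While) (simp add: tops_def)
qed

definition clean :: "nat \<Rightarrow> (reg, token) store \<Rightarrow> bool" where
  "clean l s \<longleftrightarrow> s Len = replicate l TOne \<and> s Cnt = [] \<and> s Dep = [] \<and> s Tmp = [] \<and> s Var = [] \<and> s Num = []"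

lemma clean_simps [simp]:
  "clean l (s(Ex i := x)) = clean l s" "clean l (s(En i := x)) = clean l s"
  "clean l (s(Arg := x)) = clean l s" "clean l (s(Goals := x)) = clean l s"
  by (simp_all add: clean_def)

lemma cleanD:
  "clean l s \<Longrightarrow> s Len = replicate l TOne" "clean l s \<Longrightarrow> s Cnt = []" "clean l s \<Longrightarrow> s Dep = []"
  "clean l s \<Longrightarrow> s Tmp = []" "clean l s \<Longrightarrow> s Var = []" "clean l s \<Longrightarrow> s Num = []"
  by (simp_all add: clean_def)

lemma ev_While_True: "b (tops s) \<Longrightarrow> ev (c # While b c # K) s t v \<Longrightarrow> t < t' \<Longrightarrow> ev (While b c # K) s t' v"
  by (subst ev_While) (auto elim: ev_mono)

lemma ev_While_False: "\<not> b (tops s) \<Longrightarrow> ev K s t v \<Longrightarrow> t < t' \<Longrightarrow> ev (While b c # K) s t' v"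
  by (subst ev_While) (auto elim: ev_mono)

text \<open>The positive numbers of at most \<open>m + 1\<close> bits are those that become 1 when
  their \<open>j\<close> bits below the leading one are cut off.\<close>

lemma ex_div_power_eq_1: "(\<exists>j\<le>m. a div 2 ^ j = 1) \<longleftrightarrow> 0 < a \<and> a < (2 :: nat) ^ Suc m"
proof
  assume "\<exists>j\<le>m. a div 2 ^ j = 1"
  then obtain j where j: "j \<le> m" "a div 2 ^ j = 1" by blast
  then have "a div 2 ^ j < 2" by simp
  then have "a < 2 * 2 ^ j" by (simp add: div_less_iff_less_mult)
  also have "\<dots> \<le> 2 * 2 ^ m" using j(1) by simp
  finally show "0 < a \<and> a < 2 ^ Suc m" using j(2) by (cases a) auto
next
  show "0 < a \<and> a < 2 ^ Suc m \<Longrightarrow> \<exists>j\<le>m. a div 2 ^ j = 1"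
  proof (induction m arbitrary: a)
    case (Suc m)
    show ?case
    proof (cases "a = 1")
      case False
      then have "0 < a div 2 \<and> a div 2 < 2 ^ Suc m" using Suc.prems by auto
      from Suc.IH[OF this] obtain j where "j \<le> m" "a div 2 div 2 ^ j = 1" by blast
      then show ?thesis by (intro exI[of _ "Suc j"]) (simp add: div_mult2_eq)
    qed auto
  qed auto
qed

lemma ev_Guess:
  assumes "s Len = replicate l TOne" "s Cnt = []" "r \<noteq> Len" "r \<noteq> Cnt"
    and Q: "\<And>a. a < 2 ^ l \<Longrightarrow> ev K (s(r := write_nat a @ s r)) t (Q a)"
    and t: "t + 20 * l + 20 \<le> t'"
  shows "ev (Guess r # K) s t' (\<exists>a<2 ^ l. Q a)"
proof -
  let ?M = "Move_While (\<lambda>_. True) Cnt Len"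
  have bk: "ev (?M # K) (s(Len := [], Cnt := replicate k TOne, r := x)) (t + 4 * l + 1) v"
    if "ev K (s(r := x)) t v" "k = l" for k x v
    by (rule ev_Move_While, rule ev_weaken[OF that(1)])
       (use assms that in \<open>auto simp: takeWhile_eq_all_conv[THEN iffD2] dropWhile_eq_Nil_conv[THEN iffD2]\<close>)
  have zero: "ev ((Guess_Bits r ;; ?M) # K) (s(Len := [], Cnt := replicate l TOne)) (t + 4 * l + 3) (Q 0)"
  proof -
    have "ev (?M # K) (s(Len := [], Cnt := replicate l TOne)) (t + 4 * l + 1) (Q 0)"
      by (rule ev_weaken[OF bk[of "s r" "Q 0" l]]) (use Q[of 0] assms(3,4) in auto)
    then show ?thesis unfolding Guess_Bits_def by (simp add: ev_While tops_def)
  qed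
  have c1: "ev (Move_While (\<lambda>_. True) Len Cnt # (Guess_Bits r ;; ?M) # K) s (t' - 2) (Q 0)"
    by (rule ev_Move_While, rule ev_weaken[OF zero])
       (use assms in \<open>auto simp: takeWhile_eq_all_conv[THEN iffD2] dropWhile_eq_Nil_conv[THEN iffD2]\<close>)
  \<comment> \<open>The outcome of the second alternative. If no bits are allowed, it skips the
    leading one and ends with zero like the first.\<close>
  define R where "R \<longleftrightarrow> (case l of 0 \<Rightarrow> Q 0 | Suc m \<Rightarrow> \<exists>j\<le>m. \<exists>a. a div 2 ^ j = 1 \<and> Q a)"
  have c2: "ev (If (\<lambda>t. t Len = None) Skip (Mv Len Cnt ;; Push r (\<lambda>_. TOne)) # (Guess_Bits r ;; ?M) # K) s (t' - 2) R"
  proof (cases l)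
    case 0
    have "s(Len := [], Cnt := replicate l TOne) = s" using assms 0 by auto
    then have "ev ((Guess_Bits r ;; ?M) # K) s (t' - 4) (Q 0)"
      using ev_mono[OF zero, of "t' - 4"] t 0 by simp
    then show ?thesis using assms(1) 0 t by (simp add: tops_def R_def)
  next
    case (Suc m)
    let ?s = "s(Cnt := [TOne], Len := replicate m TOne, r := TOne # s r)"
    have one: "write_nat (Suc 0) = [TOne]" by (simp add: write_nat.simps[of "Suc 0"])
    have "ev (Guess_Bits r # ?M # K) ?s (t + 14 * m + 10) (\<exists>j\<le>m. \<exists>a. a div 2 ^ j = 1 \<and> Q a)"
    proof (rule ev_Guess_Bits[where k = 1 and u = "s r"])
      fix j a :: nat assume ja: "j \<le> m" "a div 2 ^ j = 1"
      then have "a < 2 ^ l" using ex_div_power_eq_1[of m a] Suc by blast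
      from bk[OF Q[OF this], of "m + 1"] show "ev (?M # K) (?s(Len := [], Cnt := replicate (m + 1) TOne, r := write_nat a @ s r)) (t + 4 * m + 5) (Q a)"
        by (rule ev_weaken) (use Suc in auto)
    qed (use assms one in auto)
    then have "ev (Guess_Bits r # ?M # K) ?s (t' - 9) (\<exists>j\<le>m. \<exists>a. a div 2 ^ j = 1 \<and> Q a)"
      by (rule ev_mono) (use t Suc in simp)
    then show ?thesis using assms Suc t by (simp add: tops_def R_def diff_diff_add del: fun_upd_apply)
       (simp add: numeral_eq_Suc)
  qed
  have "(Q 0 \<or> R) \<longleftrightarrow> (\<exists>a<2 ^ l. Q a)"
  proof (cases l)
    case (Suc m)
    then have "(Q 0 \<or> R) \<longleftrightarrow> (\<exists>a. (a = 0 \<or> (\<exists>j\<le>m. a div 2 ^ j = 1)) \<and> Q a)"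
      by (auto simp: R_def)
    also have "\<dots> \<longleftrightarrow> (\<exists>a<2 ^ l. Q a)" unfolding ex_div_power_eq_1 Suc
      by (metis bot_nat_0.not_eq_extremum zero_less_numeral zero_less_power)
    finally show ?thesis .
  qed (simp add: R_def)
  moreover have "ev (Guess r # K) s t' (Q 0 \<or> R)"
    using ev_Or[OF c1 c2, of "t' - 1"] t by (simp add: Guess_def)
  ultimately show ?thesis by simp
qed

section \<open>Environments: binding and looking up variables\<close>

definition write_env :: "env \<Rightarrow> token list" where
  "write_env ps = concat (map (\<lambda>(x, a). write_var x @ write_atom a) ps)"

lemma write_env_simps [simp]:
  "write_env [] = []" "write_env ((x, a) # ps) = TVar # write_nat x @ TAtom # write_nat a @ write_env ps"
  by (simp_all add: write_env_def write_var_def write_atom_def)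

lemma no_digit_write_env [simp]: "no_digit (write_env ps)"
  by (cases ps) auto

text \<open>A pair is pushed back to front: digits of the atom, \<open>TAtom\<close>, digits of the
  variable, \<open>TVar\<close>. The detour through \<open>Var\<close> reverses the digits of the
  variable twice, so that they arrive in order.\<close>

definition Bind :: "which \<Rightarrow> (reg, token) com" where
  "Bind i = (Guess (En i) ;; Push (En i) (\<lambda>_. TAtom) ;; Pop (Ex i) ;;
    Move_While digit (Ex i) Var ;; Move_While digit Var (En i) ;; Push (En i) (\<lambda>_. TVar))"

lemma ev_Bind:
  assumes s: "s (Ex i) = write_var x @ u" "no_digit u" "s (En i) = write_env ps"
    and c: "s Len = replicate l TOne" "s Cnt = []" "s Var = []"
    and Q: "\<And>a. a < 2 ^ l \<Longrightarrow> ev K (s(Ex i := u, En i := write_env ((x, a) # ps))) t (Q a)"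
    and t: "t + 20 * l + 8 * length (write_var x) + 40 \<le> t'"
  shows "ev (Bind i # K) s t' (\<exists>a<2 ^ l. Q a)"
proof -
  let ?K = "(Push (En i) (\<lambda>_. TAtom) ;; Pop (Ex i) ;; Move_While digit (Ex i) Var ;; Move_While digit Var (En i) ;; Push (En i) (\<lambda>_. TVar)) # K"
  have len: "length (write_var x) = Suc (length (write_nat x))" by (simp add: write_var_def)
  note d = digits_write_nat[of x]
  have "ev ?K (s(En i := write_nat a @ s (En i))) (t + 8 * length (write_nat x) + 20) (Q a)" if a: "a < 2 ^ l" for a
  proof -
    let ?e = "TAtom # write_nat a @ write_env ps"
    have "ev (Push (En i) (\<lambda>_. TVar) # K) (s(Ex i := u, En i := write_nat x @ ?e)) (t + 1) (Q a)"
      by (simp del: fun_upd_apply, rule ev_weaken[OF Q[OF a]]) auto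
    then have "ev (Move_While digit Var (En i) # Push (En i) (\<lambda>_. TVar) # K)
        (s(Ex i := u, En i := ?e, Var := rev (write_nat x))) (t + 4 * length (write_nat x) + 2) (Q a)"
      by (rule ev_Move_While_aux[where xs = "rev (write_nat x)" and ys = "[]", OF ev_weaken])
         (use c(3) d in \<open>auto simp: list_all_iff\<close>)
    then have "ev (Move_While digit Var (En i) # Push (En i) (\<lambda>_. TVar) # K)
        (s(Ex i := u, En i := ?e, Var := rev (write_nat x))) (t + 4 * length (write_nat x) + 3) (Q a)"
      by (rule ev_mono) simp
    then have "ev (Move_While digit (Ex i) Var # (Move_While digit Var (En i) ;; Push (En i) (\<lambda>_. TVar)) # K)
        (s(Ex i := write_nat x @ u, En i := ?e)) (t + 8 * length (write_nat x) + 10) (Q a)"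
      by (intro ev_Move_While_aux[where xs = "write_nat x" and ys = u])
         (use c(3) d s(2) in \<open>auto simp: no_digit_iff fun_upd_twist elim!: ev_weaken\<close>)
    then show ?thesis
      by (simp add: s(3) del: fun_upd_apply) (auto simp: s(1) write_var_def elim!: ev_weaken)
  qed
  then have "ev (Guess (En i) # ?K) s (t' - 1) (\<exists>a<2 ^ l. Q a)"
    by (rule ev_Guess[OF c(1,2), rotated 2]) (use t len in auto)
  then show ?thesis unfolding Bind_def ev_simps(3) using t by simp
qed

text \<open>Equal leading digits are cancelled. The numbers agree exactly if no digit is then left
  on either side.\<close>

definition Eq_Num :: "reg \<Rightarrow> reg \<Rightarrow> (reg, token) com" where
  "Eq_Num r r' = (While (\<lambda>t. t r = t r' \<and> (\<exists>a. t r = Some a \<and> digit a)) (Pop r ;; Pop r') ;;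
    If (\<lambda>t. \<exists>a. digit a \<and> (t r = Some a \<or> t r' = Some a)) (Halt False) Skip)"

lemma tops_Cons: "s r = a # x \<Longrightarrow> tops s r = Some a"
  by (simp add: tops_def)

lemma tops_no_digit: "s r = u \<Longrightarrow> no_digit u \<Longrightarrow> tops s r = Some a \<Longrightarrow> \<not> digit a"
  by (cases u) (simp_all add: tops_def no_digit_iff)

lemma ev_Eq_Num_aux:
  assumes "s r = xs @ u" "s r' = ys @ w" "list_all digit xs" "list_all digit ys"
    "no_digit u" "no_digit w" "r \<noteq> r'" "xs = ys \<Longrightarrow> ev K (s(r := u, r' := w)) t v" "t + 4 * length xs + 5 \<le> t'"
  shows "ev (Eq_Num r r' # K) s t' (xs = ys \<and> v)"
proof -
  let ?I = "If (\<lambda>t. \<exists>a. digit a \<and> (t r = Some a \<or> t r' = Some a)) (Halt False) Skip"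
  let ?b = "\<lambda>t. t r = t r' \<and> (\<exists>a. t r = Some a \<and> digit a)"
  have "ev (While ?b (Pop r ;; Pop r') # ?I # K) s t' (xs = ys \<and> v)"
    if "t + 4 * length xs + 4 \<le> t'" for t'
    using assms(1-8) that
  proof (induction xs arbitrary: ys s t')
    case Nil
    have r: "\<not> digit a" if "tops s r = Some a" for a
      using tops_no_digit[of s r u a] Nil that by simp
    show ?case
    proof (cases ys)
      case ys: Nil
      have r': "\<not> digit a" if "tops s r' = Some a" for a
        using tops_no_digit[of s r' w a] Nil ys that by simp
      have K: "ev K s (t' - 3) v"
        by (rule ev_weaken[OF Nil(8)]) (use Nil ys in auto)
      have no: "\<not> (\<exists>a. digit a \<and> (tops s r = Some a \<or> tops s r' = Some a))"
        using r r' by blast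
      have "ev (?I # K) s (t' - 1) v"
        using K Nil(9) by (simp only: ev_simps no if_False) (simp add: numeral_3_eq_3)
      then have "ev (While ?b (Pop r ;; Pop r') # ?I # K) s t' v"
        by (rule ev_While_False[rotated]) (use r Nil(9) in auto)
      then show ?thesis using ys by simp
    next
      case (Cons y zs)
      have y: "tops s r' = Some y" "digit y" using Nil Cons by (auto simp: tops_Cons)
      have yes: "(\<exists>a. digit a \<and> (tops s r = Some a \<or> tops s r' = Some a)) = True"
        using y by blast
      have "ev (?I # K) s (t' - 1) False"
        using Nil(9) by (simp only: ev_simps yes if_True) simp
      then have "ev (While ?b (Pop r ;; Pop r') # ?I # K) s t' False"
        by (rule ev_While_False[rotated]) (use r y Nil(9) in auto)
      then show ?thesis using Cons by simp
    qed
  next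
    case (Cons x xs)
    have x: "tops s r = Some x" "digit x" using Cons.prems by (auto simp: tops_Cons)
    show ?case
    proof (cases "ys \<noteq> [] \<and> hd ys = x")
      case True
      then obtain zs where ys: "ys = x # zs" by (cases ys) auto
      have "ev (While ?b (Pop r ;; Pop r') # ?I # K) (s(r := xs @ u, r' := zs @ w)) (t' - 4) (xs = zs \<and> v)"
      proof (rule Cons.IH)
        assume "xs = zs"
        then show "ev K ((s(r := xs @ u, r' := zs @ w))(r := u, r' := w)) t v"
          by (intro ev_weaken[OF Cons.prems(8)]) (use Cons.prems ys in auto)
      qed (use Cons.prems ys in auto)
      moreover have "s(r := tl (s r), r' := tl ((s(r := tl (s r))) r')) = s(r := xs @ u, r' := zs @ w)"
        using Cons.prems ys by auto
      ultimately have step: "ev ((Pop r ;; Pop r') # While ?b (Pop r ;; Pop r') # ?I # K) s (t' - 1) (xs = zs \<and> v)"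
        using Cons.prems(9) by (simp only: ev_simps) (simp add: diff_diff_add numeral_eq_Suc del: fun_upd_apply)
      have "?b (tops s)" using x Cons.prems(2) ys tops_Cons[of s r' x "zs @ w"] by simp
      then have "ev (While ?b (Pop r ;; Pop r') # ?I # K) s t' (xs = zs \<and> v)"
        by (rule ev_While_True[OF _ step]) (use Cons.prems(9) in simp)
      then show ?thesis using ys by simp
    next
      case False
      have nb: "\<not> ?b (tops s)"
      proof (cases ys)
        case Nil
        then show ?thesis using x tops_no_digit[of s r' w x] Cons.prems by auto
      next
        case (Cons y zs)
        then have "tops s r' = Some y" using Cons.prems by (simp add: tops_Cons)
        then show ?thesis using x False Cons by auto
      qed
      have yes: "(\<exists>a. digit a \<and> (tops s r = Some a \<or> tops s r' = Some a)) = True"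
        using x by blast
      have "ev (?I # K) s (t' - 1) False"
        using Cons.prems(9) by (simp only: ev_simps yes if_True) simp
      then have "ev (While ?b (Pop r ;; Pop r') # ?I # K) s t' False"
        by (rule ev_While_False[rotated]) (use nb Cons.prems(9) in auto)
      moreover have "\<not> (x # xs = ys)" using False by auto
      ultimately show ?thesis by simp
    qed
  qed
  from this[of "t' - 1"] show ?thesis using assms(9) by (simp add: Eq_Num_def)
qed

lemma ev_Eq_Num:
  assumes "s r = write_nat m @ u" "s r' = write_nat n @ w" "no_digit u" "no_digit w" "r \<noteq> r'"
    "m = n \<Longrightarrow> ev K (s(r := u, r' := w)) t v" "t + 4 * length (write_nat m) + 5 \<le> t'"
  shows "ev (Eq_Num r r' # K) s t' (m = n \<and> v)"
proof -
  have "write_nat m = write_nat n \<longleftrightarrow> m = n" using write_nat_inj[of "[]" "[]" m n] by simp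
  then show ?thesis
    using ev_Eq_Num_aux[of s r "write_nat m" u r' "write_nat n" w K t v t'] assms digits_write_nat by simp
qed

lemma ev_Test:
  assumes "ev (c # Halt True # K) s t u" "u \<Longrightarrow> ev K s t v" "t + 7 \<le> t'"
  shows "ev (Test c # K) s t' (u \<and> v)"
  unfolding Test_def using assms by (intro ev_And[where t = "t + 1"]) (auto elim: ev_mono)

text \<open>A comparison destroys its operands, so it gets a branch of its own. Either the front
  pair is the one sought, or its variable is shown to differ and the search goes on; this makes the
  first pair of a variable count, as in \<open>map_of\<close>.\<close>

definition Lookup :: "which \<Rightarrow> (reg, token) com" where
  "Lookup i = (While (\<lambda>t. t (En i) \<noteq> None)
    (Or (Pop (En i) ;; Eq_Num (En i) (Ex i) ;; Pop (En i) ;; Eq_Num (En i) Num ;; Halt True)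
      (Test (Neg ;; Pop (En i) ;; Eq_Num (En i) (Ex i)) ;;
       Pop (En i) ;; Drop_While digit (En i) ;; Pop (En i) ;; Drop_While digit (En i))) ;; Halt False)"

lemma ev_Lookup:
  assumes "s (Ex i) = write_nat x @ u" "no_digit u" "s Num = write_nat v" "s (En i) = write_env ps"
    "30 * length (write_env ps) + 10 \<le> t'"
  shows "ev (Lookup i # K) s t' (map_of ps x = Some v)"
proof -
  let ?W = "While (\<lambda>t. t (En i) \<noteq> None)
    (Or (Pop (En i) ;; Eq_Num (En i) (Ex i) ;; Pop (En i) ;; Eq_Num (En i) Num ;; Halt True)
      (Test (Neg ;; Pop (En i) ;; Eq_Num (En i) (Ex i)) ;;
       Pop (En i) ;; Drop_While digit (En i) ;; Pop (En i) ;; Drop_While digit (En i)))"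
  have "ev (?W # Halt False # K) s t' (map_of ps x = Some v)"
    if "30 * length (write_env ps) + 9 \<le> t'" for t'
    using assms(1-4) that
  proof (induction ps arbitrary: s t')
    case Nil
    then show ?case by (subst ev_While) (simp add: tops_def)
  next
    case (Cons p ps)
    obtain y b where p: "p = (y, b)" by force
    let ?c = "TAtom # write_nat b @ write_env ps"
    have e: "s (En i) = TVar # write_nat y @ ?c" using Cons.prems p by simp
    have n1: "length (write_env (p # ps)) = 2 + length (write_nat y) + length (write_nat b) + length (write_env ps)"
      using p by simp
    let ?T = "30 * length (write_env ps) + 9"
    let ?s = "s(En i := write_nat y @ ?c)"
    have hit: "ev ((Pop (En i) ;; Eq_Num (En i) (Ex i) ;; Pop (En i) ;; Eq_Num (En i) Num ;; Halt True) # ?W # Halt False # K)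
        s (?T + 4 * length (write_nat y) + 4 * length (write_nat b) + 40) (y = x \<and> b = v \<and> True)"
    proof -
      have "ev (Eq_Num (En i) Num # Halt True # ?W # Halt False # K) (s(En i := write_nat b @ write_env ps, Ex i := u))
          (4 * length (write_nat b) + 10) (b = v \<and> True)"
        by (rule ev_Eq_Num[where t = 2 and u = "write_env ps" and w = "[]"]) (use Cons.prems in auto)
      then have "ev (Pop (En i) # (Eq_Num (En i) Num ;; Halt True) # ?W # Halt False # K) (s(En i := ?c, Ex i := u))
          (4 * length (write_nat b) + 12) (b = v \<and> True)"
        by (auto simp: fun_upd_twist elim!: ev_weaken)
      then have "ev (Eq_Num (En i) (Ex i) # (Pop (En i) ;; Eq_Num (En i) Num ;; Halt True) # ?W # Halt False # K) ?s
          (4 * length (write_nat y) + 4 * length (write_nat b) + 20) (y = x \<and> b = v \<and> True)"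
        by (intro ev_Eq_Num[where t = "4 * length (write_nat b) + 13" and u = ?c and w = u])
           (use Cons.prems in \<open>auto elim!: ev_weaken\<close>)
      then show ?thesis using e by (auto elim!: ev_weaken)
    qed
    have ne: "ev ((Neg ;; Pop (En i) ;; Eq_Num (En i) (Ex i)) # Halt True # K') s (4 * length (write_nat y) + 20) (\<not> (y = x \<and> True))" for K'
    proof -
      have "ev (Eq_Num (En i) (Ex i) # Halt True # K') ?s (4 * length (write_nat y) + 10) (y = x \<and> True)"
        by (rule ev_Eq_Num[where t = 1 and u = ?c and w = u]) (use Cons.prems in auto)
      then show ?thesis using e by (auto elim!: ev_weaken)
    qed
    have drop: "ev ((Pop (En i) ;; Drop_While digit (En i) ;; Pop (En i) ;; Drop_While digit (En i)) # ?W # Halt False # K) s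
        (?T + 2 * length (write_nat y) + 2 * length (write_nat b) + 12) (map_of ps x = Some v)"
    proof -
      have "ev (?W # Halt False # K) (s(En i := write_env ps)) ?T (map_of ps x = Some v)"
        by (rule Cons.IH) (use Cons.prems in auto)
      then have "ev (Drop_While digit (En i) # ?W # Halt False # K) (s(En i := write_nat b @ write_env ps))
          (?T + 2 * length (write_nat b) + 1) (map_of ps x = Some v)"
        by (intro ev_Drop_While) (auto simp: takeWhile_digits elim!: ev_weaken)
      then have "ev (Pop (En i) # Drop_While digit (En i) # ?W # Halt False # K) (s(En i := ?c))
          (?T + 2 * length (write_nat b) + 3) (map_of ps x = Some v)"
        by (auto elim!: ev_weaken)
      then have "ev (Drop_While digit (En i) # (Pop (En i) ;; Drop_While digit (En i)) # ?W # Halt False # K) ?s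
          (?T + 2 * length (write_nat y) + 2 * length (write_nat b) + 6) (map_of ps x = Some v)"
        by (intro ev_Drop_While[where t = "?T + 2 * length (write_nat b) + 4"])
           (auto simp: takeWhile_digits elim!: ev_weaken)
      then show ?thesis using e by (auto elim!: ev_weaken)
    qed
    have "ev (Test (Neg ;; Pop (En i) ;; Eq_Num (En i) (Ex i)) #
        (Pop (En i) ;; Drop_While digit (En i) ;; Pop (En i) ;; Drop_While digit (En i)) # ?W # Halt False # K) s
        (?T + 4 * length (write_nat y) + 2 * length (write_nat b) + 30) (\<not> (y = x \<and> True) \<and> map_of ps x = Some v)"
      by (rule ev_Test[where t = "?T + 4 * length (write_nat y) + 2 * length (write_nat b) + 20", OF ev_mono[OF ne] ev_mono[OF drop]]) auto
    then have "ev (Or (Pop (En i) ;; Eq_Num (En i) (Ex i) ;; Pop (En i) ;; Eq_Num (En i) Num ;; Halt True)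
      (Test (Neg ;; Pop (En i) ;; Eq_Num (En i) (Ex i)) ;;
       Pop (En i) ;; Drop_While digit (En i) ;; Pop (En i) ;; Drop_While digit (En i)) # ?W # Halt False # K) s
       (?T + 4 * length (write_nat y) + 4 * length (write_nat b) + 50)
       ((y = x \<and> b = v \<and> True) \<or> (\<not> (y = x \<and> True) \<and> map_of ps x = Some v))"
      by (intro ev_Or[where t = "?T + 4 * length (write_nat y) + 4 * length (write_nat b) + 40", OF hit]) (auto elim!: ev_weaken)
    moreover have "((y = x \<and> b = v \<and> True) \<or> (\<not> (y = x \<and> True) \<and> map_of ps x = Some v)) \<longleftrightarrow> map_of (p # ps) x = Some v"
      using p by auto
    ultimately show ?case
      using Cons.prems(5) e n1 by (intro ev_While_True[where t = "?T + 4 * length (write_nat y) + 4 * length (write_nat b) + 50"]) (simp_all add: tops_def del: write_env_simps)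
  qed
  from this[of "t' - 1"] show ?thesis using assms(5) by (simp add: Lookup_def)
qed

text \<open>The premise \<open>W = While b c\<close> lets a loop keep its name in the continuation,
  where induction hypotheses mention it.\<close>

lemma ev_loop_True:
  "W = While b c \<Longrightarrow> b (tops s) \<Longrightarrow> ev (c # W # K) s t v \<Longrightarrow> t < t' \<Longrightarrow> ev (W # K) s t' v"
  using ev_While_True by blast

lemma ev_loop_False: "W = While b c \<Longrightarrow> \<not> b (tops s) \<Longrightarrow> ev K s t v \<Longrightarrow> t < t' \<Longrightarrow> ev (W # K) s t' v"
  using ev_While_False by blast

section \<open>Evaluating formulas\<close>

definition var_token :: "token \<Rightarrow> bool" where
  "var_token a \<longleftrightarrow> a = TVar \<or> digit a"

lemma var_tokens_write_var: "list_all var_token (write_var x)"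
  using digits_write_nat[of x] by (simp add: write_var_def var_token_def list_all_iff)

text \<open>Since formulas are written in prefix notation, skipping one only requires to count the
  formulas that are still expected.\<close>

definition Skip_Loop :: "which \<Rightarrow> (reg, token) com" where
  "Skip_Loop i = While (\<lambda>t. t Dep \<noteq> None)
    (If (\<lambda>t. t (Ex i) = Some TAnd \<or> t (Ex i) = Some TOr) (Push Dep (\<lambda>_. TOne))
      (If (\<lambda>t. t (Ex i) = Some TEq) (Pop Dep) Skip) ;; Pop (Ex i))"

text \<open>An equation lowers the counter at its first token, so the loop may stop in front of
  variables of the last equation; these are dropped afterwards.\<close>

definition Skip_Fm :: "which \<Rightarrow> (reg, token) com" where
  "Skip_Fm i = (Push Dep (\<lambda>_. TOne) ;; Skip_Loop i ;; Drop_While var_token (Ex i))"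

lemma ev_Skip_Loop_step:
  assumes "s (Ex i) = a # u" "s Dep = b # d" "t + 6 \<le> t'"
    and "ev (Skip_Loop i # K) (s(Dep := if a = TAnd \<or> a = TOr then TOne # b # d else if a = TEq then d else b # d,
      Ex i := u)) t v"
  shows "ev (Skip_Loop i # K) s t' v"
proof (rule ev_loop_True[OF Skip_Loop_def, where t = "t + 5"])
  have test: "tops s (Ex i) = Some a" using assms(1) by (simp add: tops_def)
  have id: "s(Dep := b # d, Ex i := u) = s(Ex i := u)" using assms(2) by auto
  have e: "ev (Skip_Loop i # K) (s(Dep := if a = TAnd \<or> a = TOr then TOne # b # d else if a = TEq then d else b # d,
      Ex i := u)) (Suc t) v" by (rule ev_mono[OF assms(4)]) simp
  consider "a = TAnd \<or> a = TOr" | "a = TEq" | "a \<noteq> TAnd" "a \<noteq> TOr" "a \<noteq> TEq" by blast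
  then show "ev ((If (\<lambda>t. t (Ex i) = Some TAnd \<or> t (Ex i) = Some TOr) (Push Dep (\<lambda>_. TOne))
      (If (\<lambda>t. t (Ex i) = Some TEq) (Pop Dep) Skip) ;; Pop (Ex i)) # Skip_Loop i # K) s (t + 5) v"
  proof cases
    case 1
    then show ?thesis using e by (simp add: test assms(1,2) fun_upd_same fun_upd_other del: fun_upd_apply)
  next
    case 2
    then show ?thesis using assms(4) by (simp add: test assms(1,2) fun_upd_same fun_upd_other del: fun_upd_apply)
  next
    case 3
    then show ?thesis using assms(4) by (simp add: test id assms(1,2) fun_upd_same fun_upd_other del: fun_upd_apply)
  qed
qed (use assms in \<open>simp_all add: tops_def\<close>)

lemma ev_Skip_Loop_vars:
  assumes "list_all var_token z" "s (Ex i) = z @ u" "s Dep = b # d"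
    and "ev (Skip_Loop i # K) (s(Ex i := u)) t v" "t + 8 * length z \<le> t'"
  shows "ev (Skip_Loop i # K) s t' v"
  using assms
proof (induction z arbitrary: s t')
  case Nil
  then show ?case by (intro ev_weaken[OF Nil(4)]) auto
next
  case (Cons a z)
  have "ev (Skip_Loop i # K) (s(Ex i := z @ u)) (t' - 8) v"
    by (rule Cons.IH) (use Cons.prems in \<open>simp_all del: fun_upd_apply add: fun_upd_same fun_upd_other\<close>)
  moreover have "s(Ex i := z @ u) = s(Dep := b # d, Ex i := z @ u)" using Cons.prems(3) by auto
  moreover have "a \<noteq> TAnd \<and> a \<noteq> TOr \<and> a \<noteq> TEq" using Cons.prems(1) by (auto simp: var_token_def digit_def)
  ultimately have "ev (Skip_Loop i # K) (s(Dep := if a = TAnd \<or> a = TOr then TOne # b # d else if a = TEq then d else b # d,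
      Ex i := z @ u)) (t' - 8) v" by simp
  then show ?case
    by (rule ev_Skip_Loop_step[rotated 3]) (use Cons.prems in simp_all)
qed

text \<open>A specification in continuation style: reading \<open>x\<close> lowers the counter by
  one. How many tokens of the trailing variables are still unread depends on whether the loop stops
  there, so the premise is required for every rest \<open>z\<close>, with the time for it.\<close>

definition skips :: "which \<Rightarrow> token list \<Rightarrow> bool" where
  "skips i x \<longleftrightarrow> (\<forall>s d u t t' K v. s (Ex i) = x @ u \<longrightarrow> s Dep = TOne # d \<longrightarrow> t + 8 * length x \<le> t' \<longrightarrow>
    (\<forall>z. list_all var_token z \<longrightarrow> ev (Skip_Loop i # K) (s(Ex i := z @ u, Dep := d)) (t + 8 * length z) v) \<longrightarrow>
    ev (Skip_Loop i # K) s t' v)"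

lemma skips_atom: "list_all var_token z \<Longrightarrow> skips i (TEq # z)"
  unfolding skips_def
proof (intro allI impI)
  fix s d u t t' K v
  assume z: "list_all var_token z" and s: "s (Ex i) = (TEq # z) @ u" "s Dep = TOne # d" "t + 8 * length (TEq # z) \<le> t'"
    and "\<forall>z. list_all var_token z \<longrightarrow> ev (Skip_Loop i # K) (s(Ex i := z @ u, Dep := d)) (t + 8 * length z) v"
  then have e: "ev (Skip_Loop i # K) (s(Ex i := z @ u, Dep := d)) (t + 8 * length z) v" by blast
  show "ev (Skip_Loop i # K) s t' v"
    by (rule ev_Skip_Loop_step[where a = TEq and u = "z @ u" and b = TOne and d = d and t = "t + 8 * length z", OF _ _ _ ev_weaken[OF e]])
       (use s in \<open>auto simp: fun_upd_twist\<close>)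
qed

lemma skips_prefix:
  assumes "skips i x" "list_all var_token z" "a \<noteq> TAnd" "a \<noteq> TOr" "a \<noteq> TEq"
  shows "skips i (a # z @ x)"
  unfolding skips_def
proof (intro allI impI)
  fix s d u t t' K v
  assume s: "s (Ex i) = (a # z @ x) @ u" "s Dep = TOne # d" "t + 8 * length (a # z @ x) \<le> t'"
    and e: "\<forall>z. list_all var_token z \<longrightarrow> ev (Skip_Loop i # K) (s(Ex i := z @ u, Dep := d)) (t + 8 * length z) v"
  have x: "ev (Skip_Loop i # K) (s(Ex i := x @ u, Dep := TOne # d)) (t + 8 * length x) v"
  proof (rule assms(1)[unfolded skips_def, rule_format, of _ u d t])
    fix z assume "list_all var_token z"
    then have "ev (Skip_Loop i # K) (s(Ex i := z @ u, Dep := d)) (t + 8 * length z) v" using e by blast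
    then show "ev (Skip_Loop i # K) ((s(Ex i := x @ u, Dep := TOne # d))(Ex i := z @ u, Dep := d)) (t + 8 * length z) v"
      by (rule ev_weaken) auto
  qed simp_all
  have 1: "ev (Skip_Loop i # K) (s(Dep := TOne # d, Ex i := z @ x @ u)) (t + 8 * length x + 8 * length z) v"
    by (rule ev_Skip_Loop_vars[OF assms(2), where u = "x @ u" and b = TOne and d = d and t = "t + 8 * length x", OF _ _ ev_weaken[OF x]])
       (simp_all add: fun_upd_twist)
  have "(if a = TAnd \<or> a = TOr then TOne # TOne # d else if a = TEq then d else TOne # d) = TOne # d"
    using assms(3-5) by simp
  then show "ev (Skip_Loop i # K) s t' v"
    by (intro ev_Skip_Loop_step[where a = a and u = "z @ x @ u" and b = TOne and d = d and t = "t + 8 * length x + 8 * length z", OF _ _ _ ev_weaken[OF 1]])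
       (use s(3) in \<open>simp_all add: s(1,2)\<close>)
qed

text \<open>A connective raises the counter from one expected formula to two, and each operand
  lowers it by one.\<close>

lemma skips_binary:
  assumes "skips i x" "skips i y" "a = TAnd \<or> a = TOr"
  shows "skips i (a # x @ y)"
  unfolding skips_def
proof (intro allI impI)
  fix s d u t t' K v
  assume s: "s (Ex i) = (a # x @ y) @ u" "s Dep = TOne # d" "t + 8 * length (a # x @ y) \<le> t'"
    and e: "\<forall>z. list_all var_token z \<longrightarrow> ev (Skip_Loop i # K) (s(Ex i := z @ u, Dep := d)) (t + 8 * length z) v"
  have y: "ev (Skip_Loop i # K) (s(Ex i := y @ u, Dep := TOne # d)) (t + 8 * length y) v"
  proof (rule assms(2)[unfolded skips_def, rule_format, of _ u d t])
    fix z assume "list_all var_token z"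
    then have "ev (Skip_Loop i # K) (s(Ex i := z @ u, Dep := d)) (t + 8 * length z) v" using e by blast
    then show "ev (Skip_Loop i # K) ((s(Ex i := y @ u, Dep := TOne # d))(Ex i := z @ u, Dep := d)) (t + 8 * length z) v"
      by (rule ev_weaken) auto
  qed simp_all
  have x: "ev (Skip_Loop i # K) (s(Ex i := x @ y @ u, Dep := TOne # TOne # d)) (t + 8 * length y + 8 * length x) v"
  proof (rule assms(1)[unfolded skips_def, rule_format, of _ "y @ u" "TOne # d" "t + 8 * length y"])
    fix z assume z: "list_all var_token z"
    show "ev (Skip_Loop i # K) ((s(Ex i := x @ y @ u, Dep := TOne # TOne # d))(Ex i := z @ y @ u, Dep := TOne # d))
        (t + 8 * length y + 8 * length z) v"
      by (rule ev_Skip_Loop_vars[OF z, where u = "y @ u" and b = TOne and d = d, OF _ _ ev_weaken[OF y]]) auto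
  qed simp_all
  show "ev (Skip_Loop i # K) s t' v"
    by (rule ev_Skip_Loop_step[where a = a and u = "x @ y @ u" and b = TOne and d = d, OF _ _ _ ev_weaken[OF x]])
       (use s assms(3) in \<open>auto simp: fun_upd_twist\<close>)
qed

lemma skips_write_fm: "skips i (write_fm f)"
proof (induction f)
  case (FEq x y)
  show ?case using skips_atom[of "write_var x @ write_var y" i] var_tokens_write_var by simp
next
  case (FNot f)
  then show ?case using skips_prefix[of i "write_fm f" "[]"] by simp
next
  case (FEx x f)
  then show ?case using skips_prefix[OF _ var_tokens_write_var, of i "write_fm f" TEx x] by simp
next
  case (FAll x f)
  then show ?case using skips_prefix[OF _ var_tokens_write_var, of i "write_fm f" TAll x] by simp
qed (simp_all add: skips_binary)

definition no_var :: "token list \<Rightarrow> bool" where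
  "no_var u \<longleftrightarrow> u = [] \<or> \<not> var_token (hd u)"

lemma no_var_no_digit: "no_var u \<Longrightarrow> no_digit u"
  by (auto simp: no_var_def no_digit_iff var_token_def)

lemma no_var_write_fm [simp]: "no_var (write_fm f @ u)"
  by (cases f) (simp_all add: no_var_def var_token_def digit_def)

lemma ev_Skip_Fm:
  assumes "s (Ex i) = write_fm f @ u" "s Dep = []" "no_var u"
    and "ev K (s(Ex i := u)) t v" "t + 8 * length (write_fm f) + 8 \<le> t'"
  shows "ev (Skip_Fm i # K) s t' v"
proof -
  have "ev (Skip_Loop i # Drop_While var_token (Ex i) # K) (s(Dep := [TOne])) (t + 8 * length (write_fm f) + 5) v"
  proof (rule skips_write_fm[unfolded skips_def, rule_format, of _ _ f u "[]" "t + 5"])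
    fix z assume z: "list_all var_token z"
    then have "takeWhile var_token (z @ u) = z" "dropWhile var_token (z @ u) = u"
      using assms(3) by (cases u; auto simp: no_var_def list_all_iff takeWhile_append2 dropWhile_append2)+
    then have "ev (Drop_While var_token (Ex i) # K) (s(Ex i := z @ u)) (t + 2 * length z + 1) v"
      using assms(4) by (intro ev_Drop_While[where t = t]) (auto elim!: ev_weaken)
    then show "ev (Skip_Loop i # Drop_While var_token (Ex i) # K)
        ((s(Dep := [TOne]))(Ex i := z @ u, Dep := [])) (t + 5 + 8 * length z) v"
      by (intro ev_loop_False[OF Skip_Loop_def, where t = "t + 2 * length z + 1"])
         (use assms in \<open>auto simp: tops_def elim!: ev_weaken\<close>)
  qed (use assms in auto)
  then show ?thesis
    unfolding Skip_Fm_def using assms by (auto elim!: ev_weaken)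
qed

text \<open>The common value is guessed first; each conjunct then confirms it for one variable,
  consuming its own copy of the environment.\<close>

definition Sat_Atom :: "which \<Rightarrow> (reg, token) com" where
  "Sat_Atom i = (Guess Num ;; And (Pop (Ex i) ;; Lookup i)
    (Pop (Ex i) ;; Drop_While digit (Ex i) ;; Pop (Ex i) ;; Lookup i))"

lemma ev_Sat_Atom:
  assumes "s (Ex i) = write_var x @ write_var y @ u" "no_digit u" "clean l s" "s (En i) = write_env ps"
    and "30 * length (write_env ps) + 20 * l + 2 * length (write_var x) + 50 \<le> t'"
  shows "ev (Sat_Atom i # K) s t' (\<exists>v<2 ^ l. map_of ps x = Some v \<and> map_of ps y = Some v)"
proof -
  let ?T = "30 * length (write_env ps) + 10"
  let ?K = "And (Pop (Ex i) ;; Lookup i) (Pop (Ex i) ;; Drop_While digit (Ex i) ;; Pop (Ex i) ;; Lookup i) # K"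
  have "ev ?K (s(Num := write_nat v @ s Num)) (?T + 2 * length (write_nat x) + 15) (map_of ps x = Some v \<and> map_of ps y = Some v)" for v
  proof (rule ev_And[where t = "?T + 2 * length (write_nat x) + 10"])
    let ?s = "s(Num := write_nat v @ s Num)"
    have "ev (Lookup i # K) (?s(Ex i := write_nat x @ write_var y @ u)) ?T (map_of ps x = Some v)"
      by (rule ev_Lookup[where u = "write_var y @ u"]) (use assms cleanD(6)[OF assms(3)] in \<open>simp_all add: no_digit_write\<close>)
    then show "ev ((Pop (Ex i) ;; Lookup i) # K) ?s (?T + 2 * length (write_nat x) + 10) (map_of ps x = Some v)"
      using assms(1) by (auto simp: write_var_def elim!: ev_weaken)
    have "ev (Lookup i # K) (?s(Ex i := write_nat y @ u)) ?T (map_of ps y = Some v)"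
      by (rule ev_Lookup[where u = u]) (use assms cleanD(6)[OF assms(3)] in simp_all)
    then have 1: "ev ((Pop (Ex i) ;; Lookup i) # K) (?s(Ex i := write_var y @ u)) (?T + 2) (map_of ps y = Some v)"
      by (auto simp: write_var_def elim!: ev_weaken)
    have "ev (Drop_While digit (Ex i) # (Pop (Ex i) ;; Lookup i) # K) (?s(Ex i := write_nat x @ write_var y @ u))
        (?T + 2 * length (write_nat x) + 3) (map_of ps y = Some v)"
      by (rule ev_Drop_While[where t = "?T + 2"], rule ev_weaken[OF 1])
         (simp_all add: takeWhile_digits no_digit_write)
    then show "ev ((Pop (Ex i) ;; Drop_While digit (Ex i) ;; Pop (Ex i) ;; Lookup i) # K) ?s (?T + 2 * length (write_nat x) + 10) (map_of ps y = Some v)"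
      using assms(1) by (auto simp: write_var_def elim!: ev_weaken)
  qed simp
  then have "ev (Guess Num # ?K) s (t' - 1) (\<exists>v<2 ^ l. map_of ps x = Some v \<and> map_of ps y = Some v)"
    by (rule ev_Guess[OF cleanD(1,2)[OF assms(3)], rotated 2])
       (use assms(5) in \<open>simp_all add: write_var_def\<close>)
  then show ?thesis using assms(5) by (simp add: Sat_Atom_def)
qed

text \<open>A single path is walked down to an equation. At a connective one branch stays on the
  left operand, with the right one behind it as garbage, and the other skips the left operand. A
  universal quantifier is an existential one between two negations.\<close>

definition Sat :: "which \<Rightarrow> (reg, token) com" where
  "Sat i = While (\<lambda>_. True)
    (If (\<lambda>t. t (Ex i) = Some TEq) (Pop (Ex i) ;; Sat_Atom i)
    (If (\<lambda>t. t (Ex i) = Some TNot) (Pop (Ex i) ;; Neg)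
    (If (\<lambda>t. t (Ex i) = Some TAnd) (Pop (Ex i) ;; And Skip (Skip_Fm i))
    (If (\<lambda>t. t (Ex i) = Some TOr) (Pop (Ex i) ;; Or Skip (Skip_Fm i))
    (If (\<lambda>t. t (Ex i) = Some TEx) (Pop (Ex i) ;; Bind i)
      (Pop (Ex i) ;; Neg ;; Bind i ;; Neg))))))"

definition env_ok :: "nat \<Rightarrow> nat \<Rightarrow> env \<Rightarrow> bool" where
  "env_ok n l ps \<longleftrightarrow> (\<forall>(x, a)\<in>set ps. length (write_var x) \<le> n \<and> a < 2 ^ l)"

lemma env_ok_Cons [simp]: "env_ok n l ((x, a) # ps) \<longleftrightarrow> length (write_var x) \<le> n \<and> a < 2 ^ l \<and> env_ok n l ps"
  by (simp add: env_ok_def)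

lemma length_write_env: "env_ok n l ps \<Longrightarrow> l \<le> n \<Longrightarrow> length (write_env ps) \<le> (2 * n + 1) * length ps"
proof (induction ps)
  case (Cons p ps)
  obtain x a where p: "p = (x, a)" by force
  then have "length (write_var x) \<le> n" "length (write_nat a) \<le> n" "length (write_env ps) \<le> (2 * n + 1) * length ps"
    using Cons length_write_nat[of a l] by auto
  then show ?case by (simp add: p write_var_def)
qed simp

text \<open>Fewer than \<open>2 ^ l\<close> atoms are values of the other free variables, so a
  witness can be moved below \<open>2 ^ l\<close> while these are fixed.\<close>

lemma sat_exists_bounded:
  assumes "\<sigma> ` (fv_fm f - {x}) \<subseteq> {..<2 ^ l}" "length (write_fm f) < 2 ^ l"
  shows "(\<exists>a. sat f (\<sigma>(x := a))) \<longleftrightarrow> (\<exists>a<2 ^ l. sat f (\<sigma>(x := a)))"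
proof
  assume "\<exists>a. sat f (\<sigma>(x := a))"
  then obtain a where a: "sat f (\<sigma>(x := a))" by blast
  let ?F = "\<sigma> ` (fv_fm f - {x})"
  have "card ?F \<le> card (fv_fm f - {x})" using card_fv_fm[of f] by (intro card_image_le) simp
  also have "\<dots> \<le> card (fv_fm f)" using card_fv_fm[of f] by (intro card_mono) auto
  finally have "card ?F + card {a} \<le> card {..<(2::nat) ^ l}"
    using assms(2) card_fv_fm[of f] by simp
  moreover have "{a} \<inter> ?F \<subseteq> {..<2 ^ l}" "finite ?F" using assms(1) card_fv_fm[of f] by auto
  ultimately obtain \<pi> where \<pi>: "bij \<pi>" "\<forall>b\<in>?F. \<pi> b = b" "\<pi> ` {a} \<subseteq> {..<2 ^ l}"
    using ex_renaming[of ?F "{a}" "{..<2 ^ l}"] by auto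
  have "sat f (\<sigma>(x := \<pi> a)) = sat f (\<pi> \<circ> \<sigma>(x := a))"
    by (rule sat_cong) (use \<pi>(2) in auto)
  then have "sat f (\<sigma>(x := \<pi> a))" using sat_rename[OF \<pi>(1)] a by simp
  then show "\<exists>a<2 ^ l. sat f (\<sigma>(x := a))" using \<pi>(3) by auto
qed blast

lemma valuation_eq_iff:
  assumes "x \<in> fst ` set ps" "y \<in> fst ` set ps" "snd ` set ps \<subseteq> {..<2 ^ l}"
  shows "(\<exists>v<2 ^ l. map_of ps x = Some v \<and> map_of ps y = Some v) \<longleftrightarrow> valuation ps x = valuation ps y"
proof -
  obtain v w where vw: "map_of ps x = Some v" "map_of ps y = Some w"
    using assms(1,2) by (metis map_of_eq_None_iff not_None_eq)
  then have "v < 2 ^ l" using assms(3) map_of_SomeD by fastforce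
  then show ?thesis using vw by (auto simp: valuation_def)
qed

lemma env_ok_snd: "env_ok n l ps \<Longrightarrow> snd ` set ps \<subseteq> {..<2 ^ l}"
  by (auto simp: env_ok_def)

lemma ev_Sat_step:
  assumes "s (Ex i) = a # u" "t + 9 \<le> t'"
    and "ev ((if a = TEq then Sat_Atom i else if a = TNot then Neg else if a = TAnd then And Skip (Skip_Fm i)
      else if a = TOr then Or Skip (Skip_Fm i) else if a = TEx then Bind i else Neg ;; Bind i ;; Neg) # Sat i # K)
      (s(Ex i := u)) t v"
  shows "ev (Sat i # K) s t' v"
proof -
  have top: "tops s (Ex i) = Some a" using assms(1) by (simp add: tops_def)
  define B where "B = (if a = TEq then Sat_Atom i else if a = TNot then Neg else if a = TAnd then And Skip (Skip_Fm i)
      else if a = TOr then Or Skip (Skip_Fm i) else if a = TEx then Bind i else Neg ;; Bind i ;; Neg)"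
  have "ev (B # Sat i # K) (s(Ex i := u)) t1 v" if "t \<le> t1" for t1
    using ev_mono[OF assms(3) that] by (simp only: B_def)
  then have "ev (Pop (Ex i) # B # Sat i # K) s t1 v" if "t < t1" for t1
    using that by (simp add: assms(1) del: fun_upd_apply)
  then have *: "ev ((Pop (Ex i) ;; B) # Sat i # K) s t1 v" if "t + 1 < t1" for t1
    using that by (simp del: ev_simps(2))
  show ?thesis
  proof (rule ev_loop_True[OF Sat_def, where t = "t + 8"])
    show "ev (If (\<lambda>t. t (Ex i) = Some TEq) (Pop (Ex i) ;; Sat_Atom i)
      (If (\<lambda>t. t (Ex i) = Some TNot) (Pop (Ex i) ;; Neg)
      (If (\<lambda>t. t (Ex i) = Some TAnd) (Pop (Ex i) ;; And Skip (Skip_Fm i))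
      (If (\<lambda>t. t (Ex i) = Some TOr) (Pop (Ex i) ;; Or Skip (Skip_Fm i))
      (If (\<lambda>t. t (Ex i) = Some TEx) (Pop (Ex i) ;; Bind i)
        (Pop (Ex i) ;; Neg ;; Bind i ;; Neg))))) # Sat i # K) s (t + 8) v"
    proof -
      consider "a = TEq" | "a = TNot" | "a = TAnd" | "a = TOr" | "a = TEx"
        | "a \<noteq> TEq" "a \<noteq> TNot" "a \<noteq> TAnd" "a \<noteq> TOr" "a \<noteq> TEx" by blast
      then show ?thesis
        by cases (use * in \<open>simp_all add: top B_def del: ev_simps(1-3,5-7)\<close>)
    qed
  qed (use assms(2) in simp_all)
qed

text \<open>A quantifier adds one entry to the environment but removes at least two tokens from the
  formula, so \<open>length (write_fm f) + length ps\<close> decreases at each step and pays for it.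
  The factor \<open>n + 1\<close> covers the length of a single binding.\<close>

lemma ev_Sat:
  assumes "s (Ex i) = write_fm f @ u" "no_var u" "s (En i) = write_env ps" "clean l s"
    and "fv_fm f \<subseteq> fst ` set ps" "env_ok n l ps" "length (write_fm f) \<le> n" "n < 2 ^ l" "l \<le> n"
    and "100 * (n + 1) * (length (write_fm f) + length ps + 1) \<le> t'"
  shows "ev (Sat i # K) s t' (sat f (valuation ps))"
  using assms
proof (induction f arbitrary: s u ps t' K)
  case (FEq x y)
  have "length (write_env ps) \<le> (2 * n + 1) * length ps"
    by (rule length_write_env[OF FEq.prems(6,9)])
  then have t: "30 * length (write_env ps) + 20 * l + 2 * length (write_var x) + 59 \<le> t'"
    using FEq.prems(7,9,10) by (simp add: algebra_simps)
  have "ev (Sat_Atom i # Sat i # K) (s(Ex i := write_var x @ write_var y @ u)) (t' - 9)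
      (\<exists>v<2 ^ l. map_of ps x = Some v \<and> map_of ps y = Some v)"
    using t by (intro ev_Sat_Atom[where u = u]) (use FEq.prems no_var_no_digit in \<open>simp_all add: fun_upd_same fun_upd_other del: fun_upd_apply\<close>)
  moreover have "(\<exists>v<2 ^ l. map_of ps x = Some v \<and> map_of ps y = Some v) \<longleftrightarrow> sat (FEq x y) (valuation ps)"
  proof -
    have "x \<in> fst ` set ps" "y \<in> fst ` set ps" using FEq.prems(5) by simp_all
    from valuation_eq_iff[OF this env_ok_snd[OF FEq.prems(6)]] show ?thesis by (simp only: sat.simps)
  qed
  ultimately have e: "ev (Sat_Atom i # Sat i # K) (s(Ex i := write_var x @ write_var y @ u)) (t' - 9) (sat (FEq x y) (valuation ps))"
    by (simp only:)
  have "s (Ex i) = TEq # write_var x @ write_var y @ u" using FEq.prems(1) by simp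
  then show ?case by (rule ev_Sat_step[where t = "t' - 9"]) (use t ev_mono[OF e] in simp_all)
next
  case (FNot f)
  have "ev (Sat i # K) (s(Ex i := write_fm f @ u)) (t' - 20) (sat f (valuation ps))"
    by (rule FNot.IH[where u = u and ps = ps]) (use FNot.prems in \<open>simp_all add: algebra_simps fun_upd_same fun_upd_other del: fun_upd_apply\<close>)
  then show ?case
    by (intro ev_Sat_step[where a = TNot and u = "write_fm f @ u" and t = "t' - 19"])
       (use FNot.prems in \<open>simp_all del: fun_upd_apply add: algebra_simps\<close>)
next
  case (FAnd f g)
  let ?c = "100 * (n + 1)"
  let ?s = "s(Ex i := write_fm f @ write_fm g @ u)"
  have 1: "ev (Skip # Sat i # K) ?s (t' - 20) (sat f (valuation ps))"
  proof -
    have "ev (Sat i # K) ?s (t' - 21) (sat f (valuation ps))"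
      by (rule FAnd.IH(1)[where u = "write_fm g @ u" and ps = ps]) (use FAnd.prems in \<open>simp_all add: algebra_simps fun_upd_same fun_upd_other del: fun_upd_apply\<close>)
    then show ?thesis using FAnd.prems(10) by (simp add: algebra_simps)
  qed
  have 2: "ev (Skip_Fm i # Sat i # K) ?s (t' - 20) (sat g (valuation ps))"
  proof -
    have "ev (Sat i # K) (s(Ex i := write_fm g @ u)) (?c * (length (write_fm g) + length ps + 1)) (sat g (valuation ps))"
      by (rule FAnd.IH(2)[where u = u and ps = ps]) (use FAnd.prems in \<open>simp_all add: fun_upd_same fun_upd_other del: fun_upd_apply\<close>)
    then show ?thesis
      by (intro ev_Skip_Fm[where f = f and u = "write_fm g @ u" and t = "?c * (length (write_fm g) + length ps + 1)"])
         (use FAnd.prems cleanD(3)[OF FAnd.prems(4)] in \<open>simp_all add: algebra_simps\<close>)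
  qed
  have "ev (And Skip (Skip_Fm i) # Sat i # K) ?s (t' - 10) (sat f (valuation ps) \<and> sat g (valuation ps))"
    by (rule ev_And[OF 1 2]) (use FAnd.prems(10) in \<open>simp_all add: algebra_simps\<close>)
  then show ?case
    by (intro ev_Sat_step[where a = TAnd and u = "write_fm f @ write_fm g @ u" and t = "t' - 10"])
       (use FAnd.prems in \<open>simp_all del: fun_upd_apply add: algebra_simps\<close>)
next
  case (FOr f g)
  let ?c = "100 * (n + 1)"
  let ?s = "s(Ex i := write_fm f @ write_fm g @ u)"
  have 1: "ev (Skip # Sat i # K) ?s (t' - 20) (sat f (valuation ps))"
  proof -
    have "ev (Sat i # K) ?s (t' - 21) (sat f (valuation ps))"
      by (rule FOr.IH(1)[where u = "write_fm g @ u" and ps = ps]) (use FOr.prems in \<open>simp_all add: algebra_simps fun_upd_same fun_upd_other del: fun_upd_apply\<close>)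
    then show ?thesis using FOr.prems(10) by (simp add: algebra_simps)
  qed
  have 2: "ev (Skip_Fm i # Sat i # K) ?s (t' - 20) (sat g (valuation ps))"
  proof -
    have "ev (Sat i # K) (s(Ex i := write_fm g @ u)) (?c * (length (write_fm g) + length ps + 1)) (sat g (valuation ps))"
      by (rule FOr.IH(2)[where u = u and ps = ps]) (use FOr.prems in \<open>simp_all add: fun_upd_same fun_upd_other del: fun_upd_apply\<close>)
    then show ?thesis
      by (intro ev_Skip_Fm[where f = f and u = "write_fm g @ u" and t = "?c * (length (write_fm g) + length ps + 1)"])
         (use FOr.prems cleanD(3)[OF FOr.prems(4)] in \<open>simp_all add: algebra_simps\<close>)
  qed
  have "ev (Or Skip (Skip_Fm i) # Sat i # K) ?s (t' - 10) (sat f (valuation ps) \<or> sat g (valuation ps))"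
    by (rule ev_Or[OF 1 2]) (use FOr.prems(10) in \<open>simp_all add: algebra_simps\<close>)
  then show ?case
    by (intro ev_Sat_step[where a = TOr and u = "write_fm f @ write_fm g @ u" and t = "t' - 10"])
       (use FOr.prems in \<open>simp_all del: fun_upd_apply add: algebra_simps\<close>)
next
  case (FEx x f)
  let ?T = "100 * (n + 1) * (length (write_fm f) + length ps + 2)"
  have "100 * (n + 1) * (length (write_fm f) + length ps + 3) \<le> 100 * (n + 1) * (length (write_fm (FEx x f)) + length ps + 1)"
    using length_write_var[of x] by (intro mult_le_mono2) simp
  moreover have "100 * (n + 1) * (length (write_fm f) + length ps + 3) = ?T + 100 * (n + 1)"
    by (simp add: algebra_simps)
  ultimately have time: "?T + 20 * l + 8 * length (write_var x) + 40 \<le> t' - 10"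
    using FEx.prems(7,9,10) by simp
  have "\<And>a. a < 2 ^ l \<Longrightarrow> ev (Sat i # K) (s(Ex i := write_fm f @ u, En i := write_env ((x, a) # ps))) ?T (sat f (valuation ((x, a) # ps)))"
    by (rule FEx.IH[where u = u]) (use FEx.prems in \<open>auto simp: algebra_simps fun_upd_same fun_upd_other simp del: fun_upd_apply\<close>)
  then have "ev (Bind i # Sat i # K) (s(Ex i := write_var x @ write_fm f @ u)) (t' - 10)
      (\<exists>a<2 ^ l. sat f (valuation ((x, a) # ps)))"
    by (intro ev_Bind[where u = "write_fm f @ u" and ps = ps and t = ?T])
       (use FEx.prems cleanD[OF FEx.prems(4)] time in \<open>simp_all add: no_digit_write fun_upd_same fun_upd_other del: fun_upd_apply\<close>)
  moreover have "(\<exists>a<2 ^ l. sat f (valuation ((x, a) # ps))) \<longleftrightarrow> sat (FEx x f) (valuation ps)"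
  proof -
    have "valuation ps ` (fv_fm f - {x}) \<subseteq> {..<2 ^ l}"
      using FEx.prems(5) valuation_in env_ok_snd[OF FEx.prems(6)] by fastforce
    then show ?thesis
      using sat_exists_bounded[of "valuation ps" f x l] FEx.prems(7,8) by (simp add: valuation_Cons)
  qed
  ultimately show ?case
    by (intro ev_Sat_step[where a = TEx and u = "write_var x @ write_fm f @ u" and t = "t' - 10"])
       (use FEx.prems in \<open>simp_all del: fun_upd_apply add: algebra_simps\<close>)
next
  case (FAll x f)
  let ?T = "100 * (n + 1) * (length (write_fm f) + length ps + 2)"
  have "100 * (n + 1) * (length (write_fm f) + length ps + 3) \<le> 100 * (n + 1) * (length (write_fm (FAll x f)) + length ps + 1)"
    using length_write_var[of x] by (intro mult_le_mono2) simp
  moreover have "100 * (n + 1) * (length (write_fm f) + length ps + 3) = ?T + 100 * (n + 1)"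
    by (simp add: algebra_simps)
  ultimately have time: "Suc ?T + 20 * l + 8 * length (write_var x) + 40 \<le> t' - 12"
    using FAll.prems(7,9,10) by simp
  have "\<And>a. a < 2 ^ l \<Longrightarrow> ev (Neg # Sat i # K) (s(Ex i := write_fm f @ u, En i := write_env ((x, a) # ps))) (Suc ?T) (\<not> sat f (valuation ((x, a) # ps)))"
    by (simp del: fun_upd_apply write_env_simps, rule FAll.IH[where u = u]) (use FAll.prems in \<open>auto simp: algebra_simps fun_upd_same fun_upd_other simp del: fun_upd_apply\<close>)
  then have "ev (Bind i # Neg # Sat i # K) (s(Ex i := write_var x @ write_fm f @ u)) (t' - 12)
      (\<exists>a<2 ^ l. \<not> sat f (valuation ((x, a) # ps)))"
    by (intro ev_Bind[where u = "write_fm f @ u" and ps = ps and t = "Suc ?T"])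
       (use FAll.prems cleanD[OF FAll.prems(4)] time in \<open>simp_all add: no_digit_write fun_upd_same fun_upd_other del: fun_upd_apply\<close>)
  moreover have "(\<exists>a<2 ^ l. \<not> sat f (valuation ((x, a) # ps))) \<longleftrightarrow> \<not> sat (FAll x f) (valuation ps)"
  proof -
    \<comment> \<open>A universal formula is refuted by an atom satisfying the negated body, so the
      bounded quantifier is taken for \<open>FNot f\<close>.\<close>
    have "valuation ps ` (fv_fm (FNot f) - {x}) \<subseteq> {..<2 ^ l}"
      using FAll.prems(5) valuation_in env_ok_snd[OF FAll.prems(6)] by fastforce
    then show ?thesis
      using sat_exists_bounded[of "valuation ps" "FNot f" x l] FAll.prems(7,8) length_write_var[of x]
      by (simp add: valuation_Cons)
  qed
  ultimately show ?case
    by (intro ev_Sat_step[where a = TAll and u = "write_var x @ write_fm f @ u" and t = "t' - 9"])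
       (use FAll.prems in \<open>simp_all del: fun_upd_apply add: algebra_simps\<close>)
qed

lemma ev_SeqI: "ev (c # d # K) s t v \<Longrightarrow> t < t' \<Longrightarrow> ev ((c ;; d) # K) s t' v"
  using ev_mono[of "c # d # K" s t v "t' - 1"] by simp

lemma ev_Drop_All:
  "ev K (s(r := [])) t v \<Longrightarrow> t + 2 * length (s r) + 1 \<le> t' \<Longrightarrow> ev (Drop_While (\<lambda>_. True) r # K) s t' v"
  by (rule ev_Drop_While[where t = t]) (simp_all add: takeWhile_eq_all_conv[THEN iffD2] dropWhile_eq_Nil_conv[THEN iffD2])

lemma ev_Move_All:
  "ev K (s(r := [], r' := rev (s r) @ s r')) t v \<Longrightarrow> r \<noteq> r' \<Longrightarrow> t + 4 * length (s r) + 1 \<le> t' \<Longrightarrow>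
    ev (Move_While (\<lambda>_. True) r r' # K) s t' v"
  by (rule ev_Move_While[where t = t]) (simp_all add: takeWhile_eq_all_conv[THEN iffD2] dropWhile_eq_Nil_conv[THEN iffD2])

lemma ev_intros:
  "ev (c # d # K) s (t - 1) v \<Longrightarrow> 0 < t \<Longrightarrow> ev ((c ;; d) # K) s t v"
  "ev K (s(r := tl (s r))) (t - 1) v \<Longrightarrow> 0 < t \<Longrightarrow> ev (Pop r # K) s t v"
  "ev K (s(r := g (tops s) # s r)) (t - 1) v \<Longrightarrow> 0 < t \<Longrightarrow> ev (Push r g # K) s t v"
  "ev K s (t - 1) (\<not> v) \<Longrightarrow> 0 < t \<Longrightarrow> ev (Neg # K) s t v"
  "ev K s (t - 1) v \<Longrightarrow> 0 < t \<Longrightarrow> ev (Skip # K) s t v"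
  by simp_all

lemma ev_If_True: "b (tops s) \<Longrightarrow> ev (c # K) s (t - 1) v \<Longrightarrow> 0 < t \<Longrightarrow> ev (If b c d # K) s t v"
  by simp

lemma ev_If_False: "\<not> b (tops s) \<Longrightarrow> ev (d # K) s (t - 1) v \<Longrightarrow> 0 < t \<Longrightarrow> ev (If b c d # K) s t v"
  by simp

section \<open>Choosing a member\<close>

text \<open>Moves an expression to \<open>Tmp\<close>: it extends to the first bar outside of braces.\<close>

definition Split :: "which \<Rightarrow> (reg, token) com" where
  "Split i = While (\<lambda>t. t (Ex i) \<noteq> Some TBar \<or> t Dep \<noteq> None)
    (If (\<lambda>t. t (Ex i) = Some TLBrace) (Push Dep (\<lambda>_. TOne))
      (If (\<lambda>t. t (Ex i) = Some TRBrace) (Pop Dep) Skip) ;; Mv (Ex i) Tmp)"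

text \<open>The word is moved to \<open>Tmp\<close> without stopping, and balanced braces leave
  \<open>Dep\<close> unchanged. Bars in the word can be crossed only while a brace is open, which
  \<open>deep\<close> records.\<close>

definition crosses :: "which \<Rightarrow> bool \<Rightarrow> token list \<Rightarrow> bool" where
  "crosses i deep w \<longleftrightarrow> (\<forall>s u t t' K v. s (Ex i) = w @ u \<longrightarrow> (deep \<longrightarrow> s Dep \<noteq> []) \<longrightarrow> t + 10 * length w \<le> t' \<longrightarrow>
    ev (Split i # K) (s(Ex i := u, Tmp := rev w @ s Tmp)) t v \<longrightarrow> ev (Split i # K) s t' v)"

lemma ev_Split_step:
  assumes "s (Ex i) = a # u" "a \<noteq> TBar \<or> s Dep \<noteq> []" "t + 10 \<le> t'"
    and "ev (Split i # K) (s(Dep := if a = TLBrace then TOne # s Dep else if a = TRBrace then tl (s Dep) else s Dep,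
      Tmp := a # s Tmp, Ex i := u)) t v"
  shows "ev (Split i # K) s t' v"
proof (rule ev_loop_True[OF Split_def, where t = "t + 9"])
  have top: "tops s (Ex i) = Some a" using assms(1) by (simp add: tops_def)
  show "tops s (Ex i) \<noteq> Some TBar \<or> tops s Dep \<noteq> None"
    using assms(2) top by (cases "s Dep") (auto simp: tops_def)
  let ?d = "if a = TLBrace then TOne # s Dep else if a = TRBrace then tl (s Dep) else s Dep"
  have e: "ev (Split i # K) (s(Dep := ?d, Tmp := a # s Tmp, Ex i := u)) t1 v" if "t \<le> t1" for t1
    using ev_mono[OF assms(4) that] .
  have m: "ev (Mv (Ex i) Tmp # Split i # K) (s(Dep := ?d)) t1 v" if "t + 3 \<le> t1" for t1
    using that by (subst ev_Mv[where a = a and xs = u]) (simp_all add: assms(1) e fun_upd_same fun_upd_other del: fun_upd_apply)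
  consider "a = TLBrace" | "a = TRBrace" | "a \<noteq> TLBrace" "a \<noteq> TRBrace" by blast
  then show "ev ((If (\<lambda>t. t (Ex i) = Some TLBrace) (Push Dep (\<lambda>_. TOne))
      (If (\<lambda>t. t (Ex i) = Some TRBrace) (Pop Dep) Skip) ;; Mv (Ex i) Tmp) # Split i # K) s (t + 9) v"
  proof cases
    case 1
    then show ?thesis using m by (simp add: top del: ev_Mv fun_upd_apply)
  next
    case 2
    then show ?thesis using m by (simp add: top del: ev_Mv fun_upd_apply)
  next
    case 3
    then show ?thesis using m by (simp add: top fun_upd_triv del: ev_Mv fun_upd_apply)
  qed
qed (use assms(3) in simp)

lemma crosses_Nil: "crosses i deep []"
  unfolding crosses_def
proof (intro allI impI)
  fix s u t t' K v
  assume "s (Ex i) = [] @ u" "t + 10 * length [] \<le> t'" and e: "ev (Split i # K) (s(Ex i := u, Tmp := rev [] @ s Tmp)) t v"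
  then show "ev (Split i # K) s t' v" by (intro ev_weaken[OF e]) (simp_all add: fun_eq_iff)
qed

lemma crosses_append:
  assumes "crosses i deep x" "crosses i deep y"
  shows "crosses i deep (x @ y)"
  unfolding crosses_def
proof (intro allI impI)
  fix s u t t' K v
  assume s: "s (Ex i) = (x @ y) @ u" "deep \<longrightarrow> s Dep \<noteq> []" "t + 10 * length (x @ y) \<le> t'"
    and e: "ev (Split i # K) (s(Ex i := u, Tmp := rev (x @ y) @ s Tmp)) t v"
  let ?s = "s(Ex i := y @ u, Tmp := rev x @ s Tmp)"
  have "ev (Split i # K) ?s (t + 10 * length y) v"
    by (rule assms(2)[unfolded crosses_def, rule_format, of ?s u t, OF _ _ _ ev_weaken[OF e]])
       (use s(2) in \<open>simp_all add: fun_eq_iff\<close>)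
  then show "ev (Split i # K) s t' v"
    by (intro assms(1)[unfolded crosses_def, rule_format, of s "y @ u" "t + 10 * length y"]) (use s in auto)
qed

lemma crosses_one:
  assumes "a \<noteq> TLBrace" "a \<noteq> TRBrace" "deep \<or> a \<noteq> TBar"
  shows "crosses i deep [a]"
  unfolding crosses_def
proof (intro allI impI)
  fix s u t t' K v
  assume s: "s (Ex i) = [a] @ u" "deep \<longrightarrow> s Dep \<noteq> []" "t + 10 * length [a] \<le> t'"
    and e: "ev (Split i # K) (s(Ex i := u, Tmp := rev [a] @ s Tmp)) t v"
  have "a \<noteq> TBar \<or> s Dep \<noteq> []" using s(2) assms(3) by blast
  then show "ev (Split i # K) s t' v"
    by - (rule ev_Split_step[where a = a and u = u and t = t, OF _ _ _ ev_weaken[OF e]];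
      use s assms in \<open>simp add: fun_eq_iff\<close>)
qed

lemma crosses_plain:
  "list_all (\<lambda>a. a \<noteq> TLBrace \<and> a \<noteq> TRBrace \<and> (deep \<or> a \<noteq> TBar)) w \<Longrightarrow> crosses i deep w"
proof (induction w)
  case (Cons a w)
  then show ?case using crosses_append[of i deep "[a]" w] crosses_one[of a deep i] by simp
qed (simp add: crosses_Nil)

lemma crosses_mono: "crosses i False w \<Longrightarrow> crosses i deep w"
  unfolding crosses_def by blast

lemma crosses_braces:
  assumes "crosses i True w"
  shows "crosses i deep (TLBrace # w @ [TRBrace])"
  unfolding crosses_def
proof (intro allI impI)
  fix s u t t' K v
  assume s: "s (Ex i) = (TLBrace # w @ [TRBrace]) @ u" "t + 10 * length (TLBrace # w @ [TRBrace]) \<le> t'"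
    and e: "ev (Split i # K) (s(Ex i := u, Tmp := rev (TLBrace # w @ [TRBrace]) @ s Tmp)) t v"
  let ?s = "s(Dep := TOne # s Dep, Tmp := TLBrace # s Tmp, Ex i := w @ TRBrace # u)"
  let ?s' = "s(Dep := TOne # s Dep, Tmp := rev w @ TLBrace # s Tmp, Ex i := TRBrace # u)"
  have "ev (Split i # K) ?s' (t + 10) v"
    by (rule ev_Split_step[where a = TRBrace and u = u and t = t, OF _ _ _ ev_weaken[OF e]])
       (simp_all add: fun_eq_iff)
  then have e': "ev (Split i # K) (?s(Ex i := TRBrace # u, Tmp := rev w @ ?s Tmp)) (t + 10) v"
    by (rule ev_weaken) (simp_all add: fun_eq_iff)
  have "ev (Split i # K) ?s (t + 10 + 10 * length w) v"
    by (rule assms[unfolded crosses_def, rule_format, of ?s "TRBrace # u" "t + 10", OF _ _ _ e']) auto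
  then show "ev (Split i # K) s t' v"
    by - (rule ev_Split_step[where a = TLBrace and u = "w @ TRBrace # u" and t = "t + 10 + 10 * length w"];
      use s in simp)
qed

lemma plain_write_var: "list_all (\<lambda>a. a \<noteq> TLBrace \<and> a \<noteq> TRBrace \<and> (deep \<or> a \<noteq> TBar)) (write_var x)"
  using digits_write_nat[of x] by (auto simp: write_var_def list_all_iff digit_def)

lemma plain_write_fm: "list_all (\<lambda>a. a \<noteq> TLBrace \<and> a \<noteq> TRBrace \<and> a \<noteq> TBar) (write_fm f)"
  using plain_write_var[of False] by (induction f) auto

lemma crosses_vars: "crosses i True (concat (map write_var xs))"
proof (induction xs)
  case (Cons x xs)
  then show ?case using crosses_append[OF crosses_plain[OF plain_write_var[of True x]]] by simp
qed (simp add: crosses_Nil)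

lemma crosses_write_expr: "crosses i False (write_expr e)"
  and crosses_write_builder: "crosses i False (write_builder b)"
proof (induction e and b)
  case (EVar x)
  then show ?case using plain_write_var[of False x] by (simp add: crosses_plain)
next
  case (EUnion bs)
  then have "crosses i False (concat (map write_builder bs))"
    by (induction bs) (simp_all add: crosses_Nil crosses_append)
  then have "crosses i False ([TLParen] @ concat (map write_builder bs) @ [TRParen])"
    by (intro crosses_append crosses_one) auto
  then show ?case by simp
next
  case (Builder e xs f)
  have "crosses i False (write_fm f)" using plain_write_fm[of f] by (simp add: crosses_plain)
  then have f: "crosses i True (write_fm f)" by (rule crosses_mono)
  have e: "crosses i True (write_expr e)" using Builder by (rule crosses_mono)
  have "crosses i True [TBar]" "crosses i True [TComma]" by (simp_all add: crosses_one)
  then have "crosses i True (write_expr e @ [TBar] @ concat (map write_var xs) @ [TComma] @ write_fm f)"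
    using e f crosses_vars by (simp only: crosses_append)
  from crosses_braces[OF this] show ?case by simp
qed

lemma ev_Split:
  assumes "s (Ex i) = write_expr e @ TBar # u" "s Dep = []" "s Tmp = []"
    and "ev K (s(Ex i := TBar # u, Tmp := rev (write_expr e))) t v" "t + 10 * length (write_expr e) + 1 \<le> t'"
  shows "ev (Split i # K) s t' v"
proof (rule crosses_write_expr[unfolded crosses_def, rule_format, of s i e "TBar # u" "t + 1"])
  have "ev K (s(Ex i := TBar # u, Tmp := rev (write_expr e) @ s Tmp)) t v"
    by (rule ev_weaken[OF assms(4)]) (simp_all add: assms(3))
  then show "ev (Split i # K) (s(Ex i := TBar # u, Tmp := rev (write_expr e) @ s Tmp)) (t + 1) v"
    by (rule ev_loop_False[OF Split_def, rotated]) (simp_all add: tops_def assms(2))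
qed (use assms in simp_all)

text \<open>The single letter in \<open>Num\<close> is a flag: popping it settles on the current
  builder and ends the loop. The other branch drops everything up to the next closing brace, which
  ends this builder, as no brace follows its body. With no builder left the choice fails.\<close>

definition Pick_Loop :: "which \<Rightarrow> (reg, token) com" where
  "Pick_Loop i = While (\<lambda>t. t Num \<noteq> None)
    (If (\<lambda>t. t (Ex i) = Some TLBrace) Skip (Halt False) ;; Pop (Ex i) ;; Split i ;;
      Or (Pop Num) (Drop_While (\<lambda>_. True) Tmp ;; Drop_While (\<lambda>a. a \<noteq> TRBrace) (Ex i) ;; Pop (Ex i)))"

definition Pick :: "which \<Rightarrow> (reg, token) com" where
  "Pick i = (If (\<lambda>t. t (Ex i) = Some TLParen) Skip (Halt False) ;; Pop (Ex i) ;;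
    Push Num (\<lambda>_. TOne) ;; Pick_Loop i)"

definition builder_rest :: "var list \<Rightarrow> fm \<Rightarrow> token list \<Rightarrow> token list" where
  "builder_rest xs f u = TBar # concat (map write_var xs) @ TComma # write_fm f @ TRBrace # u"

lemma drop_builder_rest:
  "dropWhile (\<lambda>a. a \<noteq> TRBrace) (builder_rest xs f u) = TRBrace # u"
  "length (takeWhile (\<lambda>a. a \<noteq> TRBrace) (builder_rest xs f u)) + length (write_expr e) + 2 = length (write_builder (Builder e xs f))"
proof -
  define w where "w = TBar # concat (map write_var xs) @ TComma # write_fm f"
  have "\<forall>a\<in>set w. a \<noteq> TRBrace"
    using plain_write_var[of False] plain_write_fm[of f] by (fastforce simp: list_all_iff w_def)
  moreover have "builder_rest xs f u = w @ TRBrace # u" by (simp add: builder_rest_def w_def)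
  moreover have "length w + length (write_expr e) + 2 = length (write_builder (Builder e xs f))" by (simp add: w_def)
  ultimately show "dropWhile (\<lambda>a. a \<noteq> TRBrace) (builder_rest xs f u) = TRBrace # u"
    "length (takeWhile (\<lambda>a. a \<noteq> TRBrace) (builder_rest xs f u)) + length (write_expr e) + 2 = length (write_builder (Builder e xs f))"
    by (simp_all add: dropWhile_append2 takeWhile_append2)
qed

text \<open>The continuation may assume length bounds on what is left in the register, garbage
  included; the cost of emptying the register later depends on them.\<close>

lemma ev_Pick_Loop:
  assumes "s (Ex i) = concat (map write_builder bs) @ TRParen # u" "s Dep = []" "s Tmp = []" "s Num = [TOne]"
    and "\<And>e xs f u'. Builder e xs f \<in> set bs \<Longrightarrow> length u' \<le> length (s (Ex i)) \<Longrightarrow>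
      length (builder_rest xs f u') \<le> length (s (Ex i)) \<Longrightarrow>
      ev K (s(Ex i := builder_rest xs f u', Tmp := rev (write_expr e), Num := [])) t (Q (Builder e xs f))"
    and "t + 30 * length (concat (map write_builder bs)) + 10 \<le> t'"
  shows "ev (Pick_Loop i # K) s t' (\<exists>b\<in>set bs. Q b)"
  using assms
proof (induction bs arbitrary: s t')
  case Nil
  have top: "tops s (Ex i) = Some TRParen" using Nil(1) by (simp add: tops_def)
  have "ev (Pick_Loop i # K) s t' False"
  proof (rule ev_loop_True[OF Pick_Loop_def, where t = "t' - 1"])
    show "tops s Num \<noteq> None" using Nil(4) by (simp add: tops_def)
    show "ev ((If (\<lambda>t. t (Ex i) = Some TLBrace) Skip (Halt False) ;; Pop (Ex i) ;; Split i ;;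
      Or (Pop Num) (Drop_While (\<lambda>_. True) Tmp ;; Drop_While (\<lambda>a. a \<noteq> TRBrace) (Ex i) ;; Pop (Ex i))) # Pick_Loop i # K) s
      (t' - 1) False"
      using Nil(6) by (simp add: top)
    show "t' - 1 < t'" using Nil(6) by simp
  qed
  then show ?case by simp
next
  case (Cons b bs)
  obtain e xs f where b: "b = Builder e xs f" by (cases b)
  let ?u = "concat (map write_builder bs) @ TRParen # u"
  have s: "s (Ex i) = TLBrace # write_expr e @ builder_rest xs f ?u"
    unfolding Cons.prems(1) by (simp add: builder_rest_def b)
  \<comment> \<open>With a minimal length for builders, the allowance of 30 steps per token also
    pays for the fixed cost of a round.\<close>
  have len: "length (write_builder b) \<ge> 6"
  proof -
    have "length (write_expr e) \<ge> 1" by (cases e) (simp_all add: write_var_def)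
    moreover have "length (write_fm f) \<ge> 1" by (cases f) simp_all
    ultimately show ?thesis by (simp add: b)
  qed
  note d = drop_builder_rest[of xs f ?u] drop_builder_rest(2)[of xs f ?u e, folded b]
  let ?s = "s(Ex i := builder_rest xs f ?u, Tmp := rev (write_expr e))"
  define T where "T = t + 30 * length (concat (map write_builder bs)) + 10"
  have 1: "ev (Pop Num # Pick_Loop i # K) ?s (t + 2) (Q b)"
  proof -
    have "ev K (s(Ex i := builder_rest xs f ?u, Tmp := rev (write_expr e), Num := [])) t (Q b)"
      unfolding b by (rule Cons.prems(5)) (simp_all add: b builder_rest_def Cons.prems(1))
    then have "ev (Pick_Loop i # K) (s(Ex i := builder_rest xs f ?u, Tmp := rev (write_expr e), Num := [])) (t + 1) (Q b)"
      by (intro ev_loop_False[OF Pick_Loop_def, where t = t]) (simp_all add: tops_def)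
    then show ?thesis by (simp add: Cons.prems(4) fun_upd_same fun_upd_other del: fun_upd_apply)
  qed
  have 2: "ev ((Drop_While (\<lambda>_. True) Tmp ;; Drop_While (\<lambda>a. a \<noteq> TRBrace) (Ex i) ;; Pop (Ex i)) # Pick_Loop i # K) ?s
      (T + 2 * length (write_builder b) + 6) (\<exists>b\<in>set bs. Q b)"
  proof -
    have "ev (Pick_Loop i # K) (s(Ex i := ?u)) T (\<exists>b\<in>set bs. Q b)"
    proof (rule Cons.IH)
      fix e xs f u' assume *: "Builder e xs f \<in> set bs" "length u' \<le> length ((s(Ex i := ?u)) (Ex i))"
        "length (builder_rest xs f u') \<le> length ((s(Ex i := ?u)) (Ex i))"
      have "ev K (s(Ex i := builder_rest xs f u', Tmp := rev (write_expr e), Num := [])) t (Q (Builder e xs f))"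
        by (rule Cons.prems(5)) (use * Cons.prems(1) in simp_all)
      then show "ev K ((s(Ex i := ?u))(Ex i := builder_rest xs f u', Tmp := rev (write_expr e), Num := [])) t (Q (Builder e xs f))"
        by (simp del: fun_upd_apply)
    qed (use Cons.prems(2-4) in \<open>simp_all add: T_def\<close>)
    then have "ev (Pop (Ex i) # Pick_Loop i # K) (s(Ex i := TRBrace # ?u)) (T + 1) (\<exists>b\<in>set bs. Q b)"
      by (simp add: fun_upd_same del: fun_upd_apply)
    then have "ev (Drop_While (\<lambda>a. a \<noteq> TRBrace) (Ex i) # Pop (Ex i) # Pick_Loop i # K) (s(Ex i := builder_rest xs f ?u))
        (T + 2 * length (takeWhile (\<lambda>a. a \<noteq> TRBrace) (builder_rest xs f ?u)) + 2) (\<exists>b\<in>set bs. Q b)"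
      by (intro ev_Drop_While[where t = "T + 1"]) (simp_all add: d(1) fun_upd_same del: fun_upd_apply)
    then have e: "ev ((Drop_While (\<lambda>a. a \<noteq> TRBrace) (Ex i) ;; Pop (Ex i)) # Pick_Loop i # K) (s(Ex i := builder_rest xs f ?u))
        (T + 2 * length (takeWhile (\<lambda>a. a \<noteq> TRBrace) (builder_rest xs f ?u)) + 3) (\<exists>b\<in>set bs. Q b)"
      by (rule ev_SeqI) simp
    have "ev (Drop_While (\<lambda>_. True) Tmp # (Drop_While (\<lambda>a. a \<noteq> TRBrace) (Ex i) ;; Pop (Ex i)) # Pick_Loop i # K) ?s
        (T + 2 * length (write_builder b) + 5) (\<exists>b\<in>set bs. Q b)"
      by (rule ev_Drop_While[where t = "T + 2 * length (takeWhile (\<lambda>a. a \<noteq> TRBrace) (builder_rest xs f ?u)) + 3", OF ev_weaken[OF e]])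
         (use d(3) Cons.prems(3) in \<open>simp_all add: fun_eq_iff takeWhile_eq_all_conv[THEN iffD2] dropWhile_eq_Nil_conv[THEN iffD2]\<close>)
    then show ?thesis by (rule ev_SeqI) simp
  qed
  have "ev (Or (Pop Num) (Drop_While (\<lambda>_. True) Tmp ;; Drop_While (\<lambda>a. a \<noteq> TRBrace) (Ex i) ;; Pop (Ex i)) # Pick_Loop i # K) ?s
      (T + 2 * length (write_builder b) + 7) (Q b \<or> (\<exists>b\<in>set bs. Q b))"
    by (rule ev_Or[OF ev_mono[OF 1] 2]) (simp_all add: T_def)
  then have or: "ev (Or (Pop Num) (Drop_While (\<lambda>_. True) Tmp ;; Drop_While (\<lambda>a. a \<noteq> TRBrace) (Ex i) ;; Pop (Ex i)) # Pick_Loop i # K) ?s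
      (T + 2 * length (write_builder b) + 7) (\<exists>b\<in>set (b # bs). Q b)" by simp
  obtain r where r: "builder_rest xs f ?u = TBar # r" by (simp add: builder_rest_def)
  have le: "length (write_expr e) \<le> length (write_builder b)" using d(3) by simp
  have split: "ev (Split i # Or (Pop Num) (Drop_While (\<lambda>_. True) Tmp ;; Drop_While (\<lambda>a. a \<noteq> TRBrace) (Ex i) ;; Pop (Ex i)) # Pick_Loop i # K)
      (s(Ex i := write_expr e @ builder_rest xs f ?u)) (T + 12 * length (write_builder b) + 8) (\<exists>b\<in>set (b # bs). Q b)"
    by (rule ev_Split[where u = r and t = "T + 2 * length (write_builder b) + 7", OF _ _ _ ev_weaken[OF or]])
       (use Cons.prems(2,3) le r in \<open>simp_all del: bex_simps\<close>)
  have top: "tops s (Ex i) = Some TLBrace" using s by (simp add: tops_def)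
  show ?case
  proof (rule ev_loop_True[OF Pick_Loop_def, where t = "T + 12 * length (write_builder b) + 20"])
    show "tops s Num \<noteq> None" using Cons.prems(4) by (simp add: tops_def)
    show "ev ((If (\<lambda>t. t (Ex i) = Some TLBrace) Skip (Halt False) ;; Pop (Ex i) ;; Split i ;;
      Or (Pop Num) (Drop_While (\<lambda>_. True) Tmp ;; Drop_While (\<lambda>a. a \<noteq> TRBrace) (Ex i) ;; Pop (Ex i))) # Pick_Loop i # K) s
      (T + 12 * length (write_builder b) + 20) (\<exists>b\<in>set (b # bs). Q b)"
      by (rule ev_intros ev_If_True ev_weaken[OF split] top)+ (simp_all add: s top)
    show "T + 12 * length (write_builder b) + 20 < t'" using Cons.prems(6) len by (simp add: T_def)
  qed
qed

lemma ev_Pick: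
  assumes "s (Ex i) = write_expr (EUnion bs) @ u" "clean l s"
    and "\<And>e xs f u'. Builder e xs f \<in> set bs \<Longrightarrow> length (builder_rest xs f u') \<le> length (s (Ex i)) \<Longrightarrow>
      ev K (s(Ex i := builder_rest xs f u', Tmp := rev (write_expr e))) t (Q (Builder e xs f))"
    and "t + 30 * length (write_expr (EUnion bs)) + 20 \<le> t'"
  shows "ev (Pick i # K) s t' (\<exists>b\<in>set bs. Q b)"
proof -
  let ?s = "s(Ex i := concat (map write_builder bs) @ TRParen # u, Num := [TOne])"
  have "ev (Pick_Loop i # K) ?s (t' - 8) (\<exists>b\<in>set bs. Q b)"
  proof (rule ev_Pick_Loop)
    fix e xs f u' assume *: "Builder e xs f \<in> set bs" "length (builder_rest xs f u') \<le> length (?s (Ex i))"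
    have "ev K (s(Ex i := builder_rest xs f u', Tmp := rev (write_expr e))) t (Q (Builder e xs f))"
      by (rule assms(3)) (use * assms(1) in simp_all)
    then show "ev K (?s(Ex i := builder_rest xs f u', Tmp := rev (write_expr e), Num := [])) t (Q (Builder e xs f))"
      by (rule ev_weaken) (use cleanD(6)[OF assms(2)] in \<open>simp_all add: fun_eq_iff\<close>)
  qed (use assms cleanD[OF assms(2)] in simp_all)
  then have p: "ev (Pick_Loop i # K) ?s (t' - 8) (\<exists>b\<in>set bs. Q b)" .
  have s: "s (Ex i) = TLParen # concat (map write_builder bs) @ TRParen # u" using assms(1) by simp
  have top: "tops s (Ex i) = Some TLParen" by (simp add: tops_def s)
  show ?thesis
    unfolding Pick_def
    by (rule ev_intros ev_If_True ev_weaken[OF p] top)+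
       (use assms(4) s top cleanD(6)[OF assms(2)] in simp_all)
qed

definition Bind_All :: "which \<Rightarrow> (reg, token) com" where
  "Bind_All i = While (\<lambda>t. t (Ex i) = Some TVar) (Bind i)"

lemma ev_Bind_All:
  assumes "s (Ex i) = concat (map write_var xs) @ u" "u = TComma # u'" "s (En i) = write_env ps"
    and "s Len = replicate l TOne" "s Cnt = []" "s Var = []"
    and "\<And>ps'. ps' \<in> bindings l xs ps \<Longrightarrow> ev K (s(Ex i := u, En i := write_env ps')) t (Q ps')"
    and "t + (20 * l + 50) * length (concat (map write_var xs)) + 1 \<le> t'"
  shows "ev (Bind_All i # K) s t' (\<exists>ps'\<in>bindings l xs ps. Q ps')"
  using assms
proof (induction xs arbitrary: s ps t')
  case Nil
  have "ev K s t (Q ps)"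
    by (rule ev_weaken[OF Nil(7)[of ps]]) (use Nil in \<open>simp_all add: fun_eq_iff\<close>)
  then have "ev (Bind_All i # K) s t' (Q ps)"
    by (rule ev_loop_False[OF Bind_All_def, rotated]) (use Nil in \<open>simp_all add: tops_def\<close>)
  then show ?case by simp
next
  case (Cons x xs)
  let ?u = "concat (map write_var xs) @ u"
  define T where "T = t + (20 * l + 50) * length (concat (map write_var xs)) + 1"
  have nd: "no_digit ?u" using Cons.prems(2) by (cases xs) (simp_all add: write_var_def)
  have s: "s (Ex i) = write_var x @ ?u" using Cons.prems(1) by simp
  have "ev (Bind_All i # K) (s(Ex i := ?u, En i := write_env ((x, a) # ps))) T (\<exists>ps'\<in>bindings l xs ((x, a) # ps). Q ps')"
    if "a < 2 ^ l" for a
  proof (rule Cons.IH)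
    fix ps' assume "ps' \<in> bindings l xs ((x, a) # ps)"
    then have "ps' \<in> bindings l (x # xs) ps" using that by auto
    from Cons.prems(7)[OF this]
    show "ev K ((s(Ex i := ?u, En i := write_env ((x, a) # ps)))(Ex i := u, En i := write_env ps')) t (Q ps')"
      by (rule ev_weaken) (simp_all add: fun_eq_iff)
  qed (use Cons.prems in \<open>simp_all add: T_def fun_upd_same fun_upd_other del: fun_upd_apply\<close>)
  then have "ev (Bind i # Bind_All i # K) s (T + 20 * l + 8 * length (write_var x) + 40)
      (\<exists>a<2 ^ l. \<exists>ps'\<in>bindings l xs ((x, a) # ps). Q ps')"
    by (rule ev_Bind[OF s nd Cons.prems(3-6)]) simp_all
  moreover have "(\<exists>a<2 ^ l. \<exists>ps'\<in>bindings l xs ((x, a) # ps). Q ps') \<longleftrightarrow> (\<exists>ps'\<in>bindings l (x # xs) ps. Q ps')"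
    by auto
  ultimately have b: "ev (Bind i # Bind_All i # K) s (T + 20 * l + 8 * length (write_var x) + 40) (\<exists>ps'\<in>bindings l (x # xs) ps. Q ps')"
    by (simp only:)
  have "(20 * l + 50) * 1 \<le> (20 * l + 50) * length (write_var x)"
    using length_write_var[of x] by (rule mult_le_mono2)
  moreover have "8 * length (write_var x) + 20 * l + 42 \<le> (20 * l + 50) * length (write_var x)"
  proof -
    obtain k where "length (write_var x) = Suc k" using length_write_var[of x] by (cases "length (write_var x)") auto
    then show ?thesis by (simp add: algebra_simps)
  qed
  ultimately have "T + 20 * l + 8 * length (write_var x) + 40 < t'"
    using Cons.prems(8) by (simp add: T_def algebra_simps)
  with b show ?case
    by (intro ev_loop_True[OF Bind_All_def]) (use s in \<open>simp_all add: tops_def write_var_def\<close>)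
qed

text \<open>After a builder and values for its variables have been guessed, one conjunct verifies
  the formula, which \<open>Sat\<close> consumes, and the other discards the formula, moves the body
  back from \<open>Tmp\<close>, and goes on. The result is an existential quantifier over
  \<open>mems\<close>.\<close>

definition Choose :: "which \<Rightarrow> (reg, token) com" where
  "Choose i = (Pick i ;; Pop (Ex i) ;; Bind_All i ;; Pop (Ex i) ;;
    And (Drop_While (\<lambda>_. True) Tmp ;; Sat i)
      (Drop_While (\<lambda>_. True) (Ex i) ;; Move_While (\<lambda>_. True) Tmp (Ex i)))"

text \<open>Choosing a member replaces the variables it binds by bindings in the environment, so the
  size of an object, including its environment, does not grow.\<close>

definition prog_ok :: "nat \<Rightarrow> nat \<Rightarrow> nat \<Rightarrow> obj \<Rightarrow> bool" where
  "prog_ok k n l m \<longleftrightarrow> obj_ok k l m \<and> env_ok n l (snd m) \<and> length (write_expr (fst m)) + length (snd m) \<le> n \<and>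
    l \<le> n \<and> n < 2 ^ l \<and> 4 * k \<le> 2 ^ l"

text \<open>Garbage starting with a digit would be read as part of a variable name, hence
  \<open>no_digit u\<close>.\<close>

definition holds :: "nat \<Rightarrow> which \<Rightarrow> (reg, token) store \<Rightarrow> obj \<Rightarrow> bool" where
  "holds n i s m \<longleftrightarrow> (\<exists>u. s (Ex i) = write_expr (fst m) @ u \<and> no_digit u) \<and> length (s (Ex i)) \<le> n \<and>
    s (En i) = write_env (snd m)"

definition put :: "(reg, token) store \<Rightarrow> which \<Rightarrow> obj \<Rightarrow> (reg, token) store" where
  "put s i m = s(Ex i := write_expr (fst m), En i := write_env (snd m))"

lemma clean_put [simp]: "clean l (put s i m) = clean l s"
  by (simp add: put_def del: fun_upd_apply)

lemma holds_put [simp]: "holds n i (put s i m) m \<longleftrightarrow> length (write_expr (fst m)) \<le> n"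
  "i \<noteq> j \<Longrightarrow> holds n i (put s j m) m' = holds n i s m'"
  by (auto simp: put_def holds_def)

lemma length_bindings: "ps' \<in> bindings l xs ps \<Longrightarrow> length ps' = length xs + length ps"
proof (induction xs arbitrary: ps)
  case (Cons x xs)
  then obtain a where "ps' \<in> bindings l xs ((x, a) # ps)" by auto
  from Cons.IH[OF this] show ?case by simp
qed simp

lemma env_ok_bindings:
  "ps' \<in> bindings l xs ps \<Longrightarrow> env_ok n l ps \<Longrightarrow> length (concat (map write_var xs)) \<le> n \<Longrightarrow> env_ok n l ps'"
proof (induction xs arbitrary: ps)
  case (Cons x xs)
  from Cons.prems(1) obtain a where a: "a < 2 ^ l" "ps' \<in> bindings l xs ((x, a) # ps)" by auto
  have len: "length (write_var x) \<le> n" "length (concat (map write_var xs)) \<le> n" using Cons.prems(3) by simp_all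
  have "env_ok n l ((x, a) # ps)" unfolding env_ok_Cons by (intro conjI len(1) a(1) Cons.prems(2))
  from Cons.IH[OF a(2) this len(2)] show ?case .
next
  case Nil
  from Nil(1) have "ps' = ps" by simp
  with Nil(2) show ?case by (simp only:)
qed

lemma prog_okD:
  assumes "prog_ok k n l (e, ps)"
  shows "obj_ok k l (e, ps)" "env_ok n l ps" "length (write_expr e) + length ps \<le> n" "l \<le> n" "n < 2 ^ l" "4 * k \<le> 2 ^ l"
  using assms unfolding prog_ok_def fst_conv snd_conv by blast+

lemma prog_okI:
  "obj_ok k l (e, ps) \<Longrightarrow> env_ok n l ps \<Longrightarrow> length (write_expr e) + length ps \<le> n \<Longrightarrow> l \<le> n \<Longrightarrow> n < 2 ^ l \<Longrightarrow>
    4 * k \<le> 2 ^ l \<Longrightarrow> prog_ok k n l (e, ps)"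
  unfolding prog_ok_def fst_conv snd_conv by blast

text \<open>The four extra tokens are the two braces, the bar and the comma. Each bound variable
  occupies at least one token of the builder, which pays for its new entry in the
  environment.\<close>

lemma mems_size:
  assumes "prog_ok k n l (EUnion bs, ps)" "Builder e xs f \<in> set bs" "ps' \<in> bindings l xs ps"
  shows "length (write_expr e) + length (concat (map write_var xs)) + length (write_fm f) + 4 \<le> length (write_expr (EUnion bs))"
    "env_ok n l ps'" "length (write_expr e) + length ps' + length (write_fm f) + 4 \<le> n"
proof -
  have "length (write_builder (Builder e xs f)) = length (write_expr e) + length (concat (map write_var xs)) + length (write_fm f) + 4"
    by simp
  with length_write_member[OF assms(2)]
  show 1: "length (write_expr e) + length (concat (map write_var xs)) + length (write_fm f) + 4 \<le> length (write_expr (EUnion bs))"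
    by linarith
  have "length (concat (map write_var xs)) \<le> n" using 1 prog_okD(3)[OF assms(1)] by linarith
  then show "env_ok n l ps'" by (rule env_ok_bindings[OF assms(3) prog_okD(2)[OF assms(1)]])
  show "length (write_expr e) + length ps' + length (write_fm f) + 4 \<le> n"
    using 1 prog_okD(3)[OF assms(1)] length_bindings[OF assms(3)] length_le_write_vars[of xs] by linarith
qed

lemma prog_ok_mems:
  assumes "prog_ok k n l m" "m' \<in> mems l m"
  shows "prog_ok k n l m'" "length (write_expr (fst m')) < length (write_expr (fst m))"
proof -
  from assms(2) obtain bs ps e xs f ps' where m: "m = (EUnion bs, ps)" "m' = (e, ps')" "Builder e xs f \<in> set bs"
    "ps' \<in> bindings l xs ps" by (rule memsE)
  note ok = assms(1)[unfolded m(1)]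
  note sz = mems_size[OF ok m(3,4)]
  show "length (write_expr (fst m')) < length (write_expr (fst m))" using sz(1) unfolding m fst_conv by linarith
  have "obj_ok k l m'" using prog_okD(1)[OF ok] by (rule obj_ok_mems[OF _ assms(2)[unfolded m(1)]])
  then have "obj_ok k l (e, ps')" unfolding m(2) .
  moreover have "length (write_expr e) + length ps' \<le> n" using sz(3) by linarith
  ultimately show "prog_ok k n l m'" unfolding m(2) using prog_okD(4-6)[OF ok] sz(2) by (intro prog_okI)
qed

lemma ev_Choose:
  assumes h: "holds n i s m" and ok: "prog_ok k n l m" and cl: "clean l s"
    and Q: "\<And>m'. m' \<in> mems l m \<Longrightarrow> ev K (put s i m') t (Q m')"
    and t: "t + 200 * (n + 1) * (n + 1) \<le> t'"
  shows "ev (Choose i # K) s t' (\<exists>m'\<in>mems l m. Q m')"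
proof -
  obtain ex ps where m: "m = (ex, ps)" by force
  obtain u where u: "s (Ex i) = write_expr ex @ u" "no_digit u" "length (s (Ex i)) \<le> n" "s (En i) = write_env ps"
    using h by (auto simp: holds_def m)
  let ?A = "And (Drop_While (\<lambda>_. True) Tmp ;; Sat i)
      (Drop_While (\<lambda>_. True) (Ex i) ;; Move_While (\<lambda>_. True) Tmp (Ex i))"
  have nn: "200 * (n + 1) * (n + 1) = 200 * n * n + 400 * n + 200" by (simp add: algebra_simps)
  show ?thesis
  proof (cases ex)
    case (EVar x)
    then have "tops s (Ex i) \<noteq> Some TLParen" using u(1) by (simp add: tops_def write_var_def)
    then show ?thesis using EVar m t unfolding Choose_def Pick_def by (simp add: nn)
  next
    case (EUnion bs)
    \<comment> \<open>The quadratic term pays for \<open>Sat\<close>, the linear one for emptying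
      and refilling registers whose contents have length at most \<open>n\<close>.\<close>
    define T where "T = t + 100 * (n + 1) * (n + 1) + 10 * n + 30"
    have ok': "prog_ok k n l (EUnion bs, ps)" using ok m EUnion by simp
    have l: "l \<le> n" "n < 2 ^ l" using ok by (simp_all add: prog_ok_def)
    have inner: "ev (Pop (Ex i) # ?A # K) (s(Ex i := TComma # write_fm f @ TRBrace # u', Tmp := rev (write_expr e), En i := write_env ps'))
        T (sat f (valuation ps') \<and> Q (e, ps'))"
      if b: "Builder e xs f \<in> set bs" and ps': "ps' \<in> bindings l xs ps" and u': "length (builder_rest xs f u') \<le> n"
      for e xs f u' ps'
    proof -
      note sz = mems_size[OF ok' b ps']
      let ?s = "s(Ex i := write_fm f @ TRBrace # u', Tmp := rev (write_expr e), En i := write_env ps')"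
      have fv: "fv_fm f \<subseteq> fst ` set ps'"
      proof -
        have "fv_fm f - set xs \<subseteq> fv (EUnion bs)" using b by force
        also have "\<dots> \<subseteq> fst ` set ps" using ok' by (simp add: prog_ok_def obj_ok_def)
        finally show ?thesis using bindings_fst[OF ps'] by blast
      qed
      have time: "100 * (n + 1) * (length (write_fm f) + length ps' + 1) \<le> 100 * (n + 1) * (n + 1)"
        using sz(3) by (intro mult_le_mono2) simp
      have "clean l (s(Ex i := write_fm f @ TRBrace # u', En i := write_env ps'))"
        using cl by (simp del: fun_upd_apply)
      note cl' = this
      have sat: "ev (Sat i # K) (s(Ex i := write_fm f @ TRBrace # u', En i := write_env ps')) (100 * (n + 1) * (n + 1)) (sat f (valuation ps'))"
      proof (rule ev_Sat[where u = "TRBrace # u'" and n = n and l = l])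
        show "no_var (TRBrace # u')" by (simp add: no_var_def var_token_def digit_def)
        show "length (write_fm f) \<le> n" using sz(3) by linarith
      qed (use fv sz(2) l time cl' in simp_all)
      have c1: "ev ((Drop_While (\<lambda>_. True) Tmp ;; Sat i) # K) ?s (t + 100 * (n + 1) * (n + 1) + 10 * n + 20) (sat f (valuation ps'))"
      proof -
        have "ev (Drop_While (\<lambda>_. True) Tmp # Sat i # K) ?s (100 * (n + 1) * (n + 1) + 2 * length (write_expr e) + 1) (sat f (valuation ps'))"
          by (rule ev_Drop_All[where t = "100 * (n + 1) * (n + 1)"], rule ev_weaken[OF sat])
             (use cleanD(4)[OF cl] in \<open>simp_all add: fun_eq_iff\<close>)
        then show ?thesis by (rule ev_SeqI) (use sz(3) in linarith)
      qed
      have c2: "ev ((Drop_While (\<lambda>_. True) (Ex i) ;; Move_While (\<lambda>_. True) Tmp (Ex i)) # K) ?s (t + 100 * (n + 1) * (n + 1) + 10 * n + 20) (Q (e, ps'))"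
        if "sat f (valuation ps')"
      proof -
        have "(e, ps') \<in> mems l m" using m EUnion b ps' that by auto
        note q = Q[OF this]
        have 1: "ev (Move_While (\<lambda>_. True) Tmp (Ex i) # K) (s(Ex i := [], Tmp := rev (write_expr e), En i := write_env ps'))
            (t + 4 * n + 1) (Q (e, ps'))"
          by (rule ev_Move_All[where t = t], rule ev_weaken[OF q])
             (use cleanD(4)[OF cl] sz(3) in \<open>simp_all add: put_def fun_eq_iff\<close>)
        have "length (write_fm f @ TRBrace # u') \<le> n" using u' by (simp add: builder_rest_def)
        then have "ev (Drop_While (\<lambda>_. True) (Ex i) # Move_While (\<lambda>_. True) Tmp (Ex i) # K) ?s (t + 6 * n + 2) (Q (e, ps'))"
          by - (rule ev_Drop_All[where t = "t + 4 * n + 1"], rule ev_weaken[OF 1], simp_all add: fun_eq_iff)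
        then show ?thesis by (rule ev_SeqI) linarith
      qed
      have A: "ev (?A # K) ?s (T - 1) (sat f (valuation ps') \<and> Q (e, ps'))"
        by (rule ev_And[OF c1 c2]) (simp_all add: T_def)
      have "0 < T" by (simp add: T_def)
      then show ?thesis
        by - (rule ev_intros(2), rule ev_weaken[OF A], simp_all only: fun_eq_iff fun_upd_apply, simp_all)
    qed
    define T' where "T' = T + (20 * l + 50) * n + 1"
    have pick: "ev ((Pop (Ex i) ;; Bind_All i ;; Pop (Ex i) ;; ?A) # K) (s(Ex i := builder_rest xs f u', Tmp := rev (write_expr e))) (T' + 5)
        (\<exists>ps'\<in>bindings l xs ps. sat f (valuation ps') \<and> Q (e, ps'))"
      if b: "Builder e xs f \<in> set bs" and u': "length (builder_rest xs f u') \<le> n" for e xs f u'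
    proof -
      let ?c = "TComma # write_fm f @ TRBrace # u'"
      let ?s = "s(Ex i := concat (map write_var xs) @ ?c, Tmp := rev (write_expr e))"
      have "length (concat (map write_var xs)) \<le> n" using u' by (simp add: builder_rest_def)
      then have len: "(20 * l + 50) * length (concat (map write_var xs)) \<le> (20 * l + 50) * n" by (rule mult_le_mono2)
      have "ev (Bind_All i # (Pop (Ex i) ;; ?A) # K) ?s (T' + 1) (\<exists>ps'\<in>bindings l xs ps. sat f (valuation ps') \<and> Q (e, ps'))"
      proof (rule ev_Bind_All[where u = ?c and t = "T + 1"])
        fix ps' assume ps': "ps' \<in> bindings l xs ps"
        show "ev ((Pop (Ex i) ;; ?A) # K) (?s(Ex i := ?c, En i := write_env ps')) (T + 1) (sat f (valuation ps') \<and> Q (e, ps'))"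
          by (rule ev_SeqI[where t = T, OF ev_weaken[OF inner[OF b ps' u']]]) (simp_all add: fun_eq_iff)
      qed (use cleanD[OF cl] u(4) len in \<open>simp_all add: T'_def\<close>)
      note b = this
      show ?thesis
        by (rule ev_intros ev_weaken[OF b])+ (simp_all add: builder_rest_def fun_eq_iff)
    qed
    define R where "R = case_builder (\<lambda>e xs f. \<exists>ps'\<in>bindings l xs ps. sat f (valuation ps') \<and> Q (e, ps'))"
    have "ev (Pick i # (Pop (Ex i) ;; Bind_All i ;; Pop (Ex i) ;; ?A) # K) s (t' - 1) (\<exists>b\<in>set bs. R b)"
    proof (rule ev_Pick)
      show "s (Ex i) = write_expr (EUnion bs) @ u" using u(1) EUnion by simp
      show "clean l s" by (rule cl)
      fix e xs f u' assume "Builder e xs f \<in> set bs" "length (builder_rest xs f u') \<le> length (s (Ex i))"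
      then show "ev ((Pop (Ex i) ;; Bind_All i ;; Pop (Ex i) ;; ?A) # K) (s(Ex i := builder_rest xs f u', Tmp := rev (write_expr e))) (T' + 5) (R (Builder e xs f))"
        unfolding R_def builder.case using u(3) by (intro pick) simp_all
    next
      have "(20 * l + 50) * n \<le> (20 * n + 50) * n" using l(1) by (intro mult_le_mono1) simp
      also have "\<dots> = 20 * (n * n) + 50 * n" by (simp add: algebra_simps)
      finally have "T' \<le> t + (100 * (n + 1) * (n + 1) + 10 * n + 30) + (20 * (n * n) + 50 * n) + 1"
        unfolding T'_def T_def by linarith
      moreover have "100 * (n + 1) * (n + 1) = 100 * (n * n) + 200 * n + 100" by (simp add: algebra_simps)
      moreover have "200 * (n + 1) * (n + 1) = 200 * (n * n) + 400 * n + 200" by (simp add: algebra_simps)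
      moreover have "length (write_expr (EUnion bs)) \<le> n" using ok' by (simp add: prog_ok_def)
      ultimately show "T' + 5 + 30 * length (write_expr (EUnion bs)) + 20 \<le> t' - 1"
        using t by linarith
    qed
    moreover have "(\<exists>b\<in>set bs. R b) \<longleftrightarrow> (\<exists>m'\<in>mems l m. Q m')"
    proof
      assume "\<exists>b\<in>set bs. R b"
      then obtain b where b: "b \<in> set bs" "R b" by blast
      obtain e xs f where "b = Builder e xs f" by (cases b)
      with b obtain ps' where "Builder e xs f \<in> set bs" "ps' \<in> bindings l xs ps" "sat f (valuation ps')" "Q (e, ps')"
        by (auto simp: R_def)
      then show "\<exists>m'\<in>mems l m. Q m'" unfolding m EUnion by (intro bexI[of _ "(e, ps')"]) auto
    next
      assume "\<exists>m'\<in>mems l m. Q m'"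
      then obtain m' where m': "m' \<in> mems l m" "Q m'" by blast
      then obtain e xs f ps' where b: "m' = (e, ps')" "Builder e xs f \<in> set bs" "ps' \<in> bindings l xs ps" "sat f (valuation ps')"
        unfolding m EUnion by (auto elim: memsE)
      then have "R (Builder e xs f)" using m'(2) by (auto simp: R_def)
      with b(2) show "\<exists>b\<in>set bs. R b" by blast
    qed
    ultimately show ?thesis
      unfolding Choose_def using t nn by (intro ev_SeqI[where t = "t' - 1"]) simp_all
  qed
qed

section \<open>Comparing values\<close>

text \<open>Two variables are equal if they share a guessed value; an atom never equals a set. For
  two sets a negation, a choice on one side, a negation and a choice on the other express one
  inclusion. The chosen members replace the sets in the registers, so the recursion is a loop and
  needs no stack.\<close>

definition Eq :: "which \<Rightarrow> which \<Rightarrow> (reg, token) com" where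
  "Eq i j = While (\<lambda>_. True)
    (If (\<lambda>t. t (Ex i) = Some TVar \<and> t (Ex j) = Some TVar)
      (Guess Num ;; And (Pop (Ex i) ;; Lookup i) (Pop (Ex j) ;; Lookup j))
    (If (\<lambda>t. t (Ex i) = Some TVar \<or> t (Ex j) = Some TVar) (Halt False)
      (And (Neg ;; Choose i ;; Neg ;; Choose j) (Neg ;; Choose j ;; Neg ;; Choose i))))"

lemma map_of_valuation: "x \<in> fst ` set ps \<Longrightarrow> map_of ps x = Some (valuation ps x)"
  by (cases "map_of ps x") (auto simp: valuation_def map_of_eq_None_iff)

lemma valuations_eq_iff:
  assumes "x \<in> fst ` set ps" "y \<in> fst ` set qs" "env_ok n l ps"
  shows "(\<exists>v<2 ^ l. map_of ps x = Some v \<and> map_of qs y = Some v) \<longleftrightarrow> valuation ps x = valuation qs y"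
proof -
  have "valuation ps x < 2 ^ l" using valuation_in[OF assms(1)] env_ok_snd[OF assms(3)] by blast
  then show ?thesis using map_of_valuation[OF assms(1)] map_of_valuation[OF assms(2)] by auto
qed

lemma write_env_le:
  assumes "prog_ok k n l (e, ps)"
  shows "length (write_env ps) \<le> (2 * n + 1) * n"
proof -
  have "length (write_env ps) \<le> (2 * n + 1) * length ps"
    by (rule length_write_env[OF prog_okD(2,4)[OF assms]])
  also have "\<dots> \<le> (2 * n + 1) * n" using prog_okD(3)[OF assms] by (intro mult_le_mono2) linarith
  finally show ?thesis .
qed

lemma ev_Lookup_var:
  assumes "holds n i s (EVar x, ps)" "prog_ok k n l (EVar x, ps)" "s Num = write_nat v" "30 * ((2 * n + 1) * n) + 12 \<le> t'"
  shows "ev ((Pop (Ex i) ;; Lookup i) # K) s t' (map_of ps x = Some v)"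
proof -
  obtain u where u: "s (Ex i) = TVar # write_nat x @ u" "no_digit u" "s (En i) = write_env ps"
    using assms(1) by (auto simp: holds_def write_var_def)
  let ?T = "30 * ((2 * n + 1) * n) + 10"
  have "ev (Lookup i # K) (s(Ex i := write_nat x @ u)) ?T (map_of ps x = Some v)"
    using write_env_le[OF assms(2)]
    by (intro ev_Lookup[where u = u]) (use u assms(3) in simp_all)
  then have 1: "ev (Lookup i # K) (s(Ex i := tl (s (Ex i)))) ?T (map_of ps x = Some v)" using u(1) by simp
  show ?thesis
    by (rule ev_intros ev_weaken[OF 1] refl)+ (use assms(4) in linarith)+
qed

lemma top_expr:
  assumes "holds n i s m"
  shows "tops s (Ex i) = Some (if is_union m then TLParen else TVar)"
proof -
  obtain e ps where m: "m = (e, ps)" by force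
  then show ?thesis using assms by (cases e) (auto simp: holds_def tops_def write_var_def)
qed

lemma prog_ok_length: "prog_ok k n l m \<Longrightarrow> length (write_expr (fst m)) \<le> n"
  by (cases m) (use prog_okD(3) in fastforce)

text \<open>Both objects descend together, so the depth can be measured on the first alone. A branch
  makes two choices per level, each within \<open>200 * (n + 1) * (n + 1)\<close> steps, and the
  costs of the levels add up instead of multiplying.\<close>

lemma ev_Eq:
  assumes "i \<noteq> j" "holds n i s m" "holds n j s m'" "prog_ok k n l m" "prog_ok k n l m'" "clean l s"
    and "length (write_expr (fst m)) \<le> d" "600 * ((n + 1) * (n + 1)) * (d + 1) \<le> t'"
  shows "ev (Eq i j # K) s t' (value_of m = value_of m')"
  using assms(2-)
proof (induction d arbitrary: s m m' t' rule: less_induct)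
  case (less d)
  define C where "C = (n + 1) * (n + 1)"
  have C: "(2 * n + 1) * n \<le> 2 * C" "n \<le> C" "C \<ge> 1" by (simp_all add: C_def)
  have t: "600 * C * (d + 1) \<le> t'" using less.prems(7) by (simp add: C_def)
  have "600 * C * 1 \<le> 600 * C * (d + 1)" by (rule mult_le_mono2) simp
  with t have t1: "600 * C \<le> t'" by linarith
  note ht = less.prems(1,2)
  have top: "tops s (Ex i) = Some (if is_union m then TLParen else TVar)"
    "tops s (Ex j) = Some (if is_union m' then TLParen else TVar)"
    using ht top_expr by blast+
  let ?A = "Guess Num ;; And (Pop (Ex i) ;; Lookup i) (Pop (Ex j) ;; Lookup j)"
  let ?B = "And (Neg ;; Choose i ;; Neg ;; Choose j) (Neg ;; Choose j ;; Neg ;; Choose i)"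
  have A: "ev ((Guess Num ;; And (Pop (Ex i) ;; Lookup i) (Pop (Ex j) ;; Lookup j)) # Eq i j # K) s (t' - 2) (value_of m = value_of m')"
    if u: "\<not> is_union m" "\<not> is_union m'"
  proof -
    from u(1) obtain x ps where m: "m = (EVar x, ps)" by (cases m; cases "fst m") auto
    from u(2) obtain y qs where m': "m' = (EVar y, qs)" by (cases m'; cases "fst m'") auto
    note ok = less.prems(3)[unfolded m] less.prems(4)[unfolded m']
    note h = ht(1)[unfolded m] ht(2)[unfolded m']
    have "ev (And (Pop (Ex i) ;; Lookup i) (Pop (Ex j) ;; Lookup j) # Eq i j # K) (s(Num := write_nat v @ s Num)) (60 * C + 20)
        (map_of ps x = Some v \<and> map_of qs y = Some v)" for v
    proof (rule ev_And[where t = "60 * C + 12"])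
      let ?s = "s(Num := write_nat v @ s Num)"
      have h': "holds n i ?s (EVar x, ps)" "holds n j ?s (EVar y, qs)" using h by (simp_all add: holds_def)
      have num: "?s Num = write_nat v" using cleanD(6)[OF less.prems(5)] by simp
      show "ev ((Pop (Ex i) ;; Lookup i) # Eq i j # K) ?s (60 * C + 12) (map_of ps x = Some v)"
        by (rule ev_Lookup_var[OF h'(1) ok(1) num]) (use C in linarith)
      show "ev ((Pop (Ex j) ;; Lookup j) # Eq i j # K) ?s (60 * C + 12) (map_of qs y = Some v)"
        by (rule ev_Lookup_var[OF h'(2) ok(2) num]) (use C in linarith)
    qed simp
    then have "ev (Guess Num # And (Pop (Ex i) ;; Lookup i) (Pop (Ex j) ;; Lookup j) # Eq i j # K) s (60 * C + 20 * l + 40)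
        (\<exists>v<2 ^ l. map_of ps x = Some v \<and> map_of qs y = Some v)"
      by (rule ev_Guess[OF cleanD(1,2)[OF less.prems(5)], rotated 2]) simp_all
    moreover have "(\<exists>v<2 ^ l. map_of ps x = Some v \<and> map_of qs y = Some v) \<longleftrightarrow> value_of m = value_of m'"
    proof -
      have "x \<in> fst ` set ps" "y \<in> fst ` set qs"
        using prog_okD(1)[OF ok(1)] prog_okD(1)[OF ok(2)] by (auto simp: obj_ok_def)
      from valuations_eq_iff[OF this prog_okD(2)[OF ok(1)]] show ?thesis by (simp add: m m' value_of_def)
    qed
    ultimately have g: "ev (Guess Num # And (Pop (Ex i) ;; Lookup i) (Pop (Ex j) ;; Lookup j) # Eq i j # K) s (60 * C + 20 * l + 40) (value_of m = value_of m')"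
      by (simp only:)
    have "l \<le> n" using prog_okD(4)[OF ok(1)] .
    then show ?thesis by (intro ev_SeqI[OF g]) (use C t1 in linarith)
  qed
  have B: "ev (And (Neg ;; Choose i ;; Neg ;; Choose j) (Neg ;; Choose j ;; Neg ;; Choose i) # Eq i j # K) s (t' - 3) (value_of m = value_of m')"
    if u: "is_union m" "is_union m'"
  proof -
    define T where "T = 600 * C * d"
    have d: "600 * C * (d + 1) = T + 600 * C" by (simp add: T_def algebra_simps)
    have step: "ev (Eq i j # K) s' T (value_of w = value_of w')"
      if "w \<in> mems l m" "w' \<in> mems l m'" "holds n i s' w" "holds n j s' w'" "clean l s'" for s' w w'
    proof (rule less.IH[of "d - 1"])
      note sz = prog_ok_mems(2)[OF less.prems(3) that(1)]
      show "d - 1 < d" "length (write_expr (fst w)) \<le> d - 1" using sz less.prems(6) by linarith+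
      then have "d - 1 + 1 = d" by linarith
      then show "600 * ((n + 1) * (n + 1)) * (d - 1 + 1) \<le> T" unfolding T_def C_def by simp
    qed (use that prog_ok_mems(1)[OF less.prems(3) that(1)] prog_ok_mems(1)[OF less.prems(4) that(2)] in simp_all)
    have ch: "200 * (n + 1) * (n + 1) = 200 * C" by (simp add: C_def algebra_simps)
    have 1: "ev (Choose i # (Neg ;; Choose j) # Eq i j # K) s (T + 400 * C + 10)
        (\<exists>w\<in>mems l m. \<not> (\<exists>w'\<in>mems l m'. value_of w = value_of w'))"
    proof (rule ev_Choose[where t = "T + 200 * C + 5", OF ht(1) less.prems(3,5)])
      fix w assume w: "w \<in> mems l m"
      note ok = prog_ok_mems(1)[OF less.prems(3) w]
      have "ev (Choose j # Eq i j # K) (put s i w) (T + 200 * C) (\<exists>w'\<in>mems l m'. value_of w = value_of w')"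
      proof (rule ev_Choose[OF _ less.prems(4)])
        show "holds n j (put s i w) m'" using assms(1) ht(2) by simp
        show "clean l (put s i w)" using less.prems(5) by simp
        fix w' assume w': "w' \<in> mems l m'"
        show "ev (Eq i j # K) (put (put s i w) j w') T (value_of w = value_of w')"
          by (rule step[OF w w']) (use assms(1) less.prems(5) prog_ok_length[OF ok] prog_ok_length[OF prog_ok_mems(1)[OF less.prems(4) w']] in simp_all)
      qed (use ch in linarith)
      then have c: "ev (Choose j # Eq i j # K) (put s i w) (T + 200 * C) (\<not> \<not> (\<exists>w'\<in>mems l m'. value_of w = value_of w'))"
        by (simp only: not_not)
      show "ev ((Neg ;; Choose j) # Eq i j # K) (put s i w) (T + 200 * C + 5) (\<not> (\<exists>w'\<in>mems l m'. value_of w = value_of w'))"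
        by (rule ev_intros ev_weaken[OF c] refl)+ linarith+
    qed (use ch in linarith)
    have 2: "ev (Choose j # (Neg ;; Choose i) # Eq i j # K) s (T + 400 * C + 10)
        (\<exists>w'\<in>mems l m'. \<not> (\<exists>w\<in>mems l m. value_of w = value_of w'))"
    proof (rule ev_Choose[where t = "T + 200 * C + 5", OF ht(2) less.prems(4,5)])
      fix w' assume w': "w' \<in> mems l m'"
      note ok = prog_ok_mems(1)[OF less.prems(4) w']
      have "ev (Choose i # Eq i j # K) (put s j w') (T + 200 * C) (\<exists>w\<in>mems l m. value_of w = value_of w')"
      proof (rule ev_Choose[OF _ less.prems(3)])
        show "holds n i (put s j w') m" using assms(1) ht(1) by simp
        show "clean l (put s j w')" using less.prems(5) by simp
        fix w assume w: "w \<in> mems l m"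
        show "ev (Eq i j # K) (put (put s j w') i w) T (value_of w = value_of w')"
          by (rule step[OF w w']) (use assms(1) less.prems(5) prog_ok_length[OF ok] prog_ok_length[OF prog_ok_mems(1)[OF less.prems(3) w]] in simp_all)
      qed (use ch in linarith)
      then have c: "ev (Choose i # Eq i j # K) (put s j w') (T + 200 * C) (\<not> \<not> (\<exists>w\<in>mems l m. value_of w = value_of w'))"
        by (simp only: not_not)
      show "ev ((Neg ;; Choose i) # Eq i j # K) (put s j w') (T + 200 * C + 5) (\<not> (\<exists>w\<in>mems l m. value_of w = value_of w'))"
        by (rule ev_intros ev_weaken[OF c] refl)+ linarith+
    qed (use ch in linarith)
    have "ev (And (Neg ;; Choose i ;; Neg ;; Choose j) (Neg ;; Choose j ;; Neg ;; Choose i) # Eq i j # K) s (t' - 3)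
      (\<not> (\<exists>w\<in>mems l m. \<not> (\<exists>w'\<in>mems l m'. value_of w = value_of w')) \<and>
       \<not> (\<exists>w'\<in>mems l m'. \<not> (\<exists>w\<in>mems l m. value_of w = value_of w')))"
    proof (rule ev_And[where t = "T + 400 * C + 15"])
      have "ev (Choose i # (Neg ;; Choose j) # Eq i j # K) s (T + 400 * C + 11) (\<not> \<not> (\<exists>w\<in>mems l m. \<not> (\<exists>w'\<in>mems l m'. value_of w = value_of w')))"
        using ev_mono[OF 1, of "T + 400 * C + 11"] by (simp only: not_not)
      note c = this
      show "ev ((Neg ;; Choose i ;; Neg ;; Choose j) # Eq i j # K) s (T + 400 * C + 15)
          (\<not> (\<exists>w\<in>mems l m. \<not> (\<exists>w'\<in>mems l m'. value_of w = value_of w')))"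
        by (rule ev_intros ev_weaken[OF c] refl)+ linarith+
      have "ev (Choose j # (Neg ;; Choose i) # Eq i j # K) s (T + 400 * C + 11) (\<not> \<not> (\<exists>w'\<in>mems l m'. \<not> (\<exists>w\<in>mems l m. value_of w = value_of w')))"
        using ev_mono[OF 2, of "T + 400 * C + 11"] by (simp only: not_not)
      note c = this
      show "ev ((Neg ;; Choose j ;; Neg ;; Choose i) # Eq i j # K) s (T + 400 * C + 15)
          (\<not> (\<exists>w'\<in>mems l m'. \<not> (\<exists>w\<in>mems l m. value_of w = value_of w')))"
        by (rule ev_intros ev_weaken[OF c] refl)+ linarith+
    qed (use t d C in linarith)
    moreover have "(\<not> (\<exists>w\<in>mems l m. \<not> (\<exists>w'\<in>mems l m'. value_of w = value_of w')) \<and>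
       \<not> (\<exists>w'\<in>mems l m'. \<not> (\<exists>w\<in>mems l m. value_of w = value_of w'))) \<longleftrightarrow> value_of m = value_of m'"
    proof -
      obtain e ps e' ps' where m: "m = (e, ps)" "m' = (e', ps')" by (cases m; cases m')
      have "3 * k \<le> 2 ^ l" using prog_okD(6)[OF less.prems(3)[unfolded m(1)]] by linarith
      from value_eq_iff_mems[OF _ _ this u, unfolded m, OF prog_okD(1)[OF less.prems(3)[unfolded m]] prog_okD(1)[OF less.prems(4)[unfolded m]]]
      show ?thesis unfolding m by (metis (no_types, lifting))
    qed
    ultimately show ?thesis by (simp only:)
  qed
  show ?case
  proof (cases "is_union m = is_union m'")
    case False
    then have "value_of m \<noteq> value_of m'" using is_set_value_of by metis
    then show ?thesis
      by (intro ev_loop_True[OF Eq_def, where t = "t' - 1"]) (use top False t1 C in auto)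
  next
    case True
    show ?thesis
    proof (rule ev_loop_True[OF Eq_def, where t = "t' - 1"])
      show "ev (If (\<lambda>t. t (Ex i) = Some TVar \<and> t (Ex j) = Some TVar)
        (Guess Num ;; And (Pop (Ex i) ;; Lookup i) (Pop (Ex j) ;; Lookup j))
        (If (\<lambda>t. t (Ex i) = Some TVar \<or> t (Ex j) = Some TVar) (Halt False)
          (And (Neg ;; Choose i ;; Neg ;; Choose j) (Neg ;; Choose j ;; Neg ;; Choose i))) # Eq i j # K) s (t' - 1) (value_of m = value_of m')"
      proof (cases "is_union m")
        case u: True
        have "ev (And (Neg ;; Choose i ;; Neg ;; Choose j) (Neg ;; Choose j ;; Neg ;; Choose i) # Eq i j # K) s (t' - 1 - 1 - 1) (value_of m = value_of m')"
        proof -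
          have "t' - 1 - 1 - 1 = t' - 3" by linarith
          then show ?thesis using B u True by (simp only:)
        qed
        then show ?thesis
          by (intro ev_If_False) (use top u True t1 C in simp_all)
      next
        case u: False
        have "ev ((Guess Num ;; And (Pop (Ex i) ;; Lookup i) (Pop (Ex j) ;; Lookup j)) # Eq i j # K) s (t' - 1 - 1) (value_of m = value_of m')"
          using A u True by (simp add: numeral_2_eq_2)
        then show ?thesis
          by (intro ev_If_True) (use top u True t1 C in simp_all)
      qed
    qed (use t1 C in simp_all)
  qed
qed

section \<open>Parsing\<close>

text \<open>A predictive parser. Goals are coded by tokens: \<open>TEx\<close> stands for an expression, \<open>TNot\<close> for a
  formula, \<open>TLParen\<close> for the builders of a union up to the closing parenthesis, \<open>TComma\<close> for a
  list of variables up to the comma, \<open>TOne\<close> for a number, \<open>TZero\<close> for a positive number, \<open>TEq\<close> for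
  an environment; the other tokens stand for themselves. Every rule consumes one token.\<close>

definition expand :: "token \<Rightarrow> token \<Rightarrow> token list option" where
  "expand g a = map_of [
    ((TEx, TVar), [TOne]), ((TEx, TLParen), [TLParen]),
    ((TLParen, TRParen), []), ((TLParen, TLBrace), [TEx, TBar, TComma, TNot, TRBrace, TLParen]),
    ((TComma, TVar), [TOne, TComma]), ((TComma, TComma), []),
    ((TNot, TEq), [TVar, TOne, TVar, TOne]), ((TNot, TNot), [TNot]), ((TNot, TAnd), [TNot, TNot]),
    ((TNot, TOr), [TNot, TNot]), ((TNot, TEx), [TVar, TOne, TNot]), ((TNot, TAll), [TVar, TOne, TNot]),
    ((TOne, TOne), [TOne]), ((TOne, TZero), [TZero]), ((TZero, TOne), [TOne]), ((TZero, TZero), [TZero]),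
    ((TEq, TVar), [TOne, TAtom, TOne, TEq]),
    ((TBar, TBar), []), ((TRBrace, TRBrace), []), ((TSemicolon, TSemicolon), []), ((TVar, TVar), []), ((TAtom, TAtom), [])] (g, a)"

lemma length_expand: "expand g a = Some H \<Longrightarrow> length H \<le> 6"
  by (auto simp: expand_def split: if_splits)

definition lang :: "token \<Rightarrow> token list set" where
  "lang g = (if g = TEx then range write_expr else if g = TNot then range write_fm
    else if g = TLParen then range (\<lambda>bs. concat (map write_builder bs) @ [TRParen])
    else if g = TComma then range (\<lambda>xs. concat (map write_var xs) @ [TComma])
    else if g = TOne then range write_nat else if g = TZero then write_nat ` {n. 0 < n}
    else if g = TEq then range write_env
    else if g \<in> {TBar, TRBrace, TSemicolon, TVar, TAtom} then {[g]} else {})"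

text \<open>A number extends as far as there are digits. This constrains what may follow an object
  that ends in a number: a number itself, a variable, and any formula, since the last token group of
  a formula is a variable. An environment has to reach the end of the input.\<close>

definition ends :: "token \<Rightarrow> token list \<Rightarrow> token list \<Rightarrow> bool" where
  "ends g x w \<longleftrightarrow> (g \<in> {TNot, TOne, TZero} \<or> g = TEx \<and> hd x = TVar \<longrightarrow> no_digit w) \<and> (g = TEq \<longrightarrow> w = [])"

fun derives :: "token list \<Rightarrow> token list \<Rightarrow> bool" where
  "derives [] w \<longleftrightarrow> w = []"
| "derives (g # G) w \<longleftrightarrow> (\<exists>x\<in>lang g. \<exists>w'. w = x @ w' \<and> ends g x w' \<and> derives G w')"

declare derives.simps(2) [simp del]

section \<open>The words derived from the individual goals\<close>

lemma derives_expr: "derives (TEx # G) w \<longleftrightarrow> (\<exists>e w'. w = write_expr e @ w' \<and> ((\<exists>x. e = EVar x) \<longrightarrow> no_digit w') \<and> derives G w')"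
proof -
  have "hd (write_expr e) = TVar \<longleftrightarrow> (\<exists>x. e = EVar x)" for e by (cases e) (simp_all add: write_var_def)
  then show ?thesis by (auto simp: derives.simps lang_def ends_def)
qed

lemma derives_fm: "derives (TNot # G) w \<longleftrightarrow> (\<exists>f w'. w = write_fm f @ w' \<and> no_digit w' \<and> derives G w')"
  and derives_builders: "derives (TLParen # G) w \<longleftrightarrow> (\<exists>bs w'. w = concat (map write_builder bs) @ TRParen # w' \<and> derives G w')"
  and derives_vars: "derives (TComma # G) w \<longleftrightarrow> (\<exists>xs w'. w = concat (map write_var xs) @ TComma # w' \<and> derives G w')"
  and derives_nat: "derives (TOne # G) w \<longleftrightarrow> (\<exists>n w'. w = write_nat n @ w' \<and> no_digit w' \<and> derives G w')"
  and derives_pos: "derives (TZero # G) w \<longleftrightarrow> (\<exists>n w'. 0 < n \<and> w = write_nat n @ w' \<and> no_digit w' \<and> derives G w')"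
  and derives_env: "derives (TEq # G) w \<longleftrightarrow> (\<exists>ps. w = write_env ps \<and> derives G [])"
  by (auto simp: derives.simps lang_def ends_def)

lemma derives_token: "g \<in> {TBar, TRBrace, TSemicolon, TVar, TAtom} \<Longrightarrow> derives (g # G) w \<longleftrightarrow> (\<exists>w'. w = g # w' \<and> derives G w')"
  by (auto simp: derives.simps lang_def ends_def)

lemma not_derives: "g \<in> {TAnd, TOr, TAll, TRParen, TLBrace} \<Longrightarrow> \<not> derives (g # G) w"
  by (auto simp: derives.simps lang_def)

lemma ex_expr_token:
  assumes "g \<in> {TBar, TSemicolon}"
  shows "derives (TEx # g # G) w \<longleftrightarrow> (\<exists>e w'. w = write_expr e @ g # w' \<and> derives G w')"
proof -
  have g: "g \<in> {TBar, TRBrace, TSemicolon, TVar, TAtom}" and nd: "no_digit (g # z)" for z using assms by auto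
  show ?thesis unfolding derives_expr derives_token[OF g]
  proof
    assume "\<exists>e w'. w = write_expr e @ g # w' \<and> derives G w'"
    then obtain e w' where "w = write_expr e @ g # w'" "derives G w'" by blast
    then show "\<exists>e w'. w = write_expr e @ w' \<and> ((\<exists>x. e = EVar x) \<longrightarrow> no_digit w') \<and> (\<exists>w''. w' = g # w'' \<and> derives G w'')"
      using nd by (intro exI[of _ e] exI[of _ "g # w'"]) simp
  qed auto
qed

lemma ex_nat_token:
  assumes "g \<in> {TVar, TAtom}"
  shows "derives (TOne # g # G) w \<longleftrightarrow> (\<exists>n w'. w = write_nat n @ g # w' \<and> derives G w')"
proof -
  have g: "g \<in> {TBar, TRBrace, TSemicolon, TVar, TAtom}" and nd: "no_digit (g # z)" for z using assms by auto
  show ?thesis unfolding derives_nat derives_token[OF g]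
  proof
    assume "\<exists>n w'. w = write_nat n @ g # w' \<and> derives G w'"
    then obtain n w' where "w = write_nat n @ g # w'" "derives G w'" by blast
    then show "\<exists>n w'. w = write_nat n @ w' \<and> no_digit w' \<and> (\<exists>w''. w' = g # w'' \<and> derives G w'')"
      using nd by (intro exI[of _ n] exI[of _ "g # w'"]) simp
  qed auto
qed

lemma ex_fm_token: "derives (TNot # TRBrace # G) w \<longleftrightarrow> (\<exists>f w'. w = write_fm f @ TRBrace # w' \<and> derives G w')"
proof -
  have "derives (TNot # TRBrace # G) w \<longleftrightarrow> (\<exists>f w'. w = write_fm f @ w' \<and> no_digit w' \<and> (\<exists>w''. w' = TRBrace # w'' \<and> derives G w''))"
    by (simp only: derives_fm) (simp add: derives_token)
  also have "\<dots> \<longleftrightarrow> (\<exists>f w'. w = write_fm f @ TRBrace # w' \<and> derives G w')"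
    by fastforce
  finally show ?thesis .
qed

lemma ex_nat_fm: "derives (TOne # TNot # G) w \<longleftrightarrow> (\<exists>n f w'. w = write_nat n @ write_fm f @ w' \<and> no_digit w' \<and> derives G w')"
  unfolding derives_nat derives_fm by (blast intro: no_digit_write)

lemma ex_fm_fm: "derives (TNot # TNot # G) w \<longleftrightarrow> (\<exists>f g w'. w = write_fm f @ write_fm g @ w' \<and> no_digit w' \<and> derives G w')"
  unfolding derives_fm by (blast intro: no_digit_write)

lemma ex_nat_vars: "derives (TOne # TComma # G) w \<longleftrightarrow> (\<exists>n xs w'. w = write_nat n @ concat (map write_var xs) @ TComma # w' \<and> derives G w')"
proof -
  have "no_digit (concat (map write_var xs) @ TComma # w')" for xs w' by (cases xs) (simp_all add: write_var_def)
  then show ?thesis unfolding derives_nat derives_vars by blast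
qed

lemma ex_nat_env: "derives (TOne # TEq # G) w \<longleftrightarrow> (\<exists>n ps. w = write_nat n @ write_env ps \<and> derives G [])"
  unfolding derives_nat derives_env by (blast intro: no_digit_write_env)

lemma ex_expr: "(\<exists>e. P e) \<longleftrightarrow> (\<exists>x. P (EVar x)) \<or> (\<exists>bs. P (EUnion bs))"
  by (metis expr.exhaust)

lemma ex_fm: "(\<exists>f. P f) \<longleftrightarrow> (\<exists>x y. P (FEq x y)) \<or> (\<exists>f. P (FNot f)) \<or> (\<exists>f g. P (FAnd f g)) \<or> (\<exists>f g. P (FOr f g)) \<or>
    (\<exists>x f. P (FEx x f)) \<or> (\<exists>x f. P (FAll x f))"
  by (metis fm.exhaust)

lemma ex_list: "(\<exists>xs. P xs) \<longleftrightarrow> P [] \<or> (\<exists>x xs. P (x # xs))"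
  by (metis list.exhaust)

lemma ex_builder: "(\<exists>b. P b) \<longleftrightarrow> (\<exists>e xs f. P (Builder e xs f))"
  by (metis builder.exhaust)

text \<open>With the least significant digit first and no leading zeros, a one may be followed by
  any number, but a zero only by a positive one. This is why the parser has separate goals for
  numbers and for positive numbers.\<close>

lemma ex_pos_write_nat: "(\<exists>n>0. P (write_nat n)) \<longleftrightarrow> (\<exists>n. P (TOne # write_nat n)) \<or> (\<exists>n>0. P (TZero # write_nat n))"
proof
  assume "\<exists>n>0. P (write_nat n)"
  then obtain n where n: "0 < n" "P (write_nat n)" by blast
  then show "(\<exists>n. P (TOne # write_nat n)) \<or> (\<exists>n>0. P (TZero # write_nat n))"
  proof (cases "odd n")
    case False
    then have "0 < n div 2" using n(1) by auto
    then show ?thesis using n False write_nat.simps[of n] by auto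
  qed (auto simp: write_nat.simps[of n])
next
  assume "(\<exists>n. P (TOne # write_nat n)) \<or> (\<exists>n>0. P (TZero # write_nat n))"
  then show "\<exists>n>0. P (write_nat n)"
  proof
    assume "\<exists>n. P (TOne # write_nat n)"
    then obtain n where "P (write_nat (2 * n + 1))" unfolding write_nat_push by blast
    then show ?thesis by (intro exI[of _ "2 * n + 1"]) simp
  next
    assume "\<exists>n>0. P (TZero # write_nat n)"
    then obtain n where "0 < n" "P (write_nat (2 * n))" using write_nat_push(1) by auto
    then show ?thesis by (intro exI[of _ "2 * n"]) simp
  qed
qed

lemma ex_write_nat: "(\<exists>n. P (write_nat n)) \<longleftrightarrow> P [] \<or> (\<exists>n. P (TOne # write_nat n)) \<or> (\<exists>n>0. P (TZero # write_nat n))"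
  using ex_pos_write_nat[of P] by (metis gr0I write_nat_0)

lemma derives_Nil: "derives (g # G) [] \<longleftrightarrow> (g = TOne \<or> g = TEq) \<and> derives G []"
proof (cases g)
  case TEx
  have "write_expr e \<noteq> []" for e by (cases e) (simp_all add: write_var_def)
  then show ?thesis using TEx by (simp add: derives_expr)
next
  case TNot
  have "write_fm f \<noteq> []" for f by (cases f) simp_all
  then show ?thesis using TNot by (simp add: derives_fm)
next
  case TOne
  show ?thesis unfolding TOne derives_nat by (subst ex_comm, subst ex_write_nat) auto
next
  case TZero
  have "write_nat n \<noteq> []" if "0 < n" for n using that by (simp add: write_nat.simps)
  then show ?thesis using TZero by (auto simp: derives_pos)
next
  case TEq
  have "\<exists>ps. [] = write_env ps" by (rule exI[of _ "[]"]) simp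
  then show ?thesis using TEq by (simp add: derives_env)
qed (simp_all add: derives_builders derives_vars derives_token not_derives)

lemma derives_step_nat:
  "derives (TOne # G) (a # w) \<longleftrightarrow> (if a = TOne then derives (TOne # G) w else if a = TZero then derives (TZero # G) w else derives G (a # w))"
proof -
  have "derives (TOne # G) (a # w) \<longleftrightarrow> (\<exists>w'. \<exists>n. a # w = write_nat n @ w' \<and> no_digit w' \<and> derives G w')"
    unfolding derives_nat by blast
  also have "\<dots> \<longleftrightarrow> (\<exists>w'. (a # w = w' \<and> no_digit w' \<and> derives G w') \<or> (\<exists>n. a = TOne \<and> w = write_nat n @ w' \<and> no_digit w' \<and> derives G w') \<or>
      (\<exists>n>0. a = TZero \<and> w = write_nat n @ w' \<and> no_digit w' \<and> derives G w'))"
    by (subst ex_write_nat) simp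
  also have "\<dots> \<longleftrightarrow> (if a = TOne then derives (TOne # G) w else if a = TZero then derives (TZero # G) w else derives G (a # w))"
    unfolding derives_nat derives_pos by auto
  finally show ?thesis .
qed

lemma derives_step_pos:
  "derives (TZero # G) (a # w) \<longleftrightarrow> (if a = TOne then derives (TOne # G) w else if a = TZero then derives (TZero # G) w else False)"
proof -
  have "derives (TZero # G) (a # w) \<longleftrightarrow> (\<exists>w'. \<exists>n>0. a # w = write_nat n @ w' \<and> no_digit w' \<and> derives G w')"
    unfolding derives_pos by blast
  also have "\<dots> \<longleftrightarrow> (\<exists>w'. (\<exists>n. a = TOne \<and> w = write_nat n @ w' \<and> no_digit w' \<and> derives G w') \<or>
      (\<exists>n>0. a = TZero \<and> w = write_nat n @ w' \<and> no_digit w' \<and> derives G w'))"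
    by (subst ex_pos_write_nat) simp
  also have "\<dots> \<longleftrightarrow> (if a = TOne then derives (TOne # G) w else if a = TZero then derives (TZero # G) w else False)"
    unfolding derives_nat derives_pos by auto
  finally show ?thesis .
qed

text \<open>The next token determines the outermost constructor, so at most one production applies.
  Without one, only a number can still succeed, as the empty word.\<close>

lemma derives_step:
  "derives (g # G) (a # w) \<longleftrightarrow> (case expand g a of Some H \<Rightarrow> derives (H @ G) w | None \<Rightarrow> g = TOne \<and> derives G (a # w))"
proof (cases g)
  case TEx
  have "derives (TEx # G) (a # w) \<longleftrightarrow> (if a = TVar then derives (TOne # G) w else if a = TLParen then derives (TLParen # G) w else False)"
    unfolding derives_expr derives_nat derives_builders by (subst ex_expr) (simp add: write_var_def)
  then show ?thesis by (simp add: TEx expand_def)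
next
  case TNot
  have "derives (TNot # G) (a # w) \<longleftrightarrow> (\<exists>w'. (\<exists>x y. a # w = write_fm (FEq x y) @ w' \<and> no_digit w' \<and> derives G w') \<or> (\<exists>f. a # w = write_fm (FNot f) @ w' \<and> no_digit w' \<and> derives G w') \<or>
     (\<exists>f g. a # w = write_fm (FAnd f g) @ w' \<and> no_digit w' \<and> derives G w') \<or> (\<exists>f g. a # w = write_fm (FOr f g) @ w' \<and> no_digit w' \<and> derives G w') \<or>
     (\<exists>x f. a # w = write_fm (FEx x f) @ w' \<and> no_digit w' \<and> derives G w') \<or> (\<exists>x f. a # w = write_fm (FAll x f) @ w' \<and> no_digit w' \<and> derives G w'))"
    unfolding derives_fm by (subst ex_comm, subst ex_fm) (rule refl)
  also have "\<dots> \<longleftrightarrow> (case expand TNot a of Some H \<Rightarrow> derives (H @ G) w | None \<Rightarrow> False)"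
  proof (cases a)
    case TEq
    then show ?thesis by (simp add: expand_def derives_token ex_nat_token) (simp add: derives_nat write_var_def, blast)
  next
    case TNot
    then show ?thesis by (simp add: expand_def derives_fm) blast
  next
    case TAnd
    then show ?thesis by (simp add: expand_def ex_fm_fm) blast
  next
    case TOr
    then show ?thesis by (simp add: expand_def ex_fm_fm) blast
  next
    case TEx
    then show ?thesis by (simp add: expand_def derives_token ex_nat_fm write_var_def) blast
  next
    case TAll
    then show ?thesis by (simp add: expand_def derives_token ex_nat_fm write_var_def) blast
  qed (simp_all add: expand_def)
  finally show ?thesis by (simp add: TNot split: option.split)
next
  case TLParen
  have 1: "derives ([TEx, TBar, TComma, TNot, TRBrace, TLParen] @ G) w \<longleftrightarrow> (\<exists>e xs f bs w'.
      w = write_expr e @ TBar # concat (map write_var xs) @ TComma # write_fm f @ TRBrace # concat (map write_builder bs) @ TRParen # w' \<and> derives G w')"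
    by (simp add: ex_expr_token derives_vars ex_fm_token derives_builders) blast
  have "derives (TLParen # G) (a # w) \<longleftrightarrow> (if a = TRParen then derives G w else if a = TLBrace then derives ([TEx, TBar, TComma, TNot, TRBrace, TLParen] @ G) w else False)"
    unfolding 1 unfolding derives_builders by (subst ex_list, subst ex_builder) (simp, blast?)
  then show ?thesis by (simp add: TLParen expand_def)
next
  case TComma
  have "derives (TComma # G) (a # w) \<longleftrightarrow> (if a = TComma then derives G w else if a = TVar then derives (TOne # TComma # G) w else False)"
    unfolding ex_nat_vars unfolding derives_vars by (subst ex_list) (simp add: write_var_def, blast?)
  then show ?thesis by (simp add: TComma expand_def)
next
  case TEq
  have 1: "derives (TOne # TAtom # TOne # TEq # G) w \<longleftrightarrow> (\<exists>x b ps. w = write_nat x @ TAtom # write_nat b @ write_env ps \<and> derives G [])"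
    by (simp add: ex_nat_token ex_nat_env) blast
  have "derives (TEq # G) (a # w) \<longleftrightarrow> (if a = TVar then derives (TOne # TAtom # TOne # TEq # G) w else False)"
    unfolding 1 unfolding derives_env by (subst ex_list) (simp, blast?)
  then show ?thesis by (simp add: TEq expand_def)
next
  case TOne
  then show ?thesis using derives_step_nat[of G a w] by (simp add: expand_def)
next
  case TZero
  then show ?thesis using derives_step_pos[of G a w] by (simp add: expand_def)
qed (auto simp: derives_token not_derives expand_def)

section \<open>The parsing loop\<close>

definition rhs :: "(reg \<Rightarrow> token option) \<Rightarrow> token list option" where
  "rhs t = Option.bind (t Goals) (\<lambda>g. Option.bind (t (Ex IV)) (expand g))"

text \<open>A production has to be pushed token by token, and which production it is must be read
  off the tops of \<open>Goals\<close> and \<open>Ex IV\<close> each time. The tokens are therefore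
  gathered on \<open>Tmp\<close>; moving them to \<open>Goals\<close> afterwards restores their
  order. Six rounds suffice by \<open>length_expand\<close>.\<close>

primrec Push_Rhs :: "nat \<Rightarrow> (reg, token) com" where
  "Push_Rhs 0 = Skip"
| "Push_Rhs (Suc k) = (Push_Rhs k ;; If (\<lambda>t. k < length (the (rhs t))) (Push Tmp (\<lambda>t. the (rhs t) ! k)) Skip)"

definition Parse_Loop :: "(reg, token) com" where
  "Parse_Loop = While (\<lambda>t. t Goals \<noteq> None)
    (If (\<lambda>t. rhs t \<noteq> None) (Push_Rhs 6 ;; Pop Goals ;; Pop (Ex IV) ;; Move_While (\<lambda>_. True) Tmp Goals)
      (If (\<lambda>t. t Goals = Some TOne \<or> t Goals = Some TEq \<and> t (Ex IV) = None) (Pop Goals) (Halt False)))"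

definition Parse :: "(reg, token) com" where
  "Parse = (Push Goals (\<lambda>_. TEq) ;; Push Goals (\<lambda>_. TSemicolon) ;; Push Goals (\<lambda>_. TEx) ;; Parse_Loop ;;
    If (\<lambda>t. t (Ex IV) = None) (Halt True) (Halt False))"

lemma rhs_upd_Tmp [simp]: "rhs (tops (s(Tmp := x))) = rhs (tops s)"
  by (simp add: rhs_def tops_def)

lemma ev_Push_Rhs:
  "rhs (tops s) = Some H \<Longrightarrow> ev K (s(Tmp := rev (take k H) @ s Tmp)) t v \<Longrightarrow> t + 3 * k + 1 \<le> t' \<Longrightarrow> ev (Push_Rhs k # K) s t' v"
proof (induction k arbitrary: K t t')
  case 0
  have "ev K s t v" using 0(2) by (simp add: fun_upd_triv)
  then show ?case using ev_mono[of K s t v "t' - 1"] 0(3) by simp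
next
  case (Suc k)
  let ?s = "s(Tmp := rev (take k H) @ s Tmp)"
  have 1: "ev (If (\<lambda>t. k < length (the (rhs t))) (Push Tmp (\<lambda>t. the (rhs t) ! k)) Skip # K) ?s (t + 2) v"
  proof (cases "k < length H")
    case True
    have "ev K (?s(Tmp := H ! k # ?s Tmp)) t v"
      by (rule ev_weaken[OF Suc.prems(2)]) (simp_all add: take_Suc_conv_app_nth[OF True] fun_eq_iff)
    then have "ev (Push Tmp (\<lambda>t. the (rhs t) ! k) # K) ?s (t + 1) v" using Suc.prems(1) by (simp del: fun_upd_apply)
    then show ?thesis using True Suc.prems(1) by (simp del: fun_upd_apply ev_simps(1))
  next
    case False
    then have "take (Suc k) H = take k H" by simp
    then have "ev K ?s t v" using Suc.prems(2) by (simp only:)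
    then show ?thesis using False Suc.prems(1) by (simp del: fun_upd_apply)
  qed
  have "ev (Push_Rhs k # If (\<lambda>t. k < length (the (rhs t))) (Push Tmp (\<lambda>t. the (rhs t) ! k)) Skip # K) s (t + 2 + 3 * k + 1) v"
    by (rule Suc.IH[OF Suc.prems(1) 1]) simp
  then show ?case unfolding Push_Rhs.simps by (rule ev_SeqI) (use Suc.prems(3) in simp)
qed

text \<open>A production consumes one token and replaces one goal by at most six, so weighting
  tokens by 7 makes the measure decrease. It also decreases when an empty number or environment is
  dismissed.\<close>

lemma ev_Parse_Loop:
  "s Goals = G \<Longrightarrow> s (Ex IV) = w \<Longrightarrow> s Tmp = [] \<Longrightarrow> 60 * (7 * length w + length G) + 10 \<le> t' \<Longrightarrow>
    ev (Parse_Loop # If (\<lambda>t. t (Ex IV) = None) (Halt True) (Halt False) # K) s t' (derives G w)"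
proof (induction "7 * length w + length G" arbitrary: G w s t' rule: less_induct)
  case less
  let ?I = "If (\<lambda>t. t (Ex IV) = None) (Halt True) (Halt False)"
  show ?case
  proof (cases G)
    case Nil
    then have "ev (?I # K) s (t' - 1) (derives G w)"
      using less.prems by (cases w) (simp_all add: tops_def)
    then show ?thesis
      by (rule ev_loop_False[OF Parse_Loop_def, rotated]) (use less.prems Nil in \<open>simp_all add: tops_def\<close>)
  next
    case G: (Cons g G')
    have tG: "tops s Goals = Some g" using G less.prems(1) by (simp add: tops_def)
    have len: "60 * (7 * length w + length G') + 70 \<le> t'" using less.prems(4) G by simp
    have body: "ev (If (\<lambda>t. rhs t \<noteq> None) (Push_Rhs 6 ;; Pop Goals ;; Pop (Ex IV) ;; Move_While (\<lambda>_. True) Tmp Goals)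
      (If (\<lambda>t. t Goals = Some TOne \<or> t Goals = Some TEq \<and> t (Ex IV) = None) (Pop Goals) (Halt False)) # Parse_Loop # ?I # K) s (t' - 1) (derives G w)"
    proof (cases "rhs (tops s)")
      case None
      then have d: "derives G w \<longleftrightarrow> (g = TOne \<or> g = TEq \<and> w = []) \<and> derives G' w"
        using less.prems(2) tG G by (cases w) (auto simp: rhs_def tops_def derives_step derives_Nil)
      have tw: "tops s (Ex IV) = None \<longleftrightarrow> w = []" using less.prems(2) by (cases w) (simp_all add: tops_def)
      have ih: "ev (Parse_Loop # ?I # K) (s(Goals := tl (s Goals))) (t' - 1 - 1 - 1 - 1) (derives G' w)"
        by (rule less.hyps) (use less.prems G len in simp_all)
      show ?thesis
      proof (cases "g = TOne \<or> g = TEq \<and> w = []")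
        case True
        then have "ev (If (\<lambda>t. t Goals = Some TOne \<or> t Goals = Some TEq \<and> t (Ex IV) = None) (Pop Goals) (Halt False) # Parse_Loop # ?I # K) s (t' - 1 - 1) (derives G' w)"
          by (intro ev_If_True ev_intros(2) ih) (use tG tw len in auto)
        then have r: "ev (If (\<lambda>t. t Goals = Some TOne \<or> t Goals = Some TEq \<and> t (Ex IV) = None) (Pop Goals) (Halt False) # Parse_Loop # ?I # K) s (t' - 1 - 1) (derives G w)"
          by (rule ev_weaken[OF _ refl _ le_refl]) (use d True in blast)
        show ?thesis by (rule ev_If_False[OF _ r]) (use None len in simp_all)
      next
        case False
        then have "ev (If (\<lambda>t. t Goals = Some TOne \<or> t Goals = Some TEq \<and> t (Ex IV) = None) (Pop Goals) (Halt False) # Parse_Loop # ?I # K) s (t' - 1 - 1) False"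
          by (intro ev_If_False) (use tG tw len in auto)
        then have r: "ev (If (\<lambda>t. t Goals = Some TOne \<or> t Goals = Some TEq \<and> t (Ex IV) = None) (Pop Goals) (Halt False) # Parse_Loop # ?I # K) s (t' - 1 - 1) (derives G w)"
          using d False by simp
        show ?thesis by (rule ev_If_False[OF _ r]) (use None len in simp_all)
      qed
    next
      case (Some H)
      then obtain a w' where w: "w = a # w'" and e: "expand g a = Some H"
        using tG less.prems(2) by (cases w) (simp_all add: rhs_def tops_def)
      note lH = length_expand[OF e]
      define T where "T = 60 * (7 * length w' + length (H @ G')) + 10"
      have "ev (Parse_Loop # ?I # K) (s(Goals := H @ G', Ex IV := w')) T (derives (H @ G') w')"
        by (rule less.hyps) (use less.prems G w lH in \<open>simp_all add: T_def\<close>)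
      then have ih: "ev (Parse_Loop # ?I # K) (s(Goals := H @ G', Ex IV := w')) T (derives G w)"
        using G w e by (simp add: derives_step)
      have 1: "ev (Move_While (\<lambda>_. True) Tmp Goals # Parse_Loop # ?I # K) (s(Goals := G', Ex IV := w', Tmp := rev H)) (T + 4 * length H + 1) (derives G w)"
        by (rule ev_Move_All[where t = T], rule ev_weaken[OF ih]) (use less.prems(3) in \<open>simp_all add: fun_eq_iff\<close>)
      have 2: "ev ((Pop Goals ;; Pop (Ex IV) ;; Move_While (\<lambda>_. True) Tmp Goals) # Parse_Loop # ?I # K) (s(Tmp := rev (take 6 H) @ s Tmp)) (T + 30) (derives G w)"
        by (rule ev_intros ev_weaken[OF 1])+ (use less.prems(1-3) G w lH in \<open>simp_all add: fun_eq_iff\<close>)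
      have "ev (Push_Rhs 6 # (Pop Goals ;; Pop (Ex IV) ;; Move_While (\<lambda>_. True) Tmp Goals) # Parse_Loop # ?I # K) s (T + 49) (derives G w)"
        by (rule ev_Push_Rhs[OF Some 2]) simp
      then have "ev ((Push_Rhs 6 ;; Pop Goals ;; Pop (Ex IV) ;; Move_While (\<lambda>_. True) Tmp Goals) # Parse_Loop # ?I # K) s (T + 50) (derives G w)"
        by (rule ev_SeqI) simp
      moreover have "T + 50 \<le> t' - 1 - 1" using len w lH by (simp add: T_def)
      ultimately have "ev ((Push_Rhs 6 ;; Pop Goals ;; Pop (Ex IV) ;; Move_While (\<lambda>_. True) Tmp Goals) # Parse_Loop # ?I # K) s (t' - 1 - 1) (derives G w)"
        by (rule ev_mono)
      then show ?thesis by (intro ev_If_True) (use Some len in simp_all)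
    qed
    show ?thesis
      by (rule ev_loop_True[OF Parse_Loop_def _ body]) (use tG len in simp_all)
  qed
qed

lemma ev_Parse:
  assumes "s (Ex IV) = w" "s Tmp = []" "s Goals = []" "500 * length w + 300 \<le> t'"
  shows "ev (Parse # K) s t' (\<exists>e ps. w = write_expr e @ TSemicolon # write_env ps)"
proof -
  have "ev (Parse_Loop # If (\<lambda>t. t (Ex IV) = None) (Halt True) (Halt False) # K) (s(Goals := [TEx, TSemicolon, TEq])) (500 * length w + 200) (derives [TEx, TSemicolon, TEq] w)"
    by (rule ev_Parse_Loop) (use assms in simp_all)
  moreover have "derives [TEx, TSemicolon, TEq] w \<longleftrightarrow> (\<exists>e ps. w = write_expr e @ TSemicolon # write_env ps)"
    by (auto simp: ex_expr_token derives_env)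
  ultimately have l: "ev (Parse_Loop # If (\<lambda>t. t (Ex IV) = None) (Halt True) (Halt False) # K) (s(Goals := [TEx, TSemicolon, TEq])) (500 * length w + 200) (\<exists>e ps. w = write_expr e @ TSemicolon # write_env ps)"
    by (simp only:)
  show ?thesis unfolding Parse_def
    by (rule ev_intros ev_weaken[OF l] refl)+ (use assms in \<open>simp_all add: fun_eq_iff\<close>)
qed

section \<open>Testing the covering condition\<close>

definition Copy_Loop :: "('a \<Rightarrow> 'a) \<Rightarrow> 'r \<Rightarrow> 'r \<Rightarrow> 'r \<Rightarrow> ('r, 'a) com" where
  "Copy_Loop f q r r' = While (\<lambda>t. t q \<noteq> None) (Push r' (\<lambda>t. f (the (t q))) ;; Mv q r)"

text \<open>The source is reversed into \<open>Tmp\<close> and rebuilt while it is copied. With a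
  constant function the copy is the length in unary.\<close>

definition Copy :: "(token \<Rightarrow> token) \<Rightarrow> reg \<Rightarrow> reg \<Rightarrow> (reg, token) com" where
  "Copy f r r' = (Move_While (\<lambda>_. True) r Tmp ;; Copy_Loop f Tmp r r')"

lemma ev_Copy_Loop:
  "s q = xs \<Longrightarrow> q \<noteq> r \<Longrightarrow> q \<noteq> r' \<Longrightarrow> r \<noteq> r' \<Longrightarrow> ev K (s(q := [], r := rev xs @ s r, r' := rev (map f xs) @ s r')) t v \<Longrightarrow>
    t + 6 * length xs + 1 \<le> t' \<Longrightarrow> ev (Copy_Loop f q r r' # K) s t' v"
proof (induction xs arbitrary: s t')
  case Nil
  have "ev K s t v" by (rule ev_weaken[OF Nil(5)]) (use Nil in \<open>simp_all add: fun_eq_iff\<close>)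
  then show ?case by (rule ev_loop_False[OF Copy_Loop_def, rotated]) (use Nil in \<open>simp_all add: tops_def\<close>)
next
  case (Cons x xs)
  let ?s = "s(r' := f x # s r', r := x # s r, q := xs)"
  have e: "ev K (?s(q := [], r := rev xs @ ?s r, r' := rev (map f xs) @ ?s r')) t v"
    by (rule ev_weaken[OF Cons.prems(5)]) (use Cons.prems(1-4) in \<open>simp_all add: fun_eq_iff\<close>)
  have 1: "ev (Copy_Loop f q r r' # K) ?s (t' - 6) v"
    by (rule Cons.IH[OF _ _ _ _ e]) (use Cons.prems(1-4,6) in simp_all)
  have q: "tops s q = Some x" using Cons.prems(1) by (simp add: tops_def)
  have "ev ((Push r' (\<lambda>t. f (the (t q))) ;; Mv q r) # Copy_Loop f q r r' # K) s (t' - 1) v"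
    using 1 q Cons.prems(1-4,6) by (simp add: Mv_def tops_def fun_upd_same fun_upd_other diff_diff_add numeral_eq_Suc del: fun_upd_apply)
  then show ?case
    by (rule ev_loop_True[OF Copy_Loop_def, rotated]) (use q Cons.prems(6) in simp_all)
qed

lemma ev_Copy:
  assumes "s Tmp = []" "r \<noteq> Tmp" "r' \<noteq> Tmp" "r \<noteq> r'" "ev K (s(r' := map f (s r) @ s r')) t v" "t + 10 * length (s r) + 5 \<le> t'"
  shows "ev (Copy f r r' # K) s t' v"
proof -
  have "ev (Copy_Loop f Tmp r r' # K) (s(r := [], Tmp := rev (s r))) (t + 6 * length (s r) + 1) v"
    by (rule ev_Copy_Loop[where xs = "rev (s r)" and t = t, OF _ _ _ _ ev_weaken[OF assms(5)]])
       (use assms in \<open>simp_all add: fun_eq_iff rev_map\<close>)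
  then have "ev (Move_While (\<lambda>_. True) r Tmp # Copy_Loop f Tmp r r' # K) s (t + 6 * length (s r) + 1 + 4 * length (s r) + 1) v"
    by - (rule ev_Move_All[where t = "t + 6 * length (s r) + 1"], use assms in simp_all)
  then show ?thesis unfolding Copy_def by (rule ev_SeqI) (use assms(6) in simp)
qed

definition Copy_Obj :: "which \<Rightarrow> which \<Rightarrow> (reg, token) com" where
  "Copy_Obj i j = (Copy id (Ex i) (Ex j) ;; Copy id (En i) (En j))"

text \<open>The cost of \<open>Eq\<close> at the maximal depth \<open>n\<close>. It also dominates
  the cost of choosing a member and of copying an object, and thus serves as a common unit.\<close>

definition unit_cost :: "nat \<Rightarrow> nat" where
  "unit_cost n = 600 * ((n + 1) * (n + 1)) * (n + 1)"

lemma unit_cost: "200 * (n + 1) * (n + 1) \<le> unit_cost n" "20 * (n + (2 * n + 1) * n) + 50 \<le> unit_cost n"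
proof -
  have "600 * ((n + 1) * (n + 1)) * 1 \<le> unit_cost n" unfolding unit_cost_def by (rule mult_le_mono2) simp
  then have 1: "600 * (n * n) + 1200 * n + 600 \<le> unit_cost n" by (simp add: algebra_simps)
  show "200 * (n + 1) * (n + 1) \<le> unit_cost n" using 1 by (simp add: algebra_simps)
  show "20 * (n + (2 * n + 1) * n) + 50 \<le> unit_cost n" using 1 by (simp add: algebra_simps)
qed

lemma ev_Copy_Obj:
  assumes "holds n i s m" "prog_ok k n l m" "clean l s" "i \<noteq> j" "s (Ex j) = []" "s (En j) = []"
    and "\<And>s'. holds n j s' m \<Longrightarrow> clean l s' \<Longrightarrow> (\<And>r. r \<noteq> Ex j \<Longrightarrow> r \<noteq> En j \<Longrightarrow> s' r = s r) \<Longrightarrow> ev K s' t v"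
    and "t + unit_cost n \<le> t'"
  shows "ev (Copy_Obj i j # K) s t' v"
proof -
  obtain e ps where m: "m = (e, ps)" by force
  have len: "length (s (Ex i)) \<le> n" "length (s (En i)) \<le> (2 * n + 1) * n"
    using assms(1) write_env_le[OF assms(2)[unfolded m]] by (simp_all add: holds_def m)
  let ?s = "s(Ex j := s (Ex i), En j := s (En i))"
  have 1: "ev K ?s t v"
    by (rule assms(7)) (use assms(1,3,4) in \<open>simp_all add: holds_def\<close>)
  have 2: "ev (Copy id (En i) (En j) # K) (s(Ex j := s (Ex i))) (t + 10 * length (s (En i)) + 5) v"
    by (rule ev_Copy[where t = t, OF _ _ _ _ ev_weaken[OF 1]]) (use assms cleanD(4)[OF assms(3)] in \<open>simp_all add: fun_eq_iff\<close>)
  have "ev (Copy id (Ex i) (Ex j) # Copy id (En i) (En j) # K) s (t + 10 * length (s (En i)) + 5 + 10 * length (s (Ex i)) + 5) v"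
    by (rule ev_Copy[where t = "t + 10 * length (s (En i)) + 5", OF _ _ _ _ ev_weaken[OF 2]])
       (use assms cleanD(4)[OF assms(3)] in \<open>simp_all add: fun_eq_iff\<close>)
  then show ?thesis unfolding Copy_Obj_def
  proof (rule ev_SeqI)
    define N where "N = (2 * n + 1) * n"
    show "t + 10 * length (s (En i)) + 5 + 10 * length (s (Ex i)) + 5 < t'"
      using len unit_cost(2)[of n] assms(8) unfolding N_def[symmetric] by simp
  qed
qed

definition Choose_All :: "which \<Rightarrow> (reg, token) com" where
  "Choose_All i = (Neg ;; Choose i ;; Neg)"

definition Is_Union :: "which \<Rightarrow> (reg, token) com" where
  "Is_Union i = If (\<lambda>t. t (Ex i) = Some TLParen) (Halt True) (Halt False)"

text \<open>Each conjunct runs in its own branch and may overwrite the objects it starts from. In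
  the last one the bound is switched by pushing to and popping from \<open>Len\<close>: elements of
  \<open>X\<close> and of the covering set use \<open>Suc l\<close>, the choice of the covering set
  itself uses \<open>l\<close>.\<close>

definition Cover_Test :: "(reg, token) com" where
  "Cover_Test =
    And (Choose_All IV ;; Or (Eq IV IX) (Eq IV IP))
    (And (Choose IP ;; Eq IP IX)
    (And (Choose_All IP ;; Or (Eq IP IX) (Eq IP IS))
    (And (Is_Union IX)
    (And (Is_Union IS)
    (And (Choose_All IS ;; Is_Union IS)
    (And (Choose_All IS ;; Choose_All IS ;; Choose IX ;; Eq IS IX)
      (Push Len (\<lambda>_. TOne) ;; Choose_All IX ;; Pop Len ;; Choose IS ;; Push Len (\<lambda>_. TOne) ;; Choose IS ;; Eq IS IX)))))))"

text \<open>Members are chosen in copies, because the test refers to \<open>V\<close> and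
  \<open>P\<close> as well.\<close>

definition Solve :: "(reg, token) com" where
  "Solve = (Copy_Obj IV IX ;; Choose IX ;; Copy_Obj IV IP ;; Choose IP ;; Copy_Obj IP IS ;; Choose IS ;; Cover_Test)"

section \<open>Correctness and cost of the covering test\<close>

lemma ev_Choose_unit:
  assumes "holds n i s m" "prog_ok k n l m" "clean l s"
    and "\<And>m'. m' \<in> mems l m \<Longrightarrow> prog_ok k n l m' \<Longrightarrow> holds n i (put s i m') m' \<Longrightarrow> ev K (put s i m') t (Q m')"
    and "t + unit_cost n \<le> t'"
  shows "ev (Choose i # K) s t' (\<exists>m'\<in>mems l m. Q m')"
proof (rule ev_Choose[OF assms(1-3)])
  fix m' assume m': "m' \<in> mems l m"
  note ok = prog_ok_mems(1)[OF assms(2) m']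
  show "ev K (put s i m') t (Q m')"
    by (rule assms(4)[OF m' ok]) (simp add: prog_ok_length[OF ok])
qed (use assms(5) unit_cost(1)[of n] in linarith)

lemma ev_Choose_All:
  assumes "holds n i s m" "prog_ok k n l m" "clean l s"
    and "\<And>m'. m' \<in> mems l m \<Longrightarrow> prog_ok k n l m' \<Longrightarrow> holds n i (put s i m') m' \<Longrightarrow> ev K (put s i m') t (Q m')"
    and "t + unit_cost n + 5 \<le> t'"
  shows "ev (Choose_All i # K) s t' (\<forall>m'\<in>mems l m. Q m')"
proof -
  have "ev (Choose i # Neg # K) s (t + 1 + unit_cost n) (\<exists>m'\<in>mems l m. \<not> Q m')"
  proof (rule ev_Choose_unit[OF assms(1-3), where t = "t + 1"])
    fix m' assume "m' \<in> mems l m" "prog_ok k n l m'" "holds n i (put s i m') m'"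
    from assms(4)[OF this] show "ev (Neg # K) (put s i m') (t + 1) (\<not> Q m')" by simp
  qed simp
  then have 1: "ev (Choose i # Neg # K) s (t + 1 + unit_cost n) (\<not> (\<forall>m'\<in>mems l m. Q m'))" by (simp only: ball_simps)
  show ?thesis unfolding Choose_All_def
    by (rule ev_intros ev_weaken[OF 1] refl)+ (use assms(5) in linarith)+
qed

lemma ev_Eq_unit:
  assumes "i \<noteq> j" "holds n i s m" "holds n j s m'" "prog_ok k n l m" "prog_ok k n l m'" "clean l s" "unit_cost n \<le> t'"
  shows "ev (Eq i j # K) s t' (value_of m = value_of m')"
  by (rule ev_Eq[OF assms(1-6) prog_ok_length[OF assms(4)]]) (use assms(7) in \<open>simp add: unit_cost_def\<close>)

lemma ev_Is_Union: "holds n i s m \<Longrightarrow> 5 \<le> t' \<Longrightarrow> ev (Is_Union i # K) s t' (is_union m)"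
  using top_expr[of n i s m] by (simp add: Is_Union_def)

lemma prog_ok_Suc:
  assumes "prog_ok k n l m" "Suc l \<le> n"
  shows "prog_ok k n (Suc l) m"
proof -
  obtain e ps where m: "m = (e, ps)" by force
  note ok = prog_okD[OF assms(1)[unfolded m]]
  have le: "(2::nat) ^ l \<le> 2 ^ Suc l" by simp
  have "obj_ok k (Suc l) (e, ps)" by (rule obj_ok_mono[OF ok(1)]) simp
  moreover have "env_ok n (Suc l) ps" using ok(2) le unfolding env_ok_def by (blast intro: less_le_trans)
  ultimately show ?thesis unfolding m using ok(3,5,6) le assms(2) by (intro prog_okI) (assumption | linarith)+
qed

lemma holds_Len [simp]: "holds n i (s(Len := x)) m = holds n i s m"
  by (simp add: holds_def)

lemma clean_Len: "clean l s \<Longrightarrow> clean (Suc l) (s(Len := TOne # s Len))" "clean (Suc l) s \<Longrightarrow> clean l (s(Len := tl (s Len)))"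
  by (simp_all add: clean_def)

lemma ev_Cover_Test:
  assumes h: "holds n IV s V" "holds n IX s X" "holds n IP s P" "holds n IS s S"
    and ok: "prog_ok k n l V" "prog_ok k n l X" "prog_ok k n l P" "prog_ok k n l S"
    and cl: "clean l s" and n: "Suc l \<le> n" and t: "5 * unit_cost n + 100 \<le> t'"
  shows "ev (Cover_Test # K) s t' (cover_test l V X P S)"
proof -
  define E where "E = unit_cost n"
  \<comment> \<open>The longest conjuncts consist of three choices and one comparison, that is four
    units; the rest is slack for control steps.\<close>
  define T where "T = 5 * E + 50"
  note sc = E_def[symmetric]
  have or: "ev (Or (Eq a b) (Eq a c) # K) s' (E + 5) (value_of ma = value_of mb \<or> value_of ma = value_of mc)"
    if "a \<noteq> b" "a \<noteq> c" "holds n a s' ma" "holds n b s' mb" "holds n c s' mc" "prog_ok k n l ma" "prog_ok k n l mb" "prog_ok k n l mc" "clean l s'"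
    for a b c s' ma mb mc
    by (rule ev_Or[where t = "E + 4"]; (rule ev_Eq_unit[where l = l and k = k and n = n])?) (use that in \<open>simp_all add: E_def\<close>)
  have c1: "ev ((Choose_All IV ;; Or (Eq IV IX) (Eq IV IP)) # K) s T (\<forall>v\<in>mems l V. value_of v = value_of X \<or> value_of v = value_of P)"
  proof (rule ev_SeqI)
    show "ev (Choose_All IV # Or (Eq IV IX) (Eq IV IP) # K) s (2 * E + 20) (\<forall>v\<in>mems l V. value_of v = value_of X \<or> value_of v = value_of P)"
      by (rule ev_Choose_All[where t = "E + 5", OF h(1) ok(1) cl], rule or) (use h ok cl in \<open>simp_all add: sc\<close>)
  qed (simp add: T_def)
  have c2: "ev ((Choose IP ;; Eq IP IX) # K) s T (\<exists>p\<in>mems l P. value_of p = value_of X)"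
  proof (rule ev_SeqI)
    show "ev (Choose IP # Eq IP IX # K) s (2 * E + 20) (\<exists>p\<in>mems l P. value_of p = value_of X)"
      by (rule ev_Choose_unit[where t = "E", OF h(3) ok(3) cl], rule ev_Eq_unit[where l = l and k = k and n = n]) (use h ok cl in \<open>simp_all add: sc\<close>)
  qed (simp add: T_def)
  have c3: "ev ((Choose_All IP ;; Or (Eq IP IX) (Eq IP IS)) # K) s T (\<forall>p\<in>mems l P. value_of p = value_of X \<or> value_of p = value_of S)"
  proof (rule ev_SeqI)
    show "ev (Choose_All IP # Or (Eq IP IX) (Eq IP IS) # K) s (2 * E + 20) (\<forall>p\<in>mems l P. value_of p = value_of X \<or> value_of p = value_of S)"
      by (rule ev_Choose_All[where t = "E + 5", OF h(3) ok(3) cl], rule or) (use h ok cl in \<open>simp_all add: sc\<close>)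
  qed (simp add: T_def)
  have c4: "ev (Is_Union IX # K) s T (is_union X)" by (rule ev_Is_Union[OF h(2)]) (simp add: T_def)
  have c5: "ev (Is_Union IS # K) s T (is_union S)" by (rule ev_Is_Union[OF h(4)]) (simp add: T_def)
  have c6: "ev ((Choose_All IS ;; Is_Union IS) # K) s T (\<forall>u\<in>mems l S. is_union u)"
  proof (rule ev_SeqI)
    show "ev (Choose_All IS # Is_Union IS # K) s (2 * E + 20) (\<forall>u\<in>mems l S. is_union u)"
      by (rule ev_Choose_All[where t = 5, OF h(4) ok(4) cl], rule ev_Is_Union) (simp_all add: sc)
  qed (simp add: T_def)
  have c7: "ev ((Choose_All IS ;; Choose_All IS ;; Choose IX ;; Eq IS IX) # K) s T
      (\<forall>u\<in>mems l S. \<forall>y\<in>mems l u. \<exists>x\<in>mems l X. value_of y = value_of x)"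
  proof (rule ev_SeqI)
    show "ev (Choose_All IS # (Choose_All IS ;; Choose IX ;; Eq IS IX) # K) s (4 * E + 30)
        (\<forall>u\<in>mems l S. \<forall>y\<in>mems l u. \<exists>x\<in>mems l X. value_of y = value_of x)"
    proof (rule ev_Choose_All[where t = "3 * E + 20", OF h(4) ok(4) cl])
      fix u assume u: "u \<in> mems l S" "prog_ok k n l u" "holds n IS (put s IS u) u"
      have cu: "clean l (put s IS u)" using cl by simp
      show "ev ((Choose_All IS ;; Choose IX ;; Eq IS IX) # K) (put s IS u) (3 * E + 20) (\<forall>y\<in>mems l u. \<exists>x\<in>mems l X. value_of y = value_of x)"
      proof (rule ev_SeqI)
        show "ev (Choose_All IS # (Choose IX ;; Eq IS IX) # K) (put s IS u) (3 * E + 15) (\<forall>y\<in>mems l u. \<exists>x\<in>mems l X. value_of y = value_of x)"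
        proof (rule ev_Choose_All[where t = "2 * E + 10", OF u(3,2) cu])
          fix y assume y: "y \<in> mems l u" "prog_ok k n l y" "holds n IS (put (put s IS u) IS y) y"
          let ?s = "put (put s IS u) IS y"
          have x: "holds n IX ?s X" "clean l ?s" using h(2) cl by simp_all
          show "ev ((Choose IX ;; Eq IS IX) # K) ?s (2 * E + 10) (\<exists>x\<in>mems l X. value_of y = value_of x)"
          proof (rule ev_SeqI)
            show "ev (Choose IX # Eq IS IX # K) ?s (2 * E + 5) (\<exists>x\<in>mems l X. value_of y = value_of x)"
              by (rule ev_Choose_unit[where t = E, OF x(1) ok(2) x(2)], rule ev_Eq_unit[where l = l and k = k and n = n])
                 (use y x in \<open>simp_all add: sc\<close>)
          qed simp
        qed (simp add: sc)
      qed simp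
    qed (simp add: sc)
  qed (simp add: T_def)
  note oks = ok[THEN prog_ok_Suc[OF _ n]]
  have c8: "ev ((Push Len (\<lambda>_. TOne) ;; Choose_All IX ;; Pop Len ;; Choose IS ;; Push Len (\<lambda>_. TOne) ;; Choose IS ;; Eq IS IX) # K) s T
      (\<forall>x\<in>mems (Suc l) X. \<exists>u\<in>mems l S. \<exists>y\<in>mems (Suc l) u. value_of y = value_of x)"
  proof -
    let ?s1 = "s(Len := TOne # s Len)"
    have h1: "holds n IX ?s1 X" "clean (Suc l) ?s1" "holds n IS ?s1 S" using h clean_Len(1)[OF cl] by (simp_all del: fun_upd_apply)
    have c: "ev (Choose_All IX # (Pop Len ;; Choose IS ;; Push Len (\<lambda>_. TOne) ;; Choose IS ;; Eq IS IX) # K) ?s1 (4 * E + 40)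
        (\<forall>x\<in>mems (Suc l) X. \<exists>u\<in>mems l S. \<exists>y\<in>mems (Suc l) u. value_of y = value_of x)"
    proof (rule ev_Choose_All[where t = "3 * E + 30", OF h1(1) oks(2) h1(2)])
      fix x assume x: "x \<in> mems (Suc l) X" "prog_ok k n (Suc l) x" "holds n IX (put ?s1 IX x) x"
      define s2 where "s2 = put ?s1 IX x"
      let ?s3 = "s2(Len := tl (s2 Len))"
      have "clean (Suc l) s2" using h1(2) by (simp add: s2_def del: fun_upd_apply)
      then have s3: "clean l ?s3" by (rule clean_Len(2))
      have h3: "holds n IX ?s3 x" "holds n IS ?s3 S" using x(3) h(4) by (simp_all add: s2_def del: fun_upd_apply)
      have c: "ev (Choose IS # (Push Len (\<lambda>_. TOne) ;; Choose IS ;; Eq IS IX) # K) ?s3 (3 * E + 20)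
          (\<exists>u\<in>mems l S. \<exists>y\<in>mems (Suc l) u. value_of y = value_of x)"
      proof (rule ev_Choose_unit[where t = "2 * E + 10", OF h3(2) ok(4) s3])
        fix u assume u: "u \<in> mems l S" "prog_ok k n l u" "holds n IS (put ?s3 IS u) u"
        define s4 where "s4 = put ?s3 IS u"
        let ?s5 = "s4(Len := TOne # s4 Len)"
        have "clean l s4" using s3 by (simp add: s4_def del: fun_upd_apply)
        then have s5: "clean (Suc l) ?s5" by (rule clean_Len(1))
        have h5: "holds n IX ?s5 x" "holds n IS ?s5 u" using h3(1) u(3) by (simp_all add: s4_def del: fun_upd_apply)
        have c: "ev (Choose IS # Eq IS IX # K) ?s5 (2 * E + 5) (\<exists>y\<in>mems (Suc l) u. value_of y = value_of x)"
        proof (rule ev_Choose_unit[where t = E, OF h5(2) prog_ok_Suc[OF u(2) n] s5])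
          fix y assume y: "y \<in> mems (Suc l) u" "prog_ok k n (Suc l) y" "holds n IS (put ?s5 IS y) y"
          show "ev (Eq IS IX # K) (put ?s5 IS y) E (value_of y = value_of x)"
            by (rule ev_Eq_unit[OF _ y(3) _ y(2) x(2)]) (use h5(1) s5 in \<open>simp_all add: sc del: fun_upd_apply\<close>)
        qed (simp add: sc)
        show "ev ((Push Len (\<lambda>_. TOne) ;; Choose IS ;; Eq IS IX) # K) (put ?s3 IS u) (2 * E + 10) (\<exists>y\<in>mems (Suc l) u. value_of y = value_of x)"
          unfolding s4_def[symmetric] by (rule ev_intros ev_weaken[OF c] refl)+ simp_all
      qed (simp add: sc)
      show "ev ((Pop Len ;; Choose IS ;; Push Len (\<lambda>_. TOne) ;; Choose IS ;; Eq IS IX) # K) (put ?s1 IX x) (3 * E + 30)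
          (\<exists>u\<in>mems l S. \<exists>y\<in>mems (Suc l) u. value_of y = value_of x)"
        unfolding s2_def[symmetric] by (rule ev_intros ev_weaken[OF c] refl)+ simp_all
    qed (simp add: sc)
    show ?thesis by (rule ev_intros ev_weaken[OF c] refl)+ (simp_all add: T_def)
  qed
  have "ev (Cover_Test # K) s (T + 35) (cover_test l V X P S)"
    unfolding Cover_Test_def cover_test_def
    by (rule ev_And[where t = "T + 30", OF ev_mono[OF c1]], simp,
        rule ev_And[where t = "T + 25", OF ev_mono[OF c2]], simp,
        rule ev_And[where t = "T + 20", OF ev_mono[OF c3]], simp,
        rule ev_And[where t = "T + 15", OF ev_mono[OF c4]], simp,
        rule ev_And[where t = "T + 10", OF ev_mono[OF c5]], simp,
        rule ev_And[where t = "T + 5", OF ev_mono[OF c6]], simp,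
        rule ev_And[where t = T, OF c7 c8]) simp_all
  then show ?thesis by (rule ev_mono) (use t in \<open>simp add: T_def E_def\<close>)
qed

lemma ev_Solve:
  assumes h: "holds n IV s V" and ok: "prog_ok k n l V" and cl: "clean l s" and n: "Suc l \<le> n"
    and e: "\<And>i. i \<noteq> IV \<Longrightarrow> s (Ex i) = [] \<and> s (En i) = []" and t: "11 * unit_cost n + 200 \<le> t'"
  shows "ev (Solve # K) s t' (\<exists>X\<in>mems l V. \<exists>P\<in>mems l V. \<exists>S\<in>mems l P. cover_test l V X P S)"
proof -
  define E where "E = unit_cost n"
  note sc = E_def[symmetric]
  let ?v1 = "\<exists>X\<in>mems l V. \<exists>P\<in>mems l V. \<exists>S\<in>mems l P. cover_test l V X P S"
  \<comment> \<open>Three copies and three choices take six units, and the test gets five.\<close>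
  have 1: "ev (Copy_Obj IV IX # (Choose IX ;; Copy_Obj IV IP ;; Choose IP ;; Copy_Obj IP IS ;; Choose IS ;; Cover_Test) # K) s (11 * E + 150) ?v1"
  proof (rule ev_Copy_Obj[where t = "10 * E + 150", OF h ok cl])
    fix s1 assume s1: "holds n IX s1 V" "clean l s1" "\<And>r. r \<noteq> Ex IX \<Longrightarrow> r \<noteq> En IX \<Longrightarrow> s1 r = s r"
    have "ev (Choose IX # (Copy_Obj IV IP ;; Choose IP ;; Copy_Obj IP IS ;; Choose IS ;; Cover_Test) # K) s1 (10 * E + 140) ?v1"
    proof (rule ev_Choose_unit[where t = "9 * E + 140", OF s1(1) ok s1(2)])
      fix X assume X: "X \<in> mems l V" "prog_ok k n l X" "holds n IX (put s1 IX X) X"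
      define s2 where "s2 = put s1 IX X"
      have s2: "clean l s2" "holds n IV s2 V" "holds n IX s2 X" "s2 (Ex IP) = []" "s2 (En IP) = []" "s2 (Ex IS) = []" "s2 (En IS) = []"
        using s1 X h e by (simp_all add: s2_def holds_def put_def)
      let ?v = "\<exists>P\<in>mems l V. \<exists>S\<in>mems l P. cover_test l V X P S"
      have "ev (Copy_Obj IV IP # (Choose IP ;; Copy_Obj IP IS ;; Choose IS ;; Cover_Test) # K) s2 (9 * E + 130) ?v"
      proof (rule ev_Copy_Obj[where t = "8 * E + 130", OF s2(2) ok s2(1)])
        fix s3 assume s3: "holds n IP s3 V" "clean l s3" "\<And>r. r \<noteq> Ex IP \<Longrightarrow> r \<noteq> En IP \<Longrightarrow> s3 r = s2 r"
        have "ev (Choose IP # (Copy_Obj IP IS ;; Choose IS ;; Cover_Test) # K) s3 (8 * E + 125) ?v"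
        proof (rule ev_Choose_unit[where t = "7 * E + 125", OF s3(1) ok s3(2)])
          fix P assume P: "P \<in> mems l V" "prog_ok k n l P" "holds n IP (put s3 IP P) P"
          define s4 where "s4 = put s3 IP P"
          have s4: "clean l s4" "holds n IV s4 V" "holds n IX s4 X" "holds n IP s4 P" "s4 (Ex IS) = []" "s4 (En IS) = []"
            using s3 s2 P by (simp_all add: s4_def holds_def put_def)
          let ?v = "\<exists>S\<in>mems l P. cover_test l V X P S"
          have "ev (Copy_Obj IP IS # (Choose IS ;; Cover_Test) # K) s4 (7 * E + 120) ?v"
          proof (rule ev_Copy_Obj[where t = "6 * E + 120", OF s4(4) P(2) s4(1)])
            fix s5 assume s5: "holds n IS s5 P" "clean l s5" "\<And>r. r \<noteq> Ex IS \<Longrightarrow> r \<noteq> En IS \<Longrightarrow> s5 r = s4 r"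
            have "ev (Choose IS # Cover_Test # K) s5 (6 * E + 110) ?v"
            proof (rule ev_Choose_unit[where t = "5 * E + 100", OF s5(1) P(2) s5(2)])
              fix S assume S: "S \<in> mems l P" "prog_ok k n l S" "holds n IS (put s5 IS S) S"
              have "clean l (put s5 IS S)" using s5(2) by simp
              moreover have "holds n IV (put s5 IS S) V" "holds n IX (put s5 IS S) X" "holds n IP (put s5 IS S) P"
                using s5(3) s4 by (simp_all add: holds_def put_def)
              ultimately show "ev (Cover_Test # K) (put s5 IS S) (5 * E + 100) (cover_test l V X P S)"
                by (intro ev_Cover_Test[where n = n and k = k]) (use S ok X(2) P(2) n in \<open>simp_all add: sc\<close>)
            qed (simp add: sc)
            then show "ev ((Choose IS ;; Cover_Test) # K) s5 (6 * E + 120) ?v" by (rule ev_SeqI) simp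
          qed (use s4 in \<open>simp_all add: sc\<close>)
          then have "ev ((Copy_Obj IP IS ;; Choose IS ;; Cover_Test) # K) s4 (7 * E + 125) ?v" by (rule ev_SeqI) simp
          then show "ev ((Copy_Obj IP IS ;; Choose IS ;; Cover_Test) # K) (put s3 IP P) (7 * E + 125) ?v" unfolding s4_def .
        qed (simp add: sc)
        then show "ev ((Choose IP ;; Copy_Obj IP IS ;; Choose IS ;; Cover_Test) # K) s3 (8 * E + 130) ?v" by (rule ev_SeqI) simp
      qed (use s2 in \<open>simp_all add: sc\<close>)
      then have "ev ((Copy_Obj IV IP ;; Choose IP ;; Copy_Obj IP IS ;; Choose IS ;; Cover_Test) # K) s2 (9 * E + 140) ?v" by (rule ev_SeqI) simp
      then show "ev ((Copy_Obj IV IP ;; Choose IP ;; Copy_Obj IP IS ;; Choose IS ;; Cover_Test) # K) (put s1 IX X) (9 * E + 140) ?v" unfolding s2_def .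
    qed (simp add: sc)
    then show "ev ((Choose IX ;; Copy_Obj IV IP ;; Choose IP ;; Copy_Obj IP IS ;; Choose IS ;; Cover_Test) # K) s1 (10 * E + 150) ?v1" by (rule ev_SeqI) simp
  qed (use e in \<open>simp_all add: sc\<close>)
  show ?thesis unfolding Solve_def by (rule ev_SeqI[OF 1]) (use t in \<open>simp add: E_def\<close>)
qed

section \<open>Checking the valuation\<close>

text \<open>A variable is free in an expression if one can walk to a free occurrence of it, so alternation
  avoids computing the set of free variables.\<close>

definition Avoid :: "(reg, token) com" where
  "Avoid = (Test (Neg ;; Pop (Ex IV) ;; Eq_Num (Ex IV) Arg) ;; Pop (Ex IV) ;; Drop_While digit (Ex IV))"

definition Avoid_All :: "(reg, token) com" where
  "Avoid_All = While (\<lambda>t. t (Ex IV) = Some TVar) Avoid"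

text \<open>The walk fails at a quantifier that binds \<open>Arg\<close>; at an equation one of the
  two variables has to be \<open>Arg\<close>.\<close>

definition Occ_Fm :: "(reg, token) com" where
  "Occ_Fm = While (\<lambda>_. True)
    (If (\<lambda>t. t (Ex IV) = Some TEq)
      (Pop (Ex IV) ;; Or (Pop (Ex IV) ;; Eq_Num (Ex IV) Arg ;; Halt True)
        (Pop (Ex IV) ;; Drop_While digit (Ex IV) ;; Pop (Ex IV) ;; Eq_Num (Ex IV) Arg ;; Halt True))
    (If (\<lambda>t. t (Ex IV) = Some TNot) (Pop (Ex IV))
    (If (\<lambda>t. t (Ex IV) = Some TAnd \<or> t (Ex IV) = Some TOr) (Pop (Ex IV) ;; Or Skip (Skip_Fm IV))
      (Pop (Ex IV) ;; Avoid))))"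

text \<open>The variables of a builder bind both in its formula and in its body, so they are checked
  before the walk branches into one of the two.\<close>

definition Occ :: "(reg, token) com" where
  "Occ = While (\<lambda>_. True)
    (If (\<lambda>t. t (Ex IV) = Some TVar) (Pop (Ex IV) ;; Eq_Num (Ex IV) Arg ;; Halt True)
      (Pick IV ;; Pop (Ex IV) ;; Avoid_All ;; Pop (Ex IV) ;;
        Or Occ_Fm (Drop_While (\<lambda>_. True) (Ex IV) ;; Move_While (\<lambda>_. True) Tmp (Ex IV))))"

section \<open>Correctness and cost of the walk to a free occurrence\<close>

lemma ev_Eq_Arg:
  assumes "s (Ex IV) = write_nat y @ u" "no_digit u" "s Arg = write_nat x" "4 * length (write_nat y) + 10 \<le> t'"
  shows "ev (Eq_Num (Ex IV) Arg # Halt True # K) s t' (y = x)"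
proof -
  have "ev (Eq_Num (Ex IV) Arg # Halt True # K) s t' (y = x \<and> True)"
    by (rule ev_Eq_Num[where t = 1 and u = u and w = "[]"]) (use assms in simp_all)
  then show ?thesis by simp
qed

lemma ev_Pop_Eq_Arg:
  assumes "s (Ex IV) = write_var y @ u" "no_digit u" "s Arg = write_nat x" "4 * length (write_var y) + 15 \<le> t'"
  shows "ev ((Pop (Ex IV) ;; Eq_Num (Ex IV) Arg ;; Halt True) # K) s t' (y = x)"
proof -
  have 1: "ev (Eq_Num (Ex IV) Arg # Halt True # K) (s(Ex IV := write_nat y @ u)) (4 * length (write_nat y) + 10) (y = x)"
    by (rule ev_Eq_Arg) (use assms in simp_all)
  show ?thesis by (rule ev_intros ev_weaken[OF 1] refl)+ (use assms in \<open>simp_all add: write_var_def\<close>)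
qed

lemma ev_Drop_Var:
  assumes "s (Ex IV) = write_var y @ u" "no_digit u" "ev K (s(Ex IV := u)) t v" "t + 2 * length (write_var y) + 5 \<le> t'"
  shows "ev (Pop (Ex IV) # Drop_While digit (Ex IV) # K) s t' v"
proof -
  have 1: "ev (Drop_While digit (Ex IV) # K) (s(Ex IV := write_nat y @ u)) (t + 2 * length (write_nat y) + 1) v"
    by (rule ev_Drop_While[where t = t], rule ev_weaken[OF assms(3)]) (use assms(2) in \<open>simp_all add: takeWhile_digits\<close>)
  show ?thesis by (rule ev_intros ev_weaken[OF 1] refl)+ (use assms in \<open>simp_all add: write_var_def\<close>)
qed

lemma ev_Avoid:
  assumes "s (Ex IV) = write_var y @ u" "no_digit u" "s Arg = write_nat x" "ev K (s(Ex IV := u)) t v"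
    and "t + 6 * length (write_var y) + 40 \<le> t'"
  shows "ev (Avoid # K) s t' (y \<noteq> x \<and> v)"
proof -
  let ?K = "(Pop (Ex IV) ;; Drop_While digit (Ex IV)) # K"
  have 1: "ev (Eq_Num (Ex IV) Arg # Halt True # ?K) (s(Ex IV := write_nat y @ u)) (4 * length (write_nat y) + 10) (y = x)"
    by (rule ev_Eq_Arg) (use assms in simp_all)
  then have 1: "ev (Eq_Num (Ex IV) Arg # Halt True # ?K) (s(Ex IV := write_nat y @ u)) (4 * length (write_nat y) + 10) (\<not> y \<noteq> x)"
    by simp
  have c: "ev ((Neg ;; Pop (Ex IV) ;; Eq_Num (Ex IV) Arg) # Halt True # ?K) s (t + 4 * length (write_var y) + 25) (y \<noteq> x)"
    by (rule ev_intros ev_weaken[OF 1] refl)+ (use assms in \<open>simp_all add: write_var_def\<close>)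
  have "ev (Pop (Ex IV) # Drop_While digit (Ex IV) # K) s (t + 2 * length (write_var y) + 5) v"
    by (rule ev_Drop_Var[OF assms(1,2,4)]) simp
  then have d: "ev ?K s (t + 2 * length (write_var y) + 6) v" by (rule ev_SeqI) simp
  have "ev (Test (Neg ;; Pop (Ex IV) ;; Eq_Num (Ex IV) Arg) # ?K) s (t + 6 * length (write_var y) + 35) (y \<noteq> x \<and> v)"
    by (rule ev_Test[where t = "t + 4 * length (write_var y) + 25", OF c ev_mono[OF d]]) simp_all
  then show ?thesis unfolding Avoid_def by (rule ev_SeqI) (use assms(5) in simp)
qed

lemma ev_Avoid_All:
  assumes "s (Ex IV) = concat (map write_var xs) @ TComma # u" "s Arg = write_nat x"
    and "ev K (s(Ex IV := TComma # u)) t v" "t + 60 * length (concat (map write_var xs)) + 1 \<le> t'"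
  shows "ev (Avoid_All # K) s t' (x \<notin> set xs \<and> v)"
  using assms
proof (induction xs arbitrary: s t')
  case Nil
  have "ev K s t v" by (rule ev_weaken[OF Nil(3)]) (use Nil(1) in \<open>simp_all add: fun_eq_iff\<close>)
  then have "ev (Avoid_All # K) s t' v"
    by (rule ev_loop_False[OF Avoid_All_def, rotated]) (use Nil(1,4) in \<open>simp_all add: tops_def\<close>)
  then show ?case by simp
next
  case (Cons y xs)
  define T where "T = t + 60 * length (concat (map write_var xs)) + 1"
  let ?u = "concat (map write_var xs) @ TComma # u"
  have nd: "no_digit ?u" by (cases xs) (simp_all add: write_var_def)
  have s: "s (Ex IV) = write_var y @ ?u" using Cons.prems(1) by simp
  have e: "ev K ((s(Ex IV := ?u))(Ex IV := TComma # u)) t v"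
    by (rule ev_weaken[OF Cons.prems(3)]) (simp_all add: fun_eq_iff)
  have "ev (Avoid_All # K) (s(Ex IV := ?u)) T (x \<notin> set xs \<and> v)"
    by (rule Cons.IH[OF _ _ e]) (use Cons.prems(2) in \<open>simp_all add: T_def\<close>)
  then have "ev (Avoid # Avoid_All # K) s (T + 6 * length (write_var y) + 40) (y \<noteq> x \<and> x \<notin> set xs \<and> v)"
    by (rule ev_Avoid[OF s nd Cons.prems(2)]) simp
  then have b: "ev (Avoid # Avoid_All # K) s (T + 6 * length (write_var y) + 40) (x \<notin> set (y # xs) \<and> v)"
    by (rule ev_weaken) auto
  have top: "tops s (Ex IV) = Some TVar" using s by (simp add: tops_def write_var_def)
  show ?case
    by (rule ev_loop_True[OF Avoid_All_def _ b])
       (use top Cons.prems(4) length_write_var[of y] in \<open>simp_all add: T_def\<close>)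
qed

lemma ev_Occ_Fm:
  assumes "s (Ex IV) = write_fm f @ u" "no_var u" "s Arg = write_nat x" "s Dep = []"
    and "100 * (length (write_fm f) + 1) \<le> t'"
  shows "ev (Occ_Fm # K) s t' (x \<in> fv_fm f)"
  using assms
proof (induction f arbitrary: s u t' K)
  case (FEq y z)
  let ?s = "s(Ex IV := write_var y @ write_var z @ u)"
  have nd: "no_digit u" using FEq.prems(2) by (rule no_var_no_digit)
  define T where "T = 6 * (length (write_var y) + length (write_var z)) + 40"
  have 1: "ev ((Pop (Ex IV) ;; Eq_Num (Ex IV) Arg ;; Halt True) # Occ_Fm # K) ?s T (y = x)"
    by (rule ev_Pop_Eq_Arg[where u = "write_var z @ u"]) (use FEq.prems in \<open>simp_all add: T_def\<close>)
  have 2: "ev ((Pop (Ex IV) ;; Drop_While digit (Ex IV) ;; Pop (Ex IV) ;; Eq_Num (Ex IV) Arg ;; Halt True) # Occ_Fm # K) ?s T (z = x)"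
  proof (rule ev_intros(1), rule ev_intros(2), rule ev_intros(1), rule ev_Drop_While)
    show "ev ((Pop (Ex IV) ;; Eq_Num (Ex IV) Arg ;; Halt True) # Occ_Fm # K)
      ((?s(Ex IV := tl (?s (Ex IV))))(Ex IV := dropWhile digit ((?s(Ex IV := tl (?s (Ex IV)))) (Ex IV)))) (4 * length (write_var z) + 15) (z = x)"
      by (rule ev_Pop_Eq_Arg[where u = u]) (use FEq.prems nd in \<open>simp_all add: write_var_def[of y] takeWhile_digits\<close>)
  qed (simp_all add: write_var_def[of y] takeWhile_digits T_def)
  have "ev (Or (Pop (Ex IV) ;; Eq_Num (Ex IV) Arg ;; Halt True)
        (Pop (Ex IV) ;; Drop_While digit (Ex IV) ;; Pop (Ex IV) ;; Eq_Num (Ex IV) Arg ;; Halt True) # Occ_Fm # K) ?s (T + 1) (y = x \<or> z = x)"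
    by (rule ev_Or[OF 1 2]) simp
  then have e: "ev (Or (Pop (Ex IV) ;; Eq_Num (Ex IV) Arg ;; Halt True)
        (Pop (Ex IV) ;; Drop_While digit (Ex IV) ;; Pop (Ex IV) ;; Eq_Num (Ex IV) Arg ;; Halt True) # Occ_Fm # K) ?s (T + 1) (x \<in> fv_fm (FEq y z))"
    by (rule ev_weaken) auto
  have s: "s (Ex IV) = TEq # write_var y @ write_var z @ u" using FEq.prems(1) by simp
  have top: "tops s (Ex IV) = Some TEq" using s by (simp add: tops_def)
  show ?case
  proof (rule ev_loop_True[OF Occ_Fm_def, where t = "T + 10"], simp)
    show "T + 10 < t'" using FEq.prems(5) by (simp add: T_def)
  qed (rule ev_If_True ev_intros(1,2) ev_weaken[OF e] | simp add: top s)+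
next
  case (FNot f)
  have s: "s (Ex IV) = TNot # write_fm f @ u" using FNot.prems(1) by simp
  have top: "tops s (Ex IV) = Some TNot" using s by (simp add: tops_def)
  have e: "ev (Occ_Fm # K) (s(Ex IV := write_fm f @ u)) (100 * (length (write_fm f) + 1)) (x \<in> fv_fm (FNot f))"
    unfolding fv_fm.simps by (rule FNot.IH[where u = u]) (use FNot.prems in simp_all)
  show ?case
  proof (rule ev_loop_True[OF Occ_Fm_def, where t = "100 * (length (write_fm f) + 1) + 10"], simp)
    show "100 * (length (write_fm f) + 1) + 10 < t'" using FNot.prems(5) by simp
  qed (rule ev_If_True ev_If_False ev_intros(1,2) ev_weaken[OF e] | simp add: top s)+
next
  case (FAnd f g)
  let ?s = "s(Ex IV := write_fm f @ write_fm g @ u)"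
  define T where "T = 100 * (length (write_fm f) + length (write_fm g) + 1)"
  have "ev (Occ_Fm # K) ?s (100 * (length (write_fm f) + 1)) (x \<in> fv_fm f)"
    by (rule FAnd.IH(1)[where u = "write_fm g @ u"]) (use FAnd.prems in simp_all)
  then have 1: "ev (Skip # Occ_Fm # K) ?s (T + 10) (x \<in> fv_fm f)"
    using ev_mono[of "Occ_Fm # K" ?s "100 * (length (write_fm f) + 1)" _ "T + 9"] by (simp add: T_def)
  have "ev (Occ_Fm # K) (s(Ex IV := write_fm g @ u)) (100 * (length (write_fm g) + 1)) (x \<in> fv_fm g)"
    by (rule FAnd.IH(2)[where u = u]) (use FAnd.prems in simp_all)
  then have e: "ev (Occ_Fm # K) (?s(Ex IV := write_fm g @ u)) (100 * (length (write_fm g) + 1)) (x \<in> fv_fm g)"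
    by (rule ev_weaken) (simp_all add: fun_eq_iff)
  have 2: "ev (Skip_Fm IV # Occ_Fm # K) ?s (T + 10) (x \<in> fv_fm g)"
    by (rule ev_Skip_Fm[where f = f and u = "write_fm g @ u", OF _ _ _ e]) (use FAnd.prems in \<open>simp_all add: T_def\<close>)
  have "ev (Or Skip (Skip_Fm IV) # Occ_Fm # K) ?s (T + 11) (x \<in> fv_fm f \<or> x \<in> fv_fm g)"
    by (rule ev_Or[OF 1 2]) simp
  then have e: "ev (Or Skip (Skip_Fm IV) # Occ_Fm # K) ?s (T + 11) (x \<in> fv_fm (FAnd f g))" by simp
  have s: "s (Ex IV) = TAnd # write_fm f @ write_fm g @ u" using FAnd.prems(1) by simp
  have top: "tops s (Ex IV) = Some TAnd" using s by (simp add: tops_def)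
  show ?case
  proof (rule ev_loop_True[OF Occ_Fm_def, where t = "T + 20"], simp)
    show "T + 20 < t'" using FAnd.prems(5) by (simp add: T_def)
  qed (rule ev_If_True ev_If_False ev_intros(1,2) ev_weaken[OF e] | simp add: top s)+
next
  case (FOr f g)
  let ?s = "s(Ex IV := write_fm f @ write_fm g @ u)"
  define T where "T = 100 * (length (write_fm f) + length (write_fm g) + 1)"
  have "ev (Occ_Fm # K) ?s (100 * (length (write_fm f) + 1)) (x \<in> fv_fm f)"
    by (rule FOr.IH(1)[where u = "write_fm g @ u"]) (use FOr.prems in simp_all)
  then have 1: "ev (Skip # Occ_Fm # K) ?s (T + 10) (x \<in> fv_fm f)"
    using ev_mono[of "Occ_Fm # K" ?s "100 * (length (write_fm f) + 1)" _ "T + 9"] by (simp add: T_def)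
  have "ev (Occ_Fm # K) (s(Ex IV := write_fm g @ u)) (100 * (length (write_fm g) + 1)) (x \<in> fv_fm g)"
    by (rule FOr.IH(2)[where u = u]) (use FOr.prems in simp_all)
  then have e: "ev (Occ_Fm # K) (?s(Ex IV := write_fm g @ u)) (100 * (length (write_fm g) + 1)) (x \<in> fv_fm g)"
    by (rule ev_weaken) (simp_all add: fun_eq_iff)
  have 2: "ev (Skip_Fm IV # Occ_Fm # K) ?s (T + 10) (x \<in> fv_fm g)"
    by (rule ev_Skip_Fm[where f = f and u = "write_fm g @ u", OF _ _ _ e]) (use FOr.prems in \<open>simp_all add: T_def\<close>)
  have "ev (Or Skip (Skip_Fm IV) # Occ_Fm # K) ?s (T + 11) (x \<in> fv_fm f \<or> x \<in> fv_fm g)"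
    by (rule ev_Or[OF 1 2]) simp
  then have e: "ev (Or Skip (Skip_Fm IV) # Occ_Fm # K) ?s (T + 11) (x \<in> fv_fm (FOr f g))" by simp
  have s: "s (Ex IV) = TOr # write_fm f @ write_fm g @ u" using FOr.prems(1) by simp
  have top: "tops s (Ex IV) = Some TOr" using s by (simp add: tops_def)
  show ?case
  proof (rule ev_loop_True[OF Occ_Fm_def, where t = "T + 20"], simp)
    show "T + 20 < t'" using FOr.prems(5) by (simp add: T_def)
  qed (rule ev_If_True ev_If_False ev_intros(1,2) ev_weaken[OF e] | simp add: top s)+
next
  case (FEx y f)
  let ?s = "s(Ex IV := write_var y @ write_fm f @ u)"
  define T where "T = 100 * (length (write_fm f) + 1)"
  have "ev (Occ_Fm # K) (s(Ex IV := write_fm f @ u)) T (x \<in> fv_fm f)"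
    by (rule FEx.IH[where u = u]) (use FEx.prems in \<open>simp_all add: T_def\<close>)
  then have "ev (Occ_Fm # K) (?s(Ex IV := write_fm f @ u)) T (x \<in> fv_fm f)"
    by (rule ev_weaken) (simp_all add: fun_eq_iff)
  then have "ev (Avoid # Occ_Fm # K) ?s (T + 6 * length (write_var y) + 40) (y \<noteq> x \<and> x \<in> fv_fm f)"
    by (rule ev_Avoid[where u = "write_fm f @ u" and y = y, rotated 3]) (use FEx.prems in simp_all)
  then have e: "ev (Avoid # Occ_Fm # K) ?s (T + 6 * length (write_var y) + 40) (x \<in> fv_fm (FEx y f))"
    by (rule ev_weaken) auto
  have s: "s (Ex IV) = TEx # write_var y @ write_fm f @ u" using FEx.prems(1) by simp
  have top: "tops s (Ex IV) = Some TEx" using s by (simp add: tops_def)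
  show ?case
  proof (rule ev_loop_True[OF Occ_Fm_def, where t = "T + 6 * length (write_var y) + 50"], simp)
    show "T + 6 * length (write_var y) + 50 < t'" using FEx.prems(5) length_write_var[of y] by (simp add: T_def)
  qed (rule ev_If_True ev_If_False ev_intros(1,2) ev_weaken[OF e] | simp add: top s)+
next
  case (FAll y f)
  let ?s = "s(Ex IV := write_var y @ write_fm f @ u)"
  define T where "T = 100 * (length (write_fm f) + 1)"
  have "ev (Occ_Fm # K) (s(Ex IV := write_fm f @ u)) T (x \<in> fv_fm f)"
    by (rule FAll.IH[where u = u]) (use FAll.prems in \<open>simp_all add: T_def\<close>)
  then have "ev (Occ_Fm # K) (?s(Ex IV := write_fm f @ u)) T (x \<in> fv_fm f)"
    by (rule ev_weaken) (simp_all add: fun_eq_iff)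
  then have "ev (Avoid # Occ_Fm # K) ?s (T + 6 * length (write_var y) + 40) (y \<noteq> x \<and> x \<in> fv_fm f)"
    by (rule ev_Avoid[where u = "write_fm f @ u" and y = y, rotated 3]) (use FAll.prems in simp_all)
  then have e: "ev (Avoid # Occ_Fm # K) ?s (T + 6 * length (write_var y) + 40) (x \<in> fv_fm (FAll y f))"
    by (rule ev_weaken) auto
  have s: "s (Ex IV) = TAll # write_var y @ write_fm f @ u" using FAll.prems(1) by simp
  have top: "tops s (Ex IV) = Some TAll" using s by (simp add: tops_def)
  show ?case
  proof (rule ev_loop_True[OF Occ_Fm_def, where t = "T + 6 * length (write_var y) + 50"], simp)
    show "T + 6 * length (write_var y) + 50 < t'" using FAll.prems(5) length_write_var[of y] by (simp add: T_def)
  qed (rule ev_If_True ev_If_False ev_intros(1,2) ev_weaken[OF e] | simp add: top s)+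
qed

lemma ev_Occ:
  assumes "s (Ex IV) = write_expr e @ u" "no_digit u" "length (s (Ex IV)) \<le> n" "s Arg = write_nat x" "clean l s"
    and "length (write_expr e) \<le> d" "300 * (n + 1) * (d + 1) \<le> t'"
  shows "ev (Occ # K) s t' (x \<in> fv e)"
  using assms
proof (induction d arbitrary: s e u t' rule: less_induct)
  case (less d)
  have "300 * n + 300 = 300 * (n + 1) * 1" by simp
  also have "\<dots> \<le> 300 * (n + 1) * (d + 1)" by (rule mult_le_mono2) simp
  also have "\<dots> \<le> t'" by (rule less.prems(7))
  finally have t1: "300 * n + 300 \<le> t'" .
  show ?case
  proof (cases e)
    case (EVar y)
    have "length (write_var y) \<le> n" using less.prems(1,3) EVar by simp
    then have 1: "ev ((Pop (Ex IV) ;; Eq_Num (Ex IV) Arg ;; Halt True) # Occ # K) s (4 * n + 15) (y = x)"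
      by (intro ev_Pop_Eq_Arg[where u = u]) (use less.prems EVar in simp_all)
    have v: "x \<in> fv e \<longleftrightarrow> y = x" using EVar by auto
    have top: "tops s (Ex IV) = Some TVar" using less.prems(1) EVar by (simp add: tops_def write_var_def)
    show ?thesis unfolding v
    proof (rule ev_loop_True[OF Occ_def, where t = "4 * n + 16"], simp)
      show "4 * n + 16 < t'" using t1 by linarith
    qed (rule ev_If_True ev_weaken[OF 1] | simp add: top)+
  next
    case (EUnion bs)
    define T where "T = 300 * (n + 1) * d"
    have d: "300 * (n + 1) * (d + 1) = T + 300 * n + 300" by (simp add: T_def algebra_simps)
    let ?Or = "Or Occ_Fm (Drop_While (\<lambda>_. True) (Ex IV) ;; Move_While (\<lambda>_. True) Tmp (Ex IV))"
    have pick: "ev ((Pop (Ex IV) ;; Avoid_All ;; Pop (Ex IV) ;; ?Or) # Occ # K)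
        (s(Ex IV := builder_rest xs f u', Tmp := rev (write_expr e'))) (T + 200 * n + 200) (x \<in> fv_builder (Builder e' xs f))"
      if b: "Builder e' xs f \<in> set bs" and u': "length (builder_rest xs f u') \<le> length (s (Ex IV))" for e' xs f u'
    proof -
      have len: "length (concat (map write_var xs)) \<le> n" "length (write_fm f) \<le> n" "length (write_fm f @ TRBrace # u') \<le> n"
        using u' less.prems(3) by (simp_all add: builder_rest_def)
      have lt: "length (write_expr e') < length (write_expr e)"
        using length_write_member[OF b] by (simp add: EUnion)
      have le': "length (write_expr e') \<le> n" using lt less.prems(1,3) by simp
      let ?s = "s(Ex IV := write_fm f @ TRBrace # u', Tmp := rev (write_expr e'))"
      have 1: "ev (Occ_Fm # Occ # K) ?s (T + 100 * n + 100) (x \<in> fv_fm f)"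
        by (rule ev_Occ_Fm[where u = "TRBrace # u'"])
           (use less.prems(4) cleanD(3)[OF less.prems(5)] len in \<open>simp_all add: no_var_def var_token_def digit_def\<close>)
      have ih: "ev (Occ # K) (s(Ex IV := write_expr e')) T (x \<in> fv e')"
      proof (rule less.IH[of "d - 1" _ _ "[]"])
        show "d - 1 < d" "length (write_expr e') \<le> d - 1" using lt less.prems(6) by linarith+
        then have "d - 1 + 1 = d" by linarith
        then show "300 * (n + 1) * (d - 1 + 1) \<le> T" unfolding T_def by simp
      qed (use less.prems(4,5) le' in \<open>simp_all add: fun_upd_same fun_upd_other del: fun_upd_apply\<close>)
      have m: "ev (Move_While (\<lambda>_. True) Tmp (Ex IV) # Occ # K) (s(Ex IV := [], Tmp := rev (write_expr e'))) (T + 4 * n + 1) (x \<in> fv e')"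
        by (rule ev_Move_All[where t = T], rule ev_weaken[OF ih]) (use cleanD(4)[OF less.prems(5)] le' in \<open>simp_all add: fun_eq_iff\<close>)
      have "ev (Drop_While (\<lambda>_. True) (Ex IV) # Move_While (\<lambda>_. True) Tmp (Ex IV) # Occ # K) ?s (T + 6 * n + 2) (x \<in> fv e')"
        by (rule ev_Drop_All[where t = "T + 4 * n + 1"], rule ev_weaken[OF m]) (use len(3) in \<open>simp_all add: fun_eq_iff\<close>)
      then have 2: "ev ((Drop_While (\<lambda>_. True) (Ex IV) ;; Move_While (\<lambda>_. True) Tmp (Ex IV)) # Occ # K) ?s (T + 100 * n + 100) (x \<in> fv e')"
        by (rule ev_SeqI) simp
      have 3: "ev (?Or # Occ # K) ?s (T + 100 * n + 101) (x \<in> fv_fm f \<or> x \<in> fv e')"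
        by (rule ev_Or[OF 1 2]) simp
      let ?c = "TComma # write_fm f @ TRBrace # u'"
      have 4: "ev ((Pop (Ex IV) ;; ?Or) # Occ # K) ((s(Ex IV := concat (map write_var xs) @ ?c, Tmp := rev (write_expr e')))(Ex IV := ?c))
          (T + 100 * n + 105) (x \<in> fv_fm f \<or> x \<in> fv e')"
        by (rule ev_intros ev_weaken[OF 3])+ (simp_all add: fun_eq_iff)
      have "ev (Avoid_All # (Pop (Ex IV) ;; ?Or) # Occ # K) (s(Ex IV := concat (map write_var xs) @ ?c, Tmp := rev (write_expr e')))
          (T + 160 * n + 110) (x \<notin> set xs \<and> (x \<in> fv_fm f \<or> x \<in> fv e'))"
        by (rule ev_Avoid_All[OF _ _ 4]) (use less.prems(4) len in simp_all)
      then have 5: "ev (Avoid_All # (Pop (Ex IV) ;; ?Or) # Occ # K) (s(Ex IV := concat (map write_var xs) @ ?c, Tmp := rev (write_expr e')))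
          (T + 160 * n + 110) (x \<in> fv_builder (Builder e' xs f))"
        by (rule ev_weaken) auto
      show ?thesis
        by (rule ev_intros ev_weaken[OF 5])+ (simp_all add: fun_eq_iff builder_rest_def)
    qed
    have "ev (Pick IV # (Pop (Ex IV) ;; Avoid_All ;; Pop (Ex IV) ;; ?Or) # Occ # K) s (T + 250 * n + 250) (\<exists>b\<in>set bs. x \<in> fv_builder b)"
    proof (rule ev_Pick[where u = u and l = l, OF _ less.prems(5) pick])
      show "s (Ex IV) = write_expr (EUnion bs) @ u" using less.prems(1) EUnion by simp
      have "length (write_expr (EUnion bs)) \<le> n" using less.prems(1,3) EUnion by simp
      then show "T + 200 * n + 200 + 30 * length (write_expr (EUnion bs)) + 20 \<le> T + 250 * n + 250" by linarith
    qed
    then have "ev (Pick IV # (Pop (Ex IV) ;; Avoid_All ;; Pop (Ex IV) ;; ?Or) # Occ # K) s (T + 250 * n + 250) (x \<in> fv e)"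
      using EUnion by (simp only: fv.simps UN_iff)
    then have 6: "ev ((Pick IV ;; Pop (Ex IV) ;; Avoid_All ;; Pop (Ex IV) ;; ?Or) # Occ # K) s (T + 250 * n + 251) (x \<in> fv e)"
      by (rule ev_SeqI) simp
    have top: "tops s (Ex IV) = Some TLParen" using less.prems(1) EUnion by (simp add: tops_def)
    show ?thesis
    proof (rule ev_loop_True[OF Occ_def, where t = "T + 250 * n + 252"], simp)
      show "T + 250 * n + 252 < t'" using less.prems(7) d by linarith
    qed (rule ev_If_False ev_weaken[OF 6] | simp add: top)+
  qed
qed

text \<open>Membership in the domain is reduced to \<open>Lookup\<close> by guessing the
  value.\<close>

definition In_Env :: "(reg, token) com" where
  "In_Env = (Guess Num ;; Lookup IV)"

lemma ev_In_Env:
  assumes "s (Ex IV) = write_nat x @ u" "no_digit u" "s (En IV) = write_env ps" "snd ` set ps \<subseteq> {..<2 ^ l}"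
    and "s Len = replicate l TOne" "s Cnt = []" "s Num = []" "30 * length (write_env ps) + 20 * l + 40 \<le> t'"
  shows "ev (In_Env # K) s t' (x \<in> fst ` set ps)"
proof -
  have "ev (Lookup IV # K) (s(Num := write_nat v @ s Num)) (30 * length (write_env ps) + 10) (map_of ps x = Some v)" for v
    by (rule ev_Lookup[where u = u]) (use assms in simp_all)
  then have "ev (Guess Num # Lookup IV # K) s (30 * length (write_env ps) + 20 * l + 35) (\<exists>v<2 ^ l. map_of ps x = Some v)"
    by (rule ev_Guess[OF assms(5,6), rotated 2]) simp_all
  moreover have "(\<exists>v<2 ^ l. map_of ps x = Some v) \<longleftrightarrow> x \<in> fst ` set ps"
  proof
    assume "x \<in> fst ` set ps"
    then show "\<exists>v<2 ^ l. map_of ps x = Some v"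
      using valuation_in[of x ps] map_of_valuation[of x ps] assms(4) by blast
  next
    assume "\<exists>v<2 ^ l. map_of ps x = Some v"
    then show "x \<in> fst ` set ps" by (metis map_of_eq_None_iff option.distinct(1))
  qed
  ultimately have 1: "ev (Guess Num # Lookup IV # K) s (30 * length (write_env ps) + 20 * l + 35) (x \<in> fst ` set ps)"
    by (simp only:)
  show ?thesis unfolding In_Env_def by (rule ev_SeqI[OF 1]) (use assms(8) in simp)
qed

definition Dom :: "(reg, token) com" where
  "Dom = (Drop_While (\<lambda>_. True) (Ex IV) ;; Move_While (\<lambda>_. True) Arg Var ;; Move_While (\<lambda>_. True) Var (Ex IV) ;; In_Env)"

lemma ev_Dom:
  assumes "s Arg = write_nat x" "s (En IV) = write_env ps" "snd ` set ps \<subseteq> {..<2 ^ l}" "clean l s"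
    and "30 * length (write_env ps) + 20 * l + 2 * length (s (Ex IV)) + 8 * length (write_nat x) + 60 \<le> t'"
  shows "ev (Dom # K) s t' (x \<in> fst ` set ps)"
proof -
  define T where "T = 30 * length (write_env ps) + 20 * l + 40"
  have 1: "ev (In_Env # K) (s(Ex IV := write_nat x, Arg := [])) T (x \<in> fst ` set ps)"
    by (rule ev_In_Env[where u = "[]", OF _ _ _ assms(3)]) (use assms(2) cleanD[OF assms(4)] in \<open>simp_all add: T_def\<close>)
  have "ev (Move_While (\<lambda>_. True) Var (Ex IV) # In_Env # K) (s(Ex IV := [], Arg := [], Var := rev (write_nat x))) (T + 4 * length (write_nat x) + 1) (x \<in> fst ` set ps)"
    by (rule ev_Move_All[where t = T], rule ev_weaken[OF 1]) (use cleanD(5)[OF assms(4)] in \<open>simp_all add: fun_eq_iff\<close>)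
  then have 2: "ev ((Move_While (\<lambda>_. True) Var (Ex IV) ;; In_Env) # K) (s(Ex IV := [], Arg := [], Var := rev (write_nat x))) (T + 4 * length (write_nat x) + 2) (x \<in> fst ` set ps)"
    by (rule ev_SeqI) simp
  have "ev (Move_While (\<lambda>_. True) Arg Var # (Move_While (\<lambda>_. True) Var (Ex IV) ;; In_Env) # K) (s(Ex IV := [])) (T + 8 * length (write_nat x) + 3) (x \<in> fst ` set ps)"
    by (rule ev_Move_All[where t = "T + 4 * length (write_nat x) + 2"], rule ev_weaken[OF 2])
       (use cleanD(5)[OF assms(4)] assms(1) in \<open>simp_all add: fun_eq_iff\<close>)
  then have 3: "ev ((Move_While (\<lambda>_. True) Arg Var ;; Move_While (\<lambda>_. True) Var (Ex IV) ;; In_Env) # K) (s(Ex IV := [])) (T + 8 * length (write_nat x) + 4) (x \<in> fst ` set ps)"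
    by (rule ev_SeqI) simp
  have "ev (Drop_While (\<lambda>_. True) (Ex IV) # (Move_While (\<lambda>_. True) Arg Var ;; Move_While (\<lambda>_. True) Var (Ex IV) ;; In_Env) # K) s
      (T + 8 * length (write_nat x) + 4 + 2 * length (s (Ex IV)) + 1) (x \<in> fst ` set ps)"
    by (rule ev_Drop_All[OF 3]) simp
  then show ?thesis unfolding Dom_def by (rule ev_SeqI) (use assms(5) in \<open>simp add: T_def\<close>)
qed

text \<open>Equality of two sets of variables is tested for every name below \<open>2 ^ l\<close>.
  This suffices because both sets consist of names written in the input, whose length bounds their
  number of bits.\<close>

definition Fv_Check :: "(reg, token) com" where
  "Fv_Check = (Neg ;; Guess Arg ;; Neg ;; Or (And Occ Dom) (And (Neg ;; Occ) (Neg ;; Dom)))"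

lemma ev_Fv_Check:
  assumes s: "s (Ex IV) = write_expr e @ u" "no_digit u" "length (s (Ex IV)) \<le> n" "s (En IV) = write_env ps" "length (write_env ps) \<le> n"
    and l: "snd ` set ps \<subseteq> {..<2 ^ l}" "fst ` set ps \<subseteq> {..<2 ^ l}" "fv e \<subseteq> {..<2 ^ l}" "l \<le> n"
    and cl: "clean l s" "s Arg = []" and t: "400 * (n + 1) * (n + 1) + 100 \<le> t'"
  shows "ev (Fv_Check # K) s t' (fv e = fst ` set ps)"
proof -
  define T where "T = 300 * (n + 1) * (n + 1)"
  have "300 * n + 300 = 300 * (n + 1) * 1" by simp
  also have "\<dots> \<le> T" unfolding T_def by (rule mult_le_mono2) simp
  finally have T: "300 * n + 300 \<le> T" .
  have T': "400 * (n + 1) * (n + 1) = T + 100 * (n * n) + 200 * n + 100" by (simp add: T_def algebra_simps)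
  have g: "ev (Neg # Or (And Occ Dom) (And (Neg ;; Occ) (Neg ;; Dom)) # K) (s(Arg := write_nat x @ s Arg)) (T + 50)
      (\<not> (x \<in> fv e \<longleftrightarrow> x \<in> fst ` set ps))" if x: "x < 2 ^ l" for x
  proof -
    let ?s = "s(Arg := write_nat x @ s Arg)"
    have lx: "length (write_nat x) \<le> n" using length_write_nat[OF x] l(4) by linarith
    have o: "ev (Occ # K) ?s T (x \<in> fv e)"
      by (rule ev_Occ[where u = u and n = n and l = l and d = n]) (use s cl in \<open>simp_all add: T_def\<close>)
    have d: "ev (Dom # K) ?s T (x \<in> fst ` set ps)"
      by (rule ev_Dom[OF _ _ l(1)]) (use s cl lx T l(4) in simp_all)
    have o': "ev ((Neg ;; Occ) # K) ?s (T + 5) (x \<notin> fv e)"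
    proof -
      from o have 1: "ev (Occ # K) ?s T (\<not> x \<notin> fv e)" by (simp only: not_not)
      show ?thesis by (rule ev_intros ev_weaken[OF 1] refl)+ simp_all
    qed
    have d': "ev ((Neg ;; Dom) # K) ?s (T + 5) (x \<notin> fst ` set ps)"
    proof -
      from d have 1: "ev (Dom # K) ?s T (\<not> x \<notin> fst ` set ps)" by (simp only: not_not)
      show ?thesis by (rule ev_intros ev_weaken[OF 1] refl)+ simp_all
    qed
    have "ev (Or (And Occ Dom) (And (Neg ;; Occ) (Neg ;; Dom)) # K) ?s (T + 20)
        ((x \<in> fv e \<and> x \<in> fst ` set ps) \<or> (x \<notin> fv e \<and> x \<notin> fst ` set ps))"
      by (rule ev_Or[where t = "T + 15", OF ev_And[OF o d] ev_And[OF o' d']]) simp_all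
    then have e: "ev (Or (And Occ Dom) (And (Neg ;; Occ) (Neg ;; Dom)) # K) ?s (T + 20) (\<not> \<not> (x \<in> fv e \<longleftrightarrow> x \<in> fst ` set ps))"
      by (rule ev_weaken) auto
    show ?thesis by (rule ev_intros ev_weaken[OF e] refl)+ simp_all
  qed
  have "ev (Guess Arg # (Neg ;; Or (And Occ Dom) (And (Neg ;; Occ) (Neg ;; Dom))) # K) s (T + 80 + 20 * l)
      (\<exists>x<2 ^ l. \<not> (x \<in> fv e \<longleftrightarrow> x \<in> fst ` set ps))"
  proof (rule ev_Guess[OF cleanD(1,2)[OF cl(1)], where t = "T + 51"])
    fix x :: nat assume "x < 2 ^ l"
    from g[OF this] show "ev ((Neg ;; Or (And Occ Dom) (And (Neg ;; Occ) (Neg ;; Dom))) # K) (s(Arg := write_nat x @ s Arg)) (T + 51)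
      (\<not> (x \<in> fv e \<longleftrightarrow> x \<in> fst ` set ps))" by (rule ev_SeqI) simp
  qed simp_all
  moreover have "(\<exists>x<2 ^ l. \<not> (x \<in> fv e \<longleftrightarrow> x \<in> fst ` set ps)) \<longleftrightarrow> \<not> fv e = fst ` set ps"
    using l(2,3) by blast
  ultimately have 1: "ev (Guess Arg # (Neg ;; Or (And Occ Dom) (And (Neg ;; Occ) (Neg ;; Dom))) # K) s (T + 80 + 20 * l) (\<not> fv e = fst ` set ps)"
    by (simp only:)
  show ?thesis unfolding Fv_Check_def
    by (rule ev_intros ev_weaken[OF 1] refl)+ (use t T' l(4) in linarith)+
qed

text \<open>The search for a second occurrence consumes the environment, so it runs as a test in a
  branch of its own.\<close>

definition Distinct_Loop :: "(reg, token) com" where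
  "Distinct_Loop = While (\<lambda>t. t (En IV) \<noteq> None) (Pop (En IV) ;;
    Test (Neg ;; Drop_While (\<lambda>_. True) (Ex IV) ;; Move_While digit (En IV) Var ;; Move_While (\<lambda>_. True) Var (Ex IV) ;;
      Pop (En IV) ;; Drop_While digit (En IV) ;; In_Env) ;;
    Drop_While digit (En IV) ;; Pop (En IV) ;; Drop_While digit (En IV))"

definition Distinct_Check :: "(reg, token) com" where
  "Distinct_Check = (Distinct_Loop ;; Halt True)"

lemma ev_Distinct_Loop:
  assumes "length (s (Ex IV)) \<le> n" "s (En IV) = write_env ps" "length (write_env ps) \<le> n"
    and "snd ` set ps \<subseteq> {..<2 ^ l}" "l \<le> n" "clean l s" "100 * (n + 1) * (length ps + 1) \<le> t'"
  shows "ev (Distinct_Loop # Halt True # K) s t' (distinct (map fst ps))"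
  using assms
proof (induction ps arbitrary: s t')
  case Nil
  have "ev (Halt True # K) s 1 True" by simp
  then have "ev (Distinct_Loop # Halt True # K) s t' True"
    by (rule ev_loop_False[OF Distinct_Loop_def, rotated]) (use Nil(2,7) in \<open>simp_all add: tops_def\<close>)
  then show ?case by simp
next
  case (Cons p ps)
  obtain x a where p: "p = (x, a)" by force
  let ?K = "Distinct_Loop # Halt True # K"
  let ?D = "Drop_While digit (En IV) ;; Pop (En IV) ;; Drop_While digit (En IV)"
  let ?c = "TAtom # write_nat a @ write_env ps"
  define T where "T = 100 * (n + 1) * (length ps + 1)"
  have T: "100 * (n + 1) * (length (p # ps) + 1) = T + 100 * n + 100" by (simp add: T_def algebra_simps)
  have "length (write_env (p # ps)) = 2 + length (write_nat x) + length (write_nat a) + length (write_env ps)" by (simp add: p)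
  then have len: "2 + length (write_nat x) + length (write_nat a) + length (write_env ps) \<le> n" using Cons.prems(3) by linarith
  have e: "s (En IV) = TVar # write_nat x @ ?c" using Cons.prems(2) p by simp
  let ?s = "s(En IV := write_nat x @ ?c)"
  have snd: "snd ` set ps \<subseteq> {..<2 ^ l}" using Cons.prems(4) by simp
  note cl = cleanD[OF Cons.prems(6)]
  have test: "ev ((Neg ;; Drop_While (\<lambda>_. True) (Ex IV) ;; Move_While digit (En IV) Var ;; Move_While (\<lambda>_. True) Var (Ex IV) ;;
      Pop (En IV) ;; Drop_While digit (En IV) ;; In_Env) # Halt True # K') ?s (60 * n + 80) (x \<notin> fst ` set ps)" for K'
  proof -
    define B where "B = (\<not> x \<notin> fst ` set ps)"
    have B: "x \<in> fst ` set ps \<longleftrightarrow> B" by (simp add: B_def)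
    have 1: "ev (In_Env # Halt True # K') (s(En IV := write_env ps, Ex IV := write_nat x)) (50 * n + 40) B"
      unfolding B[symmetric]
      by (rule ev_In_Env[where u = "[]", OF _ _ _ snd]) (use cl Cons.prems(5) len in simp_all)
    have "ev (Drop_While digit (En IV) # In_Env # Halt True # K') (s(En IV := write_nat a @ write_env ps, Ex IV := write_nat x))
        (50 * n + 40 + 2 * length (write_nat a) + 1) B"
      by (rule ev_Drop_While[where t = "50 * n + 40"], rule ev_weaken[OF 1]) (simp_all add: takeWhile_digits fun_eq_iff)
    then have 2: "ev ((Drop_While digit (En IV) ;; In_Env) # Halt True # K') (s(En IV := write_nat a @ write_env ps, Ex IV := write_nat x))
        (50 * n + 42 + 2 * length (write_nat a)) B"
      by (rule ev_SeqI) simp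
    have 3: "ev ((Pop (En IV) ;; Drop_While digit (En IV) ;; In_Env) # Halt True # K') (s(En IV := ?c, Ex IV := write_nat x))
        (50 * n + 44 + 2 * length (write_nat a)) B"
      by (rule ev_intros ev_weaken[OF 2])+ (simp_all add: fun_eq_iff)
    have "ev (Move_While (\<lambda>_. True) Var (Ex IV) # (Pop (En IV) ;; Drop_While digit (En IV) ;; In_Env) # Halt True # K')
        (s(En IV := ?c, Ex IV := [], Var := rev (write_nat x))) (50 * n + 45 + 2 * length (write_nat a) + 4 * length (write_nat x)) B"
      by (rule ev_Move_All[where t = "50 * n + 44 + 2 * length (write_nat a)"], rule ev_weaken[OF 3]) (use cl in \<open>simp_all add: fun_eq_iff\<close>)
    then have 4: "ev ((Move_While (\<lambda>_. True) Var (Ex IV) ;; Pop (En IV) ;; Drop_While digit (En IV) ;; In_Env) # Halt True # K')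
        (s(En IV := ?c, Ex IV := [], Var := rev (write_nat x))) (50 * n + 46 + 2 * length (write_nat a) + 4 * length (write_nat x)) B"
      by (rule ev_SeqI) simp
    have "ev (Move_While digit (En IV) Var # (Move_While (\<lambda>_. True) Var (Ex IV) ;; Pop (En IV) ;; Drop_While digit (En IV) ;; In_Env) # Halt True # K')
        (s(En IV := write_nat x @ ?c, Ex IV := [])) (50 * n + 47 + 2 * length (write_nat a) + 8 * length (write_nat x)) B"
      by (rule ev_Move_While[where t = "50 * n + 46 + 2 * length (write_nat a) + 4 * length (write_nat x)"], rule ev_weaken[OF 4])
         (use cl in \<open>simp_all add: fun_eq_iff takeWhile_digits\<close>)
    then have 5: "ev ((Move_While digit (En IV) Var ;; Move_While (\<lambda>_. True) Var (Ex IV) ;; Pop (En IV) ;; Drop_While digit (En IV) ;; In_Env) # Halt True # K')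
        (s(En IV := write_nat x @ ?c, Ex IV := [])) (50 * n + 48 + 2 * length (write_nat a) + 8 * length (write_nat x)) B"
      by (rule ev_SeqI) simp
    have 6: "ev (Drop_While (\<lambda>_. True) (Ex IV) # (Move_While digit (En IV) Var ;; Move_While (\<lambda>_. True) Var (Ex IV) ;; Pop (En IV) ;; Drop_While digit (En IV) ;; In_Env) # Halt True # K')
        ?s (60 * n + 70) (\<not> (x \<notin> fst ` set ps))"
      unfolding B_def[symmetric]
      by (rule ev_Drop_All[where t = "50 * n + 48 + 2 * length (write_nat a) + 8 * length (write_nat x)"], rule ev_weaken[OF 5])
         (use Cons.prems(1) len in \<open>simp_all add: fun_eq_iff\<close>)
    show ?thesis by (rule ev_intros ev_weaken[OF 6] refl)+ simp_all
  qed
  have rest: "ev (?D # ?K) ?s (T + 4 * n + 20) (distinct (map fst ps))"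
  proof -
    have 1: "ev ?K (s(En IV := write_env ps)) T (distinct (map fst ps))"
      by (rule Cons.IH) (use Cons.prems(1,5,6) snd len in \<open>simp_all add: T_def fun_upd_same fun_upd_other del: fun_upd_apply\<close>)
    have 2: "ev (Drop_While digit (En IV) # ?K) (s(En IV := write_nat a @ write_env ps)) (T + 2 * length (write_nat a) + 1) (distinct (map fst ps))"
      by (rule ev_Drop_While[where t = T], rule ev_weaken[OF 1]) (simp_all add: takeWhile_digits fun_eq_iff)
    have 3: "ev ((Pop (En IV) ;; Drop_While digit (En IV)) # ?K) (s(En IV := ?c)) (T + 2 * length (write_nat a) + 4) (distinct (map fst ps))"
      by (rule ev_intros ev_weaken[OF 2])+ (simp_all add: fun_eq_iff)
    have "ev (Drop_While digit (En IV) # (Pop (En IV) ;; Drop_While digit (En IV)) # ?K) ?s (T + 2 * length (write_nat a) + 2 * length (write_nat x) + 5) (distinct (map fst ps))"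
      by (rule ev_Drop_While[where t = "T + 2 * length (write_nat a) + 4"], rule ev_weaken[OF 3]) (simp_all add: takeWhile_digits fun_eq_iff)
    then show ?thesis by (rule ev_SeqI) (use len in simp)
  qed
  define B where "B \<longleftrightarrow> x \<notin> fst ` set ps \<and> distinct (map fst ps)"
  have v: "distinct (map fst (p # ps)) \<longleftrightarrow> B" by (simp add: p B_def image_iff)
  have "ev (Test (Neg ;; Drop_While (\<lambda>_. True) (Ex IV) ;; Move_While digit (En IV) Var ;; Move_While (\<lambda>_. True) Var (Ex IV) ;;
      Pop (En IV) ;; Drop_While digit (En IV) ;; In_Env) # ?D # ?K) ?s (T + 60 * n + 87) B"
    unfolding B_def by (rule ev_Test[where t = "T + 60 * n + 80", OF ev_mono[OF test] ev_mono[OF rest]]) simp_all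
  then have 7: "ev ((Test (Neg ;; Drop_While (\<lambda>_. True) (Ex IV) ;; Move_While digit (En IV) Var ;; Move_While (\<lambda>_. True) Var (Ex IV) ;;
      Pop (En IV) ;; Drop_While digit (En IV) ;; In_Env) ;; ?D) # ?K) ?s (T + 60 * n + 88) B"
    by (rule ev_SeqI) simp
  show ?case unfolding v
  proof (rule ev_loop_True[OF Distinct_Loop_def, where t = "T + 60 * n + 91"])
    show "tops s (En IV) \<noteq> None" using e by (simp add: tops_def)
    show "T + 60 * n + 91 < t'" using Cons.prems(7) T by linarith
  qed (rule ev_intros(1,2) ev_weaken[OF 7] | simp add: e)+
qed

section \<open>The decision procedure\<close>

text \<open>The bound is \<open>l = N + 3\<close> for an input of length \<open>N\<close>. Then
  \<open>2 ^ l\<close> is at least \<open>8 * (N + 1)\<close>, which leaves the room of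
  \<open>4 * N\<close> atoms and exceeds the size bound \<open>2 * N + 6\<close> used for the
  program.\<close>

definition Prepare :: "(reg, token) com" where
  "Prepare = (Copy (\<lambda>_. TOne) (Ex IV) Len ;; Push Len (\<lambda>_. TOne) ;; Push Len (\<lambda>_. TOne) ;; Push Len (\<lambda>_. TOne) ;;
    Copy id (Ex IV) (En IV) ;; Drop_While (\<lambda>a. a \<noteq> TSemicolon) (En IV) ;; Pop (En IV))"

text \<open>The order matters: by \<open>ev_And\<close> a conjunct has to be analysed only if the
  previous one holds, and the specifications of the later checks presuppose the earlier
  ones.\<close>

definition Main :: "(reg, token) com" where
  "Main = And Parse (Prepare ;; And Fv_Check (And Distinct_Check Solve))"

lemma no_semicolon_var: "TSemicolon \<notin> set (write_var x)"
  using digits_write_nat[of x] by (auto simp: write_var_def list_all_iff digit_def)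

lemma no_semicolon_fm: "TSemicolon \<notin> set (write_fm f)"
  by (induction f) (simp_all add: no_semicolon_var)

lemma no_semicolon_expr: "TSemicolon \<notin> set (write_expr e)"
  and no_semicolon_builder: "TSemicolon \<notin> set (write_builder b)"
  by (induction e and b) (auto simp: no_semicolon_var no_semicolon_fm)

lemma dropWhile_semicolon: "dropWhile (\<lambda>a. a \<noteq> TSemicolon) (write_expr e @ TSemicolon # u) = TSemicolon # u"
proof -
  have "\<forall>a\<in>set (write_expr e). a \<noteq> TSemicolon" using no_semicolon_expr[of e] by auto
  then show ?thesis by (simp add: dropWhile_append2)
qed

lemma ev_Prepare:
  assumes w: "w = write_expr e @ TSemicolon # write_env ps"
    and K: "ev K ((\<lambda>_. [])(Ex IV := w, En IV := write_env ps, Len := replicate (length w + 3) TOne)) t v"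
    and t: "t + 30 * length w + 40 \<le> t'"
  shows "ev (Prepare # K) ((\<lambda>_. [])(Ex IV := w)) t' v"
proof -
  let ?N = "length w"
  let ?s = "(\<lambda>_. [])(Ex IV := w, Len := replicate (?N + 3) TOne)"
  have 1: "ev (Pop (En IV) # K) (?s(En IV := TSemicolon # write_env ps)) (t + 1) v"
    by (rule ev_intros ev_weaken[OF K])+ (simp_all add: fun_eq_iff)
  have le: "length (takeWhile (\<lambda>a. a \<noteq> TSemicolon) w) \<le> ?N" by (rule length_takeWhile_le)
  have "ev (Drop_While (\<lambda>a. a \<noteq> TSemicolon) (En IV) # Pop (En IV) # K) (?s(En IV := w)) (t + 2 * ?N + 2) v"
    by (rule ev_Drop_While[where t = "t + 1"], rule ev_weaken[OF 1])
       (use le in \<open>simp_all add: fun_eq_iff dropWhile_semicolon[of e, folded w]\<close>, simp add: w dropWhile_semicolon)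
  then have 2: "ev ((Drop_While (\<lambda>a. a \<noteq> TSemicolon) (En IV) ;; Pop (En IV)) # K) (?s(En IV := w)) (t + 2 * ?N + 3) v"
    by (rule ev_SeqI) simp
  have 3: "ev (Copy id (Ex IV) (En IV) # (Drop_While (\<lambda>a. a \<noteq> TSemicolon) (En IV) ;; Pop (En IV)) # K) ?s (t + 12 * ?N + 8) v"
    by (rule ev_Copy[where t = "t + 2 * ?N + 3", OF _ _ _ _ ev_weaken[OF 2]]) (simp_all add: fun_eq_iff)
  have 4: "ev ((Push Len (\<lambda>_. TOne) ;; Push Len (\<lambda>_. TOne) ;; Push Len (\<lambda>_. TOne) ;; Copy id (Ex IV) (En IV) ;;
      Drop_While (\<lambda>a. a \<noteq> TSemicolon) (En IV) ;; Pop (En IV)) # K) ((\<lambda>_. [])(Ex IV := w, Len := replicate ?N TOne)) (t + 12 * ?N + 20) v"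
    by (rule ev_intros ev_weaken[OF 3])+ (simp_all add: fun_eq_iff numeral_3_eq_3)
  have "ev (Copy (\<lambda>_. TOne) (Ex IV) Len # (Push Len (\<lambda>_. TOne) ;; Push Len (\<lambda>_. TOne) ;; Push Len (\<lambda>_. TOne) ;; Copy id (Ex IV) (En IV) ;;
      Drop_While (\<lambda>a. a \<noteq> TSemicolon) (En IV) ;; Pop (En IV)) # K) ((\<lambda>_. [])(Ex IV := w)) (t + 22 * ?N + 25) v"
    by (rule ev_Copy[where t = "t + 12 * ?N + 20", OF _ _ _ _ ev_weaken[OF 4]]) (simp_all add: fun_eq_iff map_replicate_const)
  then show ?thesis unfolding Prepare_def by (rule ev_SeqI) (use t in simp)
qed

section \<open>Sizes bounded by the length of the written input\<close>

lemma less_power_length_write_nat: "n < 2 ^ length (write_nat n)"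
proof (induction n rule: less_induct)
  case (less n)
  show ?case
  proof (cases "n = 0")
    case False
    then have "n div 2 < 2 ^ length (write_nat (n div 2))" by (intro less) simp
    then show ?thesis using False by (subst write_nat.simps) auto
  qed simp
qed

lemma less_if_length_write_var: "length (write_var x) \<le> l \<Longrightarrow> x < 2 ^ l"
proof -
  assume "length (write_var x) \<le> l"
  then have "(2::nat) ^ length (write_nat x) \<le> 2 ^ l" by (simp add: write_var_def)
  then show ?thesis using less_power_length_write_nat[of x] by linarith
qed

lemma length_write_env_ge: "length ps \<le> length (write_env ps)"
  by (induction ps) auto

lemma length_in_write_env: "(x, a) \<in> set ps \<Longrightarrow> length (write_var x) + length (write_atom a) \<le> length (write_env ps)"
proof (induction ps)
  case (Cons p ps)
  obtain y b where "p = (y, b)" by force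
  then show ?case using Cons by (auto simp: write_var_def write_atom_def)
qed simp

lemma length_free_fm: "x \<in> fv_fm f \<Longrightarrow> length (write_var x) \<le> length (write_fm f)"
  by (induction f) auto

lemma length_free: "x \<in> fv e \<Longrightarrow> length (write_var x) \<le> length (write_expr e)"
  and length_free_builder: "x \<in> fv_builder b \<Longrightarrow> length (write_var x) \<le> length (write_builder b)"
proof (induction e and b)
  case (EUnion bs)
  then obtain b where b: "b \<in> set bs" "x \<in> fv_builder b" by auto
  show ?case using EUnion.IH[OF b] length_write_member[OF b(1)] by linarith
next
  case (Builder e xs f)
  then show ?case using length_free_fm[of x f] by auto
qed auto

lemma ev_Distinct_Check:
  assumes "length (s (Ex IV)) \<le> n" "s (En IV) = write_env ps" "length (write_env ps) \<le> n"
    and "snd ` set ps \<subseteq> {..<2 ^ l}" "l \<le> n" "clean l s" "100 * (n + 1) * (n + 1) + 2 \<le> t'"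
  shows "ev (Distinct_Check # K) s t' (distinct (map fst ps))"
proof -
  have "length ps \<le> n" using length_write_env_ge[of ps] assms(3) by linarith
  then have "100 * (n + 1) * (length ps + 1) \<le> 100 * (n + 1) * (n + 1)" by (intro mult_le_mono2) simp
  then have "ev (Distinct_Loop # Halt True # K) s (100 * (n + 1) * (n + 1)) (distinct (map fst ps))"
    by (rule ev_Distinct_Loop[OF assms(1-6)])
  then show ?thesis unfolding Distinct_Check_def by (rule ev_SeqI) (use assms(7) in simp)
qed

text \<open>Writing is injective, so a word that parses stands for one representation only, and the
  existential quantifier over representations disappears.\<close>

lemma SetCovering_iff:
  "write_expr e @ TSemicolon # write_env ps \<in> SetCovering \<longleftrightarrow> fv e = fst ` set ps \<and> distinct (map fst ps) \<and>
    (\<exists>X S. value_of (e, ps) = kpair X S \<and> set_covering_instance X S \<and> has_finite_cover X S)"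
proof -
  have w: "write_expr e @ TSemicolon # write_env ps = write_representation (e, ps)"
    by (simp add: write_representation_def write_env_def)
  have "represented (e, ps) = value_of (e, ps)" by (simp add: represented_def value_of_def valuation_def)
  moreover have "write_representation (e, ps) = write_representation r \<longleftrightarrow> r = (e, ps)" for r
    using inj_eq[OF inj_write_representation] by (metis (no_types))
  moreover have "is_representation (e, ps) \<longleftrightarrow> fv e = fst ` set ps \<and> distinct (map fst ps)"
    by (auto simp: is_representation_def)
  ultimately show ?thesis unfolding w SetCovering_def by auto
qed

lemma ev_Main: "ev [Main] ((\<lambda>_. [])(Ex IV := w)) (13 * unit_cost (2 * length w + 6) + 500) (w \<in> SetCovering)"
proof -
  define N where "N = length w"
  \<comment> \<open>The size bound has to dominate the input length \<open>N\<close> and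
    \<open>Suc l = N + 4\<close>, and to stay below \<open>2 ^ l\<close>.\<close>
  define n where "n = 2 * N + 6"
  define l where "l = N + 3"
  define U where "U = unit_cost n"
  have U: "600 * (n * n) + 1200 * n + 600 \<le> U"
  proof -
    have "600 * ((n + 1) * (n + 1)) * 1 \<le> U" unfolding U_def unit_cost_def by (rule mult_le_mono2) simp
    then show ?thesis by (simp add: algebra_simps)
  qed
  let ?s0 = "(\<lambda>_. [])(Ex IV := w)"
  let ?Rest = "Prepare ;; And Fv_Check (And Distinct_Check Solve)"
  have parse: "ev [Parse] ?s0 (13 * U + 490) (\<exists>e ps. w = write_expr e @ TSemicolon # write_env ps)"
    by (rule ev_Parse) (use U in \<open>simp_all add: n_def N_def\<close>)
  have "ev [And Parse ?Rest] ?s0 (13 * U + 500) (w \<in> SetCovering)"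
  proof (cases "\<exists>e ps. w = write_expr e @ TSemicolon # write_env ps")
    case False
    have "w \<notin> SetCovering"
    proof
      assume "w \<in> SetCovering"
      then obtain e ps where "w = write_representation (e, ps)" by (auto simp: SetCovering_def)
      then show False using False by (auto simp: write_representation_def write_env_def)
    qed
    moreover have "ev [And Parse ?Rest] ?s0 (13 * U + 500) ((\<exists>e ps. w = write_expr e @ TSemicolon # write_env ps) \<and> True)"
      by (rule ev_And[OF parse]) (use False in simp_all)
    ultimately show ?thesis using False by simp
  next
    case True
    then obtain e ps where w: "w = write_expr e @ TSemicolon # write_env ps" by blast
    define s where "s = (\<lambda>_. [])(Ex IV := w, En IV := write_env ps, Len := replicate (length w + 3) TOne)"
    have sr: "s (Ex IV) = w" "s (En IV) = write_env ps" "s Arg = []" "clean l s"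
      by (simp_all add: s_def clean_def l_def N_def)
    have lw: "length (write_expr e) + length (write_env ps) + 1 = N" by (simp add: N_def w)
    have small: "length (write_var x) \<le> N" "x < 2 ^ l" "a < 2 ^ l" if "(x, a) \<in> set ps" for x a
    proof -
      have 1: "length (write_var x) + length (write_atom a) \<le> N" using length_in_write_env[OF that] lw by linarith
      then show "length (write_var x) \<le> N" by linarith
      show "x < 2 ^ l" by (rule less_if_length_write_var) (use 1 in \<open>simp add: l_def\<close>)
      show "a < 2 ^ l" by (rule less_if_length_write_var) (use 1 in \<open>simp add: l_def write_var_def write_atom_def\<close>)
    qed
    have ps: "snd ` set ps \<subseteq> {..<2 ^ l}" "fst ` set ps \<subseteq> {..<2 ^ l}" using small(2,3) by auto
    have fv: "fv e \<subseteq> {..<2 ^ l}"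
    proof
      fix x assume "x \<in> fv e"
      then have "length (write_var x) \<le> l" using length_free[of x e] lw unfolding l_def by linarith
      then have "x < 2 ^ l" by (rule less_if_length_write_var)
      then show "x \<in> {..<2 ^ l}" by simp
    qed
    have ln: "l \<le> n" "Suc l \<le> n" by (simp_all add: l_def n_def)
    have lE: "length (s (Ex IV)) \<le> n" "length (write_env ps) \<le> n" using lw by (simp_all add: sr N_def n_def)
    have f: "ev [Fv_Check] s (12 * U + 230) (fv e = fst ` set ps)"
    proof (rule ev_Fv_Check[OF _ _ lE(1) sr(2) lE(2) ps fv ln(1) sr(4,3)])
      show "s (Ex IV) = write_expr e @ TSemicolon # write_env ps" using sr(1) w by simp
      have "400 * (n + 1) * (n + 1) = 400 * (n * n) + 800 * n + 400" by (simp add: algebra_simps)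
      then show "400 * (n + 1) * (n + 1) + 100 \<le> 12 * U + 230" using U by linarith
    qed simp
    have d: "ev [Distinct_Check] s (12 * U + 220) (distinct (map fst ps))"
    proof (rule ev_Distinct_Check[OF lE(1) sr(2) lE(2) ps(1) ln(1) sr(4)])
      have "100 * (n + 1) * (n + 1) = 100 * (n * n) + 200 * n + 100" by (simp add: algebra_simps)
      then show "100 * (n + 1) * (n + 1) + 2 \<le> 12 * U + 220" using U by linarith
    qed
    let ?v = "\<exists>X S. value_of (e, ps) = kpair X S \<and> set_covering_instance X S \<and> has_finite_cover X S"
    have v: "ev [Solve] s (12 * U + 220) ?v" if fvs: "fv e = fst ` set ps"
    proof -
      have ok: "obj_ok N l (e, ps)" using lw fvs ps(1) by (simp add: obj_ok_def)
      have pw: "N + 1 \<le> 2 ^ N" using less_exp[of N] by linarith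
      have l8: "(2::nat) ^ l = 8 * 2 ^ N" by (simp add: l_def power_add)
      have pok: "prog_ok N n l (e, ps)"
      proof (rule prog_okI[OF ok])
        show "env_ok n l ps" unfolding env_ok_def using small(1,3) by (fastforce simp: n_def)
        show "length (write_expr e) + length ps \<le> n" using lw length_write_env_ge[of ps] unfolding n_def by linarith
        show "n < 2 ^ l" "4 * N \<le> 2 ^ l" using pw unfolding l8 n_def by linarith+
      qed (rule ln)
      have "holds n IV s (e, ps)" using sr(1,2) lE(1) w by (auto simp: holds_def)
      then have "ev [Solve] s (12 * U + 220) (\<exists>X\<in>mems l (e, ps). \<exists>P\<in>mems l (e, ps). \<exists>S\<in>mems l P. cover_test l (e, ps) X P S)"
        by (rule ev_Solve[OF _ pok sr(4) ln(2)]) (simp_all add: s_def U_def)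
      moreover have "4 * N \<le> 2 ^ l" using pw unfolding l8 by linarith
      ultimately show ?thesis using covering_pair_iff_test[OF ok] by (simp only:)
    qed
    have "ev [And Fv_Check (And Distinct_Check Solve)] s (12 * U + 240) (fv e = fst ` set ps \<and> (distinct (map fst ps) \<and> ?v))"
    proof (rule ev_And[OF f])
      assume "fv e = fst ` set ps"
      from v[OF this] show "ev [And Distinct_Check Solve] s (12 * U + 230) (distinct (map fst ps) \<and> ?v)"
        by (intro ev_And[OF d]) simp_all
    qed simp
    then have m: "ev [And Fv_Check (And Distinct_Check Solve)] s (12 * U + 240) (w \<in> SetCovering)"
      unfolding w SetCovering_iff .
    have "ev (Prepare # [And Fv_Check (And Distinct_Check Solve)]) ?s0 (12 * U + 240 + 30 * N + 40) (w \<in> SetCovering)"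
      by (rule ev_Prepare[OF w m[unfolded s_def]]) (simp add: N_def)
    then have r: "ev [?Rest] ?s0 (13 * U + 490) (w \<in> SetCovering)"
      by (rule ev_SeqI) (use U in \<open>simp add: n_def\<close>)
    have "ev [And Parse ?Rest] ?s0 (13 * U + 500) ((\<exists>e ps. w = write_expr e @ TSemicolon # write_env ps) \<and> w \<in> SetCovering)"
      by (rule ev_And[OF parse r]) simp
    then show ?thesis using True by simp
  qed
  then show ?thesis unfolding Main_def U_def n_def N_def .
qed

theorem theorem7p7:
  shows "SetCovering \<in> PSPACE"
proof (rule alternating_PSPACE)
  fix w :: "token list"
  \<comment> \<open>The bound of \<open>ev_Main\<close> as a polynomial: 7800 is 13 times the factor
    600 of \<open>unit_cost\<close>, and \<open>n + 1\<close> is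
    \<open>2 * length w + 7\<close>.\<close>
  let ?p = "smult 7800 ([:7, 2:] ^ 3) + [:500:] :: nat poly"
  have "poly ?p (length w) = 13 * unit_cost (2 * length w + 6) + 500"
    by (simp add: unit_cost_def power3_eq_cube algebra_simps)
  then show "run (poly ?p (length w)) [Main] ((\<lambda>_. [])(Ex IV := w)) = Some (w \<in> SetCovering)"
    using ev_Main[of w] unfolding ev_def by (simp only:)
qed

end
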